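(* Let $n\ge 1$ be an integer, let $(\mathbb{S}^n,g_0)$ be the standard round unit sphere, and let $q\in(2,\infty)$. For $\lambda,a,b,c\in\mathbb{R}$ consider the system for $(u_1,u_2)\in C^2(\mathbb{S}^n)^2$ $$\Delta_{g_0}u_1+\lambda u_1=a\,u_1^{q-1}+b\,u_2^{q-2}u_1,\qquad \Delta_{g_0}u_2+\lambda u_2=b\,u_1^{q-2}u_2+c\,u_2^{q-1},\qquad u_1,u_2>0\qquad\text{in }\mathbb{S}^n. \tag{S}$$ (i) If either $c\le b\le a$ or $a\le b\le c$, and at least one of the two inequalities is strict, then (S) has no solutions. (ii) If either [$a<b$ and $c<b$] or $a=b=c$, then every solution of (S) is synchronized. (iii) There exist real numbers $\lambda,a,b,c$ such that $\lambda>0$, $a=c>b>0$ and (S) has non-synchronized solutions. More precisely, for every $\delta>0$ and every $\lambda,a,b\in C^1([-\delta,\delta])$, if the following conditions hold: (A1) $\lambda(0)\,(a(0)+b(0))>0$; (A2) $\lambda(0)\notin\left\{\frac{2j(2j+n-1)}{q-2}:\ j\in\mathbb{N}\right\}$, where $\mathbb{N}=\{1,2,\dots\}$; (A3) setting $\beta(\alpha):=\lambda(\alpha)\frac{a(\alpha)-b(\alpha)}{a(\alpha)+b(\alpha)}$ (for $\alpha$ near $0$), one has $\beta(0)\in\left\{\frac{j(j+n-1)}{q-2}:\ j\in\mathbb{N}\right\}$ and $\beta'(0)\neq0$; then there exists a $C^1$ branch of non-synchronized solutions to (S) with $\lambda=\lambda(\alpha)$, $c=a=a(\alpha)$ and $b=b(\alpha)$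 emanating from the constant solution at $\alpha=0$.
   Context: $\Delta_g:=-\mathrm{div}\,\nabla$ denotes the Laplace–Beltrami operator (nonnegative sign convention). Solutions are pairs of $C^2$ functions. A solution $(u_1,u_2)$ is synchronized if there is a constant $\Lambda>0$ with $u_2\equiv\Lambda u_1$; otherwise it is non-synchronized. $C^1$ branch: let $(M,g)$ be a smooth closed Riemannian manifold, $\Omega\subseteq\mathbb{R}^2$ open, $I:=[-\delta,\delta]$, $\delta>0$, $F_1,F_2\in C^1(I\times\Omega)$, and consider the system $\Delta_gu_1=F_1(\alpha,u_1,u_2)$, $\Delta_gu_2=F_2(\alpha,u_1,u_2)$ in $M$, $\alpha\in I$. Assume that for every $\alpha\in I$ a solution $(\overline{u}_1(\alpha),\overline{u}_2(\alpha))\in C^2(M)^2$ is given with $(\overline{u}_1(\alpha),\overline{u}_2(\alpha))\to(\overline{u}_1(0),\overline{u}_2(0))$ in $C^2(M)^2$ as $\alpha\to0$. Let $\mathcal{S}$ be the set of all solutions $(\alpha,u_1,u_2)\in I\times C^2(M)^2$ of the system with $(u_1,u_2)\ne(\overline{u}_1(\alpha),\overline{u}_2(\alpha))$. A subset $\mathcal{B}\subseteq\mathcal{S}$ is a $C^1$ branch of solutions emanating from $(0,\overline{u}_1(0),\overline{u}_2(0))$ if $\mathcal{B}\neq\emptyset$ and $\mathcal{B}\cup\{(0,\overline{u}_1(0),\overline{u}_2(0))\}$ is a $C^1$ curve in $I\times C^2(M)^2$. In (iii), $M=\mathbb{S}^n$, $\Omega=(0,\infty)^2$, and the reference solution is,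 for $\alpha$ near $0$, the constant solution $\overline{u}_1(\alpha)=\overline{u}_2(\alpha)=\left(\frac{\lambda(\alpha)}{a(\alpha)+b(\alpha)}\right)^{1/(q-2)}$. A branch of non-synchronized solutions is one in which, for every $(\alpha,u_1,u_2)\in\mathcal{B}$, $(u_1,u_2)$ is non-synchronized. *)

theory Defs
  imports "HOL-Analysis.Analysis"
begin

section \<open>Calculus on the round sphere\<close>

text \<open>
  The round sphere of dimension \<open>n\<close> is the unit sphere of a Euclidean space of dimension
  \<open>n + 1\<close> with the induced metric; its tangent space at \<open>x\<close> is the orthogonal complement of \<open>x\<close>.
\<close>

abbreviation usphere :: "'a::euclidean_space set" where
  "usphere \<equiv> sphere 0 1"

text \<open>
  On an interval, on the product of an interval with an open set, and on the sphere this is the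
  usual notion of a \<open>C\<^sup>1\<close> map. On the sphere the derivative relative to the sphere is
  determined only on tangent vectors; composing a continuous choice \<open>f'\<close> with the orthogonal
  projections onto the tangent spaces gives the continuous differential.
\<close>

definition C1_on :: "'a::real_normed_vector set \<Rightarrow> ('a \<Rightarrow> 'b::real_normed_vector) \<Rightarrow> bool" where
  "C1_on S f \<longleftrightarrow>
     (\<exists>f' :: 'a \<Rightarrow> 'a \<Rightarrow>\<^sub>L 'b.
        (\<forall>x\<in>S. (f has_derivative blinfun_apply (f' x)) (at x within S)) \<and> continuous_on S f')"

definition tangent_proj :: "'a::euclidean_space \<Rightarrow> 'a \<Rightarrow> 'a" where
  "tangent_proj x v = v - (x \<bullet> v) *\<^sub>R x"

text \<open>The differential at \<open>x\<close> of a map on the sphere, extended by \<open>0\<close> to the normal line.\<close>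

definition tderiv :: "('a::euclidean_space \<Rightarrow> 'b::real_normed_vector) \<Rightarrow> 'a \<Rightarrow> 'a \<Rightarrow> 'b" where
  "tderiv f x = (THE D. (f has_derivative D) (at x within usphere) \<and> D x = 0)"

text \<open>The tangent vector representing the differential of \<open>u\<close> (see \<open>grad_inner\<close> below).\<close>

definition grad :: "('a::euclidean_space \<Rightarrow> real) \<Rightarrow> 'a \<Rightarrow> 'a" where
  "grad u x = (\<Sum>b\<in>Basis. tderiv u x b *\<^sub>R b)"

text \<open>
  The Levi-Civita connection of the induced metric is the tangential part of the ambient derivative.
  As \<open>cov_deriv X x\<close> vanishes on the normal line, its trace over the ambient
  space is its trace over the tangent space, and likewise for the Hilbert-Schmidt norm below.
\<close>

definition cov_deriv :: "('a::euclidean_space \<Rightarrow> 'a) \<Rightarrow> 'a \<Rightarrow> 'a \<Rightarrow> 'a" where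
  "cov_deriv X x v = tangent_proj x (tderiv X x v)"

definition divergence :: "('a::euclidean_space \<Rightarrow> 'a) \<Rightarrow> 'a \<Rightarrow> real" where
  "divergence X x = (\<Sum>b\<in>Basis. cov_deriv X x b \<bullet> b)"

definition laplace_beltrami :: "('a::euclidean_space \<Rightarrow> real) \<Rightarrow> 'a \<Rightarrow> real" where
  "laplace_beltrami u x = - divergence (grad u) x"

definition C2_on_sphere :: "('a::euclidean_space \<Rightarrow> real) \<Rightarrow> bool" where
  "C2_on_sphere u \<longleftrightarrow> C1_on usphere u \<and> C1_on usphere (grad u)"

definition hess_norm :: "('a::euclidean_space \<Rightarrow> real) \<Rightarrow> 'a \<Rightarrow> real" where
  "hess_norm u x = L2_set (\<lambda>b. norm (cov_deriv (grad u) x b)) Basis"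

definition C2_pnorm :: "('a::euclidean_space \<Rightarrow> real) \<Rightarrow> 'a \<Rightarrow> real" where
  "C2_pnorm u x = \<bar>u x\<bar> + norm (grad u x) + hess_norm u x"

lemma proj_has_derivative:
  fixes x :: "'a::euclidean_space"
  assumes "x \<in> usphere"
  shows "((\<lambda>y. y) has_derivative tangent_proj x) (at x within usphere)"
proof -
  have nx: "x \<bullet> x = 1" using assms by (simp add: norm_eq_1)
  have "((\<lambda>y. tangent_proj x y + (1 - ((y - x) \<bullet> (y - x)) / 2) *\<^sub>R x) has_derivative tangent_proj x)
          (at x within usphere)"
    unfolding tangent_proj_def
    by (auto intro!: derivative_eq_intros simp: algebra_simps)
  then show ?thesis
  proof (rule has_derivative_transform_within[where d = 1])
    fix y :: 'a assume "y \<in> usphere"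
    then have "y \<bullet> y = 1" by (simp add: norm_eq_1)
    then have e: "1 - ((y - x) \<bullet> (y - x)) / 2 = x \<bullet> y"
      using nx by (simp add: inner_diff_left inner_diff_right inner_commute[of y x] field_simps)
    show "tangent_proj x y + (1 - ((y - x) \<bullet> (y - x)) / 2) *\<^sub>R x = y"
      unfolding e by (simp add: tangent_proj_def)
  qed (use assms in auto)
qed

lemma tangent_proj_self: "x \<in> usphere \<Longrightarrow> tangent_proj x x = 0"
  by (simp add: tangent_proj_def norm_eq_1)

lemma tangent_deriv_unique:
  fixes x :: "'a::euclidean_space"
  assumes x: "x \<in> usphere"
    and D: "(f has_derivative D) (at x within usphere)"
    and E: "(f has_derivative E) (at x within usphere)"
    and v: "x \<bullet> v = 0"
  shows "D v = E v"
proof (cases "v = 0")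
  case True
  then show ?thesis using D E by (simp add: has_derivative_def linear_simps)
next
  case False
  define w where "w = v /\<^sub>R norm v"
  have w: "x \<bullet> w = 0" "w \<bullet> w = 1" and vw: "v = norm v *\<^sub>R w"
    using v False by (simp_all add: w_def dot_square_norm power2_eq_square)
  define c where "c t = cos t *\<^sub>R x + sin t *\<^sub>R w" for t :: real
  have nx: "x \<bullet> x = 1" using x by (simp add: norm_eq_1)
  have cS: "c t \<in> usphere" for t
  proof -
    have "c t \<bullet> c t = (cos t)\<^sup>2 + (sin t)\<^sup>2"
      using nx w by (simp add: c_def inner_add_left inner_add_right inner_commute power2_eq_square)
    then show ?thesis by (simp add: norm_eq_1)
  qed
  have c0: "c 0 = x" by (simp add: c_def)
  have dc: "(c has_derivative (\<lambda>t. t *\<^sub>R w)) (at 0)"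
    unfolding c_def by (auto intro!: derivative_eq_intros)
  have comp: "((f \<circ> c) has_derivative (G \<circ> (\<lambda>t. t *\<^sub>R w))) (at 0)"
    if G: "(f has_derivative G) (at x within usphere)" for G
  proof -
    have "(f has_derivative G) (at (c 0) within c ` UNIV)"
      unfolding c0 by (rule has_derivative_subset[OF G]) (use cS in blast)
    then show ?thesis using diff_chain_within[OF dc] by simp
  qed
  have "D \<circ> (\<lambda>t. t *\<^sub>R w) = E \<circ> (\<lambda>t. t *\<^sub>R w)"
    using has_derivative_unique[OF comp[OF D] comp[OF E]] .
  then have "D (norm v *\<^sub>R w) = E (norm v *\<^sub>R w)" by (metis comp_apply)
  then show ?thesis using vw by simp
qed

lemma tderiv_eq:
  assumes x: "x \<in> usphere" and D: "(f has_derivative D) (at x within usphere)"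
  shows "tderiv f x = (\<lambda>v. D (tangent_proj x v))"
    and "(f has_derivative tderiv f x) (at x within usphere)"
proof -
  interpret D: bounded_linear D using D by (rule has_derivative_bounded_linear)
  have 1: "(f has_derivative (\<lambda>v. D (tangent_proj x v))) (at x within usphere)"
  proof -
    have "(f has_derivative D) (at ((\<lambda>y. y) x) within (\<lambda>y. y) ` usphere)" using D by simp
    then show ?thesis using diff_chain_within[OF proj_has_derivative[OF x]] by (simp add: o_def)
  qed
  have nx: "x \<bullet> x = 1" using x by (simp add: norm_eq_1)
  show 2: "tderiv f x = (\<lambda>v. D (tangent_proj x v))"
    unfolding tderiv_def
  proof (rule the_equality, intro conjI)
    show "D (tangent_proj x x) = 0" using tangent_proj_self[OF x] by simp
    fix E assume E: "(f has_derivative E) (at x within usphere) \<and> E x = 0"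
    then interpret E: bounded_linear E using has_derivative_bounded_linear by blast
    show "E = (\<lambda>v. D (tangent_proj x v))"
    proof
      fix v
      have "E v = E (tangent_proj x v) + (x \<bullet> v) *\<^sub>R E x"
        by (simp add: tangent_proj_def E.diff E.scale)
      also have "\<dots> = E (tangent_proj x v)" using E by simp
      also have "\<dots> = D (tangent_proj x v)"
        using tangent_deriv_unique[OF x _ D] E nx
        by (simp add: tangent_proj_def inner_diff_right)
      finally show "E v = D (tangent_proj x v)" .
    qed
  qed (rule 1)
  show "(f has_derivative tderiv f x) (at x within usphere)" unfolding 2 by (rule 1)
qed

lemma tderiv_props:
  assumes "f differentiable (at x within usphere)" "x \<in> usphere"
  shows "(f has_derivative tderiv f x) (at x within usphere)" "tderiv f x x = 0"
    and "bounded_linear (tderiv f x)"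
proof -
  obtain D where D: "(f has_derivative D) (at x within usphere)"
    using assms by (auto simp: differentiable_def)
  then interpret D: bounded_linear D using has_derivative_bounded_linear by blast
  show 1: "(f has_derivative tderiv f x) (at x within usphere)" by (rule tderiv_eq[OF assms(2) D])
  show "tderiv f x x = 0" by (simp add: tderiv_eq(1)[OF assms(2) D] tangent_proj_self[OF assms(2)])
  show "bounded_linear (tderiv f x)" using 1 by (rule has_derivative_bounded_linear)
qed

lemma tderiv_unique:
  assumes "x \<in> usphere" "(f has_derivative D) (at x within usphere)" "D x = 0"
  shows "tderiv f x = D"
proof
  fix v
  interpret D: bounded_linear D using assms(2) by (rule has_derivative_bounded_linear)
  show "tderiv f x v = D v"
    using assms(3) by (simp add: tderiv_eq(1)[OF assms(1,2)] tangent_proj_def D.diff D.scale)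
qed

lemma tderiv_cong:
  assumes "x \<in> usphere" "\<And>y. y \<in> usphere \<Longrightarrow> f y = g y"
  shows "tderiv f x = tderiv g x"
proof -
  have "(f has_derivative D) (at x within usphere) \<longleftrightarrow> (g has_derivative D) (at x within usphere)" for D
    using has_derivative_transform[OF assms(1), of f g D] has_derivative_transform[OF assms(1), of g f D]
      assms(2) by fastforce
  then show ?thesis by (simp add: tderiv_def)
qed

lemma grad_cong:
  assumes "x \<in> usphere" "\<And>y. y \<in> usphere \<Longrightarrow> f y = g y"
  shows "grad f x = grad g x"
  using tderiv_cong[OF assms] by (simp add: grad_def)

lemma grad_inner:
  assumes "u differentiable (at x within usphere)" "x \<in> usphere"
  shows "grad u x \<bullet> v = tderiv u x v" "x \<bullet> grad u x = 0"
proof -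
  interpret T: bounded_linear "tderiv u x" by (rule tderiv_props(3)[OF assms])
  show *: "grad u x \<bullet> v = tderiv u x v" for v
  proof -
    have "grad u x \<bullet> v = (\<Sum>b\<in>Basis. tderiv u x b * (v \<bullet> b))"
      by (simp add: grad_def inner_sum_left inner_commute[of v])
    also have "\<dots> = tderiv u x (\<Sum>b\<in>Basis. (v \<bullet> b) *\<^sub>R b)"
      by (simp add: T.sum T.scale mult.commute)
    finally show ?thesis by (simp add: euclidean_representation)
  qed
  show "x \<bullet> grad u x = 0" using *[of x] tderiv_props(2)[OF assms] by (simp add: inner_commute)
qed

lemma C1_on_cong:
  assumes "C1_on S f" "\<And>y. y \<in> S \<Longrightarrow> f y = g y"
  shows "C1_on S g"
proof -
  obtain f' where f': "\<forall>x\<in>S. (f has_derivative blinfun_apply (f' x)) (at x within S)"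
    "continuous_on S f'"
    using assms(1) unfolding C1_on_def by blast
  have "(g has_derivative blinfun_apply (f' x)) (at x within S)" if "x \<in> S" for x
    using f'(1) that assms(2) by (auto intro: has_derivative_transform[of x S g f])
  then show ?thesis using f'(2) unfolding C1_on_def by blast
qed

lemma C1_on_add:
  assumes "C1_on S f" "C1_on S g"
  shows "C1_on S (\<lambda>x. f x + g x)"
proof -
  obtain f' g' where
    "\<forall>x\<in>S. (f has_derivative blinfun_apply (f' x)) (at x within S)" "continuous_on S f'"
    "\<forall>x\<in>S. (g has_derivative blinfun_apply (g' x)) (at x within S)" "continuous_on S g'"
    using assms unfolding C1_on_def by blast
  then show ?thesis unfolding C1_on_def
    by (intro exI[of _ "\<lambda>x. f' x + g' x"])
       (auto intro!: derivative_eq_intros continuous_intros simp: blinfun.add_left)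
qed

lemma C1_on_scaleR:
  assumes "C1_on S f"
  shows "C1_on S (\<lambda>x. r *\<^sub>R f x)"
proof -
  obtain f' where
    "\<forall>x\<in>S. (f has_derivative blinfun_apply (f' x)) (at x within S)" "continuous_on S f'"
    using assms unfolding C1_on_def by blast
  then show ?thesis unfolding C1_on_def
    by (intro exI[of _ "\<lambda>x. r *\<^sub>R f' x"])
       (auto intro!: derivative_eq_intros continuous_intros simp: blinfun.scaleR_left)
qed

lemma C1_on_const: "C1_on S (\<lambda>x. k)"
  unfolding C1_on_def by (intro exI[of _ "\<lambda>x. 0"]) (auto simp: zero_blinfun.rep_eq)

lemma C1_on_differentiable: "C1_on S f \<Longrightarrow> x \<in> S \<Longrightarrow> f differentiable (at x within S)"
  unfolding C1_on_def differentiable_def by blast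

lemma C1_on_continuous: "C1_on S f \<Longrightarrow> continuous_on S f"
  unfolding C1_on_def continuous_on_eq_continuous_within
  by (blast intro: has_derivative_continuous)

lemma tderiv_add:
  assumes "f differentiable (at x within usphere)" "g differentiable (at x within usphere)"
    "x \<in> usphere"
  shows "tderiv (\<lambda>y. f y + g y) x = (\<lambda>v. tderiv f x v + tderiv g x v)"
  by (rule tderiv_unique[OF assms(3)])
     (use tderiv_props[OF assms(1,3)] tderiv_props[OF assms(2,3)] in
       \<open>auto intro!: derivative_eq_intros\<close>)

lemma tderiv_scaleR:
  assumes "f differentiable (at x within usphere)" "x \<in> usphere"
  shows "tderiv (\<lambda>y. r *\<^sub>R f y) x = (\<lambda>v. r *\<^sub>R tderiv f x v)"
  by (rule tderiv_unique[OF assms(2)])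
     (use tderiv_props[OF assms] in \<open>auto intro!: derivative_eq_intros\<close>)

lemma tderiv_const: "x \<in> usphere \<Longrightarrow> tderiv (\<lambda>y. k) x = (\<lambda>v. 0)"
  by (rule tderiv_unique) auto

lemma grad_add:
  assumes "C1_on usphere f" "C1_on usphere g" "x \<in> usphere"
  shows "grad (\<lambda>y. f y + g y) x = grad f x + grad g x"
  using assms
  by (simp add: grad_def tderiv_add C1_on_differentiable scaleR_add_left sum.distrib)

lemma grad_scaleR:
  assumes "C1_on usphere f" "x \<in> usphere"
  shows "grad (\<lambda>y. r * f y) x = r *\<^sub>R grad f x"
  using assms tderiv_scaleR[of f x r]
  by (simp add: grad_def C1_on_differentiable scaleR_sum_right)

lemma C2_add:
  assumes "C2_on_sphere f" "C2_on_sphere g"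
  shows "C2_on_sphere (\<lambda>y. f y + g y)"
proof -
  have "C1_on usphere (\<lambda>y. grad f y + grad g y)"
    using assms by (simp add: C2_on_sphere_def C1_on_add)
  then have "C1_on usphere (grad (\<lambda>y. f y + g y))"
    by (rule C1_on_cong) (use assms in \<open>simp add: C2_on_sphere_def grad_add\<close>)
  then show ?thesis using assms by (simp add: C2_on_sphere_def C1_on_add)
qed

lemma C2_scale:
  assumes "C2_on_sphere f"
  shows "C2_on_sphere (\<lambda>y. r * f y)"
proof -
  have "C1_on usphere (\<lambda>y. r *\<^sub>R grad f y)"
    using assms by (simp add: C2_on_sphere_def C1_on_scaleR)
  then have "C1_on usphere (grad (\<lambda>y. r * f y))"
    by (rule C1_on_cong) (use assms in \<open>simp add: C2_on_sphere_def grad_scaleR\<close>)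
  then show ?thesis using assms C1_on_scaleR[of usphere f r] by (simp add: C2_on_sphere_def)
qed

lemma C2_cong:
  assumes "C2_on_sphere f" "\<And>y. y \<in> usphere \<Longrightarrow> f y = g y"
  shows "C2_on_sphere g"
proof -
  have "C1_on usphere g"
    by (rule C1_on_cong[of _ f]) (use assms in \<open>auto simp: C2_on_sphere_def\<close>)
  moreover have "C1_on usphere (grad g)"
    by (rule C1_on_cong[of _ "grad f"]) (use assms grad_cong[of _ f g] in \<open>auto simp: C2_on_sphere_def\<close>)
  ultimately show ?thesis by (simp add: C2_on_sphere_def)
qed

lemma C2_const_fun: "C2_on_sphere (\<lambda>y. k)"
proof -
  have "C1_on usphere (grad (\<lambda>y :: 'a. k))"
    by (rule C1_on_cong[OF C1_on_const[of _ 0]]) (simp add: grad_def tderiv_const)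
  then show ?thesis by (simp add: C2_on_sphere_def C1_on_const)
qed

lemma cov_deriv_grad_add:
  assumes "C2_on_sphere f" "C2_on_sphere g" "x \<in> usphere"
  shows "cov_deriv (grad (\<lambda>y. f y + g y)) x v = cov_deriv (grad f) x v + cov_deriv (grad g) x v"
proof -
  have "tderiv (grad (\<lambda>y. f y + g y)) x = tderiv (\<lambda>y. grad f y + grad g y) x"
    using assms by (intro tderiv_cong) (auto simp: C2_on_sphere_def grad_add)
  then show ?thesis
    using assms by (simp add: cov_deriv_def tangent_proj_def tderiv_add C2_on_sphere_def
        C1_on_differentiable inner_add_right scaleR_add_left)
qed

lemma cov_deriv_grad_scale:
  assumes "C2_on_sphere f" "x \<in> usphere"
  shows "cov_deriv (grad (\<lambda>y. r * f y)) x v = r *\<^sub>R cov_deriv (grad f) x v"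
proof -
  have "tderiv (grad (\<lambda>y. r * f y)) x = tderiv (\<lambda>y. r *\<^sub>R grad f y) x"
    using assms by (intro tderiv_cong) (auto simp: C2_on_sphere_def grad_scaleR)
  then show ?thesis
    using assms by (simp add: cov_deriv_def tangent_proj_def tderiv_scaleR C2_on_sphere_def
        C1_on_differentiable scaleR_diff_right)
qed

lemma C2_pnorm_cong:
  assumes "x \<in> usphere" "\<And>y. y \<in> usphere \<Longrightarrow> f y = g y"
  shows "C2_pnorm f x = C2_pnorm g x"
proof -
  have "tderiv (grad f) x = tderiv (grad g) x"
    using assms grad_cong by (intro tderiv_cong) auto
  then show ?thesis
    using assms grad_cong[OF assms] by (simp add: C2_pnorm_def hess_norm_def cov_deriv_def)
qed

lemma C2_pnorm_add:
  assumes "C2_on_sphere f" "C2_on_sphere g" "x \<in> usphere"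
  shows "C2_pnorm (\<lambda>y. f y + g y) x \<le> C2_pnorm f x + C2_pnorm g x"
proof -
  have "hess_norm (\<lambda>y. f y + g y) x
      = L2_set (\<lambda>b. norm (cov_deriv (grad f) x b + cov_deriv (grad g) x b)) Basis"
    using assms by (simp add: hess_norm_def cov_deriv_grad_add)
  also have "\<dots> \<le> L2_set (\<lambda>b. norm (cov_deriv (grad f) x b) + norm (cov_deriv (grad g) x b)) Basis"
    by (rule L2_set_mono) (auto intro: norm_triangle_ineq)
  also have "\<dots> \<le> hess_norm f x + hess_norm g x"
    unfolding hess_norm_def by (rule L2_set_triangle_ineq)
  finally have "hess_norm (\<lambda>y. f y + g y) x \<le> hess_norm f x + hess_norm g x" .
  moreover have "norm (grad (\<lambda>y. f y + g y) x) \<le> norm (grad f x) + norm (grad g x)"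
    using assms by (simp add: grad_add C2_on_sphere_def norm_triangle_ineq)
  moreover have "\<bar>f x + g x\<bar> \<le> \<bar>f x\<bar> + \<bar>g x\<bar>" by (rule abs_triangle_ineq)
  ultimately show ?thesis unfolding C2_pnorm_def by linarith
qed

lemma C2_pnorm_scale:
  assumes "C2_on_sphere f" "x \<in> usphere"
  shows "C2_pnorm (\<lambda>y. r * f y) x = \<bar>r\<bar> * C2_pnorm f x"
  using assms
  by (simp add: C2_pnorm_def hess_norm_def cov_deriv_grad_scale grad_scaleR C2_on_sphere_def
      abs_mult distrib_left L2_set_right_distrib)

lemma C2_pnorm_bdd:
  fixes f :: "'a::euclidean_space \<Rightarrow> real"
  assumes "C2_on_sphere f"
  shows "bdd_above (C2_pnorm f ` usphere)"
proof -
  obtain G' where G: "\<forall>x\<in>usphere. (grad f has_derivative blinfun_apply (G' x)) (at x within usphere)"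
    "continuous_on usphere G'"
    using assms unfolding C2_on_sphere_def C1_on_def by blast
  have e: "hess_norm f x
      = L2_set (\<lambda>b. norm (tangent_proj x (blinfun_apply (G' x) (tangent_proj x b)))) Basis"
    if "x \<in> usphere" for x
    using that G(1) tderiv_eq(1)[OF that, of "grad f" "blinfun_apply (G' x)"]
    by (simp add: hess_norm_def cov_deriv_def)
  have "continuous_on usphere
      (\<lambda>x. L2_set (\<lambda>b. norm (tangent_proj x (blinfun_apply (G' x) (tangent_proj x b)))) Basis)"
    unfolding L2_set_def tangent_proj_def by (intro continuous_intros G(2))
  then have "continuous_on usphere (hess_norm f)"
    by (subst continuous_on_cong[OF refl e]) auto
  then have "continuous_on usphere (C2_pnorm f)"
    using assms unfolding C2_pnorm_def C2_on_sphere_def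
    by (intro continuous_intros) (auto intro: C1_on_continuous)
  then have "compact (C2_pnorm f ` usphere)" by (intro compact_continuous_image) auto
  then show ?thesis by (simp add: compact_imp_bounded bounded_imp_bdd_above)
qed

lemma usphere_nonempty: "(usphere :: 'a::euclidean_space set) \<noteq> {}"
  by simp

lemma C2_pnorm_nonneg: "0 \<le> C2_pnorm f x"
  by (simp add: C2_pnorm_def hess_norm_def)


section \<open>The normed space of \<open>C\<^sup>2\<close> functions on the sphere\<close>

text \<open>Functions are normalised to be \<open>0\<close> off the sphere, so that equality in the type is equality on the sphere.\<close>

typedef (overloaded) ('a::euclidean_space) C2_sphere =
  "{u :: 'a \<Rightarrow> real. C2_on_sphere u \<and> (\<forall>x. x \<notin> usphere \<longrightarrow> u x = 0)}"
  morphisms C2_fun Abs_C2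
proof
  show "(\<lambda>x. 0) \<in> {u :: 'a \<Rightarrow> real. C2_on_sphere u \<and> (\<forall>x. x \<notin> usphere \<longrightarrow> u x = 0)}"
    using C2_const_fun by simp
qed

setup_lifting type_definition_C2_sphere

lemma C2_fun_C2: "C2_on_sphere (C2_fun u)"
  using C2_fun[of u] by simp

instantiation C2_sphere :: (euclidean_space) real_vector
begin

lift_definition zero_C2_sphere :: "'a C2_sphere" is "\<lambda>x. 0"
  using C2_const_fun by simp

lift_definition plus_C2_sphere :: "'a C2_sphere \<Rightarrow> 'a C2_sphere \<Rightarrow> 'a C2_sphere"
  is "\<lambda>u v x. u x + v x"
  by (simp add: C2_add)

lift_definition scaleR_C2_sphere :: "real \<Rightarrow> 'a C2_sphere \<Rightarrow> 'a C2_sphere" is "\<lambda>r u x. r * u x"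
  by (simp add: C2_scale)

definition uminus_C2_sphere :: "'a C2_sphere \<Rightarrow> 'a C2_sphere" where
  "uminus_C2_sphere u = (-1) *\<^sub>R u"

definition minus_C2_sphere :: "'a C2_sphere \<Rightarrow> 'a C2_sphere \<Rightarrow> 'a C2_sphere" where
  "minus_C2_sphere u v = u + - v"

instance
proof
  fix u v w :: "'a C2_sphere" and r s :: real
  show "u + v + w = u + (v + w)" "u + v = v + u" "0 + u = u"
    by (transfer, simp add: algebra_simps)+
  show "- u + u = 0" unfolding uminus_C2_sphere_def by transfer simp
  show "u - v = u + - v" by (rule minus_C2_sphere_def)
  show "r *\<^sub>R (u + v) = r *\<^sub>R u + r *\<^sub>R v" "(r + s) *\<^sub>R u = r *\<^sub>R u + s *\<^sub>R u"
    "r *\<^sub>R s *\<^sub>R u = (r * s) *\<^sub>R u" "1 *\<^sub>R u = u"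
    by (transfer, simp add: algebra_simps)+
qed

end

instantiation C2_sphere :: (euclidean_space) real_normed_vector
begin

definition norm_C2_sphere :: "'a C2_sphere \<Rightarrow> real" where
  "norm_C2_sphere u = (SUP x\<in>usphere. C2_pnorm (C2_fun u) x)"

definition dist_C2_sphere :: "'a C2_sphere \<Rightarrow> 'a C2_sphere \<Rightarrow> real" where
  "dist_C2_sphere u v = norm (u - v)"

definition sgn_C2_sphere :: "'a C2_sphere \<Rightarrow> 'a C2_sphere" where
  "sgn_C2_sphere u = u /\<^sub>R norm u"

definition uniformity_C2_sphere :: "('a C2_sphere \<times> 'a C2_sphere) filter" where
  "uniformity_C2_sphere = (INF e\<in>{0<..}. principal {(u, v). dist u v < e})"

definition open_C2_sphere :: "'a C2_sphere set \<Rightarrow> bool" where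
  "open_C2_sphere U \<longleftrightarrow> (\<forall>u\<in>U. eventually (\<lambda>(u', v). u' = u \<longrightarrow> v \<in> U) uniformity)"

instance
proof
  fix u v :: "'a C2_sphere" and r :: real and U :: "'a C2_sphere set"
  show "dist u v = norm (u - v)" by (rule dist_C2_sphere_def)
  show "sgn u = u /\<^sub>R norm u" by (rule sgn_C2_sphere_def)
  show "uniformity = (INF e\<in>{0<..}. principal {(u :: 'a C2_sphere, v). dist u v < e})"
    by (rule uniformity_C2_sphere_def)
  show "open U \<longleftrightarrow> (\<forall>u\<in>U. eventually (\<lambda>(u', v). u' = u \<longrightarrow> v \<in> U) uniformity)"
    by (rule open_C2_sphere_def)
  have le: "C2_pnorm (C2_fun u) x \<le> norm u" if "x \<in> usphere" for x and u :: "'a C2_sphere"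
    unfolding norm_C2_sphere_def by (intro cSUP_upper that C2_pnorm_bdd C2_fun_C2)
  show "norm u = 0 \<longleftrightarrow> u = 0"
  proof
    assume 0: "norm u = 0"
    have "C2_fun u x = 0" for x
    proof (cases "x \<in> usphere")
      case True
      then show ?thesis using le[OF True, of u] 0 unfolding C2_pnorm_def hess_norm_def
        by (smt (verit) L2_set_nonneg norm_ge_zero)
    next
      case False
      then show ?thesis using C2_fun[of u] by simp
    qed
    then show "u = 0" by transfer auto
  next
    assume "u = 0"
    moreover have "C2_pnorm (\<lambda>y :: 'a. 0) x = 0" if "x \<in> usphere" for x
      using C2_pnorm_scale[OF C2_const_fun that, of 0 0] by simp
    ultimately have "norm u = (SUP x\<in>(usphere :: 'a set). (0::real))"
      unfolding norm_C2_sphere_def by (intro SUP_cong) (auto simp: zero_C2_sphere.rep_eq)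
    then show "norm u = 0" by simp
  qed
  show "norm (u + v) \<le> norm u + norm v"
    unfolding norm_C2_sphere_def[of "u + v"]
  proof (rule cSUP_least[OF usphere_nonempty])
    fix x :: 'a assume x: "x \<in> usphere"
    have "C2_pnorm (C2_fun (u + v)) x \<le> C2_pnorm (C2_fun u) x + C2_pnorm (C2_fun v) x"
      using C2_pnorm_add[OF C2_fun_C2 C2_fun_C2 x] by (simp add: plus_C2_sphere.rep_eq)
    then show "C2_pnorm (C2_fun (u + v)) x \<le> norm u + norm v"
      using le[OF x, of u] le[OF x, of v] by linarith
  qed
  have sle: "norm (r *\<^sub>R u) \<le> \<bar>r\<bar> * norm u" for r and u :: "'a C2_sphere"
    unfolding norm_C2_sphere_def[of "r *\<^sub>R u"]
  proof (rule cSUP_least[OF usphere_nonempty])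
    fix x :: 'a assume x: "x \<in> usphere"
    have "C2_pnorm (C2_fun (r *\<^sub>R u)) x = \<bar>r\<bar> * C2_pnorm (C2_fun u) x"
      using C2_pnorm_scale[OF C2_fun_C2 x] by (simp add: scaleR_C2_sphere.rep_eq)
    then show "C2_pnorm (C2_fun (r *\<^sub>R u)) x \<le> \<bar>r\<bar> * norm u"
      using le[OF x, of u] by (simp add: mult_left_mono)
  qed
  show "norm (r *\<^sub>R u) = \<bar>r\<bar> * norm u"
  proof (cases "r = 0")
    case True
    obtain x :: 'a where x: "x \<in> usphere" using usphere_nonempty by blast
    have "0 \<le> norm (r *\<^sub>R u)" by (rule order_trans[OF C2_pnorm_nonneg le[OF x]])
    then show ?thesis using sle[of r u] True by simp
  next
    case False
    have "inverse r *\<^sub>R r *\<^sub>R u = u" using False by transfer simp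
    then have "norm u \<le> \<bar>inverse r\<bar> * norm (r *\<^sub>R u)" using sle[of "inverse r" "r *\<^sub>R u"] by simp
    then have "\<bar>r\<bar> * norm u \<le> norm (r *\<^sub>R u)" using False by (simp add: field_simps)
    then show ?thesis using sle[of r u] by simp
  qed
qed

end

lift_definition C2_const :: "real \<Rightarrow> 'a::euclidean_space C2_sphere"
  is "\<lambda>k x. if x \<in> usphere then k else 0"
  by (auto intro: C2_cong[OF C2_const_fun])


section \<open>Systems, synchronized solutions and branches\<close>

definition is_solution ::
    "(real \<times> real) set \<Rightarrow> (real \<times> real \<times> real \<Rightarrow> real) \<Rightarrow> (real \<times> real \<times> real \<Rightarrow> real) \<Rightarrow>
     real \<Rightarrow> 'a::euclidean_space C2_sphere \<Rightarrow> 'a C2_sphere \<Rightarrow> bool" where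
  "is_solution \<Omega> F1 F2 \<alpha> u1 u2 \<longleftrightarrow>
     (\<forall>x\<in>usphere. (C2_fun u1 x, C2_fun u2 x) \<in> \<Omega> \<and>
        laplace_beltrami (C2_fun u1) x = F1 (\<alpha>, C2_fun u1 x, C2_fun u2 x) \<and>
        laplace_beltrami (C2_fun u2) x = F2 (\<alpha>, C2_fun u1 x, C2_fun u2 x))"

definition synchronized :: "'a::euclidean_space C2_sphere \<Rightarrow> 'a C2_sphere \<Rightarrow> bool" where
  "synchronized u1 u2 \<longleftrightarrow> (\<exists>\<Lambda>>0. \<forall>x\<in>usphere. C2_fun u2 x = \<Lambda> * C2_fun u1 x)"

definition solves_S ::
    "real \<Rightarrow> real \<Rightarrow> real \<Rightarrow> real \<Rightarrow> real \<Rightarrow> 'a::euclidean_space C2_sphere \<Rightarrow> 'a C2_sphere \<Rightarrow> bool"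
  where
  "solves_S q lam a b c u1 u2 \<longleftrightarrow>
     (\<forall>x\<in>usphere.
        laplace_beltrami (C2_fun u1) x + lam * C2_fun u1 x
          = a * C2_fun u1 x powr (q - 1) + b * C2_fun u2 x powr (q - 2) * C2_fun u1 x \<and>
        laplace_beltrami (C2_fun u2) x + lam * C2_fun u2 x
          = b * C2_fun u1 x powr (q - 2) * C2_fun u2 x + c * C2_fun u2 x powr (q - 1) \<and>
        C2_fun u1 x > 0 \<and> C2_fun u2 x > 0)"

text \<open>The right-hand sides of that system with parameter-dependent coefficients, in the form required by \<^const>\<open>is_solution\<close>.\<close>

definition S_rhs1 ::
    "real \<Rightarrow> (real \<Rightarrow> real) \<Rightarrow> (real \<Rightarrow> real) \<Rightarrow> (real \<Rightarrow> real) \<Rightarrow> real \<times> real \<times> real \<Rightarrow> real" where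
  "S_rhs1 q lam a b = (\<lambda>(\<alpha>, s, t). a \<alpha> * s powr (q - 1) + b \<alpha> * t powr (q - 2) * s - lam \<alpha> * s)"

definition S_rhs2 ::
    "real \<Rightarrow> (real \<Rightarrow> real) \<Rightarrow> (real \<Rightarrow> real) \<Rightarrow> (real \<Rightarrow> real) \<Rightarrow> real \<times> real \<times> real \<Rightarrow> real" where
  "S_rhs2 q lam b c = (\<lambda>(\<alpha>, s, t). b \<alpha> * s powr (q - 2) * t + c \<alpha> * t powr (q - 1) - lam \<alpha> * t)"

lemma is_solution_S:
  "is_solution ({0<..} \<times> {0<..}) (S_rhs1 q lam a b) (S_rhs2 q lam b c) \<alpha> u1 u2 \<longleftrightarrow>
   solves_S q (lam \<alpha>) (a \<alpha>) (b \<alpha>) (c \<alpha>) u1 u2"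
  unfolding is_solution_def solves_S_def S_rhs1_def S_rhs2_def by (auto simp: algebra_simps)

text \<open>The standing assumptions under which branches are defined; \<open>U1, U2\<close> is the given family of solutions.\<close>

definition branch_setting ::
    "real \<Rightarrow> (real \<times> real) set \<Rightarrow> (real \<times> real \<times> real \<Rightarrow> real) \<Rightarrow> (real \<times> real \<times> real \<Rightarrow> real) \<Rightarrow>
     (real \<Rightarrow> 'a::euclidean_space C2_sphere) \<Rightarrow> (real \<Rightarrow> 'a C2_sphere) \<Rightarrow> bool" where
  "branch_setting \<delta> \<Omega> F1 F2 U1 U2 \<longleftrightarrow>
     \<delta> > 0 \<and> open \<Omega> \<and> C1_on ({-\<delta>..\<delta>} \<times> \<Omega>) F1 \<and> C1_on ({-\<delta>..\<delta>} \<times> \<Omega>) F2 \<and>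
     (\<forall>\<alpha>\<in>{-\<delta>..\<delta>}. is_solution \<Omega> F1 F2 \<alpha> (U1 \<alpha>) (U2 \<alpha>)) \<and>
     ((\<lambda>\<alpha>. (U1 \<alpha>, U2 \<alpha>)) \<longlongrightarrow> (U1 0, U2 0)) (at 0 within {-\<delta>..\<delta>})"

definition nonref_solutions ::
    "real \<Rightarrow> (real \<times> real) set \<Rightarrow> (real \<times> real \<times> real \<Rightarrow> real) \<Rightarrow> (real \<times> real \<times> real \<Rightarrow> real) \<Rightarrow>
     (real \<Rightarrow> 'a::euclidean_space C2_sphere) \<Rightarrow> (real \<Rightarrow> 'a C2_sphere) \<Rightarrow>
     (real \<times> 'a C2_sphere \<times> 'a C2_sphere) set" where
  "nonref_solutions \<delta> \<Omega> F1 F2 U1 U2 =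
     {(\<alpha>, u1, u2). \<alpha> \<in> {-\<delta>..\<delta>} \<and> is_solution \<Omega> F1 F2 \<alpha> u1 u2 \<and> (u1, u2) \<noteq> (U1 \<alpha>, U2 \<alpha>)}"

text \<open>
  A \<open>C\<^sup>1\<close> curve, as a subset of a normed space, is a simple regular one: the image of a
  nondegenerate interval (open, half-open or closed) under an injective \<open>C\<^sup>1\<close> map with nowhere
  vanishing derivative.
\<close>

definition C1_curve :: "'b::real_normed_vector set \<Rightarrow> bool" where
  "C1_curve C \<longleftrightarrow>
     (\<exists>(J :: real set) \<gamma>. is_interval J \<and> interior J \<noteq> {} \<and> C1_on J \<gamma> \<and> inj_on \<gamma> J \<and>
        (\<forall>t\<in>J. vector_derivative \<gamma> (at t within J) \<noteq> 0) \<and> C = \<gamma> ` J)"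

definition C1_branch ::
    "real \<Rightarrow> (real \<times> real) set \<Rightarrow> (real \<times> real \<times> real \<Rightarrow> real) \<Rightarrow> (real \<times> real \<times> real \<Rightarrow> real) \<Rightarrow>
     (real \<Rightarrow> 'a::euclidean_space C2_sphere) \<Rightarrow> (real \<Rightarrow> 'a C2_sphere) \<Rightarrow>
     (real \<times> 'a C2_sphere \<times> 'a C2_sphere) set \<Rightarrow> bool" where
  "C1_branch \<delta> \<Omega> F1 F2 U1 U2 B \<longleftrightarrow>
     B \<subseteq> nonref_solutions \<delta> \<Omega> F1 F2 U1 U2 \<and> B \<noteq> {} \<and> C1_curve (insert (0, U1 0, U2 0) B)"

definition nonsynchronized_branch ::
    "(real \<times> 'a::euclidean_space C2_sphere \<times> 'a C2_sphere) set \<Rightarrow> bool" where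
  "nonsynchronized_branch B \<longleftrightarrow> (\<forall>(\<alpha>, u1, u2)\<in>B. \<not> synchronized u1 u2)"

text \<open>
  Constant solution of the symmetric system (\<open>c = a\<close>); it is a solution where
  \<open>lam \<alpha> / (a \<alpha> + b \<alpha>) > 0\<close>, which may hold for \<open>\<alpha>\<close> near \<open>0\<close> only, so branches emanating
  from it are taken over a possibly smaller parameter interval.
\<close>

definition const_ref ::
    "real \<Rightarrow> (real \<Rightarrow> real) \<Rightarrow> (real \<Rightarrow> real) \<Rightarrow> (real \<Rightarrow> real) \<Rightarrow> real \<Rightarrow> 'a::euclidean_space C2_sphere"
  where
  "const_ref q lam a b \<alpha> = C2_const ((lam \<alpha> / (a \<alpha> + b \<alpha>)) powr (1 / (q - 2)))"

end

theory Submission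
  imports Defs
begin

text \<open>
  Parts (i) and (ii) come from comparing the two components at a point where their quotient is
  extremal. Let \<open>M\<close> be the maximum of \<open>u1 / u2\<close>. Then \<open>M * u2 - u1 \<ge> 0\<close> has a zero, hence a
  minimum, where its (nonnegative) Laplacian is \<open>\<le> 0\<close>. Computed from the system, this Laplacian is
  a positive multiple of \<open>(b - a) * u1 powr (q - 2) + (c - b) * u2 powr (q - 2)\<close>
  (\<open>quotient_maximum\<close>). If \<open>a \<le> b \<le> c\<close> with one strict inequality this is positive, a
  contradiction; the opposite order is the same statement with the components exchanged. If
  \<open>a < b\<close> and \<open>c < b\<close>, the inequality bounds \<open>M\<close> by a constant, and the inequality for \<open>u2 / u1\<close>
  bounds its maximum by the reciprocal constant, so the quotient cannot vary. If \<open>a = b = c\<close>, the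
  function \<open>M * u2 - u1\<close> solves a linear equation, and the strong maximum principle makes it
  vanish identically.

  For (iii) the solutions are sought among zonal functions, which depend only on the angle \<open>\<theta>\<close> to
  a fixed axis \<open>e\<close>; for them the Laplacian is the ordinary differential operator
  \<open>v'' + (n - 1) cot \<theta> v'\<close> up to sign. Since \<open>c = a\<close>, the system is invariant under exchanging the
  components. Write \<open>u1 = p + r\<close> and \<open>u2 = p - r\<close>: the equation for \<open>p\<close> is even in \<open>r\<close> and the one
  for \<open>r\<close> is odd in \<open>r\<close>. Let \<open>j\<close> be the index of the resonance of \<open>\<beta> 0\<close>. One looks for \<open>p\<close>
  symmetric about the equator and \<open>r\<close> with the parity of \<open>j\<close>, which turns the sphere problem into
  a boundary value problem between the pole and the equator.

  There the problem is solved by shooting. Put \<open>r = s * \<rho>\<close> with \<open>\<rho> = 1\<close> at the pole and divide the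
  odd equation by \<open>s\<close>; this removes the trivial branch, and the divided equation is still \<open>C\<^sup>1\<close>
  because the difference quotients of powers have an integral representation (\<open>C1_diff_quot\<close>). The
  singular initial value problem at the pole is an integral equation of Volterra type, so its
  solution is a \<open>C\<^sup>1\<close> function of the amplitude \<open>s\<close>, the parameter \<open>\<alpha>\<close> and the value \<open>\<zeta>\<close> of
  \<open>p - pbar \<alpha>\<close> at the pole (\<open>singular_ivp_C1_family\<close>); here \<open>pbar \<alpha>\<close> is the constant solution. It
  remains to choose \<open>\<alpha>\<close> and \<open>\<zeta>\<close> as functions of \<open>s\<close> such that two conditions hold at the equator,
  one for \<open>p\<close> and one for \<open>r\<close>. This is the implicit function theorem in the plane, with a
  triangular Jacobian: the derivative of the first condition with respect to \<open>\<zeta>\<close> is nonzero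
  because \<open>lam 0\<close> is not resonant (\<open>nonresonant_moment\<close>), and the derivative of the second one
  with respect to \<open>\<alpha>\<close> is nonzero because \<open>\<beta>\<close> crosses its resonant value with nonzero speed
  (\<open>transversality\<close>, from Green's identity).

  Reflecting about the equator gives solutions on the sphere (\<open>zonal_branch\<close>). Their difference at
  the pole is \<open>2 * s\<close>, so the resulting curve is injective and regular, and it consists of
  solutions with \<open>u1 \<noteq> u2\<close> for \<open>s \<noteq> 0\<close>. Near \<open>\<alpha> = 0\<close> one has \<open>a \<noteq> b\<close>, and then a synchronized
  solution of the symmetric system has equal components; hence the branch is non-synchronized.
\<close>

section \<open>Continuously differentiable maps between normed spaces\<close>

lemma C1_on_openD:
  assumes "C1_on W f" "open W"
  obtains f' where "\<And>x. x \<in> W \<Longrightarrow> (f has_derivative blinfun_apply (f' x)) (at x)"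
    "continuous_on W f'"
  using assms unfolding C1_on_def by (metis at_within_open)

lemma C1_on_openI:
  assumes "\<And>x. x \<in> W \<Longrightarrow> (f has_derivative blinfun_apply (f' x)) (at x)" "continuous_on W f'"
  shows "C1_on W f"
  using assms unfolding C1_on_def by (blast intro: has_derivative_at_withinI)

lemma C1_on_subset: "C1_on T f \<Longrightarrow> S \<subseteq> T \<Longrightarrow> C1_on S f"
  unfolding C1_on_def by (meson continuous_on_subset has_derivative_subset subsetD)

lemma C1_on_compose:
  assumes f: "C1_on S f" and g: "C1_on T g" and "f ` S \<subseteq> T"
  shows "C1_on S (\<lambda>x. g (f x))"
proof -
  obtain f' where f': "\<forall>x\<in>S. (f has_derivative blinfun_apply (f' x)) (at x within S)"
    "continuous_on S f'" using f unfolding C1_on_def by blast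
  obtain g' where g': "\<forall>x\<in>T. (g has_derivative blinfun_apply (g' x)) (at x within T)"
    "continuous_on T g'" using g unfolding C1_on_def by blast
  have "((\<lambda>x. g (f x)) has_derivative blinfun_apply (g' (f x) o\<^sub>L f' x)) (at x within S)"
    if "x \<in> S" for x
  proof -
    have "(g has_derivative blinfun_apply (g' (f x))) (at (f x) within f ` S)"
      using g'(1) that assms(3) by (blast intro: has_derivative_subset)
    then show ?thesis using diff_chain_within[of f "blinfun_apply (f' x)" x S g] f'(1) that
      by (simp add: o_def blinfun_compose.rep_eq)
  qed
  moreover have "continuous_on S (\<lambda>x. g' (f x) o\<^sub>L f' x)"
    using C1_on_continuous[OF f] assms(3) f'(2)
    by (intro continuous_intros continuous_on_compose2[OF g'(2)]) auto
  ultimately show ?thesis unfolding C1_on_def by (intro exI[of _ "\<lambda>x. g' (f x) o\<^sub>L f' x"]) auto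
qed

lemma C1_on_bounded_linear: "bounded_linear f \<Longrightarrow> C1_on S f"
  unfolding C1_on_def
  by (intro exI[of _ "\<lambda>x. Blinfun f"])
     (simp add: bounded_linear_Blinfun_apply bounded_linear_imp_has_derivative)

lemma C1_on_linear_image:
  assumes "bounded_linear L" "C1_on S f"
  shows "C1_on S (\<lambda>x. L (f x))"
  using C1_on_compose[OF assms(2) C1_on_bounded_linear[OF assms(1), of UNIV]] by simp

lemma C1_on_diff: "C1_on S f \<Longrightarrow> C1_on S g \<Longrightarrow> C1_on S (\<lambda>x. f x - g x)"
  using C1_on_add[OF _ C1_on_scaleR[of S g "-1"], of f] by simp

lemma C1_on_uminus: "C1_on S f \<Longrightarrow> C1_on S (\<lambda>x. - f x)"
  using C1_on_scaleR[of S f "-1"] by simp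

lemma C1_on_Pair:
  assumes "C1_on S f" "C1_on S g"
  shows "C1_on S (\<lambda>x. (f x, g x))"
proof -
  have l: "bounded_linear (\<lambda>x. (x, 0))" "bounded_linear (\<lambda>x. (0, x))"
    by (auto intro!: bounded_linear_intros)
  have "C1_on S (\<lambda>x. (f x, 0) + (0, g x))"
    by (intro C1_on_add C1_on_linear_image[OF l(1) assms(1)] C1_on_linear_image[OF l(2) assms(2)])
  then show ?thesis by simp
qed

lemma C1_on_bilinear:
  assumes "bounded_bilinear B" "C1_on S f" "C1_on S g"
  shows "C1_on S (\<lambda>x. B (f x) (g x))"
proof -
  interpret bounded_bilinear B by fact
  obtain f' where f1: "\<forall>x\<in>S. (f has_derivative blinfun_apply (f' x)) (at x within S)" "continuous_on S f'"
    using assms(2) unfolding C1_on_def by blast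
  obtain g' where g1: "\<forall>x\<in>S. (g has_derivative blinfun_apply (g' x)) (at x within S)" "continuous_on S g'"
    using assms(3) unfolding C1_on_def by blast
  note f' = f1 g1
  have l: "\<And>x. bounded_linear (\<lambda>y. B y x)" "\<And>x. bounded_linear (B x)"
    by (rule bounded_linear_left, rule bounded_linear_right)
  have c: "bounded_linear prod_left" "bounded_linear prod_right"
    by (rule bounded_linear_prod_left, rule bounded_linear_prod_right)
  let ?D = "\<lambda>x. (prod_right (f x) o\<^sub>L g' x) + (prod_left (g x) o\<^sub>L f' x)"
  have "((\<lambda>x. B (f x) (g x)) has_derivative blinfun_apply (?D x)) (at x within S)"
    if "x \<in> S" for x
    using FDERIV[OF f'(1)[rule_format, OF that] f'(3)[rule_format, OF that]]
    by (simp add: plus_blinfun.rep_eq blinfun_compose.rep_eq prod_left.rep_eq prod_right.rep_eq)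
  moreover have "continuous_on S ?D"
    using C1_on_continuous[OF assms(2)] C1_on_continuous[OF assms(3)] f'(2,4)
    by (intro continuous_on_add bounded_bilinear.continuous_on[OF bounded_bilinear_blinfun_compose]
          bounded_linear.continuous_on[OF c(1)] bounded_linear.continuous_on[OF c(2)])
  ultimately show ?thesis unfolding C1_on_def by (intro exI[of _ ?D]) auto
qed

lemmas C1_on_mult = C1_on_bilinear[OF bounded_bilinear_mult]

lemma C1_on_fst: "C1_on S fst" and C1_on_snd: "C1_on S snd"
  by (auto intro: C1_on_bounded_linear bounded_linear_fst bounded_linear_snd)

lemma C1_on_real_deriv:
  fixes f :: "real \<Rightarrow> real"
  assumes "\<And>x. x \<in> S \<Longrightarrow> (f has_real_derivative f' x) (at x within S)" "continuous_on S f'"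
  shows "C1_on S f"
  unfolding C1_on_def
proof (intro exI[of _ "\<lambda>x. blinfun_mult_right (f' x)"] conjI ballI)
  show "continuous_on S (\<lambda>x. blinfun_mult_right (f' x))"
    by (intro bounded_linear.continuous_on[OF bounded_linear_blinfun_mult_right] assms)
qed (use assms(1) in \<open>simp add: has_field_derivative_def\<close>)

lemma C1_on_powr:
  fixes f :: "'a::real_normed_vector \<Rightarrow> real"
  assumes "C1_on S f" "\<And>x. x \<in> S \<Longrightarrow> f x > 0"
  shows "C1_on S (\<lambda>x. f x powr e)"
proof (rule C1_on_compose[OF assms(1)])
  show "C1_on {0<..} (\<lambda>x::real. x powr e)"
    by (rule C1_on_real_deriv[where f' = "\<lambda>x. e * x powr (e - 1)"])
       (auto intro!: derivative_eq_intros continuous_intros)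
qed (use assms(2) in auto)

lemma C1_on_divide:
  fixes f :: "'a::real_normed_vector \<Rightarrow> real"
  assumes f: "C1_on S f" and g: "C1_on S g" "\<And>x. x \<in> S \<Longrightarrow> g x \<noteq> 0"
  shows "C1_on S (\<lambda>x. f x / g x)"
proof -
  have "C1_on S (\<lambda>x. inverse (g x))"
  proof (rule C1_on_compose[OF g(1)])
    show "C1_on (-{0}) (\<lambda>x::real. inverse x)"
      by (rule C1_on_real_deriv[where f' = "\<lambda>x. - (inverse x * inverse x)"])
         (auto intro!: derivative_eq_intros continuous_intros simp: power2_eq_square)
  qed (use g in auto)
  from C1_on_mult[OF f this] show ?thesis by (simp add: divide_inverse)
qed

section \<open>The implicit function theorem in Banach spaces\<close>

text \<open>
  The bound on the powers is allowed to be any summable sequence, so that the series also inverts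
  \<open>1 - A\<close> for Volterra operators, whose norm need not be less than \<open>1\<close>.
\<close>

lemma neumann_series:
  fixes A :: "'a::banach \<Rightarrow> 'a"
  assumes A: "bounded_linear A" and c: "\<And>k y. norm ((A ^^ k) y) \<le> c k * norm y" "summable c"
  obtains S where "bounded_linear S" "\<And>y. S y = y + A (S y)" "\<And>y. S (y - A y) = y"
proof -
  interpret A: bounded_linear A by fact
  have lin: "linear (A ^^ k)" for k
  proof (induction k)
    case 0 show ?case using linear_id by (simp add: id_def)
  next
    case (Suc k)
    show ?case using linear_compose[OF Suc A.linear_axioms] by (simp add: o_def)
  qed
  have s: "summable (\<lambda>k. (A ^^ k) y)" for y
    by (rule summable_comparison_test[OF _ summable_mult2[OF c(2)]]) (use c(1) in blast)
  have sn: "summable (\<lambda>k. norm ((A ^^ k) y))" for y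
    by (rule summable_comparison_test[OF _ summable_mult2[OF c(2)]]) (use c(1) in auto)
  define S where "S y = (\<Sum>k. (A ^^ k) y)" for y
  have 1: "S y = y + A (S y)" for y
  proof -
    have "(\<Sum>k. (A ^^ Suc k) y) = S y - (A ^^ 0) y"
      unfolding S_def by (rule suminf_split_head[OF s])
    moreover have "(\<Sum>k. (A ^^ Suc k) y) = A (S y)"
      unfolding S_def by (simp add: A.suminf[OF s])
    ultimately have "S y - y = A (S y)" by simp
    then show ?thesis by (metis diff_eq_eq add.commute)
  qed
  have add: "S (x + y) = S x + S y" for x y
    unfolding S_def using linear_add[OF lin] suminf_add[OF s s] by simp
  have sc: "S (r *\<^sub>R x) = r *\<^sub>R S x" for r x
    unfolding S_def using linear_scale[OF lin] suminf_scaleR_right[OF s] by simp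
  have bl: "bounded_linear S"
  proof (rule bounded_linear_intro[OF add sc])
    fix y show "norm (S y) \<le> norm y * suminf c"
    proof -
      have "norm (S y) \<le> (\<Sum>k. norm ((A ^^ k) y))"
        unfolding S_def by (rule summable_norm[OF sn])
      also have "\<dots> \<le> (\<Sum>k. c k * norm y)"
        by (rule suminf_le[OF c(1) sn summable_mult2[OF c(2)]])
      also have "\<dots> = suminf c * norm y" by (rule suminf_mult2[OF c(2), symmetric])
      finally show ?thesis by (simp add: mult.commute)
    qed
  qed
  interpret S: bounded_linear S by fact
  have com: "S (A y) = A (S y)" for y
  proof -
    have "S (A y) = (\<Sum>k. A ((A ^^ k) y))" unfolding S_def by (simp add: funpow_swap1)
    then show ?thesis unfolding S_def by (simp add: A.suminf[OF s])
  qed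
  have "S (y - A y) = y" for y
    using 1[of y] by (simp add: S.diff com diff_eq_eq)
  with 1 bl that show ?thesis by blast
qed

lemma neumann_contraction:
  fixes A :: "'a::banach \<Rightarrow>\<^sub>L 'a"
  assumes "norm A \<le> 1/2"
  obtains S :: "'a \<Rightarrow>\<^sub>L 'a" where "\<And>y. S y = y + A (S y)"
proof -
  have "norm ((blinfun_apply A ^^ k) y) \<le> (1/2) ^ k * norm y" for k y
  proof (induction k)
    case (Suc k)
    have "norm (A ((blinfun_apply A ^^ k) y)) \<le> norm A * norm ((blinfun_apply A ^^ k) y)"
      by (rule norm_blinfun)
    also have "\<dots> \<le> 1/2 * ((1/2) ^ k * norm y)"
      by (intro mult_mono assms Suc) auto
    finally show ?case by simp
  qed simp
  moreover have "summable (\<lambda>k. (1/2 :: real) ^ k)" by (rule summable_geometric) simp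
  ultimately obtain S where "bounded_linear S" "\<And>y. S y = y + A (S y)"
    using neumann_series[OF blinfun.bounded_linear_right[of A], where c = "\<lambda>k. (1/2) ^ k"] by metis
  then show ?thesis using that[of "Blinfun S"] by (simp add: bounded_linear_Blinfun_apply)
qed

text \<open>
  Near the base point the derivative of \<open>\<Phi>\<close> in the second variable is small by continuity, so
  \<open>\<Phi> (x, _)\<close> is a contraction with factor \<open>1/2\<close>, uniformly in \<open>x\<close>. Its fixed point \<open>g x\<close> is
  Lipschitz in \<open>x\<close>, and differentiating \<open>\<Phi> (x, g x) = g x\<close> shows that the derivative must solve
  \<open>g' = C + A g'\<close>, where \<open>C\<close> and \<open>A\<close> are the two partial derivatives along the graph; as
  \<open>norm A \<le> 1/2\<close>, this equation is solvable and \<open>g'\<close> depends continuously on \<open>C\<close> and \<open>A\<close>.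
\<close>

lemma fixed_point_C1:
  fixes \<Phi> :: "'x::real_normed_vector \<times> 'y::banach \<Rightarrow> 'y"
  assumes W: "open W" "(x0, y0) \<in> W" and C: "C1_on W \<Phi>" and fp: "\<Phi> (x0, y0) = y0"
    and D: "(\<Phi> has_derivative D) (at (x0, y0))" "\<And>y. D (0, y) = 0"
  obtains U g where "open U" "x0 \<in> U" "C1_on U g" "g x0 = y0"
    "\<And>x. x \<in> U \<Longrightarrow> (x, g x) \<in> W \<and> \<Phi> (x, g x) = g x"
proof -
  obtain \<Phi>' where d: "\<And>w. w \<in> W \<Longrightarrow> (\<Phi> has_derivative blinfun_apply (\<Phi>' w)) (at w)"
    and c: "continuous_on W \<Phi>'"
    using C1_on_openD[OF C W(1)] by blast
  have D0: "blinfun_apply (\<Phi>' (x0, y0)) = D"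
    by (rule has_derivative_unique[OF d[OF W(2)] D(1)])
  obtain e where e: "e > 0" "\<And>w. dist w (x0, y0) < e \<Longrightarrow> w \<in> W \<and> norm (\<Phi>' w - \<Phi>' (x0, y0)) \<le> 1/2"
  proof -
    obtain e1 where e1: "e1 > 0" "ball (x0, y0) e1 \<subseteq> W" using W open_contains_ball by blast
    obtain e2 where e2: "e2 > 0" "\<And>w. w \<in> W \<Longrightarrow> dist w (x0, y0) < e2 \<Longrightarrow> dist (\<Phi>' w) (\<Phi>' (x0, y0)) < 1/2"
      using c W(2) unfolding continuous_on_iff by (metis half_gt_zero_iff zero_less_one)
    show ?thesis
      by (rule that[of "min e1 e2"]) (use e1 e2 in \<open>force simp: dist_commute dist_norm subset_iff\<close>)+
  qed
  define M where "M = norm (\<Phi>' (x0, y0)) + 1"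
  have M: "norm (\<Phi>' w) \<le> M" if "dist w (x0, y0) < e" for w
    using e(2)[OF that] norm_triangle_sub[of "\<Phi>' w" "\<Phi>' (x0, y0)"] by (simp add: M_def)
  have half: "norm (\<Phi>' w (0, y)) \<le> 1/2 * norm y" if "dist w (x0, y0) < e" for w y
  proof -
    have "\<Phi>' w (0, y) = (\<Phi>' w - \<Phi>' (x0, y0)) (0, y)"
      using D(2) D0 by (simp add: blinfun.diff_left)
    also have "norm \<dots> \<le> norm (\<Phi>' w - \<Phi>' (x0, y0)) * norm (0 :: 'x, y)" by (rule norm_blinfun)
    also have "\<dots> \<le> 1/2 * norm y" using e(2)[OF that] by (intro mult_mono) (auto simp: norm_Pair)
    finally show ?thesis .
  qed
  have near: "dist (x, y) (x0, y0) < e" if "dist x x0 < e/2" "dist y y0 \<le> e/2" for x y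
  proof -
    have "dist (x, y) (x0, y0) \<le> dist x x0 + dist y y0"
      by (simp add: dist_Pair_Pair sqrt_sum_squares_le_sum)
    then show ?thesis using that by linarith
  qed
  have conv: "convex (ball x0 (e/2) \<times> cball y0 (e/2))" by (intro convex_Times) auto
  have bnear: "dist w (x0, y0) < e" if "w \<in> ball x0 (e/2) \<times> cball y0 (e/2)" for w
    using that near[of "fst w" "snd w"] by (simp add: mem_Times_iff dist_commute)
  have dw: "(\<Phi> has_derivative blinfun_apply (\<Phi>' w)) (at w within ball x0 (e/2) \<times> cball y0 (e/2))"
    if "w \<in> ball x0 (e/2) \<times> cball y0 (e/2)" for w
    by (rule has_derivative_at_withinI, rule d, rule conjunct1[OF e(2)], rule bnear, rule that)
  have Lx: "norm (\<Phi> (x, y) - \<Phi> (x', y)) \<le> M * norm (x - x')"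
    if "dist x x0 < e/2" "dist x' x0 < e/2" "dist y y0 \<le> e/2" for x x' y
  proof -
    have "norm (\<Phi> (x, y) - \<Phi> (x', y)) \<le> M * norm ((x, y) - (x', y))"
    proof (rule differentiable_bound[OF conv dw])
      fix w assume "w \<in> ball x0 (e/2) \<times> cball y0 (e/2)"
      then show "onorm (blinfun_apply (\<Phi>' w)) \<le> M"
        using M[OF bnear] by (simp add: norm_blinfun.rep_eq[symmetric])
    qed (use that in \<open>auto simp: dist_commute\<close>)
    then show ?thesis by (simp add: norm_Pair)
  qed
  have Ly: "norm (\<Phi> (x, y) - \<Phi> (x, y')) \<le> 1/2 * norm (y - y')"
    if x: "dist x x0 < e/2" and y: "dist y y0 \<le> e/2" "dist y' y0 \<le> e/2" for x y y'
  proof (rule differentiable_bound[of "cball y0 (e/2)" "\<lambda>y. \<Phi> (x, y)" "\<lambda>y v. \<Phi>' (x, y) (0, v)"])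
    fix z assume z: "z \<in> cball y0 (e/2)"
    have "(\<Phi> has_derivative blinfun_apply (\<Phi>' (x, z))) (at (x, z))"
      using z x by (intro d conjunct1[OF e(2)] near) (simp_all add: dist_commute)
    from diff_chain_at[OF has_derivative_Pair[OF has_derivative_const has_derivative_ident, of x z UNIV] this]
    have "((\<lambda>y. \<Phi> (x, y)) has_derivative (\<lambda>v. \<Phi>' (x, z) (0, v))) (at z)"
      by (simp add: o_def)
    then show "((\<lambda>y. \<Phi> (x, y)) has_derivative (\<lambda>v. \<Phi>' (x, z) (0, v))) (at z within cball y0 (e/2))"
      by (rule has_derivative_at_withinI)
    show "onorm (\<lambda>v. \<Phi>' (x, z) (0, v)) \<le> 1/2"
      by (rule onorm_bound, simp, rule half, rule near) (use x z in \<open>simp_all add: dist_commute\<close>)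
  qed (use y in \<open>auto simp: dist_commute\<close>)
  have Mpos: "M > 0" by (simp add: M_def add_nonneg_pos)
  \<comment> \<open>For \<open>x\<close> within \<open>\<delta>\<close> of \<open>x0\<close> the centre \<open>y0\<close> moves by at most \<open>e/8\<close>, and the contraction adds
    at most half of \<open>e/4\<close>: the ball of radius \<open>e/4\<close> is mapped into itself.\<close>
  define \<delta> where "\<delta> = min (e/2) (e / (8 * M))"
  have \<delta>: "\<delta> > 0" "\<delta> \<le> e/2" "M * \<delta> \<le> e/8"
    using e(1) Mpos by (auto simp: \<delta>_def min_def field_simps)
  define U where "U = ball x0 \<delta>"
  have ex: "\<exists>!y. y \<in> cball y0 (e/4) \<and> \<Phi> (x, y) = y" if x: "x \<in> U" for x
  proof (rule Banach_fix[where c = "1/2"])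
    have xe: "dist x x0 < e/2" using x \<delta> by (auto simp: U_def dist_commute)
    show "complete (cball y0 (e/4))" by (simp add: complete_eq_closed)
    show "cball y0 (e/4) \<noteq> {}" using e(1) by simp
    show "(\<lambda>y. \<Phi> (x, y)) ` cball y0 (e/4) \<subseteq> cball y0 (e/4)"
    proof (rule image_subsetI)
      fix y assume "y \<in> cball y0 (e/4)"
      then have y: "dist y0 y \<le> e/4" by simp
      have "norm (\<Phi> (x, y) - \<Phi> (x, y0)) \<le> 1/2 * norm (y - y0)"
        by (rule Ly) (use xe y e(1) in \<open>auto simp: dist_commute\<close>)
      moreover have "norm (\<Phi> (x, y0) - \<Phi> (x0, y0)) \<le> M * norm (x - x0)"
        by (rule Lx) (use xe e(1) in auto)
      moreover have "M * norm (x - x0) \<le> M * \<delta>"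
        using x Mpos by (auto simp: U_def dist_norm norm_minus_commute)
      moreover have "norm (y - y0) \<le> e/4" using y by (simp add: dist_norm norm_minus_commute)
      moreover have "norm (\<Phi> (x, y) - y0) \<le> norm (\<Phi> (x, y) - \<Phi> (x, y0)) + norm (\<Phi> (x, y0) - y0)"
        using norm_triangle_ineq[of "\<Phi> (x, y) - \<Phi> (x, y0)" "\<Phi> (x, y0) - y0"] by simp
      ultimately have "norm (\<Phi> (x, y) - y0) \<le> e/4" using fp \<delta> by simp
      then show "\<Phi> (x, y) \<in> cball y0 (e/4)" by (simp add: dist_norm norm_minus_commute)
    qed
    show "dist (\<Phi> (x, y)) (\<Phi> (x, y')) \<le> 1/2 * dist y y'"
      if "y \<in> cball y0 (e/4)" "y' \<in> cball y0 (e/4)" for y y'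
      using Ly[OF xe, of y y'] that e(1) by (auto simp: dist_norm[symmetric] dist_commute)
  qed auto
  define g where "g x = (THE y. y \<in> cball y0 (e/4) \<and> \<Phi> (x, y) = y)" for x
  have g: "dist (g x) y0 \<le> e/4" "\<Phi> (x, g x) = g x" if "x \<in> U" for x
    using theI'[OF ex[OF that]] by (auto simp: g_def dist_commute)
  have gnear: "dist (x, g x) (x0, y0) < e" "dist x x0 < e/2" "dist (g x) y0 \<le> e/2" if "x \<in> U" for x
    using g[OF that] that \<delta> e(1) near[of x "g x"] by (auto simp: U_def dist_commute)
  have gx0: "g x0 = y0"
    unfolding g_def by (rule the1_equality[OF ex]) (use fp e(1) \<delta> in \<open>simp_all add: U_def\<close>)
  have Lip: "norm (g x - g x') \<le> 2 * M * norm (x - x')" if "x \<in> U" "x' \<in> U" for x x'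
  proof -
    have "norm (\<Phi> (x, g x) - \<Phi> (x', g x)) \<le> M * norm (x - x')"
      "norm (\<Phi> (x', g x) - \<Phi> (x', g x')) \<le> 1/2 * norm (g x - g x')"
      by (rule Lx, rule gnear, rule that, rule gnear, rule that, rule gnear, rule that)
         (rule Ly, rule gnear, rule that, rule gnear, rule that, rule gnear, rule that)
    moreover have "norm (g x - g x') \<le> norm (\<Phi> (x, g x) - \<Phi> (x', g x)) + norm (\<Phi> (x', g x) - \<Phi> (x', g x'))"
      using norm_triangle_ineq[of "\<Phi> (x, g x) - \<Phi> (x', g x)" "\<Phi> (x', g x) - \<Phi> (x', g x')"] g that by simp
    ultimately show ?thesis by linarith
  qed
  have cg: "continuous_on U g"
    by (rule lipschitz_on_continuous_on[of "2 * M"]) (use Lip Mpos in \<open>auto simp: lipschitz_on_def dist_norm\<close>)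
  let ?i1 = "Blinfun (\<lambda>x::'x. (x, 0::'y))" and ?i2 = "Blinfun (\<lambda>y::'y. (0::'x, y))"
  have i: "blinfun_apply ?i1 = (\<lambda>x. (x, 0))" "blinfun_apply ?i2 = (\<lambda>y. (0, y))"
    by (auto intro!: bounded_linear_Blinfun_apply bounded_linear_intros)
  define A where "A x = \<Phi>' (x, g x) o\<^sub>L ?i2" for x
  define C where "C x = \<Phi>' (x, g x) o\<^sub>L ?i1" for x
  have nA: "norm (A x) \<le> 1/2" if "x \<in> U" for x
    by (rule norm_blinfun_bound) (use half gnear that in \<open>auto simp: A_def i\<close>)
  have "\<exists>S. \<forall>y. blinfun_apply S y = y + A x (S y)" if "x \<in> U" for x
    using neumann_contraction[OF nA[OF that]] by metis
  then obtain S where S: "\<And>x y. x \<in> U \<Longrightarrow> blinfun_apply (S x) y = y + A x (S x y)"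
    by metis
  define g' where "g' x = S x o\<^sub>L C x" for x
  have g'eq: "g' x v = C x v + A x (g' x v)" if "x \<in> U" for x v
    using S[OF that] by (simp add: g'_def)
  have cont: "continuous_on U A" "continuous_on U C"
    unfolding A_def C_def
    by (intro continuous_intros continuous_on_compose2[OF c] cg; use gnear e(2) in force)+
  have "(g has_derivative blinfun_apply (g' x)) (at x)" if x: "x \<in> U" for x
    unfolding has_derivative_at_alt
  proof (intro conjI allI impI blinfun.bounded_linear_right)
    fix \<epsilon> :: real assume \<epsilon>: "\<epsilon> > 0"
    define \<eta> where "\<eta> = \<epsilon> / (2 * (1 + 2 * M))"
    have \<eta>: "\<eta> > 0" using \<epsilon> Mpos by (simp add: \<eta>_def)
    obtain d1 where d1: "d1 > 0" "\<And>w. norm (w - (x, g x)) < d1 \<Longrightarrow>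
        norm (\<Phi> w - \<Phi> (x, g x) - \<Phi>' (x, g x) (w - (x, g x))) \<le> \<eta> * norm (w - (x, g x))"
      using d[of "(x, g x)"] e(2)[OF gnear(1)[OF x]] \<eta> unfolding has_derivative_at_alt by blast
    obtain d2 where d2: "d2 > 0" "ball x d2 \<subseteq> U" using x open_contains_ball unfolding U_def by blast
    define d3 where "d3 = min d2 (d1 / (1 + 2 * M))"
    have "norm (g x' - g x - g' x (x' - x)) \<le> \<epsilon> * norm (x' - x)" if x': "norm (x' - x) < d3" for x'
    proof -
      have x'U: "x' \<in> U" using x' d2 by (auto simp: d3_def dist_norm norm_minus_commute subset_iff)
      define k where "k = g x' - g x"
      define h where "h = x' - x"
      have nk: "norm k \<le> 2 * M * norm h" unfolding k_def h_def by (rule Lip[OF x'U x])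
      have nhk: "norm (h, k) \<le> (1 + 2 * M) * norm h"
        using norm_Pair_le[of h k] nk by (simp add: algebra_simps)
      also have "\<dots> < d1" using x' Mpos by (simp add: d3_def h_def field_simps)
      finally have "norm (\<Phi> (x', g x') - \<Phi> (x, g x) - \<Phi>' (x, g x) (h, k)) \<le> \<eta> * norm (h, k)"
        using d1(2)[of "(x', g x')"] by (simp add: h_def k_def)
      moreover have "\<Phi>' (x, g x) (h, k) = C x h + A x k"
        by (simp add: C_def A_def i blinfun.add_right[symmetric])
      ultimately have "norm (k - C x h - A x k) \<le> \<eta> * norm (h, k)"
        using g(2)[OF x] g(2)[OF x'U] by (simp add: k_def diff_diff_eq add.assoc)
      also have "\<dots> \<le> \<eta> * ((1 + 2 * M) * norm h)" by (intro mult_left_mono nhk) (use \<eta> in simp)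
      also have "\<dots> = \<epsilon> / 2 * norm h" using Mpos by (simp add: \<eta>_def field_simps)
      finally have 1: "norm (k - C x h - A x k) \<le> \<epsilon> / 2 * norm h" .
      \<comment> \<open>The error \<open>k - g' x h\<close> is reproduced on the right with factor at most \<open>1/2\<close>, so it is
        absorbed.\<close>
      have "k - g' x h = (k - C x h - A x k) + A x (k - g' x h)"
        using g'eq[OF x, of h] by (simp add: blinfun.diff_right algebra_simps)
      then have "norm (k - g' x h) \<le> norm (k - C x h - A x k) + norm (A x (k - g' x h))"
        by (metis norm_triangle_ineq)
      also have "norm (A x (k - g' x h)) \<le> 1/2 * norm (k - g' x h)"
        using norm_blinfun[of "A x" "k - g' x h"] nA[OF x] by (meson mult_right_mono norm_ge_zero order_trans)
      finally show ?thesis using 1 by (simp add: k_def h_def)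
    qed
    then show "\<exists>d>0. \<forall>y. norm (y - x) < d \<longrightarrow> norm (g y - g x - g' x (y - x)) \<le> \<epsilon> * norm (y - x)"
      using d1(1) d2(1) Mpos by (intro exI[of _ d3]) (auto simp: d3_def)
  qed
  moreover have "continuous_on U g'"
    unfolding continuous_on_def
  proof
    fix x assume x: "x \<in> U"
    have "((\<lambda>x'. 2 * (norm (C x' - C x) + norm (A x' - A x) * norm (g' x))) \<longlongrightarrow>
        2 * (norm (C x - C x) + norm (A x - A x) * norm (g' x))) (at x within U)"
      using cont x unfolding continuous_on_def by (intro tendsto_intros) auto
    then have "((\<lambda>x'. 2 * (norm (C x' - C x) + norm (A x' - A x) * norm (g' x))) \<longlongrightarrow> 0) (at x within U)"
      by simp
    moreover have "norm (g' x' - g' x) \<le> 2 * (norm (C x' - C x) + norm (A x' - A x) * norm (g' x))"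
      if x': "x' \<in> U" for x'
    proof -
      have "g' x' - g' x = (C x' - C x) + ((A x' - A x) o\<^sub>L g' x) + (A x' o\<^sub>L (g' x' - g' x))"
      proof (rule blinfun_eqI)
        fix v
        have "C x v = g' x v - A x (g' x v)" "C x' v = g' x' v - A x' (g' x' v)"
          using g'eq[OF x, of v] g'eq[OF x', of v] by (metis add_diff_cancel_right')+
        then show "(g' x' - g' x) v = (C x' - C x + ((A x' - A x) o\<^sub>L g' x) + (A x' o\<^sub>L (g' x' - g' x))) v"
          by (simp add: blinfun.add_left blinfun.diff_left blinfun.diff_right)
      qed
      then have "norm (g' x' - g' x) \<le> norm (C x' - C x) + norm ((A x' - A x) o\<^sub>L g' x) + norm (A x' o\<^sub>L (g' x' - g' x))"
        by (metis (no_types, opaque_lifting) add_mono_thms_linordered_semiring(3) norm_triangle_ineq order_trans)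
      moreover have "norm (A x' o\<^sub>L (g' x' - g' x)) \<le> 1/2 * norm (g' x' - g' x)"
        using norm_blinfun_compose[of "A x'" "g' x' - g' x"] nA[OF x'] by (meson mult_right_mono norm_ge_zero order_trans)
      ultimately show ?thesis using norm_blinfun_compose[of "A x' - A x" "g' x"] by argo
    qed
    ultimately have "((\<lambda>x'. g' x' - g' x) \<longlongrightarrow> 0) (at x within U)"
      by (intro Lim_null_comparison[of "\<lambda>x'. g' x' - g' x"]) (auto simp: eventually_at_filter)
    then show "(g' \<longlongrightarrow> g' x) (at x within U)" by (rule LIM_zero_cancel)
  qed
  ultimately have "C1_on U g" by (rule C1_on_openI)
  moreover have "(x, g x) \<in> W \<and> \<Phi> (x, g x) = g x" if "x \<in> U" for x
    using e(2)[OF gnear(1)[OF that]] g(2)[OF that] by blast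
  ultimately show ?thesis
    using that[of U g] gx0 \<delta>(1) by (simp add: U_def)
qed

text \<open>
  The Newton-type map \<open>y - B (G (x, y))\<close> has a vanishing derivative in \<open>y\<close> at the base point
  because \<open>B\<close> is a left inverse of the partial derivative of \<open>G\<close>, and its fixed points are zeros
  of \<open>G\<close> because \<open>B\<close> is injective.
\<close>

theorem implicit_function_C1:
  fixes G :: "'x::real_normed_vector \<times> 'y::banach \<Rightarrow> 'z::real_normed_vector"
  assumes W: "open W" "(x0, y0) \<in> W" and C: "C1_on W G" and z: "G (x0, y0) = 0"
    and D: "(G has_derivative D) (at (x0, y0))"
    and B: "bounded_linear B" "\<And>y. B (D (0, y)) = y" "\<And>z. B z = 0 \<Longrightarrow> z = 0"
  obtains U g where "open U" "x0 \<in> U" "C1_on U g" "g x0 = y0"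
    "\<And>x. x \<in> U \<Longrightarrow> (x, g x) \<in> W \<and> G (x, g x) = 0"
proof -
  interpret B: bounded_linear B by fact
  have C1: "C1_on W (\<lambda>w. snd w - B (G w))"
    by (intro C1_on_diff C1_on_snd C1_on_linear_image[OF B(1) C])
  have D1: "((\<lambda>w. snd w - B (G w)) has_derivative (\<lambda>v. snd v - B (D v))) (at (x0, y0))"
    by (intro derivative_intros B.has_derivative D)
  obtain U g where "open U" "x0 \<in> U" "C1_on U g" "g x0 = y0"
    "\<And>x. x \<in> U \<Longrightarrow> (x, g x) \<in> W \<and> snd (x, g x) - B (G (x, g x)) = g x"
    by (rule fixed_point_C1[OF W C1 _ D1]) (auto simp: z B.zero B(2))
  then show ?thesis using that B(3) by auto
qed

section \<open>Superposition operators on continuous functions\<close>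

lemma bcontfun_compact_compose:
  fixes f :: "real \<Rightarrow> 'b::metric_space"
  assumes "continuous_on UNIV f" "compact (range f)"
  shows "f \<in> bcontfun"
  using assms(1) compact_imp_bounded[OF assms(2)] unfolding bcontfun_def by blast

text \<open>
  Continuous functions on the compact interval from the pole to the equator are represented as
  bounded continuous functions on the line that are read only through this retraction. This gives
  a Banach space without introducing a new type.
\<close>

definition qclamp :: "real \<Rightarrow> real" where "qclamp t = max 0 (min (pi/2) t)"

lemma qclamp: "qclamp t \<in> {0..pi/2}" "t \<in> {0..pi/2} \<Longrightarrow> qclamp t = t" "continuous_on A qclamp"
proof -
  show "continuous_on A qclamp" unfolding qclamp_def by (intro continuous_intros)
qed (use pi_gt_zero in \<open>auto simp: qclamp_def max_def min_def\<close>)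

lemma qclamp_idem [simp]: "qclamp (qclamp t) = qclamp t"
  by (rule qclamp(2)[OF qclamp(1)])

lemma qclamp_range: "range qclamp = {0..pi/2}"
proof (rule set_eqI)
  fix t show "t \<in> range qclamp \<longleftrightarrow> t \<in> {0..pi/2}"
    using qclamp(1) qclamp(2)[of t] by (metis rangeE rangeI)
qed

lemma bcontfun_qclamp:
  fixes f :: "real \<Rightarrow> 'b::metric_space"
  assumes "continuous_on {0..pi/2} f"
  shows "(\<lambda>t. f (qclamp t)) \<in> bcontfun"
proof (rule bcontfun_compact_compose)
  show "continuous_on UNIV (\<lambda>t. f (qclamp t))"
    by (rule continuous_on_compose2[OF assms qclamp(3)]) (use qclamp(1) in auto)
  have "range (\<lambda>t. f (qclamp t)) = f ` {0..pi/2}" unfolding qclamp_range[symmetric] image_image ..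
  then show "compact (range (\<lambda>t. f (qclamp t)))" using assms by (simp add: compact_continuous_image)
qed

text \<open>
  The superposition (Nemytskii) operator of a function \<open>f\<close> that also depends on a parameter
  \<open>fst w\<close>.
\<close>

definition superpose :: "('p \<times> 'e \<Rightarrow> 'f) \<Rightarrow> 'p \<times> (real \<Rightarrow>\<^sub>C 'e::metric_space) \<Rightarrow> (real \<Rightarrow>\<^sub>C 'f::metric_space)"
  where "superpose f w = Bcontfun (\<lambda>t. f (fst w, apply_bcontfun (snd w) (qclamp t)))"

definition tube :: "('p \<times> 'e) set \<Rightarrow> ('p \<times> (real \<Rightarrow>\<^sub>C 'e::metric_space)) set"
  where "tube U = {w. \<forall>t. (fst w, apply_bcontfun (snd w) (qclamp t)) \<in> U}"

lemma continuous_on_track: "continuous_on A (\<lambda>t. (p::'p::metric_space, apply_bcontfun y t))"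
  by (intro continuous_intros continuous_on_apply_bcontfun)

lemma superpose_apply:
  fixes f :: "'p::metric_space \<times> 'e::metric_space \<Rightarrow> 'f::metric_space"
  assumes "continuous_on U f" "w \<in> tube U"
  shows "apply_bcontfun (superpose f w) t = f (fst w, apply_bcontfun (snd w) (qclamp t))"
proof -
  have "(fst w, apply_bcontfun (snd w) s) \<in> U" if "s \<in> {0..pi/2}" for s
    using assms(2)[unfolded tube_def, THEN CollectD, rule_format, of s] qclamp(2)[OF that] by simp
  then have "continuous_on {0..pi/2} (\<lambda>t. f (fst w, apply_bcontfun (snd w) t))"
    by (intro continuous_on_compose2[OF assms(1) continuous_on_track] image_subsetI)
  then show ?thesis unfolding superpose_def
    by (subst Bcontfun_inverse) (auto intro: bcontfun_qclamp)
qed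

text \<open>
  A neighbourhood of the compact set is included in the uniformity: the point \<open>x\<close> ranges over the
  ambient space and is shown to lie in the domain \<open>U\<close>.
\<close>

lemma compact_uniform_continuity:
  fixes F :: "'a::metric_space \<Rightarrow> 'b::metric_space"
  assumes "open U" "continuous_on U F" "compact K" "K \<subseteq> U" "\<epsilon> > 0"
  obtains \<delta> where "\<delta> > 0" "\<And>c x. c \<in> K \<Longrightarrow> dist x c < \<delta> \<Longrightarrow> x \<in> U \<and> dist (F x) (F c) < \<epsilon>"
proof -
  have "\<exists>d>0. \<forall>x. dist x c < d \<longrightarrow> x \<in> U \<and> dist (F x) (F c) < \<epsilon>/2" if c: "c \<in> K" for c
  proof -
    obtain d1 where d1: "d1 > 0" "ball c d1 \<subseteq> U" using assms c open_contains_ball by blast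
    obtain d2 where d2: "d2 > 0" "\<And>x. x \<in> U \<Longrightarrow> dist x c < d2 \<Longrightarrow> dist (F x) (F c) < \<epsilon>/2"
      using assms(2,4,5) c unfolding continuous_on_iff by (metis half_gt_zero subsetD)
    show ?thesis
      using d1 d2 by (intro exI[of _ "min d1 d2"]) (auto simp: dist_commute subset_iff)
  qed
  then obtain d where d: "\<And>c. c \<in> K \<Longrightarrow> d c > 0"
    "\<And>c x. c \<in> K \<Longrightarrow> dist x c < d c \<Longrightarrow> x \<in> U \<and> dist (F x) (F c) < \<epsilon>/2" by metis
  obtain \<delta> where \<delta>: "\<delta> > 0" "\<And>x. x \<in> K \<Longrightarrow> \<exists>G\<in>(\<lambda>c. ball c (d c)) ` K. ball x \<delta> \<subseteq> G"
    using Heine_Borel_lemma[OF assms(3), of "(\<lambda>c. ball c (d c)) ` K"] d(1) by (metis (no_types, lifting) UN_I centre_in_ball imageE open_ball subsetI)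
  show ?thesis
  proof (rule that[OF \<delta>(1)])
    fix c x assume c: "c \<in> K" and x: "dist x c < \<delta>"
    obtain c' where c': "c' \<in> K" "ball c \<delta> \<subseteq> ball c' (d c')" using \<delta>(2)[OF c] by blast
    have "x \<in> ball c' (d c')" "c \<in> ball c' (d c')"
      by (rule subsetD[OF c'(2)], use x \<delta>(1) in \<open>simp add: dist_commute\<close>)+
    then have "x \<in> U \<and> dist (F x) (F c') < \<epsilon>/2" "dist (F c) (F c') < \<epsilon>/2"
      using d(2)[OF c'(1), of x] d(2)[OF c'(1), of c] by (simp_all add: dist_commute)
    then show "x \<in> U \<and> dist (F x) (F c) < \<epsilon>"
      using dist_triangle2[of "F x" "F c" "F c'"] by auto
  qed
qed

lemma dist_track:
  fixes w w' :: "'p::metric_space \<times> (real \<Rightarrow>\<^sub>C 'e::metric_space)"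
  shows "dist (fst w, apply_bcontfun (snd w) t) (fst w', apply_bcontfun (snd w') t) \<le> dist w w'"
  unfolding dist_prod_def fst_conv snd_conv
  by (intro real_sqrt_le_mono add_mono order_refl power_mono dist_bounded) auto

lemma compact_track:
  "compact (range (\<lambda>t. (p::'p::metric_space, apply_bcontfun y (qclamp t))))"
proof -
  have "range (\<lambda>t. (p, apply_bcontfun y (qclamp t))) = (\<lambda>t. (p, apply_bcontfun y t)) ` {0..pi/2}"
    unfolding qclamp_range[symmetric] image_image ..
  then show ?thesis using compact_continuous_image[OF continuous_on_track] by (metis compact_Icc)
qed

lemma open_tube:
  fixes U :: "('p::metric_space \<times> 'e::metric_space) set"
  assumes "open U"
  shows "open (tube U)"
  unfolding open_dist
proof
  fix w :: "'p \<times> (real \<Rightarrow>\<^sub>C 'e)" assume w: "w \<in> tube U"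
  obtain \<delta> where \<delta>: "\<delta> > 0" "\<And>c x. c \<in> range (\<lambda>t. (fst w, apply_bcontfun (snd w) (qclamp t))) \<Longrightarrow>
      dist x c < \<delta> \<Longrightarrow> x \<in> U \<and> dist x c < 1"
    by (rule compact_uniform_continuity[OF assms continuous_on_id compact_track, of "fst w" "snd w" 1])
       (use w in \<open>auto simp: tube_def\<close>)
  have "w' \<in> tube U" if "dist w' w < \<delta>" for w'
    unfolding tube_def
  proof (intro CollectI allI)
    fix t
    show "(fst w', apply_bcontfun (snd w') (qclamp t)) \<in> U"
      using \<delta>(2)[OF rangeI[of _ t]] order_le_less_trans[OF dist_track that] by blast
  qed
  then show "\<exists>e>0. \<forall>y. dist y w < e \<longrightarrow> y \<in> tube U" using \<delta>(1) by blast
qed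

text \<open>
  The graph of a continuous function over the compact interval is compact, so the derivative of
  \<open>f\<close> is uniformly continuous along it, and the linearisation error of \<open>f\<close> is uniformly small on
  balls around its points. The supremum norm then turns pointwise estimates into operator
  estimates.
\<close>

lemma superpose_C1:
  fixes f :: "'p::real_normed_vector \<times> 'e::real_normed_vector \<Rightarrow> 'f::real_normed_vector"
  assumes U: "open U"
    and f': "\<And>x. x \<in> U \<Longrightarrow> (f has_derivative blinfun_apply (f' x)) (at x)" "continuous_on U f'"
  obtains N' where "\<And>w. w \<in> tube U \<Longrightarrow> (superpose f has_derivative blinfun_apply (N' w)) (at w)"
    "continuous_on (tube U) N'"
    "\<And>w v t. w \<in> tube U \<Longrightarrow> apply_bcontfun (N' w v) t =
        f' (fst w, apply_bcontfun (snd w) (qclamp t)) (fst v, apply_bcontfun (snd v) (qclamp t))"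
proof -
  define tr where "tr w t = (fst w, apply_bcontfun (snd w) (qclamp t))"
    for w :: "'p \<times> (real \<Rightarrow>\<^sub>C 'e)" and t
  have cf: "continuous_on U f"
    using f'(1) has_derivative_continuous continuous_at_imp_continuous_on by blast
  have tube: "w \<in> tube U \<longleftrightarrow> (\<forall>t. tr w t \<in> U)" for w by (simp add: tube_def tr_def)
  have ctr: "compact (range (tr w))" for w unfolding tr_def by (rule compact_track)
  have ctr': "continuous_on UNIV (tr w)" for w
    unfolding tr_def
    by (rule continuous_on_compose2[OF continuous_on_track[of UNIV] qclamp(3)]) auto
  have trd: "tr w t - tr w' t = tr (w - w') t" for w w' t by (simp add: tr_def)
  have ntr: "norm (tr w t) \<le> norm w" for w t
    unfolding tr_def norm_prod_def fst_conv snd_conv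
    by (intro real_sqrt_le_mono add_mono order_refl power_mono norm_bounded) auto
  have mem: "(\<lambda>t. f' (tr w t) (tr v t)) \<in> bcontfun" if "w \<in> tube U" for w v
  proof -
    have "continuous_on UNIV (\<lambda>t. (f' (tr w t), tr v t))"
      using that by (intro continuous_intros ctr' continuous_on_compose2[OF f'(2) ctr']) (auto simp: tube)
    have 1: "continuous_on {0..pi/2} (\<lambda>t. f' (tr w t) (tr v t))"
      using that by (intro continuous_intros continuous_on_subset[OF ctr' subset_UNIV]
          continuous_on_compose2[OF f'(2) continuous_on_subset[OF ctr' subset_UNIV]]) (auto simp: tube)
    show ?thesis using bcontfun_qclamp[OF 1] by (simp add: tr_def)
  qed
  define D where "D w v = Bcontfun (\<lambda>t. f' (tr w t) (tr v t))" for w v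
  have D: "apply_bcontfun (D w v) t = f' (tr w t) (tr v t)" if "w \<in> tube U" for w v t
    unfolding D_def using mem[OF that] by (simp add: Bcontfun_inverse)
  have bl: "bounded_linear (D w)" if w: "w \<in> tube U" for w
  proof -
    have "bounded ((\<lambda>x. f' x) ` range (tr w))"
      using w by (intro compact_imp_bounded compact_continuous_image ctr continuous_on_subset[OF f'(2)])
                 (auto simp: tube)
    then obtain B where B: "\<And>t. norm (f' (tr w t)) \<le> B" by (auto simp: bounded_iff)
    show ?thesis
    proof (rule bounded_linear_intro)
      show "D w (v + v') = D w v + D w v'" for v v'
        by (rule bcontfun_eqI) (simp add: D[OF w] tr_def blinfun.add_right[symmetric])
      show "D w (r *\<^sub>R v) = r *\<^sub>R D w v" for r v
        by (rule bcontfun_eqI) (simp add: D[OF w] tr_def blinfun.scaleR_right[symmetric])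
      show "norm (D w v) \<le> norm v * B" for v
      proof (rule norm_bound)
        fix t
        have "norm (f' (tr w t) (tr v t)) \<le> norm (f' (tr w t)) * norm (tr v t)" by (rule norm_blinfun)
        also have "\<dots> \<le> B * norm v" by (intro mult_mono B ntr) (use order_trans[OF norm_ge_zero B[of 0]] in auto)
        finally show "norm (apply_bcontfun (D w v) t) \<le> norm v * B" by (simp add: D[OF w] mult.commute)
      qed
    qed
  qed
  define N' where "N' w = Blinfun (D w)" for w
  have N': "blinfun_apply (N' w) v = D w v" if "w \<in> tube U" for w v
    unfolding N'_def by (simp add: bounded_linear_Blinfun_apply[OF bl[OF that]])
  have key: "\<exists>\<delta>>0. \<forall>w'. dist w' w < \<delta> \<longrightarrow> w' \<in> tube U \<and>
      (\<forall>t x. dist x (tr w t) < \<delta> \<longrightarrow> x \<in> U \<and> norm (f' x - f' (tr w t)) \<le> \<epsilon>)"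
    if w: "w \<in> tube U" and e: "\<epsilon> > 0" for w \<epsilon>
  proof -
    obtain \<delta> where \<delta>: "\<delta> > 0" "\<And>c x. c \<in> range (tr w) \<Longrightarrow> dist x c < \<delta> \<Longrightarrow> x \<in> U \<and> dist (f' x) (f' c) < \<epsilon>"
      by (rule compact_uniform_continuity[OF U f'(2) ctr[of w] _ e]) (use w in \<open>auto simp: tube\<close>)
    have "x \<in> U \<and> norm (f' x - f' (tr w t)) \<le> \<epsilon>" if "dist x (tr w t) < \<delta>" for x t
      using \<delta>(2)[OF rangeI that] by (simp add: dist_norm)
    moreover have "w' \<in> tube U" if "dist w' w < \<delta>" for w'
      unfolding tube
    proof
      fix t
      have "dist (tr w' t) (tr w t) < \<delta>" unfolding tr_def by (rule order_le_less_trans[OF dist_track that])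
      then show "tr w' t \<in> U" using \<delta>(2)[OF rangeI] by blast
    qed
    ultimately show ?thesis using \<delta>(1) by blast
  qed
  have "(superpose f has_derivative blinfun_apply (N' w)) (at w)" if w: "w \<in> tube U" for w
    unfolding has_derivative_at_alt
  proof (intro conjI allI impI blinfun.bounded_linear_right)
    fix \<epsilon> :: real assume "\<epsilon> > 0"
    then obtain \<delta> where \<delta>: "\<delta> > 0" "\<And>w'. dist w' w < \<delta> \<Longrightarrow> w' \<in> tube U"
      "\<And>t x. dist x (tr w t) < \<delta> \<Longrightarrow> x \<in> U \<and> norm (f' x - f' (tr w t)) \<le> \<epsilon>"
      using key[OF w, of \<epsilon>] \<open>\<epsilon> > 0\<close> by (metis (no_types, opaque_lifting) dist_self)
    have "norm (superpose f w' - superpose f w - N' w (w' - w)) \<le> \<epsilon> * norm (w' - w)"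
      if w': "norm (w' - w) < \<delta>" for w'
    proof (rule norm_bound)
      fix t
      have t': "w' \<in> tube U" using \<delta>(2) w' by (simp add: dist_norm)
      have a: "dist (tr w' t) (tr w t) < \<delta>"
        unfolding tr_def by (rule order_le_less_trans[OF dist_track]) (use w' in \<open>simp add: dist_norm\<close>)
      have seg: "tr w t + s *\<^sub>R (tr w' t - tr w t) \<in> ball (tr w t) \<delta>" if "s \<in> {0..1}" for s
      proof -
        have "\<bar>s\<bar> * norm (tr w' t - tr w t) \<le> 1 * norm (tr w' t - tr w t)"
          using that by (intro mult_right_mono) auto
        then show ?thesis using a by (simp add: dist_norm)
      qed
      have "norm (f (tr w' t) - f (tr w t) - f' (tr w t) (tr w' t - tr w t))
          \<le> norm (tr w' t - tr w t) * \<epsilon>"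
      proof (rule differentiable_bound_linearization[where S = "ball (tr w t) \<delta>" and f' = "\<lambda>x. blinfun_apply (f' x)"])
        show "(f has_derivative blinfun_apply (f' x)) (at x within ball (tr w t) \<delta>)" if "x \<in> ball (tr w t) \<delta>" for x
          by (rule has_derivative_at_withinI, rule f'(1)) (use \<delta>(3)[of x t] that in \<open>simp add: dist_commute\<close>)
        show "onorm (blinfun_apply (f' x) - blinfun_apply (f' (tr w t))) \<le> \<epsilon>" if "x \<in> ball (tr w t) \<delta>" for x
          using \<delta>(3)[of x t] that
          by (simp add: dist_commute norm_blinfun.rep_eq minus_blinfun.rep_eq fun_diff_def)
      qed (use seg \<delta>(1) in auto)
      also have "\<dots> \<le> \<epsilon> * norm (w' - w)"
        unfolding trd using ntr[of "w' - w" t] \<open>\<epsilon> > 0\<close> by (simp add: mult.commute mult_right_mono)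
      finally show "norm (apply_bcontfun (superpose f w' - superpose f w - N' w (w' - w)) t) \<le> \<epsilon> * norm (w' - w)"
        by (simp add: superpose_apply[OF cf t'] superpose_apply[OF cf w] N'[OF w] D[OF w] trd tr_def[symmetric])
    qed
    then show "\<exists>d>0. \<forall>y. norm (y - w) < d \<longrightarrow>
        norm (superpose f y - superpose f w - N' w (y - w)) \<le> \<epsilon> * norm (y - w)"
      using \<delta>(1) by blast
  qed
  moreover have "continuous_on (tube U) N'"
    unfolding continuous_on_iff
  proof (intro ballI allI impI)
    fix w and \<epsilon> :: real assume w: "w \<in> tube U" and e: "\<epsilon> > 0"
    obtain \<delta> where \<delta>: "\<delta> > 0" "\<And>w'. dist w' w < \<delta> \<Longrightarrow> w' \<in> tube U"
      "\<And>t x. dist x (tr w t) < \<delta> \<Longrightarrow> x \<in> U \<and> norm (f' x - f' (tr w t)) \<le> \<epsilon>/2"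
      using key[OF w, of "\<epsilon>/2"] e by (metis (no_types, opaque_lifting) dist_self half_gt_zero)
    have "dist (N' w') (N' w) < \<epsilon>" if w': "w' \<in> tube U" "dist w' w < \<delta>" for w'
    proof -
      have "norm (N' w' - N' w) \<le> \<epsilon>/2"
      proof (rule norm_blinfun_bound)
        fix v
        show "norm ((N' w' - N' w) v) \<le> \<epsilon>/2 * norm v"
        proof (rule norm_bound)
          fix t
          have "dist (tr w' t) (tr w t) < \<delta>" unfolding tr_def by (rule order_le_less_trans[OF dist_track w'(2)])
          then have 1: "norm (f' (tr w' t) - f' (tr w t)) \<le> \<epsilon>/2" using \<delta>(3) by blast
          have "norm ((f' (tr w' t) - f' (tr w t)) (tr v t)) \<le> norm (f' (tr w' t) - f' (tr w t)) * norm (tr v t)"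
            by (rule norm_blinfun)
          also have "\<dots> \<le> \<epsilon>/2 * norm v" by (intro mult_mono 1 ntr) (use e in auto)
          finally show "norm (apply_bcontfun ((N' w' - N' w) v) t) \<le> \<epsilon>/2 * norm v"
            by (simp add: blinfun.diff_left N' D w w')
        qed
      qed (use e in simp)
      then show ?thesis using e by (simp add: dist_norm)
    qed
    then show "\<exists>d>0. \<forall>x'\<in>tube U. dist x' w < d \<longrightarrow> dist (N' x') (N' w) < \<epsilon>" using \<delta>(1) by blast
  qed
  ultimately show ?thesis using that[of N'] N' D by (simp add: tr_def)
qed

section \<open>The singular radial equation as a Volterra integral equation\<close>

instance bcontfun :: (metric_space, banach) banach ..

text \<open>
  On zonal functions the Laplacian is, up to sign, the operator
  \<open>v'' + m cot \<theta> v' = (sin \<theta> ^ m v')' / sin \<theta> ^ m\<close> with \<open>m = n - 1\<close>. Regular solutions of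
  \<open>v'' + m cot \<theta> v' = h\<close> are obtained by integrating twice: the flux is \<open>sin \<theta> ^ m v'\<close>, the slope
  is \<open>v'\<close>, and the potential is the solution with \<open>v 0 = 0\<close>. At the pole the slope of a regular
  solution vanishes.
\<close>

definition flux :: "nat \<Rightarrow> (real \<Rightarrow> 'e::euclidean_space) \<Rightarrow> real \<Rightarrow> 'e" where
  "flux m h \<theta> = integral {0..\<theta>} (\<lambda>\<sigma>. sin \<sigma> ^ m *\<^sub>R h \<sigma>)"

definition slope :: "nat \<Rightarrow> (real \<Rightarrow> 'e::euclidean_space) \<Rightarrow> real \<Rightarrow> 'e" where
  "slope m h \<theta> = (if \<theta> = 0 then 0 else flux m h \<theta> /\<^sub>R sin \<theta> ^ m)"

definition potential :: "nat \<Rightarrow> (real \<Rightarrow> 'e::euclidean_space) \<Rightarrow> real \<Rightarrow> 'e" where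
  "potential m h \<theta> = integral {0..\<theta>} (slope m h)"

lemma flux_has_derivative:
  assumes "continuous_on {0..b} h" "\<theta> \<in> {0..b}"
  shows "(flux m h has_vector_derivative sin \<theta> ^ m *\<^sub>R h \<theta>) (at \<theta> within {0..b})"
  unfolding flux_def
  by (rule integral_has_vector_derivative[OF _ assms(2)]) (intro continuous_intros assms)

lemma flux_0 [simp]: "flux m h 0 = 0"
  by (simp add: flux_def)

lemma continuous_on_flux: "continuous_on {0..b} h \<Longrightarrow> continuous_on {0..b} (flux m h)"
  by (rule continuous_on_vector_derivative) (rule flux_has_derivative)

text \<open>
  The sine increases up to the equator, so the weight \<open>sin \<sigma> ^ m / sin \<theta> ^ m\<close> under the integral
  is at most \<open>1\<close>: the singularity of the coefficient at the pole is harmless.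
\<close>

lemma slope_bound:
  assumes h: "continuous_on {0..\<theta>} h" and t: "\<theta> \<in> {0..pi/2}"
    and B: "\<And>\<sigma>. \<sigma> \<in> {0..\<theta>} \<Longrightarrow> norm (h \<sigma>) \<le> B"
  shows "norm (slope m h \<theta>) \<le> \<theta> * B"
proof (cases "\<theta> = 0")
  case False
  then have t0: "0 < \<theta>" "\<theta> \<le> pi/2" using t by auto
  have s0: "sin \<theta> > 0" using t0 pi_gt_zero by (intro sin_gt_zero) linarith+
  have B0: "0 \<le> B" using order_trans[OF norm_ge_zero B[of 0]] t0 by simp
  have "norm (flux m h \<theta>) \<le> integral {0..\<theta>} (\<lambda>\<sigma>. sin \<theta> ^ m * B)"
    unfolding flux_def
  proof (rule integral_norm_bound_integral)
    show "(\<lambda>\<sigma>. sin \<sigma> ^ m *\<^sub>R h \<sigma>) integrable_on {0..\<theta>}"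
      by (intro integrable_continuous_interval continuous_intros h)
    fix \<sigma> assume s: "\<sigma> \<in> {0..\<theta>}"
    have "0 \<le> sin \<sigma>" "sin \<sigma> \<le> sin \<theta>"
      using s t0 by (auto intro!: sin_ge_zero sin_monotone_2pi_le)
    then show "norm (sin \<sigma> ^ m *\<^sub>R h \<sigma>) \<le> sin \<theta> ^ m * B"
      using B[OF s] B0 by (auto intro!: mult_mono power_mono)
  qed auto
  also have "\<dots> = \<theta> * B * sin \<theta> ^ m" using t0 by simp
  finally show ?thesis using False s0 by (simp add: slope_def divide_simps mult.commute)
qed (simp add: slope_def)

lemma slope_bound_power:
  assumes h: "continuous_on {0..pi/2} h" and t: "\<theta> \<in> {0..pi/2}"
    and B: "\<And>\<sigma>. \<sigma> \<in> {0..pi/2} \<Longrightarrow> norm (h \<sigma>) \<le> B * \<sigma> ^ k" "0 \<le> B"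
  shows "norm (slope m h \<theta>) \<le> 2 * B * \<theta> ^ k"
proof -
  have "norm (slope m h \<theta>) \<le> \<theta> * (B * \<theta> ^ k)"
  proof (rule slope_bound[OF continuous_on_subset[OF h] t])
    fix \<sigma> assume s: "\<sigma> \<in> {0..\<theta>}"
    then have "norm (h \<sigma>) \<le> B * \<sigma> ^ k" using t by (intro B) auto
    also have "\<dots> \<le> B * \<theta> ^ k" using s B(2) by (intro mult_left_mono power_mono) auto
    finally show "norm (h \<sigma>) \<le> B * \<theta> ^ k" .
  qed (use t in auto)
  \<comment> \<open>The factor \<open>\<theta> \<le> pi/2\<close> is rounded up to \<open>2\<close>.\<close>
  also have "\<dots> \<le> 2 * (B * \<theta> ^ k)"
    using t B(2) pi_less_4 by (intro mult_right_mono) auto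
  finally show ?thesis by (simp add: mult.assoc)
qed

lemma continuous_on_slope:
  fixes h :: "real \<Rightarrow> 'e::euclidean_space"
  assumes h: "continuous_on {0..b} h" and b: "b < pi"
  shows "continuous_on {0..b} (slope m h)"
  unfolding continuous_on_def
proof
  fix \<theta> assume t: "\<theta> \<in> {0..b}"
  show "(slope m h \<longlongrightarrow> slope m h \<theta>) (at \<theta> within {0..b})"
  proof (cases "\<theta> = 0")
    case False
    then have t0: "0 < \<theta>" "\<theta> < pi" using t b by auto
    have "((\<lambda>\<theta>. flux m h \<theta> /\<^sub>R sin \<theta> ^ m) \<longlongrightarrow> flux m h \<theta> /\<^sub>R sin \<theta> ^ m) (at \<theta> within {0..b})"
      using continuous_on_flux[OF h, of m] t sin_gt_zero[OF t0] unfolding continuous_on_def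
      by (intro tendsto_intros) auto
    moreover have "eventually (\<lambda>x. flux m h x /\<^sub>R sin x ^ m = slope m h x) (at \<theta> within {0..b})"
    proof -
      have "eventually (\<lambda>x. x \<in> {0<..}) (at \<theta> within {0..b})"
        unfolding eventually_at using t0 by (intro exI[of _ \<theta>]) (auto simp: dist_norm)
      then show ?thesis by eventually_elim (auto simp: slope_def)
    qed
    ultimately show ?thesis using False by (simp add: slope_def[of m h \<theta>] tendsto_cong)
  next
    case True
    have "bounded (h ` {0..b})" using h by (intro compact_imp_bounded compact_continuous_image) auto
    then obtain B where B: "\<And>s. s \<in> {0..b} \<Longrightarrow> norm (h s) \<le> B" unfolding bounded_iff by blast
    have "((\<lambda>x. x * B) \<longlongrightarrow> 0 * B) (at 0 within {0..b})" by (intro tendsto_intros)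
    moreover have "eventually (\<lambda>x. norm (slope m h x) \<le> x * B) (at 0 within {0..b})"
      unfolding eventually_at
    proof (intro exI[of _ "pi/2"] conjI ballI impI)
      fix x assume x: "x \<in> {0..b}" "x \<noteq> 0 \<and> dist x 0 < pi/2"
      show "norm (slope m h x) \<le> x * B"
        by (rule slope_bound[OF continuous_on_subset[OF h]]) (use x B in \<open>auto simp: dist_norm\<close>)
    qed simp
    ultimately have "(slope m h \<longlongrightarrow> 0) (at 0 within {0..b})"
      by (intro Lim_null_comparison[of "slope m h"]) auto
    then show ?thesis using True by (simp add: slope_def[of m h 0])
  qed
qed

lemma potential_has_derivative:
  assumes "continuous_on {0..b} h" "b < pi" "\<theta> \<in> {0..b}"
  shows "(potential m h has_vector_derivative slope m h \<theta>) (at \<theta> within {0..b})"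
  unfolding potential_def
  by (rule integral_has_vector_derivative[OF continuous_on_slope[OF assms(1,2)] assms(3)])

lemma potential_0 [simp]: "potential m h 0 = 0"
  by (simp add: potential_def)

lemma pi_half_less: "pi/2 < pi" "0 \<le> pi/2"
  using pi_gt_zero by auto

text \<open>
  Each application of the solution operator raises the power of \<open>\<theta>\<close> by one and divides by the new
  exponent, which produces the factorials in the bound for its iterates.
\<close>

lemma potential_bound_power:
  assumes h: "continuous_on {0..pi/2} h" and t: "\<theta> \<in> {0..pi/2}"
    and B: "\<And>\<sigma>. \<sigma> \<in> {0..pi/2} \<Longrightarrow> norm (h \<sigma>) \<le> B * \<sigma> ^ k" "0 \<le> B"
  shows "norm (potential m h \<theta>) \<le> 2 * B / real (Suc k) * \<theta> ^ Suc k"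
proof -
  have c: "continuous_on {0..\<theta>} (slope m h)"
    by (rule continuous_on_subset[OF continuous_on_slope[OF h pi_half_less(1)]]) (use t in auto)
  have i: "((\<lambda>\<sigma>. 2 * B * \<sigma> ^ k) has_integral (2 * B / real (Suc k) * \<theta> ^ Suc k - 2 * B / real (Suc k) * 0 ^ Suc k)) {0..\<theta>}"
  proof (rule fundamental_theorem_of_calculus)
    fix x
    have "((\<lambda>\<sigma>. 2 * B / real (Suc k) * \<sigma> ^ Suc k) has_real_derivative 2 * B * x ^ k) (at x within {0..\<theta>})"
      by (rule DERIV_cong[OF DERIV_cmult[OF DERIV_pow]]) (simp del: of_nat_Suc)
    then show "((\<lambda>\<sigma>. 2 * B / real (Suc k) * \<sigma> ^ Suc k) has_vector_derivative 2 * B * x ^ k) (at x within {0..\<theta>})"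
      by (simp only: has_real_derivative_iff_has_vector_derivative)
  qed (use t in simp)
  have "norm (potential m h \<theta>) \<le> integral {0..\<theta>} (\<lambda>\<sigma>. 2 * B * \<sigma> ^ k)"
    unfolding potential_def
  proof (rule integral_norm_bound_integral)
    show "norm (slope m h \<sigma>) \<le> 2 * B * \<sigma> ^ k" if "\<sigma> \<in> {0..\<theta>}" for \<sigma>
      using that t by (intro slope_bound_power[OF h _ B]) auto
  qed (use i in \<open>auto intro: integrable_continuous_interval c\<close>)
  then show ?thesis using integral_unique[OF i] by simp
qed

lemma slope_add: 
  assumes "continuous_on {0..\<theta>} h" "continuous_on {0..\<theta>} k"
  shows "slope m (\<lambda>\<sigma>. h \<sigma> + k \<sigma>) \<theta> = slope m h \<theta> + slope m k \<theta>"
proof -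
  have "integral {0..\<theta>} (\<lambda>\<sigma>. sin \<sigma> ^ m *\<^sub>R h \<sigma> + sin \<sigma> ^ m *\<^sub>R k \<sigma>) = flux m h \<theta> + flux m k \<theta>"
    unfolding flux_def
    by (rule integral_add) (intro integrable_continuous_interval continuous_intros assms)+
  then show ?thesis by (simp add: slope_def flux_def scaleR_add_right)
qed

lemma slope_scaleR: "slope m (\<lambda>\<sigma>. r *\<^sub>R h \<sigma>) \<theta> = r *\<^sub>R slope m h \<theta>"
proof -
  have "integral {0..\<theta>} (\<lambda>\<sigma>. sin \<sigma> ^ m *\<^sub>R r *\<^sub>R h \<sigma>) = r *\<^sub>R flux m h \<theta>"
    unfolding flux_def by (subst scaleR_left_commute) (rule integral_cmul)
  then show ?thesis by (simp add: slope_def flux_def)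
qed

lemma potential_add:
  assumes "continuous_on {0..\<theta>} h" "continuous_on {0..\<theta>} k" "\<theta> < pi"
  shows "potential m (\<lambda>\<sigma>. h \<sigma> + k \<sigma>) \<theta> = potential m h \<theta> + potential m k \<theta>"
proof -
  have "potential m (\<lambda>\<sigma>. h \<sigma> + k \<sigma>) \<theta> = integral {0..\<theta>} (\<lambda>x. slope m h x + slope m k x)"
    unfolding potential_def
    by (intro integral_cong slope_add) (auto intro: continuous_on_subset[OF assms(1)] continuous_on_subset[OF assms(2)])
  also have "\<dots> = potential m h \<theta> + potential m k \<theta>"
    unfolding potential_def
    by (rule integral_add) (intro integrable_continuous_interval continuous_on_slope assms)+
  finally show ?thesis .
qed

lemma potential_scaleR: "potential m (\<lambda>\<sigma>. r *\<^sub>R h \<sigma>) \<theta> = r *\<^sub>R potential m h \<theta>"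
  unfolding potential_def slope_scaleR by (rule integral_cmul)

text \<open>
  The source is arbitrary outside the interval; clamping the argument makes the result a bounded
  function.
\<close>

definition solve_op :: "nat \<Rightarrow> (real \<Rightarrow>\<^sub>C 'e::euclidean_space) \<Rightarrow> (real \<Rightarrow>\<^sub>C 'e)" where
  "solve_op m h = Bcontfun (\<lambda>t. potential m (apply_bcontfun h) (qclamp t))"

lemma solve_op_apply:
  "apply_bcontfun (solve_op m h) t = potential m (apply_bcontfun h) (qclamp t)"
proof -
  have "continuous_on {0..pi/2} (potential m (apply_bcontfun h))"
    by (rule continuous_on_vector_derivative, rule potential_has_derivative)
       (auto simp: pi_half_less)
  from bcontfun_qclamp[OF this] show ?thesis by (simp add: solve_op_def Bcontfun_inverse)
qed

lemma qclamp_bounds: "0 \<le> qclamp t" "qclamp t \<le> pi/2" "qclamp t < pi"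
  using qclamp(1)[of t] pi_half_less(1) unfolding atLeastAtMost_iff by linarith+

lemma solve_op_bound:
  assumes B: "\<And>t. norm (apply_bcontfun h t) \<le> B * qclamp t ^ k" "0 \<le> B"
  shows "norm (apply_bcontfun (solve_op m h) t) \<le> 2 * B / real (Suc k) * qclamp t ^ Suc k"
  unfolding solve_op_apply
proof (rule potential_bound_power[OF _ qclamp(1) _ B(2)])
  show "norm (apply_bcontfun h \<sigma>) \<le> B * \<sigma> ^ k" if "\<sigma> \<in> {0..pi/2}" for \<sigma>
    using B(1)[of \<sigma>] by (simp add: qclamp(2)[OF that])
qed simp

lemma bounded_linear_solve_op: "bounded_linear (solve_op m)"
proof (rule bounded_linear_intro)
  show "solve_op m (h + k) = solve_op m h + solve_op m k" for h k :: "real \<Rightarrow>\<^sub>C 'a"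
    by (rule bcontfun_eqI) (simp add: solve_op_apply potential_add qclamp_bounds)
  show "solve_op m (r *\<^sub>R h) = r *\<^sub>R solve_op m h" for r and h :: "real \<Rightarrow>\<^sub>C 'a"
    by (rule bcontfun_eqI) (simp add: solve_op_apply potential_scaleR)
  show "norm (solve_op m h) \<le> norm h * 4" for h :: "real \<Rightarrow>\<^sub>C 'a"
  proof (rule norm_bound)
    fix t
    have "norm (apply_bcontfun (solve_op m h) t) \<le> 2 * norm h / real (Suc 0) * qclamp t ^ Suc 0"
      by (rule solve_op_bound) (simp_all add: norm_bounded)
    also have "\<dots> \<le> 2 * norm h * 2" using qclamp_bounds(2)[of t] pi_less_4 mult_left_mono[of "qclamp t" 2 "norm h"] by simp
    finally show "norm (apply_bcontfun (solve_op m h) t) \<le> norm h * 4" by simp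
  qed
qed

text \<open>
  The iterates of a Volterra operator are bounded by the terms of an exponential series. Hence the
  linearised initial value problem is solvable whatever the size of its coefficients, which is why
  no smallness appears in the shooting argument.
\<close>

lemma volterra_resolvent:
  fixes M :: "(real \<Rightarrow>\<^sub>C 'e::euclidean_space) \<Rightarrow> (real \<Rightarrow>\<^sub>C 'e)"
  assumes M: "bounded_linear M"
    and C: "\<And>y t. norm (apply_bcontfun (M y) t) \<le> C * norm (apply_bcontfun y (qclamp t))"
  obtains S where "bounded_linear S" "\<And>y. S y = y + solve_op m (M (S y))"
    "\<And>y. S (y - solve_op m (M y)) = y"
proof -
  define D where "D = max 0 C"
  have D: "norm (apply_bcontfun (M y) t) \<le> D * norm (apply_bcontfun y (qclamp t))" for y t
    by (rule order_trans[OF C]) (auto simp: D_def intro: mult_right_mono)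
  have D0: "0 \<le> D" by (simp add: D_def)
  define A where "A y = solve_op m (M y)" for y
  have A: "bounded_linear A"
    unfolding A_def by (rule bounded_linear_compose[OF bounded_linear_solve_op M])
  have pw: "norm (apply_bcontfun ((A ^^ k) y) (qclamp t)) \<le> norm y * (2 * D) ^ k / fact k * qclamp t ^ k" for k y t
  proof (induction k arbitrary: t)
    case 0 show ?case by (simp add: norm_bounded)
  next
    case (Suc k)
    have "norm (apply_bcontfun (A ((A ^^ k) y)) (qclamp t))
        \<le> 2 * (D * (norm y * (2 * D) ^ k / fact k)) / real (Suc k) * qclamp (qclamp t) ^ Suc k"
      unfolding A_def[of "(A ^^ k) y"]
    proof (rule solve_op_bound)
      fix s
      have "norm (apply_bcontfun (M ((A ^^ k) y)) s) \<le> D * norm (apply_bcontfun ((A ^^ k) y) (qclamp s))" by (rule D)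
      also have "\<dots> \<le> D * (norm y * (2 * D) ^ k / fact k * qclamp s ^ k)"
        by (intro mult_left_mono Suc D0)
      finally show "norm (apply_bcontfun (M ((A ^^ k) y)) s) \<le> D * (norm y * (2 * D) ^ k / fact k) * qclamp s ^ k"
        by (simp add: mult.assoc)
    qed (use D0 in simp)
    then show ?case by (simp add: field_simps)
  qed
  \<comment> \<open>The constant \<open>8\<close> is \<open>2 * 4\<close>, with \<open>pi/2\<close> rounded up to \<open>4\<close>.\<close>
  have bd: "norm ((A ^^ k) y) \<le> (8 * D) ^ k / fact k * norm y" for k y
  proof (cases k)
    case (Suc j)
    have "norm (apply_bcontfun ((A ^^ k) y) t) \<le> (8 * D) ^ k / fact k * norm y" for t
    proof -
      have "apply_bcontfun ((A ^^ k) y) t = apply_bcontfun ((A ^^ k) y) (qclamp t)"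
        by (simp add: Suc A_def solve_op_apply)
      also have "norm \<dots> \<le> norm y * (2 * D) ^ k / fact k * qclamp t ^ k" by (rule pw)
      also have "\<dots> \<le> norm y * (2 * D) ^ k / fact k * 4 ^ k"
        using qclamp_bounds[of t] pi_less_4 D0 by (intro mult_left_mono power_mono) auto
      also have "\<dots> = (8 * D) ^ k / fact k * norm y"
      proof -
        have "(2 * D) ^ k * 4 ^ k = (2 * D * 4) ^ k" by (rule power_mult_distrib[symmetric])
        also have "2 * D * 4 = 8 * D" by simp
        finally show ?thesis by (simp add: mult.commute mult.left_commute)
      qed
      finally show ?thesis .
    qed
    then show ?thesis using Suc by (auto intro: norm_bound)
  qed simp
  have "summable (\<lambda>k. (8 * D) ^ k / fact k)"
    using summable_exp[of "8 * D"] by (simp add: divide_inverse mult.commute)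
  from neumann_series[OF A, where c = "\<lambda>k. (8 * D) ^ k / fact k", OF bd this] that
  show ?thesis unfolding A_def by blast
qed

section \<open>Dependence of the singular initial value problem on parameters\<close>

lemma bounded_linear_const_bcontfun:
  "bounded_linear (const_bcontfun :: 'e::real_normed_vector \<Rightarrow> (real \<Rightarrow>\<^sub>C 'e))"
  by (rule bounded_linear_intro[where K = 1]) (auto intro!: bcontfun_eqI norm_bound)

lemma bounded_along_track:
  fixes F :: "'p::metric_space \<times> 'e::metric_space \<Rightarrow> 'b::real_normed_vector"
  assumes "continuous_on U F" "(p, y) \<in> tube U"
  obtains B where "\<And>t. norm (F (p, apply_bcontfun y (qclamp t))) \<le> B"
proof -
  have "range (\<lambda>t. (p, apply_bcontfun y (qclamp t))) \<subseteq> U" using assms(2) by (auto simp: tube_def)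
  then have "bounded (F ` range (\<lambda>t. (p, apply_bcontfun y (qclamp t))))"
    by (intro compact_imp_bounded compact_continuous_image compact_track continuous_on_subset[OF assms(1)])
  then show ?thesis using that unfolding bounded_iff by blast
qed

text \<open>
  This is the implicit function theorem for \<open>y - c p - solve_op m (superpose f (p, y))\<close>: the
  partial derivative in \<open>y\<close> is the identity minus a Volterra operator, hence invertible. Besides
  the family \<open>Y\<close> itself the statement exposes the variational equation, in which \<open>Y'\<close> and \<open>H'\<close> are
  the derivatives at \<open>p0\<close> of the solution and of its source; the Jacobian of the shooting map is
  computed from it.
\<close>

theorem singular_ivp_C1_family:
  fixes f :: "'p::real_normed_vector \<times> 'e::euclidean_space \<Rightarrow> 'e" and c :: "'p \<Rightarrow> 'e"
  assumes U: "open U"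
    and f': "\<And>x. x \<in> U \<Longrightarrow> (f has_derivative blinfun_apply (f' x)) (at x)" "continuous_on U f'"
    and c: "C1_on UNIV c" "(c has_derivative c') (at p0)"
    and base: "(p0, y0) \<in> tube U" "y0 = const_bcontfun (c p0) + solve_op m (superpose f (p0, y0))"
  obtains V Y Y' H' where "open V" "p0 \<in> V" "C1_on V Y" "Y p0 = y0"
    "\<And>p. p \<in> V \<Longrightarrow> (p, Y p) \<in> tube U \<and> Y p = const_bcontfun (c p) + solve_op m (superpose f (p, Y p))"
    "C1_on V (\<lambda>p. superpose f (p, Y p))"
    "(Y has_derivative Y') (at p0)" "((\<lambda>p. superpose f (p, Y p)) has_derivative H') (at p0)"
    "\<And>v t. apply_bcontfun (H' v) t =
        f' (p0, apply_bcontfun y0 (qclamp t)) (v, apply_bcontfun (Y' v) (qclamp t))"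
    "\<And>v. Y' v = const_bcontfun (c' v) + solve_op m (H' v)"
proof -
  obtain N' where N: "\<And>w. w \<in> tube U \<Longrightarrow> (superpose f has_derivative blinfun_apply (N' w)) (at w)"
    "continuous_on (tube U) N'"
    "\<And>w v t. w \<in> tube U \<Longrightarrow> apply_bcontfun (N' w v) t =
        f' (fst w, apply_bcontfun (snd w) (qclamp t)) (fst v, apply_bcontfun (snd v) (qclamp t))"
    using superpose_C1[OF U f'] by metis
  have C1N: "C1_on (tube U) (superpose f)" by (rule C1_on_openI[OF N(1,2)])
  note lin = bounded_linear_const_bcontfun bounded_linear_solve_op[of m]
  define G where "G w = snd w - const_bcontfun (c (fst w)) - solve_op m (superpose f w)" for w
  define D where "D v = snd v - const_bcontfun (c' (fst v)) - solve_op m (N' (p0, y0) v)" for v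
  have C1G: "C1_on (tube U) G"
    unfolding G_def
    by (intro C1_on_diff C1_on_snd C1_on_linear_image[OF lin(1)] C1_on_linear_image[OF lin(2)] C1N
        C1_on_compose[OF C1_on_fst c(1)]) auto
  have DG: "(G has_derivative D) (at (p0, y0))"
    unfolding G_def D_def
    by (intro has_derivative_diff bounded_linear.has_derivative[OF lin(1)]
        bounded_linear.has_derivative[OF lin(2)] N(1) base bounded_linear_imp_has_derivative bounded_linear_snd
        has_derivative_compose[of fst fst "(p0, y0)" UNIV c c', simplified] bounded_linear_fst c(2)) 
  define M where "M y = N' (p0, y0) (0, y)" for y
  have Mt: "apply_bcontfun (M y) t = f' (p0, apply_bcontfun y0 (qclamp t)) (0, apply_bcontfun y (qclamp t))" for y t
    by (simp add: M_def N(3)[OF base(1)])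
  obtain B where B: "\<And>t. norm (f' (p0, apply_bcontfun y0 (qclamp t))) \<le> B"
    using bounded_along_track[OF f'(2) base(1)] by blast
  have M: "bounded_linear M"
    unfolding M_def by (intro bounded_linear_compose[OF blinfun.bounded_linear_right] bounded_linear_intros)
  have MB: "norm (apply_bcontfun (M y) t) \<le> B * norm (apply_bcontfun y (qclamp t))" for y t
  proof -
    have "norm (apply_bcontfun (M y) t) \<le> norm (f' (p0, apply_bcontfun y0 (qclamp t))) * norm (0::'p, apply_bcontfun y (qclamp t))"
      unfolding Mt by (rule norm_blinfun)
    also have "\<dots> \<le> B * norm (apply_bcontfun y (qclamp t))"
      using B[of t] by (simp add: norm_Pair mult_right_mono)
    finally show ?thesis .
  qed
  obtain S where S: "bounded_linear S" "\<And>y. S y = y + solve_op m (M (S y))"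
    "\<And>y. S (y - solve_op m (M y)) = y"
    using volterra_resolvent[OF M MB] by blast
  have c'0: "c' 0 = 0" using c(2) by (simp add: has_derivative_def linear_simps)
  have 1: "S (D (0, y)) = y" for y
    using S(3)[of y] by (simp add: D_def M_def c'0)
  have 2: "z = 0" if "S z = 0" for z
  proof -
    have "solve_op m (M 0) = 0"
      using linear_0[OF bounded_linear.linear[OF bounded_linear_compose[OF lin(2) M]]] .
    then show ?thesis using S(2)[of z] that by simp
  qed
  have z: "G (p0, y0) = 0" using base(2) by (simp add: G_def algebra_simps)
  obtain V Y where VY: "open V" "p0 \<in> V" "C1_on V Y" "Y p0 = y0"
    "\<And>p. p \<in> V \<Longrightarrow> (p, Y p) \<in> tube U \<and> G (p, Y p) = 0"
    using implicit_function_C1[OF open_tube[OF U] base(1) C1G z DG S(1) 1 2] by blast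
  have eqn: "Y p = const_bcontfun (c p) + solve_op m (superpose f (p, Y p))" if "p \<in> V" for p
    using VY(5)[OF that] by (simp add: G_def algebra_simps)
  obtain Y1 where Y1: "\<And>x. x \<in> V \<Longrightarrow> (Y has_derivative blinfun_apply (Y1 x)) (at x)"
    using C1_on_openD[OF VY(3,1)] by metis
  define Y' where "Y' = blinfun_apply (Y1 p0)"
  have dY: "(Y has_derivative Y') (at p0)" unfolding Y'_def by (rule Y1[OF VY(2)])
  have dG: "((\<lambda>p. G (p, Y p)) has_derivative (\<lambda>v. D (v, Y' v))) (at p0)"
    using has_derivative_compose[OF has_derivative_Pair[OF has_derivative_ident dY], of G D] DG VY(4)
    by simp
  have "((\<lambda>p. G (p, Y p)) has_derivative (\<lambda>v. 0)) (at p0)"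
    by (rule has_derivative_transform_within_open[OF has_derivative_const[of 0] VY(1,2)])
       (use VY(5) in simp)
  from has_derivative_unique[OF dG this] have D0: "D (v, Y' v) = 0" for v by metis
  define H' where "H' v = N' (p0, y0) (v, Y' v)" for v
  have 3: "((\<lambda>p. superpose f (p, Y p)) has_derivative H') (at p0)"
    unfolding H'_def
    using has_derivative_compose[OF has_derivative_Pair[OF has_derivative_ident dY], of "superpose f" "N' (p0, y0)"]
      N(1)[OF base(1)] VY(4) by simp
  have 4: "C1_on V (\<lambda>p. superpose f (p, Y p))"
    by (rule C1_on_compose[OF C1_on_Pair[OF C1_on_bounded_linear[OF bounded_linear_ident] VY(3)] C1N])
       (use VY(5) in auto)
  have 5: "Y' v = const_bcontfun (c' v) + solve_op m (H' v)" for v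
    using D0[of v] by (simp add: H'_def D_def algebra_simps)
  have 6: "apply_bcontfun (H' v) t = f' (p0, apply_bcontfun y0 (qclamp t)) (v, apply_bcontfun (Y' v) (qclamp t))" for v t
    by (simp add: H'_def N(3)[OF base(1)])
  have 7: "(p, Y p) \<in> tube U \<and> Y p = const_bcontfun (c p) + solve_op m (superpose f (p, Y p))" if "p \<in> V" for p
    using VY(5)[OF that] eqn[OF that] by blast
  show ?thesis
    by (rule that[OF VY(1-4) 7 4 dY 3 6 5])
qed

section \<open>Green's identity and cosine moments of eigenprofiles\<close>

definition profile :: "nat \<Rightarrow> real \<Rightarrow> (real \<Rightarrow> real) \<Rightarrow> (real \<Rightarrow> real) \<Rightarrow> bool" where
  "profile m c h v \<longleftrightarrow> continuous_on {0..pi/2} h \<and> (\<forall>\<theta>\<in>{0..pi/2}. v \<theta> = c + potential m h \<theta>)"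

lemma slope_weight: "\<theta> \<in> {0..pi/2} \<Longrightarrow> sin \<theta> ^ m * slope m h \<theta> = (flux m h \<theta> :: real)"
proof -
  assume t: "\<theta> \<in> {0..pi/2}"
  have "sin \<theta> > 0" if "\<theta> \<noteq> 0" using t that pi_half_less(1) by (intro sin_gt_zero) (auto intro: le_neq_trans)
  then show ?thesis by (cases "\<theta> = 0") (auto simp: slope_def)
qed

lemma profile_deriv:
  assumes "profile m c h v" "\<theta> \<in> {0..pi/2}"
  shows "(v has_vector_derivative slope m h \<theta>) (at \<theta> within {0..pi/2})"
proof -
  have "((\<lambda>x. c + potential m h x) has_vector_derivative 0 + slope m h \<theta>) (at \<theta> within {0..pi/2})"
    using assms unfolding profile_def
    by (intro has_vector_derivative_add has_vector_derivative_const potential_has_derivative pi_half_less(1)) auto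
  then show ?thesis
    using assms unfolding profile_def
    by (intro has_vector_derivative_transform[OF assms(2), of v "\<lambda>x. c + potential m h x"]) auto
qed

lemma profile_continuous: "profile m c h v \<Longrightarrow> continuous_on {0..pi/2} v"
  by (rule continuous_on_vector_derivative) (rule profile_deriv)

lemma profile_0: "profile m c h v \<Longrightarrow> v 0 = c"
  unfolding profile_def using pi_half_less(2) by simp

text \<open>
  The function \<open>v * F - \<psi> * flux m h\<close>, with \<open>F = sin \<theta> ^ m \<psi>'\<close>, is the weighted Wronskian; the
  products of first derivatives cancel in its derivative. No boundary term arises at the pole,
  where both fluxes vanish.
\<close>

lemma green_identity:
  assumes v: "profile m c h v" and k: "continuous_on {0..pi/2} k"
    and \<psi>: "\<And>\<theta>. \<theta> \<in> {0..pi/2} \<Longrightarrow> (\<psi> has_vector_derivative \<psi>1 \<theta>) (at \<theta> within {0..pi/2})"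
    and F: "\<And>\<theta>. \<theta> \<in> {0..pi/2} \<Longrightarrow> (F has_vector_derivative sin \<theta> ^ m * k \<theta>) (at \<theta> within {0..pi/2})"
    "\<And>\<theta>. \<theta> \<in> {0..pi/2} \<Longrightarrow> sin \<theta> ^ m * \<psi>1 \<theta> = F \<theta>" "F 0 = 0"
  shows "((\<lambda>\<theta>. sin \<theta> ^ m * (v \<theta> * k \<theta> - \<psi> \<theta> * h \<theta>)) has_integral
      v (pi/2) * F (pi/2) - \<psi> (pi/2) * flux m h (pi/2)) {0..pi/2}"
proof -
  have h: "continuous_on {0..pi/2} h" using v by (simp add: profile_def)
  let ?W = "\<lambda>\<theta>. v \<theta> * F \<theta> - \<psi> \<theta> * flux m h \<theta>"
  have d: "(?W has_vector_derivative sin \<theta> ^ m * (v \<theta> * k \<theta> - \<psi> \<theta> * h \<theta>)) (at \<theta> within {0..pi/2})"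
    if t: "\<theta> \<in> {0..pi/2}" for \<theta>
  proof -
    have "(?W has_vector_derivative (v \<theta> * (sin \<theta> ^ m * k \<theta>) + slope m h \<theta> * F \<theta>)
        - (\<psi> \<theta> * (sin \<theta> ^ m * h \<theta>) + \<psi>1 \<theta> * flux m h \<theta>)) (at \<theta> within {0..pi/2})"
      using flux_has_derivative[OF h t, of m]
      by (intro has_vector_derivative_diff has_vector_derivative_mult profile_deriv[OF v t] \<psi> F t) simp
    moreover have "slope m h \<theta> * F \<theta> = \<psi>1 \<theta> * flux m h \<theta>"
      using F(2)[OF t] slope_weight[OF t, of m h] by (metis mult.assoc mult.commute)
    ultimately show ?thesis by (simp add: algebra_simps)
  qed
  have "((\<lambda>\<theta>. sin \<theta> ^ m * (v \<theta> * k \<theta> - \<psi> \<theta> * h \<theta>)) has_integral ?W (pi/2) - ?W 0) {0..pi/2}"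
    by (rule fundamental_theorem_of_calculus[OF pi_half_less(2) d])
  then show ?thesis by (simp add: F(3))
qed

text \<open>
  The moments against powers of the cosine replace the eigenfunction expansion in Gegenbauer
  polynomials: parity about the equator is parity in the cosine, and the radial operator maps
  \<open>cos \<theta> ^ k\<close> to a combination of \<open>cos \<theta> ^ (k - 2)\<close> and \<open>cos \<theta> ^ k\<close>.
\<close>

definition cos_moment :: "nat \<Rightarrow> (real \<Rightarrow> real) \<Rightarrow> nat \<Rightarrow> real" where
  "cos_moment m v k = integral {0..pi/2} (\<lambda>\<theta>. sin \<theta> ^ m * (v \<theta> * cos \<theta> ^ k))"

lemma cos_moment_has_integral:
  assumes "continuous_on {0..pi/2} v"
  shows "((\<lambda>\<theta>. sin \<theta> ^ m * (v \<theta> * cos \<theta> ^ k)) has_integral cos_moment m v k) {0..pi/2}"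
  unfolding cos_moment_def
  by (intro integrable_integral integrable_continuous_interval continuous_intros assms)

text \<open>
  The left function is \<open>sin \<theta> ^ m\<close> times the derivative of \<open>cos \<theta> ^ k\<close>; thus \<open>cos \<theta> ^ k\<close> is mapped
  by the radial operator to \<open>k (k - 1) cos \<theta> ^ (k - 2) - k (k + m) cos \<theta> ^ k\<close>. For \<open>k \<le> 1\<close> the
  truncated exponents are multiplied by zero.
\<close>

lemma cos_power_flux_derivative:
  "((\<lambda>\<theta>. - (real k * (sin \<theta> ^ Suc m * cos \<theta> ^ (k - 1)))) has_vector_derivative
     sin \<theta> ^ m * (real k * (real k - 1) * cos \<theta> ^ (k - 2) - real k * (real k + real m) * cos \<theta> ^ k))
     (at \<theta> within A)"
proof -
  have s2: "sin \<theta> ^ 2 = 1 - cos \<theta> ^ 2" by (simp add: sin_squared_eq)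
  have S: "((\<lambda>\<theta>. sin \<theta> ^ Suc m) has_real_derivative (1 + real m) * (cos \<theta> * sin \<theta> ^ m)) (at \<theta> within A)"
    by (intro DERIV_power_Suc has_field_derivative_at_within[OF DERIV_sin])
  have C: "((\<lambda>\<theta>. cos \<theta> ^ Suc j) has_real_derivative (1 + real j) * (- sin \<theta> * cos \<theta> ^ j)) (at \<theta> within A)" for j
    by (intro DERIV_power_Suc has_field_derivative_at_within[OF DERIV_cos])
  consider "k = 0" | "k = 1" | j where "k = Suc (Suc j)" by (metis One_nat_def not0_implies_Suc)
  then show ?thesis
  proof cases
    case 2
    then show ?thesis using DERIV_minus[OF S]
      by (simp add: has_real_derivative_iff_has_vector_derivative[symmetric] algebra_simps)
  next
    case 3
    note DERIV_minus[OF DERIV_cmult[OF DERIV_mult[OF S C[of j]], of "real k"]]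
    also have "- (real k * ((1 + real m) * (cos \<theta> * sin \<theta> ^ m) * cos \<theta> ^ Suc j + (1 + real j) * (- sin \<theta> * cos \<theta> ^ j) * sin \<theta> ^ Suc m))
      = sin \<theta> ^ m * (real k * ((1 + real j) * cos \<theta> ^ j * sin \<theta> ^ 2 - (1 + real m) * cos \<theta> ^ Suc (Suc j)))"
      by (simp add: algebra_simps power2_eq_square)
    also have "\<dots> = sin \<theta> ^ m * (real k * (real k - 1) * cos \<theta> ^ (k - 2) - real k * (real k + real m) * cos \<theta> ^ k)"
      unfolding s2 using 3 by (simp add: algebra_simps power2_eq_square)
    finally show ?thesis using 3
      by (simp add: has_real_derivative_iff_has_vector_derivative[symmetric])
  qed simp
qed

lemma flux_eigen_half: 
  assumes v: "profile m c (\<lambda>\<theta>. - \<mu> * v \<theta>) v"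
  shows "flux m (\<lambda>\<theta>. - \<mu> * v \<theta>) (pi/2) = - \<mu> * cos_moment m v 0"
proof -
  have "((\<lambda>\<theta>. - \<mu> * (sin \<theta> ^ m * (v \<theta> * cos \<theta> ^ 0))) has_integral - \<mu> * cos_moment m v 0) {0..pi/2}"
    by (intro has_integral_mult_right cos_moment_has_integral profile_continuous[OF v])
  from integral_unique[OF this] show ?thesis by (simp add: flux_def mult.left_commute)
qed

text \<open>
  Green's identity is applied to the eigenprofile \<open>v\<close> and \<open>cos \<theta> ^ k\<close>. At the equator \<open>cos \<theta> ^ k\<close>
  vanishes unless \<open>k = 0\<close>, and its derivative vanishes unless \<open>k = 1\<close>; these are the two
  exceptional cases on the right.
\<close>

lemma cos_moment_recursion:
  assumes v: "profile m c (\<lambda>\<theta>. - \<mu> * v \<theta>) v"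
  shows "real k * (real k - 1) * cos_moment m v (k - 2) + (\<mu> - real k * (real k + real m)) * cos_moment m v k
     = (if k = 0 then \<mu> * cos_moment m v 0 else if k = 1 then - v (pi/2) else 0)"
proof -
  note cv = profile_continuous[OF v]
  define F where "F \<theta> = - (real k * (sin \<theta> ^ Suc m * cos \<theta> ^ (k - 1)))" for \<theta>
  define K where "K \<theta> = real k * (real k - 1) * cos \<theta> ^ (k - 2) - real k * (real k + real m) * cos \<theta> ^ k" for \<theta>
  have g: "((\<lambda>\<theta>. sin \<theta> ^ m * (v \<theta> * K \<theta> - cos \<theta> ^ k * (- \<mu> * v \<theta>))) has_integral
      v (pi/2) * F (pi/2) - cos (pi/2) ^ k * flux m (\<lambda>\<theta>. - \<mu> * v \<theta>) (pi/2)) {0..pi/2}"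
  proof (rule green_identity[OF v])
    show "continuous_on {0..pi/2} K" unfolding K_def by (intro continuous_intros)
    fix \<theta> :: real
    show "((\<lambda>\<theta>. cos \<theta> ^ k) has_vector_derivative real k * cos \<theta> ^ (k - 1) * (- sin \<theta>)) (at \<theta> within {0..pi/2})"
      unfolding has_real_derivative_iff_has_vector_derivative[symmetric]
      by (auto intro!: derivative_eq_intros)
    show "(F has_vector_derivative sin \<theta> ^ m * K \<theta>) (at \<theta> within {0..pi/2})"
      unfolding F_def K_def by (rule cos_power_flux_derivative)
    show "sin \<theta> ^ m * (real k * cos \<theta> ^ (k - 1) * (- sin \<theta>)) = F \<theta>" by (simp add: F_def)
  qed (simp add: F_def)
  have a: "((\<lambda>\<theta>. real k * (real k - 1) * (sin \<theta> ^ m * (v \<theta> * cos \<theta> ^ (k - 2)))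
        + (\<mu> - real k * (real k + real m)) * (sin \<theta> ^ m * (v \<theta> * cos \<theta> ^ k))) has_integral
      real k * (real k - 1) * cos_moment m v (k - 2) + (\<mu> - real k * (real k + real m)) * cos_moment m v k) {0..pi/2}"
    by (intro has_integral_add has_integral_mult_right cos_moment_has_integral cv)
  have b: "(\<lambda>\<theta>. real k * (real k - 1) * (sin \<theta> ^ m * (v \<theta> * cos \<theta> ^ (k - 2)))
        + (\<mu> - real k * (real k + real m)) * (sin \<theta> ^ m * (v \<theta> * cos \<theta> ^ k)))
     = (\<lambda>\<theta>. sin \<theta> ^ m * (v \<theta> * K \<theta> - cos \<theta> ^ k * (- \<mu> * v \<theta>)))"
    by (rule ext) (simp add: K_def algebra_simps)
  have F: "F (pi/2) = (if k = 1 then -1 else 0)"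
    by (cases "k \<le> 1") (auto simp: F_def le_Suc_eq)
  have "cos (pi/2 :: real) ^ k = (if k = 0 then 1 else 0)" by simp
  then show ?thesis
    using has_integral_unique[OF a[unfolded b] g] unfolding F flux_eigen_half[OF v] by (simp split: if_splits)
qed

lemma weighted_square_zero_imp_zero:
  assumes c: "continuous_on {0..pi/2} v" and z: "integral {0..pi/2} (\<lambda>\<theta>. sin \<theta> ^ m * (v \<theta> * v \<theta>)) \<le> 0"
  shows "v 0 = 0"
proof -
  have cc: "continuous_on {0..pi/2} (\<lambda>\<theta>. sin \<theta> ^ m * (v \<theta> * v \<theta>))" by (intro continuous_intros c)
  have s: "sin \<theta> \<ge> 0" if "\<theta> \<in> {0..pi/2}" for \<theta> using that pi_half_less(1) by (intro sin_ge_zero) auto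
  have nn: "sin \<theta> ^ m * (v \<theta> * v \<theta>) \<ge> 0" if "\<theta> \<in> {0..pi/2}" for \<theta> using s[OF that] by simp
  have "integral {0..pi/2} (\<lambda>\<theta>. sin \<theta> ^ m * (v \<theta> * v \<theta>)) \<ge> 0"
    by (rule integral_nonneg[OF integrable_continuous_interval[OF cc] nn])
  then have "integral {0..pi/2} (\<lambda>\<theta>. sin \<theta> ^ m * (v \<theta> * v \<theta>)) = 0" using z by simp
  then have all: "\<forall>\<theta>\<in>{0..pi/2}. sin \<theta> ^ m * (v \<theta> * v \<theta>) = 0"
    using integral_eq_0_iff[OF cc _ nn] pi_gt_zero by auto
  have v0: "v \<theta> = 0" if "\<theta> \<in> {0<..pi/2}" for \<theta>
  proof -
    have "sin \<theta> > 0" using that pi_half_less(1) by (intro sin_gt_zero) auto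
    then show ?thesis using bspec[OF all, of \<theta>] that by simp
  qed
  have "(v \<longlongrightarrow> v 0) (at 0 within {0..pi/2})" using c pi_half_less(2) by (simp add: continuous_on_def)
  moreover have "eventually (\<lambda>\<theta>. v \<theta> = 0) (at 0 within {0..pi/2})"
    unfolding eventually_at by (intro exI[of _ 1]) (auto intro!: v0)
  ultimately have "((\<lambda>\<theta>. 0) \<longlongrightarrow> v 0) (at 0 within {0..pi/2})"
    by (rule Lim_transform_eventually)
  moreover have "at (0::real) within {0..pi/2} \<noteq> bot"
    using pi_gt_zero by (simp add: trivial_limit_within islimpt_Icc)
  ultimately show ?thesis using tendsto_unique[OF _ tendsto_const[of "0::real"]] by metis
qed

text \<open>
  On the interval \<open>\<theta>\<close> is a continuous function of \<open>cos \<theta> ^ 2\<close>, so by the Weierstrass theorem \<open>v\<close>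
  is a uniform limit of polynomials in \<open>cos \<theta> ^ 2\<close>. As \<open>v\<close> is orthogonal to all of these, its
  weighted square norm is zero.
\<close>

lemma even_moments_vanish_imp_zero:
  assumes c: "continuous_on {0..pi/2} v" and z: "\<And>j. cos_moment m v (2 * j) = 0"
  shows "v 0 = 0"
proof (rule weighted_square_zero_imp_zero[OF c, of m], rule field_le_epsilon)
  fix e :: real assume e: "e > 0"
  define I where "I = integral {0..pi/2} (\<lambda>\<theta>. sin \<theta> ^ m * \<bar>v \<theta>\<bar>)"
  have s: "sin \<theta> \<ge> 0" if "\<theta> \<in> {0..pi/2}" for \<theta> using that pi_half_less(1) by (intro sin_ge_zero) auto
  have ci: "continuous_on {0..pi/2} (\<lambda>\<theta>. sin \<theta> ^ m * \<bar>v \<theta>\<bar>)" by (intro continuous_intros c)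
  have I0: "I \<ge> 0" unfolding I_def
    by (rule integral_nonneg[OF integrable_continuous_interval[OF ci]]) (use s in simp)
  define d where "d = e / (I + 1)"
  have d: "d > 0" "d * I \<le> e" using e I0 by (auto simp: d_def field_simps)
  have "continuous_on {0..1} (\<lambda>x. v (arccos (sqrt x)))"
    by (intro continuous_on_compose2[OF c] continuous_on_compose2[OF continuous_on_arccos'] continuous_intros)
       (auto intro!: arccos_lbound arccos_le_pi2[unfolded le_divide_eq_numeral1] simp: order_trans[of "-1::real" 0])
  then obtain g where g: "real_polynomial_function g" "\<And>x. x \<in> {0..1} \<Longrightarrow> \<bar>v (arccos (sqrt x)) - g x\<bar> < d"
    using Stone_Weierstrass_real_polynomial_function[of "{0..1::real}" "\<lambda>x. v (arccos (sqrt x))" d] d by auto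
  obtain a N where a: "g = (\<lambda>x. \<Sum>i\<le>N. a i * x ^ i)"
    using g(1) real_polynomial_function_iff_sum by blast
  have close: "\<bar>v \<theta> - g (cos \<theta> ^ 2)\<bar> \<le> d" if t: "\<theta> \<in> {0..pi/2}" for \<theta>
  proof -
    have "cos \<theta> \<ge> 0" using t by (intro cos_ge_zero) auto
    then have "arccos (sqrt (cos \<theta> ^ 2)) = \<theta>" using t pi_half_less by (simp add: arccos_cos)
    then show ?thesis using g(2)[of "cos \<theta> ^ 2"] by (simp add: abs_square_le_1 less_imp_le)
  qed
  have "((\<lambda>\<theta>. \<Sum>i\<le>N. a i * (sin \<theta> ^ m * (v \<theta> * cos \<theta> ^ (2 * i)))) has_integral (\<Sum>i\<le>N. a i * cos_moment m v (2 * i))) {0..pi/2}"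
    by (intro has_integral_sum has_integral_mult_right cos_moment_has_integral c) auto
  then have "((\<lambda>\<theta>. sin \<theta> ^ m * (v \<theta> * g (cos \<theta> ^ 2))) has_integral 0) {0..pi/2}"
    by (simp add: z a sum_distrib_left power_mult[symmetric] mult.left_commute)
  moreover have cv2: "(\<lambda>\<theta>. sin \<theta> ^ m * (v \<theta> * v \<theta>)) integrable_on {0..pi/2}"
    by (intro integrable_continuous_interval continuous_intros c)
  ultimately have 1: "((\<lambda>\<theta>. sin \<theta> ^ m * (v \<theta> * v \<theta>) - sin \<theta> ^ m * (v \<theta> * g (cos \<theta> ^ 2))) has_integral
      integral {0..pi/2} (\<lambda>\<theta>. sin \<theta> ^ m * (v \<theta> * v \<theta>)) - 0) {0..pi/2}"
    by (intro has_integral_diff integrable_integral)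
  have 2: "((\<lambda>\<theta>. d * (sin \<theta> ^ m * \<bar>v \<theta>\<bar>)) has_integral d * I) {0..pi/2}"
    unfolding I_def by (intro has_integral_mult_right integrable_integral integrable_continuous_interval ci)
  have "integral {0..pi/2} (\<lambda>\<theta>. sin \<theta> ^ m * (v \<theta> * v \<theta>)) - 0 \<le> d * I"
  proof (rule has_integral_le[OF 1 2])
    fix \<theta> assume t: "\<theta> \<in> {0..pi/2}"
    have "v \<theta> * (v \<theta> - g (cos \<theta> ^ 2)) \<le> \<bar>v \<theta>\<bar> * \<bar>v \<theta> - g (cos \<theta> ^ 2)\<bar>"
      by (metis abs_ge_self abs_mult)
    also have "\<dots> \<le> \<bar>v \<theta>\<bar> * d" by (intro mult_left_mono close t) auto
    finally have "sin \<theta> ^ m * (v \<theta> * (v \<theta> - g (cos \<theta> ^ 2))) \<le> sin \<theta> ^ m * (\<bar>v \<theta>\<bar> * d)"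
      using s[OF t] by (intro mult_left_mono) auto
    then show "sin \<theta> ^ m * (v \<theta> * v \<theta>) - sin \<theta> ^ m * (v \<theta> * g (cos \<theta> ^ 2)) \<le> d * (sin \<theta> ^ m * \<bar>v \<theta>\<bar>)"
      by (simp add: algebra_simps)
  qed
  then show "integral {0..pi/2} (\<lambda>\<theta>. sin \<theta> ^ m * (v \<theta> * v \<theta>)) \<le> 0 + e" using d by simp
qed

text \<open>
  If the moment were zero, the recursion would kill all even moments, since its leading
  coefficient \<open>\<mu> - 2 j (2 j + m)\<close> is nonzero for \<open>j \<ge> 1\<close>, and then the profile would vanish at the
  pole. For \<open>\<mu> \<noteq> 0\<close> the moment is a nonzero multiple of the flux at the equator
  (\<open>flux_eigen_half\<close>), so a nonresonant profile is not even about the equator.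
\<close>

lemma nonresonant_moment:
  assumes v: "profile m c (\<lambda>\<theta>. - \<mu> * v \<theta>) v" and c: "c \<noteq> 0"
    and \<mu>: "\<And>j. j \<ge> 1 \<Longrightarrow> \<mu> \<noteq> 2 * real j * (2 * real j + real m)"
  shows "cos_moment m v 0 \<noteq> 0"
proof
  assume z: "cos_moment m v 0 = 0"
  have "cos_moment m v (2 * j) = 0" for j
  proof (induction j)
    case (Suc j)
    have "(\<mu> - 2 * real (Suc j) * (2 * real (Suc j) + real m)) * cos_moment m v (2 * Suc j) = 0"
      using cos_moment_recursion[OF v, of "2 * Suc j"] Suc by (simp add: algebra_simps)
    then show ?case using \<mu>[of "Suc j"] by simp
  qed (use z in simp)
  from even_moments_vanish_imp_zero[OF profile_continuous[OF v] this] profile_0[OF v] c show False by simp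
qed

text \<open>
  At the resonance the coefficient of the \<open>j\<close>-th moment drops out, so the recursion starts from
  zero and runs downwards.
\<close>

lemma resonant_moments:
  assumes v: "profile m c (\<lambda>\<theta>. - \<mu> * v \<theta>) v" and \<mu>: "\<mu> = real j * (real j + real m)"
  shows "2 * i + 2 \<le> j \<Longrightarrow> cos_moment m v (j - 2 * i - 2) = 0"
proof (induction i)
  case 0
  have "real j * (real j - 1) * cos_moment m v (j - 2) = 0"
    using cos_moment_recursion[OF v, of j] 0 \<mu> by simp
  then show ?case using 0 by auto
next
  case (Suc i)
  define k where "k = j - 2 * i - 2"
  have k: "k \<ge> 2" "k - 2 = j - 2 * Suc i - 2" using Suc by (auto simp: k_def)
  have "cos_moment m v k = 0" using Suc by (simp add: k_def)
  then have "real k * (real k - 1) * cos_moment m v (k - 2) = 0"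
    using cos_moment_recursion[OF v, of k] k by simp
  then show ?case using k by auto
qed

lemma resonant_even:
  assumes v: "profile m c (\<lambda>\<theta>. - \<mu> * v \<theta>) v" and \<mu>: "\<mu> = real j * (real j + real m)" and j: "even j" "j \<ge> 1"
  shows "cos_moment m v 0 = 0"
proof -
  have "\<exists>i. j = 2 * i + 2" using j by presburger
  then obtain i where "j = 2 * i + 2" by blast
  then show ?thesis using resonant_moments[OF v \<mu>, of i] by simp
qed

lemma resonant_odd:
  assumes v: "profile m c (\<lambda>\<theta>. - \<mu> * v \<theta>) v" and \<mu>: "\<mu> = real j * (real j + real m)" and j: "odd j"
  shows "v (pi/2) = 0"
proof -
  have "(\<mu> - (1 + real m)) * cos_moment m v 1 = 0"
  proof (cases "j = 1")
    case False
    then have "\<exists>i. j = 2 * i + 3" using j by presburger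
    then obtain i where "j = 2 * i + 3" by blast
    then show ?thesis using resonant_moments[OF v \<mu>, of i] by simp
  qed (use \<mu> in simp)
  moreover have "(\<mu> - (1 + real m)) * cos_moment m v 1 = - v (pi/2)"
    using cos_moment_recursion[OF v, of 1] by simp
  ultimately show ?thesis by linarith
qed

text \<open>
  The profile \<open>r\<close> is the derivative of the eigenprofile \<open>\<phi>\<close> with respect to the bifurcation
  parameter, when the eigenvalue \<open>\<nu>\<close> moves with speed \<open>\<kappa>\<close>. The difference of the two sides is the
  boundary term of Green's identity for \<open>r\<close> and \<open>\<phi>\<close>, and this equals \<open>\<kappa>\<close> times the weighted square
  norm of \<open>\<phi>\<close>.
\<close>

lemma transversality:
  assumes \<phi>: "profile m c (\<lambda>\<theta>. - \<nu> * \<phi> \<theta>) \<phi>" "c \<noteq> 0"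
    and r: "profile m 0 (\<lambda>\<theta>. - (\<nu> * r \<theta>) - \<kappa> * \<phi> \<theta>) r" and \<kappa>: "\<kappa> \<noteq> 0"
  shows "r (pi/2) * flux m (\<lambda>\<theta>. - \<nu> * \<phi> \<theta>) (pi/2) \<noteq> \<phi> (pi/2) * flux m (\<lambda>\<theta>. - (\<nu> * r \<theta>) - \<kappa> * \<phi> \<theta>) (pi/2)"
proof -
  have c\<phi>: "continuous_on {0..pi/2} \<phi>" by (rule profile_continuous[OF \<phi>(1)])
  have ck: "continuous_on {0..pi/2} (\<lambda>\<theta>. - \<nu> * \<phi> \<theta>)" by (intro continuous_intros c\<phi>)
  have g: "((\<lambda>\<theta>. sin \<theta> ^ m * (r \<theta> * (- \<nu> * \<phi> \<theta>) - \<phi> \<theta> * (- (\<nu> * r \<theta>) - \<kappa> * \<phi> \<theta>))) has_integral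
      r (pi/2) * flux m (\<lambda>\<theta>. - \<nu> * \<phi> \<theta>) (pi/2) - \<phi> (pi/2) * flux m (\<lambda>\<theta>. - (\<nu> * r \<theta>) - \<kappa> * \<phi> \<theta>) (pi/2)) {0..pi/2}"
    by (rule green_identity[OF r ck profile_deriv[OF \<phi>(1)]])
       (use flux_has_derivative[OF ck] slope_weight in \<open>auto simp: scaleR_conv_of_real\<close>)
  have e: "(\<lambda>\<theta>. sin \<theta> ^ m * (r \<theta> * (- \<nu> * \<phi> \<theta>) - \<phi> \<theta> * (- (\<nu> * r \<theta>) - \<kappa> * \<phi> \<theta>)))
      = (\<lambda>\<theta>. \<kappa> * (sin \<theta> ^ m * (\<phi> \<theta> * \<phi> \<theta>)))" by (rule ext) (simp add: algebra_simps)
  have i: "((\<lambda>\<theta>. \<kappa> * (sin \<theta> ^ m * (\<phi> \<theta> * \<phi> \<theta>))) has_integral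
      \<kappa> * integral {0..pi/2} (\<lambda>\<theta>. sin \<theta> ^ m * (\<phi> \<theta> * \<phi> \<theta>))) {0..pi/2}"
    by (intro has_integral_mult_right integrable_integral integrable_continuous_interval continuous_intros c\<phi>)
  have "r (pi/2) * flux m (\<lambda>\<theta>. - \<nu> * \<phi> \<theta>) (pi/2) - \<phi> (pi/2) * flux m (\<lambda>\<theta>. - (\<nu> * r \<theta>) - \<kappa> * \<phi> \<theta>) (pi/2)
      = \<kappa> * integral {0..pi/2} (\<lambda>\<theta>. sin \<theta> ^ m * (\<phi> \<theta> * \<phi> \<theta>))"
    by (rule has_integral_unique[OF g[unfolded e] i])
  moreover have "integral {0..pi/2} (\<lambda>\<theta>. sin \<theta> ^ m * (\<phi> \<theta> * \<phi> \<theta>)) \<noteq> 0"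
    using weighted_square_zero_imp_zero[OF c\<phi>, of m] profile_0[OF \<phi>(1)] \<phi>(2) by force
  ultimately show ?thesis using \<kappa> by auto
qed

section \<open>Even and odd parts of the nonlinearity\<close>

text \<open>
  The pairs \<open>(p, r)\<close> for which both components \<open>p + r\<close> and \<open>p - r\<close> are positive.
\<close>

definition wedge :: "(real \<times> real) set" where "wedge = {x. \<bar>snd x\<bar> < fst x}"

lemma wedge_pos: "x \<in> wedge \<Longrightarrow> t \<in> {-1..1} \<Longrightarrow> 0 < fst x + t * snd x"
proof -
  assume x: "x \<in> wedge" and t: "t \<in> {-1..1}"
  have "\<bar>t * snd x\<bar> \<le> \<bar>snd x\<bar>" using t mult_right_mono[of "\<bar>t\<bar>" 1 "\<bar>snd x\<bar>"] by (auto simp: abs_mult abs_le_iff)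
  then show ?thesis using x unfolding wedge_def by auto
qed

text \<open>
  The difference quotient \<open>((p + r) powr e - (p - r) powr e) / (2 * r)\<close>, written as an integral so
  that it is defined and continuously differentiable across \<open>r = 0\<close>.
\<close>

definition diff_quot :: "real \<Rightarrow> real \<times> real \<Rightarrow> real" where
  "diff_quot e x = e / 2 * integral {-1..1} (\<lambda>t. (fst x + t * snd x) powr (e - 1))"

lemma diff_quot_eq:
  assumes "(p, r) \<in> wedge"
  shows "2 * r * diff_quot e (p, r) = (p + r) powr e - (p - r) powr e"
proof -
  have "((\<lambda>t. r * e * (p + t * r) powr (e - 1)) has_integral (p + 1 * r) powr e - (p + (-1) * r) powr e) {-1..1}"
  proof (rule fundamental_theorem_of_calculus)
    fix t :: real assume t: "t \<in> {-1..1}"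
    then have "0 < p + t * r" using wedge_pos[OF assms t] by simp
    then have "((\<lambda>t. (p + t * r) powr e) has_real_derivative r * e * (p + t * r) powr (e - 1)) (at t within {-1..1})"
      by (auto intro!: derivative_eq_intros)
    then show "((\<lambda>t. (p + t * r) powr e) has_vector_derivative r * e * (p + t * r) powr (e - 1)) (at t within {-1..1})"
      by (simp add: has_real_derivative_iff_has_vector_derivative)
  qed simp
  from integral_unique[OF this] show ?thesis by (simp add: diff_quot_def mult_ac)
qed

lemma diff_quot_0: "diff_quot e (p, 0) = e * p powr (e - 1)"
  by (simp add: diff_quot_def)

lemma convex_wedge: "convex wedge"
proof -
  have "wedge = {x. inner (1, -1) x > 0} \<inter> {x. inner (1, 1) x > (0::real)}"
    by (auto simp: wedge_def abs_less_iff)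
  then show ?thesis by (metis convex_Int convex_halfspace_gt)
qed

text \<open>
  Differentiation under the integral sign. The plain quotient would cost one derivative at
  \<open>r = 0\<close>.
\<close>

lemma C1_diff_quot: "C1_on wedge (diff_quot e)"
proof -
  define f where "f x t = (fst x + t * snd x) powr (e - 1)" for x :: "real \<times> real" and t :: real
  define fx where "fx x t = ((e - 1) * (fst x + t * snd x) powr (e - 1 - 1)) *\<^sub>R (fst_blinfun + t *\<^sub>R snd_blinfun :: (real \<times> real) \<Rightarrow>\<^sub>L real)"
    for x :: "real \<times> real" and t :: real
  have d: "((\<lambda>x. f x t) has_derivative blinfun_apply (fx x t)) (at x within wedge)"
    if "x \<in> wedge" "t \<in> cbox (-1) 1" for x t
  proof -
    have p: "0 < fst x + t * snd x" using wedge_pos that by simp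
    have "((\<lambda>x. fst x + t * snd x) has_derivative (\<lambda>v. fst v + t * snd v)) (at x within wedge)"
      by (auto intro!: derivative_eq_intros)
    from has_derivative_compose[OF this has_real_derivative_powr[OF p, of "e - 1", unfolded has_field_derivative_def]]
    have "((\<lambda>x. f x t) has_derivative (\<lambda>v. (e - 1) * (fst x + t * snd x) powr (e - 1 - 1) * (fst v + t * snd v))) (at x within wedge)"
      by (simp add: f_def)
    then show ?thesis
      by (rule has_derivative_eq_rhs) (simp add: fx_def fun_eq_iff blinfun.add_left blinfun.scaleR_left mult.commute)
  qed
  have c: "continuous_on (wedge \<times> cbox (-1) 1) (\<lambda>(x, t). fx x t)"
    unfolding fx_def split_beta using wedge_pos by (intro continuous_intros) force+
  have int: "f x integrable_on cbox (-1) 1" if "x \<in> wedge" for x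
    unfolding f_def using wedge_pos[OF that] by (intro integrable_continuous continuous_intros) force+
  have "((\<lambda>x. integral (cbox (-1) 1) (f x)) has_derivative integral (cbox (-1) 1) (fx x)) (at x within wedge)"
    if "x \<in> wedge" for x
    by (rule leibniz_rule[OF d int c that convex_wedge])
  moreover have "continuous_on wedge (\<lambda>x. integral (cbox (-1) 1) (fx x))"
    by (rule integral_continuous_on_param[OF c])
  ultimately have "C1_on wedge (\<lambda>x. integral (cbox (-1) 1) (f x))"
    unfolding C1_on_def by (intro exI[of _ "\<lambda>x. integral (cbox (-1) 1) (fx x)"]) auto
  from C1_on_scaleR[OF this, of "e/2"] show ?thesis
    unfolding diff_quot_def[abs_def] f_def by simp
qed

lemma bounded_linear_components:
  "bounded_linear (\<lambda>x::(real \<times> real \<times> real) \<times> (real \<times> real). fst (fst x))"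
  "bounded_linear (\<lambda>x::(real \<times> real \<times> real) \<times> (real \<times> real). fst (snd (fst x)))"
  "bounded_linear (\<lambda>x::(real \<times> real \<times> real) \<times> (real \<times> real). fst (snd x))"
  "bounded_linear (\<lambda>x::(real \<times> real \<times> real) \<times> (real \<times> real). snd (snd x))"
  by (auto intro!: bounded_linear_intros)

text \<open>
  This is for computing a derivative from lines on which the function has a closed form.
\<close>

lemma has_derivative_along_line:
  assumes "(f has_derivative D) (at x)"
  shows "((\<lambda>t. f (x + t *\<^sub>R v)) has_vector_derivative D v) (at 0)"
proof -
  have "((\<lambda>t. x + t *\<^sub>R v) has_derivative (\<lambda>t. t *\<^sub>R v)) (at 0)"
    by (auto intro!: derivative_eq_intros)
  then have "((\<lambda>t. f (x + t *\<^sub>R v)) has_derivative (\<lambda>t. D (t *\<^sub>R v))) (at 0)"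
    using assms by (intro has_derivative_compose[of "\<lambda>t. x + t *\<^sub>R v" _ _ _ f]) auto
  moreover have "D (t *\<^sub>R v) = t *\<^sub>R D v" for t
    using assms by (simp add: has_derivative_def linear_simps)
  ultimately show ?thesis by (simp add: has_vector_derivative_def)
qed

text \<open>
  The system with \<open>c = a\<close> on a parameter interval where the constant positive solution exists.
\<close>

locale symmetric_system =
  fixes q \<epsilon> :: real and lam a b :: "real \<Rightarrow> real"
  assumes q: "q > 2" and \<epsilon>: "\<epsilon> > 0"
    and C1: "C1_on {-\<epsilon><..<\<epsilon>} lam" "C1_on {-\<epsilon><..<\<epsilon>} a" "C1_on {-\<epsilon><..<\<epsilon>} b"
    and pos: "\<And>\<alpha>. \<alpha> \<in> {-\<epsilon><..<\<epsilon>} \<Longrightarrow> lam \<alpha> / (a \<alpha> + b \<alpha>) > 0"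
begin

definition pbar :: "real \<Rightarrow> real" where "pbar \<alpha> = (lam \<alpha> / (a \<alpha> + b \<alpha>)) powr (1 / (q - 2))"

definition beta :: "real \<Rightarrow> real" where "beta \<alpha> = lam \<alpha> * (a \<alpha> - b \<alpha>) / (a \<alpha> + b \<alpha>)"

lemma ab: "\<alpha> \<in> {-\<epsilon><..<\<epsilon>} \<Longrightarrow> a \<alpha> + b \<alpha> \<noteq> 0"
  using pos[of \<alpha>] by (metis div_by_0 less_irrefl)

lemma pbar_pos: "\<alpha> \<in> {-\<epsilon><..<\<epsilon>} \<Longrightarrow> pbar \<alpha> > 0"
  by (metis pbar_def pos powr_gt_zero less_irrefl)

lemma pbar_powr: "\<alpha> \<in> {-\<epsilon><..<\<epsilon>} \<Longrightarrow> pbar \<alpha> powr (q - 2) = lam \<alpha> / (a \<alpha> + b \<alpha>)"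
proof -
  assume "\<alpha> \<in> {-\<epsilon><..<\<epsilon>}"
  from pos[OF this] have "(x powr (1 / (q - 2))) powr (q - 2) = x" if "x = lam \<alpha> / (a \<alpha> + b \<alpha>)" for x
    using q that by (simp add: powr_powr del: abs_divide)
  then show ?thesis by (simp add: pbar_def)
qed

lemma C1_pbar: "C1_on {-\<epsilon><..<\<epsilon>} pbar"
  unfolding pbar_def[abs_def] by (intro C1_on_powr C1_on_divide C1_on_add C1 pos ab)

lemma C1_beta: "C1_on {-\<epsilon><..<\<epsilon>} beta"
  unfolding beta_def[abs_def] by (intro C1_on_mult C1_on_divide C1_on_add C1_on_diff C1 pos ab)

definition dom3 :: "(real \<times> real \<times> real) set" where "dom3 = {-\<epsilon><..<\<epsilon>} \<times> wedge"

text \<open>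
  For \<open>(u1, u2) = (p + r, p - r)\<close> the half sum of the right-hand sides is \<open>even_part\<close> and their
  half difference is \<open>r * odd_part\<close>. The second quotient in \<open>odd_part\<close> has exponent \<open>q - 3\<close>
  because \<open>(p - r) powr (q - 2) * (p + r) - (p + r) powr (q - 2) * (p - r)\<close> is \<open>(p + r) * (p - r)\<close>
  times a difference of powers with exponent \<open>q - 3\<close>.
\<close>

definition even_part :: "real \<times> real \<times> real \<Rightarrow> real" where
  "even_part = (\<lambda>(\<alpha>, p, r). (a \<alpha> * ((p + r) powr (q - 1) + (p - r) powr (q - 1))
     + b \<alpha> * ((p - r) powr (q - 2) * (p + r) + (p + r) powr (q - 2) * (p - r))) / 2 - lam \<alpha> * p)"

definition odd_part :: "real \<times> real \<times> real \<Rightarrow> real" where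
  "odd_part = (\<lambda>(\<alpha>, p, r). a \<alpha> * diff_quot (q - 1) (p, r)
     - b \<alpha> * ((p + r) * (p - r) * diff_quot (q - 3) (p, r)) - lam \<alpha>)"

lemma rhs_decomposition:
  assumes "(p, r) \<in> wedge"
  shows "S_rhs1 q lam a b (\<alpha>, p + r, p - r) = even_part (\<alpha>, p, r) + r * odd_part (\<alpha>, p, r)"
    and "S_rhs2 q lam b a (\<alpha>, p + r, p - r) = even_part (\<alpha>, p, r) - r * odd_part (\<alpha>, p, r)"
proof -
  have pp: "p + r > 0" "p - r > 0" using assms by (auto simp: wedge_def)
  have e: "(p + r) powr (q - 2) = (p + r) * (p + r) powr (q - 3)"
    "(p - r) powr (q - 2) = (p - r) * (p - r) powr (q - 3)"
    using pp powr_add[of "p + r" 1 "q - 3"] powr_add[of "p - r" 1 "q - 3"] by simp_all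
  have o: "2 * (r * odd_part (\<alpha>, p, r)) = a \<alpha> * (2 * r * diff_quot (q - 1) (p, r))
     - b \<alpha> * ((p + r) * (p - r) * (2 * r * diff_quot (q - 3) (p, r))) - 2 * lam \<alpha> * r"
    by (simp add: odd_part_def algebra_simps)
  have E: "2 * even_part (\<alpha>, p, r) = a \<alpha> * ((p + r) powr (q - 1) + (p - r) powr (q - 1))
     + b \<alpha> * ((p - r) powr (q - 2) * (p + r) + (p + r) powr (q - 2) * (p - r)) - 2 * lam \<alpha> * p"
    by (simp add: even_part_def right_diff_distrib)
  have "2 * S_rhs1 q lam a b (\<alpha>, p + r, p - r) = 2 * even_part (\<alpha>, p, r) + 2 * (r * odd_part (\<alpha>, p, r))"
    unfolding o E diff_quot_eq[OF assms] S_rhs1_def split_beta fst_conv snd_conv e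
    by (simp add: algebra_simps)
  moreover have "2 * S_rhs2 q lam b a (\<alpha>, p + r, p - r) = 2 * even_part (\<alpha>, p, r) - 2 * (r * odd_part (\<alpha>, p, r))"
    unfolding o E diff_quot_eq[OF assms] S_rhs2_def split_beta fst_conv snd_conv e
    by (simp add: algebra_simps)
  ultimately show "S_rhs1 q lam a b (\<alpha>, p + r, p - r) = even_part (\<alpha>, p, r) + r * odd_part (\<alpha>, p, r)"
    "S_rhs2 q lam b a (\<alpha>, p + r, p - r) = even_part (\<alpha>, p, r) - r * odd_part (\<alpha>, p, r)" by linarith+
qed

lemma parts_reflect:
  "even_part (\<alpha>, p, - r) = even_part (\<alpha>, p, r)"
  "(p, r) \<in> wedge \<Longrightarrow> odd_part (\<alpha>, p, - r) = odd_part (\<alpha>, p, r)"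
proof -
  show "even_part (\<alpha>, p, - r) = even_part (\<alpha>, p, r)" by (simp add: even_part_def algebra_simps)
  assume "(p, r) \<in> wedge"
  have "diff_quot e (p, - r) = diff_quot e (p, r)" for e
    unfolding diff_quot_def fst_conv snd_conv
    using Henstock_Kurzweil_Integration.integral_reflect_real[where a = "-1" and b = 1 and f = "\<lambda>t. (p + t * r) powr (e - 1)"] by simp
  then show "odd_part (\<alpha>, p, - r) = odd_part (\<alpha>, p, r)" by (simp add: odd_part_def)
qed

lemma C1_coordinates:
  "C1_on dom3 (\<lambda>x. lam (fst x))" "C1_on dom3 (\<lambda>x. a (fst x))" "C1_on dom3 (\<lambda>x. b (fst x))"
  "C1_on dom3 (\<lambda>x. fst (snd x))" "C1_on dom3 (\<lambda>x. snd (snd x))"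
  "C1_on dom3 (\<lambda>x. diff_quot e (snd x))"
proof -
  have f: "fst ` dom3 \<subseteq> {-\<epsilon><..<\<epsilon>}" and c: "snd ` dom3 \<subseteq> wedge" by (auto simp: dom3_def)
  show "C1_on dom3 (\<lambda>x. lam (fst x))" "C1_on dom3 (\<lambda>x. a (fst x))" "C1_on dom3 (\<lambda>x. b (fst x))"
    by (rule C1_on_compose[OF C1_on_fst C1(1) f] C1_on_compose[OF C1_on_fst C1(2) f] C1_on_compose[OF C1_on_fst C1(3) f])+
  show "C1_on dom3 (\<lambda>x. diff_quot e (snd x))" by (rule C1_on_compose[OF C1_on_snd C1_diff_quot c])
  show "C1_on dom3 (\<lambda>x. fst (snd x))" "C1_on dom3 (\<lambda>x. snd (snd x))"
    by (intro C1_on_bounded_linear bounded_linear_compose[OF bounded_linear_fst bounded_linear_snd]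
        bounded_linear_compose[OF bounded_linear_snd bounded_linear_snd])+
qed

lemma C1_parts: "C1_on dom3 even_part" "C1_on dom3 odd_part"
proof -
  have pp: "fst (snd x) + snd (snd x) > 0" "fst (snd x) - snd (snd x) > 0" if "x \<in> dom3" for x
    using that by (auto simp: dom3_def wedge_def)
  have "C1_on dom3 (\<lambda>x. (1/2) *\<^sub>R (a (fst x) * ((fst (snd x) + snd (snd x)) powr (q - 1) + (fst (snd x) - snd (snd x)) powr (q - 1))
     + b (fst x) * ((fst (snd x) - snd (snd x)) powr (q - 2) * (fst (snd x) + snd (snd x)) + (fst (snd x) + snd (snd x)) powr (q - 2) * (fst (snd x) - snd (snd x)))) - lam (fst x) * fst (snd x))"
    by (intro C1_on_diff C1_on_scaleR C1_on_add C1_on_mult C1_on_powr C1_coordinates pp)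
  moreover have "even_part = (\<lambda>x. (1/2) *\<^sub>R (a (fst x) * ((fst (snd x) + snd (snd x)) powr (q - 1) + (fst (snd x) - snd (snd x)) powr (q - 1))
     + b (fst x) * ((fst (snd x) - snd (snd x)) powr (q - 2) * (fst (snd x) + snd (snd x)) + (fst (snd x) + snd (snd x)) powr (q - 2) * (fst (snd x) - snd (snd x)))) - lam (fst x) * fst (snd x))"
    unfolding even_part_def split_beta by (simp add: fun_eq_iff)
  ultimately show "C1_on dom3 even_part" by simp
  have "C1_on dom3 (\<lambda>x. a (fst x) * diff_quot (q - 1) (snd x)
     - b (fst x) * ((fst (snd x) + snd (snd x)) * (fst (snd x) - snd (snd x)) * diff_quot (q - 3) (snd x)) - lam (fst x))"
    by (intro C1_on_diff C1_on_add C1_on_mult C1_coordinates)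
  moreover have "odd_part = (\<lambda>x. a (fst x) * diff_quot (q - 1) (snd x)
     - b (fst x) * ((fst (snd x) + snd (snd x)) * (fst (snd x) - snd (snd x)) * diff_quot (q - 3) (snd x)) - lam (fst x))"
    unfolding odd_part_def split_beta by (simp add: fun_eq_iff)
  ultimately show "C1_on dom3 odd_part" by simp
qed

lemma even_part_0: "p > 0 \<Longrightarrow> even_part (\<alpha>, p, 0) = (a \<alpha> + b \<alpha>) * p powr (q - 1) - lam \<alpha> * p"
proof -
  assume p: "p > 0"
  have "p powr (q - 1) = p powr (q - 2) * p" using p powr_add[of p 1 "q - 2"] by simp
  then show ?thesis by (simp add: even_part_def algebra_simps)
qed

lemma even_part_pbar:
  assumes "\<alpha> \<in> {-\<epsilon><..<\<epsilon>}"
  shows "even_part (\<alpha>, pbar \<alpha>, 0) = 0"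
proof -
  note p = pbar_pos[OF assms]
  have "pbar \<alpha> powr (q - 1) = lam \<alpha> / (a \<alpha> + b \<alpha>) * pbar \<alpha>"
    using p powr_add[of "pbar \<alpha>" 1 "q - 2"] pbar_powr[OF assms] by simp
  then show ?thesis using even_part_0[OF p] ab[OF assms] by simp
qed

text \<open>
  This identifies \<open>(q - 2) * beta \<alpha>\<close> as the linearisation of the system at the constant solution
  in the antisymmetric direction, which has to meet an eigenvalue \<open>j * (j + m)\<close> for solutions with
  \<open>r \<noteq> 0\<close> to branch off.
\<close>

lemma odd_part_pbar:
  assumes "\<alpha> \<in> {-\<epsilon><..<\<epsilon>}"
  shows "odd_part (\<alpha>, pbar \<alpha>, 0) = (q - 2) * beta \<alpha>"
proof -
  note p = pbar_pos[OF assms]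
  have "pbar \<alpha> powr (q - 2) = pbar \<alpha> * pbar \<alpha> * pbar \<alpha> powr (q - 4)"
    using p powr_add[of "pbar \<alpha>" 2 "q - 4"] by (simp add: power2_eq_square)
  then have "odd_part (\<alpha>, pbar \<alpha>, 0) = (a \<alpha> * (q - 1) - b \<alpha> * (q - 3)) * (pbar \<alpha> powr (q - 2)) - lam \<alpha>"
    by (simp add: odd_part_def diff_quot_0 algebra_simps)
  then show ?thesis unfolding pbar_powr[OF assms] beta_def using ab[OF assms]
    by (simp add: field_simps)
qed

text \<open>
  The parameters of the shooting problem are the amplitude \<open>s\<close>, the parameter \<open>\<alpha>\<close> of the system
  and the value \<open>\<zeta>\<close> of \<open>z\<close> at the pole; the unknowns are \<open>z = p - pbar \<alpha>\<close> and \<open>\<rho> = r / s\<close>. The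
  component \<open>\<zeta>\<close> does not enter the equation, only the initial value.
\<close>

definition coords :: "(real \<times> real \<times> real) \<times> (real \<times> real) \<Rightarrow> real \<times> real \<times> real" where
  "coords = (\<lambda>((s, \<alpha>, \<zeta>), (z, \<rho>)). (\<alpha>, pbar \<alpha> + z, s * \<rho>))"

definition fdom :: "((real \<times> real \<times> real) \<times> (real \<times> real)) set" where
  "fdom = {x. fst (snd (fst x)) \<in> {-\<epsilon><..<\<epsilon>} \<and> coords x \<in> dom3}"

text \<open>
  The source of the system for \<open>(z, \<rho>)\<close>: the odd equation has been divided by the amplitude \<open>s\<close>,
  so it is meaningful at \<open>s = 0\<close>, where it becomes the linearised equation. The minus signs come
  from the nonnegative sign convention of the Laplacian.
\<close>

definition field :: "(real \<times> real \<times> real) \<times> (real \<times> real) \<Rightarrow> real \<times> real" where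
  "field x = (- even_part (coords x), - (odd_part (coords x) * snd (snd x)))"

definition strip :: "((real \<times> real \<times> real) \<times> (real \<times> real)) set" where
  "strip = {x. fst (snd (fst x)) \<in> {-\<epsilon><..<\<epsilon>}}"

lemma open_strip: "open strip"
proof -
  have "strip = (\<lambda>x. fst (snd (fst x))) -` {-\<epsilon><..<\<epsilon>}" by (auto simp: strip_def)
  then show ?thesis
    using bounded_linear.continuous_on[OF bounded_linear_components(2) continuous_on_id, of UNIV]
    by (metis open_vimage open_greaterThanLessThan id_def)
qed

lemma C1_coords_strip: "C1_on strip coords"
proof -
  have "C1_on strip (\<lambda>x. (fst (snd (fst x)), pbar (fst (snd (fst x))) + fst (snd x), fst (fst x) * snd (snd x)))"
    by (intro C1_on_Pair C1_on_add C1_on_mult C1_on_bounded_linear bounded_linear_components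
        C1_on_compose[OF C1_on_bounded_linear[OF bounded_linear_components(2)] C1_pbar]) (auto simp: strip_def)
  then show ?thesis by (simp add: coords_def case_prod_unfold)
qed

lemma open_fdom: "open fdom"
proof -
  have "open wedge" 
  proof -
    have "wedge = {x. inner (1, -1) x > 0} \<inter> {x. inner (1, 1) x > (0::real)}"
      by (auto simp: wedge_def abs_less_iff)
    then show ?thesis by (metis open_Int open_halfspace_gt)
  qed
  then have "open dom3" unfolding dom3_def by (intro open_Times) auto
  moreover have "fdom = strip \<inter> coords -` dom3" by (auto simp: fdom_def strip_def)
  ultimately show ?thesis
    using continuous_open_preimage[OF C1_on_continuous[OF C1_coords_strip] open_strip] by simp
qed

lemma C1_field: "C1_on fdom field"
proof -
  have sub: "fdom \<subseteq> strip" by (auto simp: fdom_def strip_def)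
  have c: "coords ` fdom \<subseteq> dom3" by (auto simp: fdom_def)
  show ?thesis unfolding field_def[abs_def]
    by (intro C1_on_Pair C1_on_uminus C1_on_mult C1_on_bounded_linear bounded_linear_components
        C1_on_compose[OF C1_on_subset[OF C1_coords_strip sub] C1_parts(1) c]
        C1_on_compose[OF C1_on_subset[OF C1_coords_strip sub] C1_parts(2) c])
qed

lemma reference_in_fdom: "((0, 0, \<zeta>), (0, \<rho>)) \<in> fdom"
  using \<epsilon> pbar_pos[of 0] by (simp add: fdom_def coords_def dom3_def wedge_def)

text \<open>
  Along the line \<open>s = 0\<close>, \<open>z = 0\<close> the state stays at the constant solution, where \<open>field\<close> is
  explicitly \<open>(0, - (q - 2) * beta \<alpha> * \<rho>)\<close>.
\<close>

lemma field_derivative_along_reference: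
  assumes D: "(field has_derivative D) (at ((0, 0, 0), (0, \<phi>)))"
    and \<beta>: "(beta has_real_derivative \<beta>') (at 0)"
  shows "D ((0, d\<alpha>, d\<zeta>), (0, d\<rho>)) = (0, - ((q - 2) * (\<beta>' * d\<alpha> * \<phi> + beta 0 * d\<rho>)))"
proof -
  let ?x = "((0::real, 0::real, 0::real), (0::real, \<phi>))" and ?v = "((0::real, d\<alpha>, d\<zeta>), (0::real, d\<rho>))"
  have 1: "((\<lambda>t. field (?x + t *\<^sub>R ?v)) has_vector_derivative D ?v) (at 0)" by (rule has_derivative_along_line[OF D])
  have "((\<lambda>t. beta (t * d\<alpha>)) has_real_derivative \<beta>' * d\<alpha>) (at 0)"
    using DERIV_chain2[of beta \<beta>' "\<lambda>t. t * d\<alpha>" 0 d\<alpha> UNIV] \<beta> DERIV_cmult_right[OF DERIV_ident, of d\<alpha>] by simp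
  then have "((\<lambda>t. - ((q - 2) * (beta (t * d\<alpha>) * (\<phi> + t * d\<rho>)))) has_real_derivative
      - ((q - 2) * (\<beta>' * d\<alpha> * \<phi> + beta 0 * d\<rho>))) (at 0)"
    by (auto intro!: derivative_eq_intros)
  then have 2: "((\<lambda>t. (0::real, - ((q - 2) * (beta (t * d\<alpha>) * (\<phi> + t * d\<rho>))))) has_vector_derivative
      (0, - ((q - 2) * (\<beta>' * d\<alpha> * \<phi> + beta 0 * d\<rho>)))) (at 0)"
    unfolding has_real_derivative_iff_has_vector_derivative
    by (intro has_vector_derivative_Pair has_vector_derivative_const)
  have "\<exists>e>0. \<forall>t. dist t 0 < e \<longrightarrow> t * d\<alpha> \<in> {-\<epsilon><..<\<epsilon>}"
  proof (intro exI[of _ "\<epsilon> / (\<bar>d\<alpha>\<bar> + 1)"] conjI allI impI)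
    fix t :: real assume "dist t 0 < \<epsilon> / (\<bar>d\<alpha>\<bar> + 1)"
    then have "\<bar>t\<bar> * (\<bar>d\<alpha>\<bar> + 1) < \<epsilon>" by (simp add: dist_norm pos_less_divide_eq add_nonneg_pos)
    moreover have "\<bar>t * d\<alpha>\<bar> \<le> \<bar>t\<bar> * (\<bar>d\<alpha>\<bar> + 1)" by (simp add: abs_mult mult_left_mono)
    ultimately show "t * d\<alpha> \<in> {-\<epsilon><..<\<epsilon>}" by auto
  qed (use \<epsilon> in \<open>simp add: add_nonneg_pos\<close>)
  then obtain e where e: "e > 0" "\<And>t. dist t 0 < e \<Longrightarrow> t * d\<alpha> \<in> {-\<epsilon><..<\<epsilon>}" by blast
  have eq: "(0, - ((q - 2) * (beta (t * d\<alpha>) * (\<phi> + t * d\<rho>)))) = field (?x + t *\<^sub>R ?v)" if "dist t 0 < e" for t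
    using even_part_pbar[OF e(2)[OF that]] odd_part_pbar[OF e(2)[OF that]]
    by (simp add: field_def coords_def)
  have "((\<lambda>t. field (?x + t *\<^sub>R ?v)) has_vector_derivative
      (0, - ((q - 2) * (\<beta>' * d\<alpha> * \<phi> + beta 0 * d\<rho>)))) (at 0)"
    by (rule has_vector_derivative_transform_within[OF 2 e(1)]) (use eq in auto)
  with 1 show ?thesis by (rule vector_derivative_unique_at)
qed

text \<open>
  At \<open>s = 0\<close> the first component is that of the scalar equation, whose linearisation at the
  constant solution is \<open>(q - 2) * lam 0\<close>.
\<close>

lemma field_derivative_mean:
  assumes D: "(field has_derivative D) (at ((0, 0, 0), (0, \<phi>)))"
    and \<beta>: "(beta has_real_derivative \<beta>') (at 0)"
  shows "fst (D ((0, d\<alpha>, d\<zeta>), (dz, d\<rho>))) = - ((q - 2) * lam 0 * dz)"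
proof -
  let ?x = "((0::real, 0::real, 0::real), (0::real, \<phi>))" and ?v = "((0::real, 0::real, 0::real), (dz, 0::real))"
  have I0: "0 \<in> {-\<epsilon><..<\<epsilon>}" using \<epsilon> by simp
  note p = pbar_pos[OF I0]
  have lin: "D (v + w) = D v + D w" for v w using D by (simp add: has_derivative_def linear_simps)
  have 1: "((\<lambda>t. fst (field (?x + t *\<^sub>R ?v))) has_vector_derivative fst (D ?v)) (at 0)"
    using bounded_linear.has_vector_derivative[OF bounded_linear_fst has_derivative_along_line[OF D]] .
  have pw: "(q - 1) * (pbar 0 powr (q - 2)) * (a 0 + b 0) = (q - 1) * lam 0"
    using pbar_powr[OF I0] ab[OF I0] by simp
  have "((\<lambda>t. - ((a 0 + b 0) * (pbar 0 + t * dz) powr (q - 1) - lam 0 * (pbar 0 + t * dz))) has_real_derivative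
      - ((a 0 + b 0) * ((q - 1) * pbar 0 powr (q - 2) * dz) - lam 0 * dz)) (at 0)"
    using p by (auto intro!: derivative_eq_intros)
  also have "- ((a 0 + b 0) * ((q - 1) * pbar 0 powr (q - 2) * dz) - lam 0 * dz) = - ((q - 2) * lam 0 * dz)"
    using arg_cong[OF pw, of "\<lambda>x. x * dz"] by (simp add: algebra_simps)
  finally have 2: "((\<lambda>t. - ((a 0 + b 0) * (pbar 0 + t * dz) powr (q - 1) - lam 0 * (pbar 0 + t * dz))) has_vector_derivative
      - ((q - 2) * lam 0 * dz)) (at 0)" by (simp add: has_real_derivative_iff_has_vector_derivative)
  define e where "e = pbar 0 / (\<bar>dz\<bar> + 1)"
  have e: "e > 0" using p by (simp add: e_def add_nonneg_pos)
  have eq: "- ((a 0 + b 0) * (pbar 0 + t * dz) powr (q - 1) - lam 0 * (pbar 0 + t * dz)) = fst (field (?x + t *\<^sub>R ?v))"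
    if "dist t 0 < e" for t
  proof -
    have "\<bar>t\<bar> * (\<bar>dz\<bar> + 1) < pbar 0" using that by (simp add: e_def dist_norm pos_less_divide_eq add_nonneg_pos)
    moreover have "\<bar>t * dz\<bar> \<le> \<bar>t\<bar> * (\<bar>dz\<bar> + 1)" by (simp add: abs_mult mult_left_mono)
    ultimately have "pbar 0 + t * dz > 0" by linarith
    from even_part_0[OF this] show ?thesis by (simp add: field_def coords_def)
  qed
  have "((\<lambda>t. fst (field (?x + t *\<^sub>R ?v))) has_vector_derivative - ((q - 2) * lam 0 * dz)) (at 0)"
    by (rule has_vector_derivative_transform_within[OF 2 e]) (use eq in auto)
  then have "fst (D ?v) = - ((q - 2) * lam 0 * dz)" using 1 by (rule vector_derivative_unique_at[rotated])
  moreover have "D ((0, d\<alpha>, d\<zeta>), (dz, d\<rho>)) = D ((0, d\<alpha>, d\<zeta>), (0, d\<rho>)) + D ?v"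
    using lin[of "((0, d\<alpha>, d\<zeta>), (0, d\<rho>))" ?v] by simp
  ultimately show ?thesis using field_derivative_along_reference[OF D \<beta>, of d\<alpha> d\<zeta> d\<rho>] by simp
qed

end

section \<open>Bifurcation for the equation between pole and equator\<close>

lemma flux_linear:
  assumes L: "bounded_linear L" and h: "continuous_on {0..\<theta>} h"
  shows "flux m (\<lambda>\<sigma>. L (h \<sigma>)) \<theta> = L (flux m h \<theta>)"
proof -
  interpret bounded_linear L by fact
  have "integral {0..\<theta>} (L \<circ> (\<lambda>\<sigma>. sin \<sigma> ^ m *\<^sub>R h \<sigma>)) = L (flux m h \<theta>)"
    unfolding flux_def by (rule integral_linear[OF _ L]) (intro integrable_continuous_interval continuous_intros h)
  then show ?thesis by (simp add: flux_def o_def scale)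
qed

lemma potential_linear:
  assumes L: "bounded_linear L" and h: "continuous_on {0..\<theta>} h" and t: "\<theta> < pi"
  shows "potential m (\<lambda>\<sigma>. L (h \<sigma>)) \<theta> = L (potential m h \<theta>)"
proof -
  interpret bounded_linear L by fact
  have "slope m (\<lambda>\<sigma>. L (h \<sigma>)) x = L (slope m h x)" if "x \<in> {0..\<theta>}" for x
    using flux_linear[OF L continuous_on_subset[OF h], of x m] that by (auto simp: slope_def scale zero)
  then have "potential m (\<lambda>\<sigma>. L (h \<sigma>)) \<theta> = integral {0..\<theta>} (L \<circ> slope m h)"
    unfolding potential_def by (intro integral_cong) simp
  also have "\<dots> = L (potential m h \<theta>)"
    unfolding potential_def
    by (rule integral_linear[OF _ L]) (intro integrable_continuous_interval continuous_on_slope h t)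
  finally show ?thesis .
qed

text \<open>
  A linear functional of a vector solution solves the scalar equation with the corresponding
  source; it is used to pass from the coupled system to its decoupled linearisation.
\<close>

lemma profile_solve_op:
  fixes h :: "real \<Rightarrow>\<^sub>C 'e::euclidean_space"
  assumes y: "y = const_bcontfun c + solve_op m h" and L: "bounded_linear (L :: 'e \<Rightarrow> real)"
    and k: "\<And>\<theta>. \<theta> \<in> {0..pi/2} \<Longrightarrow> k \<theta> = L (apply_bcontfun h \<theta>)"
    and d: "d = L c"
  shows "profile m d k (\<lambda>\<theta>. L (apply_bcontfun y \<theta>))"
proof -
  interpret bounded_linear L by fact
  have hc: "continuous_on A (apply_bcontfun h)" for A by simp
  have "continuous_on {0..pi/2} (\<lambda>\<theta>. L (apply_bcontfun h \<theta>))" by (intro continuous_on hc)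
  then have kc: "continuous_on {0..pi/2} k" by (rule continuous_on_eq) (simp only: k)
  have "L (apply_bcontfun y \<theta>) = d + potential m k \<theta>" if t: "\<theta> \<in> {0..pi/2}" for \<theta>
  proof -
    have t': "\<theta> < pi" using t pi_half_less(1) by (meson atLeastAtMost_iff le_less_trans)
    have "flux m k x = flux m (\<lambda>\<sigma>. L (apply_bcontfun h \<sigma>)) x" if "x \<in> {0..\<theta>}" for x
      unfolding flux_def using t that k by (intro integral_cong) auto
    then have "potential m k \<theta> = potential m (\<lambda>\<sigma>. L (apply_bcontfun h \<sigma>)) \<theta>"
      unfolding potential_def by (intro integral_cong) (auto simp: slope_def)
    then show ?thesis
      using potential_linear[OF L hc t', of m] by (simp add: y solve_op_apply qclamp(2)[OF t] add d)
  qed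
  with kc show ?thesis unfolding profile_def by blast
qed

lemma flux_cong:
  assumes "\<And>\<theta>. \<theta> \<in> {0..x} \<Longrightarrow> h \<theta> = k \<theta>"
  shows "flux m h x = flux m k x"
  unfolding flux_def using assms by (intro integral_cong) auto

definition scaled_clamp :: "real \<Rightarrow> (real \<Rightarrow>\<^sub>C real) \<Rightarrow> (real \<Rightarrow>\<^sub>C real)" where
  "scaled_clamp \<mu> y = Bcontfun (\<lambda>t. - \<mu> * apply_bcontfun y (qclamp t))"

lemma scaled_clamp_apply: "apply_bcontfun (scaled_clamp \<mu> y) t = - \<mu> * apply_bcontfun y (qclamp t)"
  unfolding scaled_clamp_def
  by (subst Bcontfun_inverse) (intro bcontfun_qclamp continuous_intros, auto)

lemma eigen_resolvent:
  obtains S where "bounded_linear S" "\<And>y. S y = y + solve_op m (scaled_clamp \<mu> (S y))"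
    "\<And>y. S (y - solve_op m (scaled_clamp \<mu> y)) = y"
proof -
  have "bounded_linear (scaled_clamp \<mu>)"
  proof (rule bounded_linear_intro)
    show "norm (scaled_clamp \<mu> y) \<le> norm y * \<bar>\<mu>\<bar>" for y
      using norm_bounded[of y]
      by (intro norm_bound) (simp add: scaled_clamp_apply abs_mult mult.commute mult_left_mono)
  qed (auto intro!: bcontfun_eqI simp: scaled_clamp_apply algebra_simps)
  moreover have "norm (apply_bcontfun (scaled_clamp \<mu> y) t) \<le> \<bar>\<mu>\<bar> * norm (apply_bcontfun y (qclamp t))" for y t
    by (simp add: scaled_clamp_apply abs_mult)
  ultimately show ?thesis using volterra_resolvent[of "scaled_clamp \<mu>" "\<bar>\<mu>\<bar>" m] that by blast
qed

lemma eigen_profile_exists: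
  obtains \<phi> where "\<phi> = const_bcontfun 1 + solve_op m (scaled_clamp \<mu> \<phi>)"
  using eigen_resolvent[of m \<mu>] by metis

lemma eigen_profile_unique:
  assumes "v = solve_op m (h :: real \<Rightarrow>\<^sub>C real)" "\<And>t. t \<in> {0..pi/2} \<Longrightarrow> apply_bcontfun h t = - \<mu> * apply_bcontfun v t"
  shows "v = 0"
proof -
  obtain S where S: "bounded_linear S" "\<And>y. S (y - solve_op m (scaled_clamp \<mu> y)) = y"
    using eigen_resolvent[of m \<mu>] by metis
  have "apply_bcontfun (solve_op m (scaled_clamp \<mu> v)) t = apply_bcontfun (solve_op m h) t" for t
  proof -
    have "flux m (apply_bcontfun (scaled_clamp \<mu> v)) x = flux m (apply_bcontfun h) x" if "x \<in> {0..qclamp t}" for x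
    proof (rule flux_cong)
      fix \<theta> assume "\<theta> \<in> {0..x}"
      then have "\<theta> \<in> {0..pi/2}" using that qclamp_bounds[of t] by auto
      then show "apply_bcontfun (scaled_clamp \<mu> v) \<theta> = apply_bcontfun h \<theta>"
        by (simp add: scaled_clamp_apply assms(2) qclamp(2))
    qed
    then show ?thesis unfolding solve_op_apply potential_def
      by (intro integral_cong) (auto simp: slope_def)
  qed
  then have "v - solve_op m (scaled_clamp \<mu> v) = 0" using assms(1) by (metis bcontfun_eqI right_minus_eq)
  then have "v = S 0" using S(2)[of v] by simp
  then show ?thesis using linear_0[OF bounded_linear.linear[OF S(1)]] by simp
qed

lemma bounded_linear_flux_half:
  "bounded_linear (\<lambda>h :: real \<Rightarrow>\<^sub>C 'e::euclidean_space. flux m (apply_bcontfun h) (pi/2))"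
proof (rule bounded_linear_intro[where K = "pi/2"])
  have i: "(\<lambda>\<sigma>. sin \<sigma> ^ m *\<^sub>R apply_bcontfun h \<sigma>) integrable_on {0..pi/2}" for h :: "real \<Rightarrow>\<^sub>C 'e"
    by (intro integrable_continuous_interval continuous_intros) auto
  show "flux m (apply_bcontfun (h + k)) (pi/2) = flux m (apply_bcontfun h) (pi/2) + flux m (apply_bcontfun k) (pi/2)"
    for h k :: "real \<Rightarrow>\<^sub>C 'e"
    unfolding flux_def integral_add[OF i i, symmetric] by (simp add: scaleR_add_right)
  show "flux m (apply_bcontfun (r *\<^sub>R h)) (pi/2) = r *\<^sub>R flux m (apply_bcontfun h) (pi/2)" for r and h :: "real \<Rightarrow>\<^sub>C 'e"
    using flux_linear[OF bounded_linear_scaleR_right[of r], of "pi/2" "apply_bcontfun h" m] by simp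
  show "norm (flux m (apply_bcontfun h) (pi/2)) \<le> norm h * (pi/2)" for h :: "real \<Rightarrow>\<^sub>C 'e"
  proof -
    have "norm (flux m (apply_bcontfun h) (pi/2)) \<le> integral {0..pi/2} (\<lambda>\<sigma>. norm h)"
      unfolding flux_def
    proof (rule integral_norm_bound_integral[OF i])
      fix \<sigma> :: real
      have "\<bar>sin \<sigma>\<bar> ^ m \<le> 1" by (intro power_le_one) auto
      then have "\<bar>sin \<sigma>\<bar> ^ m * norm (apply_bcontfun h \<sigma>) \<le> 1 * norm h"
        by (intro mult_mono norm_bounded) auto
      then show "norm (sin \<sigma> ^ m *\<^sub>R apply_bcontfun h \<sigma>) \<le> norm h" by (simp add: power_abs)
    qed auto
    then show ?thesis by (simp add: mult.commute)
  qed
qed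

lemma bounded_linear_eval: "bounded_linear (\<lambda>y :: real \<Rightarrow>\<^sub>C 'e::real_normed_vector. apply_bcontfun y t)"
  by (rule bounded_linear_intro[where K = 1]) (auto simp: norm_bounded)

context symmetric_system
begin

text \<open>
  Shooting from the pole: for the solution with initial value \<open>(\<zeta>, 1)\<close> the two conditions at the
  equator say that \<open>z\<close> has vanishing flux (it continues evenly) and that \<open>\<rho>\<close> has vanishing flux or
  vanishing value (it continues with the parity of \<open>j\<close>). At \<open>s = 0\<close> they hold for \<open>\<alpha> = \<zeta> = 0\<close>,
  where \<open>\<rho>\<close> is the eigenprofile \<open>\<phi>\<close>, because the eigenvalue is resonant. The Jacobian in \<open>(\<alpha>, \<zeta>)\<close>
  is triangular, since moving \<open>\<alpha>\<close> at \<open>s = 0\<close> leaves \<open>z = 0\<close>; its diagonal entries are nonzero by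
  \<open>nonresonant_moment\<close> and \<open>transversality\<close>.
\<close>

theorem profile_branch:
  assumes j: "j \<ge> 1" and res: "(q - 2) * beta 0 = real j * (real j + real m)"
    and nonres: "\<And>i. i \<ge> 1 \<Longrightarrow> (q - 2) * lam 0 \<noteq> 2 * real i * (2 * real i + real m)"
    and lam0: "lam 0 \<noteq> 0"
    and \<beta>: "(beta has_real_derivative \<beta>') (at 0)" "\<beta>' \<noteq> 0"
  obtains \<eta> \<alpha> \<zeta> y h where "\<eta> > 0" "\<alpha> 0 = 0" "\<zeta> 0 = 0" "\<And>t. fst (apply_bcontfun (y 0) t) = 0"
    "C1_on (ball 0 \<eta>) \<alpha>" "C1_on (ball 0 \<eta>) \<zeta>" "C1_on (ball 0 \<eta>) y" "C1_on (ball 0 \<eta>) h"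
    "\<And>s. s \<in> ball 0 \<eta> \<Longrightarrow> ((s, \<alpha> s, \<zeta> s), y s) \<in> tube fdom"
    "\<And>s. s \<in> ball 0 \<eta> \<Longrightarrow> h s = superpose field ((s, \<alpha> s, \<zeta> s), y s)"
    "\<And>s. s \<in> ball 0 \<eta> \<Longrightarrow> y s = const_bcontfun (\<zeta> s, 1) + solve_op m (h s)"
    "\<And>s. s \<in> ball 0 \<eta> \<Longrightarrow> fst (flux m (apply_bcontfun (h s)) (pi/2)) = 0"
    "\<And>s. s \<in> ball 0 \<eta> \<Longrightarrow> if even j then snd (flux m (apply_bcontfun (h s)) (pi/2)) = 0
        else snd (apply_bcontfun (y s) (pi/2)) = 0"
proof -
  define \<nu> where "\<nu> = (q - 2) * beta 0"
  define \<mu> where "\<mu> = (q - 2) * lam 0"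
  have hp: "pi/2 \<in> {0..pi/2}" using pi_half_less(2) by simp
  have \<mu>0: "\<mu> \<noteq> 0" using q lam0 by (simp add: \<mu>_def)
  obtain \<phi> where \<phi>: "\<phi> = const_bcontfun 1 + solve_op m (scaled_clamp \<nu> \<phi>)"
    using eigen_profile_exists by blast
  have p\<phi>: "profile m 1 (\<lambda>\<theta>. - \<nu> * apply_bcontfun \<phi> \<theta>) (apply_bcontfun \<phi>)"
    using profile_solve_op[OF \<phi> bounded_linear_ident, of "\<lambda>\<theta>. - \<nu> * apply_bcontfun \<phi> \<theta>" 1]
    by (simp add: scaled_clamp_apply qclamp(2))
  have \<phi>q: "apply_bcontfun \<phi> (qclamp t) = apply_bcontfun \<phi> t" for t
    by (subst (1 2) \<phi>) (simp add: solve_op_apply)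
  obtain f' where f': "\<And>x. x \<in> fdom \<Longrightarrow> (field has_derivative blinfun_apply (f' x)) (at x)"
    "continuous_on fdom f'"
    using C1_on_openD[OF C1_field open_fdom] by blast
  define y0 :: "real \<Rightarrow>\<^sub>C (real \<times> real)" where "y0 = Bcontfun (\<lambda>t. (0, apply_bcontfun \<phi> (qclamp t)))"
  have "apply_bcontfun y0 t = (0, apply_bcontfun \<phi> (qclamp t))" for t
    unfolding y0_def by (subst Bcontfun_inverse) (intro bcontfun_qclamp continuous_intros, auto)
  then have y0: "apply_bcontfun y0 t = (0, apply_bcontfun \<phi> t)" for t by (simp add: \<phi>q)
  define p0 :: "real \<times> real \<times> real" where "p0 = (0, 0, 0)"
  define c :: "real \<times> real \<times> real \<Rightarrow> real \<times> real" where "c p = (snd (snd p), 1)" for p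
  define c' :: "real \<times> real \<times> real \<Rightarrow> real \<times> real" where "c' v = (snd (snd v), 0)" for v
  have C1c: "C1_on UNIV c"
    unfolding c_def[abs_def]
    by (intro C1_on_Pair C1_on_const C1_on_bounded_linear bounded_linear_compose[OF bounded_linear_snd bounded_linear_snd])
  have Dc: "(c has_derivative c') (at p0)"
    unfolding c_def[abs_def] c'_def[abs_def] by (auto intro!: derivative_eq_intros)
  have base1: "(p0, y0) \<in> tube fdom"
    by (simp add: tube_def p0_def y0 reference_in_fdom)
  have cf: "continuous_on fdom field" by (rule C1_on_continuous[OF C1_field])
  have I0: "0 \<in> {-\<epsilon><..<\<epsilon>}" using \<epsilon> by simp
  have Fb: "apply_bcontfun (superpose field (p0, y0)) t = (0, apply_bcontfun (scaled_clamp \<nu> \<phi>) t)" for t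
    unfolding superpose_apply[OF cf base1]
    using even_part_pbar[OF I0] odd_part_pbar[OF I0]
    by (simp add: field_def coords_def y0 p0_def scaled_clamp_apply \<nu>_def)
  have base2: "y0 = const_bcontfun (c p0) + solve_op m (superpose field (p0, y0))"
  proof (rule bcontfun_eqI)
    fix t
    let ?H = "apply_bcontfun (superpose field (p0, y0))"
    have hc: "continuous_on A ?H" for A by simp
    have "fst (potential m ?H (qclamp t)) = potential m (\<lambda>\<sigma>. fst (?H \<sigma>)) (qclamp t)"
      by (rule potential_linear[symmetric, OF bounded_linear_fst hc qclamp_bounds(3)])
    also have "\<dots> = 0" using potential_scaleR[of m 0 "\<lambda>\<sigma>. 0" "qclamp t"] by (simp add: Fb)
    finally have 1: "fst (potential m ?H (qclamp t)) = 0" .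
    have "snd (potential m ?H (qclamp t)) = potential m (\<lambda>\<sigma>. snd (?H \<sigma>)) (qclamp t)"
      by (rule potential_linear[symmetric, OF bounded_linear_snd hc qclamp_bounds(3)])
    also have "\<dots> = potential m (apply_bcontfun (scaled_clamp \<nu> \<phi>)) (qclamp t)" by (simp add: Fb)
    also have "\<dots> = apply_bcontfun \<phi> t - 1"
      using arg_cong[OF \<phi>, of "\<lambda>f. apply_bcontfun f t"] by (simp add: solve_op_apply)
    finally have 2: "snd (potential m ?H (qclamp t)) = apply_bcontfun \<phi> t - 1" .
    show "apply_bcontfun y0 t = apply_bcontfun (const_bcontfun (c p0) + solve_op m (superpose field (p0, y0))) t"
      using 1 2 by (simp add: solve_op_apply y0 c_def p0_def prod_eq_iff)
  qed
  show ?thesis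
  proof (rule singular_ivp_C1_family[OF open_fdom f' C1c Dc base1 base2])
  fix V Y Y' H'
  assume V: "open V" "p0 \<in> V" "C1_on V Y" "Y p0 = y0"
    "\<And>p. p \<in> V \<Longrightarrow> (p, Y p) \<in> tube fdom \<and> Y p = const_bcontfun (c p) + solve_op m (superpose field (p, Y p))"
    and H: "C1_on V (\<lambda>p. superpose field (p, Y p))" "(Y has_derivative Y') (at p0)"
      "((\<lambda>p. superpose field (p, Y p)) has_derivative H') (at p0)"
      "\<And>v t. apply_bcontfun (H' v) t =
        f' (p0, apply_bcontfun y0 (qclamp t)) (v, apply_bcontfun (Y' v) (qclamp t))"
      "\<And>v. Y' v = const_bcontfun (c' v) + solve_op m (H' v)"
  define fl where "fl h = flux m (apply_bcontfun h) (pi/2)" for h :: "real \<Rightarrow>\<^sub>C (real \<times> real)"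
  have blfl: "bounded_linear fl" unfolding fl_def by (rule bounded_linear_flux_half)
  define ev where "ev y = apply_bcontfun y (pi/2)" for y :: "real \<Rightarrow>\<^sub>C (real \<times> real)"
  have blev: "bounded_linear ev" unfolding ev_def by (rule bounded_linear_eval)
  \<comment> \<open>The shooting map: its zeros are the parameters whose solutions satisfy both conditions at
    the equator.\<close>
  define \<Gamma> where "\<Gamma> p = (fst (fl (superpose field (p, Y p))),
      if even j then snd (fl (superpose field (p, Y p))) else snd (ev (Y p)))" for p
  define D where "D v = (fst (fl (H' v)), if even j then snd (fl (H' v)) else snd (ev (Y' v)))" for v
  note bl1 = bounded_linear_compose[OF bounded_linear_fst blfl]
    and bl2 = bounded_linear_compose[OF bounded_linear_snd blfl]
    and bl3 = bounded_linear_compose[OF bounded_linear_snd blev]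
  have C1\<Gamma>: "C1_on V \<Gamma>"
    unfolding \<Gamma>_def[abs_def]
    by (intro C1_on_Pair C1_on_linear_image[OF bl1 H(1)])
       (cases "even j"; simp add: C1_on_linear_image[OF bl2 H(1)] C1_on_linear_image[OF bl3 V(3)])
  have D\<Gamma>: "(\<Gamma> has_derivative D) (at p0)"
    unfolding \<Gamma>_def[abs_def] D_def[abs_def]
    by (intro has_derivative_Pair bounded_linear.has_derivative[OF bl1 H(3)])
       (cases "even j"; simp add: bounded_linear.has_derivative[OF bl2 H(3)] bounded_linear.has_derivative[OF bl3 H(2)])
  \<comment> \<open>Resonance: the eigenprofile itself satisfies the condition of its parity.\<close>
  have \<phi>end: "if even j then flux m (\<lambda>\<theta>. - \<nu> * apply_bcontfun \<phi> \<theta>) (pi/2) = 0 else apply_bcontfun \<phi> (pi/2) = 0"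
    using resonant_even[OF p\<phi> _ _ j] resonant_odd[OF p\<phi>] flux_eigen_half[OF p\<phi>] res by (simp add: \<nu>_def)
  have flf: "fst (fl h) = flux m (\<lambda>\<theta>. fst (apply_bcontfun h \<theta>)) (pi/2)"
    "snd (fl h) = flux m (\<lambda>\<theta>. snd (apply_bcontfun h \<theta>)) (pi/2)" for h
    unfolding fl_def by (intro flux_linear[symmetric] bounded_linear_fst bounded_linear_snd; simp)+
  have \<Gamma>0: "\<Gamma> p0 = 0"
  proof -
    have "fst (fl (superpose field (p0, y0))) = 0"
      unfolding flf using flux_linear[OF bounded_linear_zero[where 'a = real and 'b = real], of "pi/2" "\<lambda>_. 0" m] by (simp add: Fb)
    moreover have "snd (fl (superpose field (p0, y0))) = flux m (\<lambda>\<theta>. - \<nu> * apply_bcontfun \<phi> \<theta>) (pi/2)"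
      unfolding flf by (rule flux_cong) (simp add: Fb scaled_clamp_apply qclamp(2))
    ultimately show ?thesis using \<phi>end by (auto simp: \<Gamma>_def V(4) ev_def y0 zero_prod_def)
  qed
  have base_f': "(field has_derivative blinfun_apply (f' (p0, apply_bcontfun y0 t))) (at ((0, 0, 0), (0, apply_bcontfun \<phi> t)))" for t
    using f'(1)[OF reference_in_fdom, of 0 "apply_bcontfun \<phi> t"] by (simp add: p0_def y0)
  have H'fst: "fst (apply_bcontfun (H' (0, d\<alpha>, d\<zeta>)) t) = - \<mu> * fst (apply_bcontfun (Y' (0, d\<alpha>, d\<zeta>)) t)"
    if "t \<in> {0..pi/2}" for t d\<alpha> d\<zeta>
    using field_derivative_mean[OF base_f' \<beta>(1), of t d\<alpha> d\<zeta> "fst (apply_bcontfun (Y' (0, d\<alpha>, d\<zeta>)) t)" "snd (apply_bcontfun (Y' (0, d\<alpha>, d\<zeta>)) t)"]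
    by (simp add: H(4) qclamp(2)[OF that] \<mu>_def)
  have c'v: "c' (0, d\<alpha>, d\<zeta>) = (d\<zeta>, 0)" for d\<alpha> d\<zeta> by (simp add: c'_def)
  have pZ: "profile m d\<zeta> (\<lambda>\<theta>. - \<mu> * fst (apply_bcontfun (Y' (0, d\<alpha>, d\<zeta>)) \<theta>)) (\<lambda>\<theta>. fst (apply_bcontfun (Y' (0, d\<alpha>, d\<zeta>)) \<theta>))" for d\<alpha> d\<zeta>
    by (rule profile_solve_op[OF H(5) bounded_linear_fst]) (use H'fst c'v in auto)
  have Dfst: "fst (D (0, d\<alpha>, d\<zeta>)) = - \<mu> * cos_moment m (\<lambda>\<theta>. fst (apply_bcontfun (Y' (0, d\<alpha>, d\<zeta>)) \<theta>)) 0" for d\<alpha> d\<zeta>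
    unfolding D_def fst_conv flf flux_eigen_half[OF pZ, symmetric]
    by (rule flux_cong) (rule H'fst)
  have P: "fst (D (0, 0, 1)) \<noteq> 0"
    unfolding Dfst using nonresonant_moment[OF pZ, of 1] nonres \<mu>0 by (auto simp: \<mu>_def)
  \<comment> \<open>For \<open>d\<zeta> = 0\<close> the first component solves a homogeneous linear initial value problem.\<close>
  have Z0: "fst (apply_bcontfun (Y' (0, d\<alpha>, 0)) t) = 0" for d\<alpha> t
  proof -
    define Z where "Z = Bcontfun (\<lambda>t. fst (apply_bcontfun (Y' (0, d\<alpha>, 0)) t))"
    define K where "K = Bcontfun (\<lambda>t. fst (apply_bcontfun (H' (0, d\<alpha>, 0)) t))"
    have fstb: "(\<lambda>t. fst (apply_bcontfun y t)) \<in> bcontfun" for y :: "real \<Rightarrow>\<^sub>C (real \<times> real)"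
    proof (rule bcontfun_normI[where b = "norm y"])
      show "norm (fst (apply_bcontfun y t)) \<le> norm y" for t
        using norm_fst_le[of "fst (apply_bcontfun y t)" "snd (apply_bcontfun y t)"] norm_bounded[of y t] by simp
    qed (intro continuous_intros, simp)
    have Zt: "apply_bcontfun Z t = fst (apply_bcontfun (Y' (0, d\<alpha>, 0)) t)"
      "apply_bcontfun K t = fst (apply_bcontfun (H' (0, d\<alpha>, 0)) t)" for t
      by (simp_all add: Z_def K_def Bcontfun_inverse[OF fstb])
    have "Z = solve_op m K"
    proof (rule bcontfun_eqI)
      fix t
      have "apply_bcontfun (solve_op m K) t = potential m (\<lambda>\<sigma>. fst (apply_bcontfun (H' (0, d\<alpha>, 0)) \<sigma>)) (qclamp t)"
        by (simp add: solve_op_apply Zt(2)[abs_def])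
      also have "\<dots> = fst (potential m (apply_bcontfun (H' (0, d\<alpha>, 0))) (qclamp t))"
        by (rule potential_linear[OF bounded_linear_fst _ qclamp_bounds(3)]) simp
      also have "\<dots> = apply_bcontfun Z t"
        unfolding Zt using arg_cong[OF H(5)[of "(0, d\<alpha>, 0)"], of "\<lambda>f. fst (apply_bcontfun f t)"]
        by (simp add: solve_op_apply c'v)
      finally show "apply_bcontfun Z t = apply_bcontfun (solve_op m K) t" by simp
    qed
    then have "Z = 0" by (rule eigen_profile_unique[of _ _ _ \<mu>]) (use H'fst Zt in auto)
    then show ?thesis using Zt(1)[of t] by simp
  qed
  have D1: "fst (D (0, 1, 0)) = 0"
    unfolding Dfst Z0 by (simp add: cos_moment_def)
  have A: "snd (D (0, 1, 0)) \<noteq> 0"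
  proof -
    let ?r = "\<lambda>\<theta>. snd (apply_bcontfun (Y' (0, 1, 0)) \<theta>)"
    define \<kappa> where "\<kappa> = (q - 2) * \<beta>'"
    have \<kappa>: "\<kappa> \<noteq> 0" using q \<beta>(2) by (simp add: \<kappa>_def)
    have Hs: "snd (apply_bcontfun (H' (0, 1, 0)) t) = - (\<nu> * ?r t) - \<kappa> * apply_bcontfun \<phi> t" if "t \<in> {0..pi/2}" for t
    proof -
      have "apply_bcontfun (Y' (0, 1, 0)) t = (0, ?r t)" using Z0[of 1 t] by (metis prod.collapse)
      then show ?thesis
        using field_derivative_along_reference[OF base_f' \<beta>(1), of t 1 0 "?r t"]
        by (simp add: H(4) qclamp(2)[OF that] \<nu>_def \<kappa>_def algebra_simps)
    qed
    have pr: "profile m 0 (\<lambda>\<theta>. - (\<nu> * ?r \<theta>) - \<kappa> * apply_bcontfun \<phi> \<theta>) ?r"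
      by (rule profile_solve_op[OF H(5) bounded_linear_snd]) (use Hs c'v in auto)
    have s: "snd (fl (H' (0, 1, 0))) = flux m (\<lambda>\<theta>. - (\<nu> * ?r \<theta>) - \<kappa> * apply_bcontfun \<phi> \<theta>) (pi/2)"
      unfolding flf by (rule flux_cong) (rule Hs)
    show ?thesis
      using transversality[OF p\<phi> _ pr \<kappa>] \<phi>end s by (auto simp: D_def ev_def split: if_splits)
  qed
  define A0 where "A0 = snd (D (0, 1, 0))"
  define P0 where "P0 = fst (D (0, 0, 1))"
  define X0 where "X0 = snd (D (0, 0, 1))"
  have AP: "A0 \<noteq> 0" "P0 \<noteq> 0" using A P by (simp_all add: A0_def P0_def)
  \<comment> \<open>The inverse of the matrix with rows \<open>(0, P0)\<close> and \<open>(A0, X0)\<close> acting on \<open>(d\<alpha>, d\<zeta>)\<close>.\<close>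
  define B where "B z = (snd z / A0 - fst z * (X0 / (A0 * P0)), fst z / P0)" for z :: "real \<times> real"
  have B: "bounded_linear B"
    unfolding B_def[abs_def] divide_inverse
    by (intro bounded_linear_Pair bounded_linear_sub bounded_linear_compose[OF bounded_linear_mult_left bounded_linear_snd]
        bounded_linear_compose[OF bounded_linear_mult_left bounded_linear_fst])
  have Dlin: "D (v + w) = D v + D w" "D (r *\<^sub>R v) = r *\<^sub>R D v" for v w r
    using has_derivative_bounded_linear[OF D\<Gamma>] by (simp_all add: linear_simps)
  have De: "D (0, d\<alpha>, d\<zeta>) = (d\<zeta> * P0, d\<alpha> * A0 + d\<zeta> * X0)" for d\<alpha> d\<zeta>
    using Dlin(1)[of "d\<alpha> *\<^sub>R (0, 1, 0)" "d\<zeta> *\<^sub>R (0, 0, 1)"] Dlin(2)[of d\<alpha> "(0, 1, 0)"] Dlin(2)[of d\<zeta> "(0, 0, 1)"] D1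
    by (simp add: prod_eq_iff A0_def P0_def X0_def)
  have B1: "B (D (0, w)) = w" for w
    using AP by (cases w) (simp add: De B_def field_simps)
  have B2: "z = 0" if "B z = 0" for z
    using that AP by (auto simp: B_def prod_eq_iff)
  have p0': "p0 = (0, (0, 0))" by (simp add: p0_def)
  obtain W g where W: "open W" "0 \<in> W" "C1_on W g" "g 0 = (0, 0)"
    "\<And>s. s \<in> W \<Longrightarrow> (s, g s) \<in> V \<and> \<Gamma> (s, g s) = 0"
    using implicit_function_C1[OF V(1) V(2)[unfolded p0'] C1\<Gamma> \<Gamma>0[unfolded p0'] D\<Gamma>[unfolded p0'] B B1 B2] by blast
  obtain \<eta> where \<eta>: "\<eta> > 0" "ball 0 \<eta> \<subseteq> W" using W(1,2) open_contains_ball by blast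
  define \<alpha> where "\<alpha> s = fst (g s)" for s
  define \<zeta> where "\<zeta> s = snd (g s)" for s
  define y where "y s = Y (s, g s)" for s
  define h where "h s = superpose field ((s, g s), Y (s, g s))" for s
  note Wb = subsetD[OF \<eta>(2)]
  have C1g: "C1_on (ball 0 \<eta>) g" by (rule C1_on_subset[OF W(3) \<eta>(2)])
  have C1p: "C1_on (ball 0 \<eta>) (\<lambda>s. (s, g s))"
    by (intro C1_on_Pair C1g C1_on_bounded_linear bounded_linear_ident)
  have img: "(\<lambda>s. (s, g s)) ` ball 0 \<eta> \<subseteq> V" using W(5) Wb by blast
  have sg: "(s, \<alpha> s, \<zeta> s) = (s, g s)" for s by (simp add: \<alpha>_def \<zeta>_def)
  show thesis
  proof (rule that[of \<eta> \<alpha> \<zeta> y h])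
    show "C1_on (ball 0 \<eta>) \<alpha>" "C1_on (ball 0 \<eta>) \<zeta>"
      unfolding \<alpha>_def[abs_def] \<zeta>_def[abs_def]
      by (intro C1_on_linear_image[OF bounded_linear_fst C1g] C1_on_linear_image[OF bounded_linear_snd C1g])+
    show "C1_on (ball 0 \<eta>) y" unfolding y_def[abs_def] by (rule C1_on_compose[OF C1p V(3) img])
    show "C1_on (ball 0 \<eta>) h" unfolding h_def[abs_def] by (rule C1_on_compose[OF C1p H(1) img])
    show "fst (apply_bcontfun (y 0) t) = 0" for t
      using V(4) W(4) by (simp add: y_def p0_def[symmetric] y0)
    fix s assume s: "s \<in> ball (0::real) \<eta>"
    note Vs = W(5)[OF Wb[OF s]]
    show "((s, \<alpha> s, \<zeta> s), y s) \<in> tube fdom" unfolding sg y_def using V(5) Vs by blast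
    show "h s = superpose field ((s, \<alpha> s, \<zeta> s), y s)" unfolding sg y_def h_def ..
    show "y s = const_bcontfun (\<zeta> s, 1) + solve_op m (h s)"
      using V(5)[of "(s, g s)"] Vs unfolding y_def h_def \<zeta>_def c_def by simp
    show "fst (flux m (apply_bcontfun (h s)) (pi/2)) = 0"
      "if even j then snd (flux m (apply_bcontfun (h s)) (pi/2)) = 0
        else snd (apply_bcontfun (y s) (pi/2)) = 0"
      using Vs by (auto simp: \<Gamma>_def fl_def ev_def h_def y_def zero_prod_def split: if_splits)
  qed (use \<eta>(1) W(4) in \<open>simp_all add: \<alpha>_def \<zeta>_def\<close>)
  qed
qed

end

section \<open>Zonal functions on the sphere\<close>

text \<open>
  Where the second factor vanishes, continuity of the first one suffices for the product rule.
  This gives the second derivatives of a zonal function at the poles, where the derivative of its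
  profile blows up but the gradient of the axis coordinate is zero.
\<close>

lemma has_derivative_scaleR_vanishing:
  fixes g :: "'a::real_normed_vector \<Rightarrow> 'b::real_normed_vector"
  assumes f: "(f \<longlongrightarrow> f x) (at x within S)" and g: "(g has_derivative g') (at x within S)" "g x = 0"
  shows "((\<lambda>y. f y *\<^sub>R g y) has_derivative (\<lambda>v. f x *\<^sub>R g' v)) (at x within S)"
proof -
  interpret g': bounded_linear g' using g(1) by (rule has_derivative_bounded_linear)
  obtain K where K: "\<And>v. norm (g' v) \<le> norm v * K" "K > 0" using g'.pos_bounded by blast
  have 1: "((\<lambda>y. (1 / norm (y - x)) *\<^sub>R (g y - (g x + g' (y - x)))) \<longlongrightarrow> 0) (at x within S)"
    using g(1) by (simp add: has_derivative_within)
  have 2: "((\<lambda>y. (f y - f x) *\<^sub>R ((1 / norm (y - x)) *\<^sub>R g' (y - x))) \<longlongrightarrow> 0) (at x within S)"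
  proof (rule Lim_null_comparison)
    have "((\<lambda>y. \<bar>f y - f x\<bar> * K) \<longlongrightarrow> \<bar>f x - f x\<bar> * K) (at x within S)"
      by (intro tendsto_intros f)
    then show "((\<lambda>y. \<bar>f y - f x\<bar> * K) \<longlongrightarrow> 0) (at x within S)" by simp
    have "norm ((f y - f x) *\<^sub>R ((1 / norm (y - x)) *\<^sub>R g' (y - x))) \<le> \<bar>f y - f x\<bar> * K" for y
    proof -
      have "(1 / norm (y - x)) * norm (g' (y - x)) \<le> K"
        using K(1)[of "y - x"] K(2) by (cases "y = x") (simp_all add: divide_simps mult.commute)
      from mult_left_mono[OF this, of "\<bar>f y - f x\<bar>"] show ?thesis by (simp add: abs_mult)
    qed
    then show "\<forall>\<^sub>F y in at x within S. norm ((f y - f x) *\<^sub>R ((1 / norm (y - x)) *\<^sub>R g' (y - x))) \<le> \<bar>f y - f x\<bar> * K"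
      by simp
  qed
  have "((\<lambda>y. f y *\<^sub>R ((1 / norm (y - x)) *\<^sub>R (g y - (g x + g' (y - x))))
      + (f y - f x) *\<^sub>R ((1 / norm (y - x)) *\<^sub>R g' (y - x))) \<longlongrightarrow> f x *\<^sub>R 0 + 0) (at x within S)"
    by (intro tendsto_intros f 1 2)
  moreover have "f y *\<^sub>R ((1 / norm (y - x)) *\<^sub>R (g y - (g x + g' (y - x))))
      + (f y - f x) *\<^sub>R ((1 / norm (y - x)) *\<^sub>R g' (y - x))
      = (1 / norm (y - x)) *\<^sub>R (f y *\<^sub>R g y - (f x *\<^sub>R g x + f x *\<^sub>R g' (y - x)))" for y
    using g(2) by (simp add: algebra_simps diff_divide_distrib)
  ultimately show ?thesis
    unfolding has_derivative_within
    by (auto intro: bounded_linear_compose[OF bounded_linear_scaleR_right g'.bounded_linear_axioms])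
qed

text \<open>The tangential gradient of the height function \<open>x \<bullet> e\<close>.\<close>

definition axis_grad :: "'a::euclidean_space \<Rightarrow> 'a \<Rightarrow> 'a" where "axis_grad e x = e - (x \<bullet> e) *\<^sub>R x"

lemma axis_grad:
  assumes "x \<in> usphere" "e \<in> usphere"
  shows "axis_grad e x \<bullet> axis_grad e x = 1 - (x \<bullet> e)\<^sup>2" "x \<bullet> axis_grad e x = 0"
    "axis_grad e x \<bullet> v = e \<bullet> tangent_proj x v"
    "x \<bullet> e \<in> {-1..1}" "axis_grad e x \<bullet> x = 0"
    "\<not> (- 1 < x \<bullet> e \<and> x \<bullet> e < 1) \<Longrightarrow> axis_grad e x = 0"
proof -
  have n: "x \<bullet> x = 1" "e \<bullet> e = 1" using assms by (simp_all add: norm_eq_1)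
  show 1: "axis_grad e x \<bullet> axis_grad e x = 1 - (x \<bullet> e)\<^sup>2"
    using n by (simp add: axis_grad_def inner_diff_left inner_diff_right inner_commute[of e x] power2_eq_square)
  show "x \<bullet> axis_grad e x = 0" "axis_grad e x \<bullet> x = 0"
    using n by (simp_all add: axis_grad_def inner_diff_right inner_diff_left inner_commute)
  show "axis_grad e x \<bullet> v = e \<bullet> tangent_proj x v"
    by (simp add: axis_grad_def tangent_proj_def inner_diff_left inner_diff_right inner_commute[of e x])
  have "(x \<bullet> e)\<^sup>2 \<le> 1" using 1 inner_ge_zero[of "axis_grad e x"] by simp
  then show i: "x \<bullet> e \<in> {-1..1}" by (auto simp: abs_square_le_1 abs_le_iff)
  assume "\<not> (- 1 < x \<bullet> e \<and> x \<bullet> e < 1)"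
  then have "x \<bullet> e = 1 \<or> x \<bullet> e = -1" using i by auto
  then show "axis_grad e x = 0" using 1 by auto
qed

text \<open>
  The zonal function \<open>V (x \<bullet> e)\<close> is \<open>C\<^sup>2\<close> on the whole sphere even if \<open>V\<close> has a second derivative
  only inside the interval, provided \<open>V'\<close> is continuous up to the ends and \<open>M = (1 - t\<^sup>2) * V''\<close>
  tends to zero there. Such profiles arise from the radial equation with a merely continuous
  source; assuming \<open>V\<close> to be \<open>C\<^sup>2\<close> up to the ends would exclude them.
\<close>

locale zonal_profile =
  fixes e :: "'a::euclidean_space" and V V1 M :: "real \<Rightarrow> real"
  assumes e: "e \<in> usphere"
    and V: "continuous_on {-1..1} V" "\<And>t. -1 < t \<Longrightarrow> t < 1 \<Longrightarrow> (V has_real_derivative V1 t) (at t)"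
    and V1: "continuous_on {-1..1} V1"
      "\<And>t. -1 < t \<Longrightarrow> t < 1 \<Longrightarrow> (V1 has_real_derivative M t / (1 - t\<^sup>2)) (at t)"
    and M: "continuous_on {-1..1} M" "M 1 = 0" "M (-1) = 0"
begin

definition u :: "'a \<Rightarrow> real" where "u x = V (x \<bullet> e)"

lemma V_lipschitz:
  obtains C where "\<And>s t. s \<in> {-1..1} \<Longrightarrow> t \<in> {-1..1} \<Longrightarrow> \<bar>V s - V t\<bar> \<le> C * \<bar>s - t\<bar>"
proof -
  have "bounded (V1 ` {-1..1})" by (intro compact_imp_bounded compact_continuous_image V1) auto
  then obtain C where C: "\<And>t. t \<in> {-1..1} \<Longrightarrow> \<bar>V1 t\<bar> \<le> C" unfolding bounded_iff real_norm_def by blast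
  have lt: "\<bar>V t - V s\<bar> \<le> C * \<bar>t - s\<bar>" if st: "s < t" "-1 \<le> s" "t \<le> 1" for s t
  proof -
    have d: "(V has_derivative (*) (V1 x)) (at x)" if "s < x" "x < t" for x
      using V(2)[of x] that st by (simp add: has_field_derivative_def)
    obtain x where "s < x" "x < t" "V t - V s = V1 x * (t - s)"
      by (rule mvt[OF st(1) continuous_on_subset[OF V(1)] d]) (use st in auto)
    then show ?thesis using C[of x] st by (auto simp: abs_mult intro!: mult_right_mono)
  qed
  have "\<bar>V s - V t\<bar> \<le> C * \<bar>s - t\<bar>" if "s \<in> {-1..1}" "t \<in> {-1..1}" for s t
    using lt[of s t] lt[of t s] that by (cases s t rule: linorder_cases) (auto simp: abs_minus_commute)
  then show ?thesis using that by blast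
qed

lemma u_has_derivative:
  assumes x: "x \<in> usphere"
  shows "(u has_derivative (\<lambda>v. V1 (x \<bullet> e) * (axis_grad e x \<bullet> v))) (at x within usphere)"
proof (cases "- 1 < x \<bullet> e \<and> x \<bullet> e < 1")
  case True
  have d: "((\<lambda>y. y \<bullet> e) has_derivative (\<lambda>v. v \<bullet> e)) (at x within usphere)"
    by (auto intro!: derivative_eq_intros)
  have d0: "(u has_derivative (\<lambda>v. V1 (x \<bullet> e) * (v \<bullet> e))) (at x within usphere)"
    unfolding u_def[abs_def]
    by (rule has_derivative_compose[OF d V(2)[unfolded has_field_derivative_def]]) (use True in auto)
  from tderiv_eq(2)[OF x d0] show ?thesis
    unfolding tderiv_eq(1)[OF x d0] axis_grad(3)[OF x e] inner_commute[of e] .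
next
  case False
  note w0 = axis_grad(6)[OF x e False]
  have pole: "x \<bullet> e = 1 \<or> x \<bullet> e = -1" using axis_grad(4)[OF x e] False by auto
  have ex: "e = (x \<bullet> e) *\<^sub>R x" using w0 by (simp add: axis_grad_def)
  obtain C where C: "\<And>s t. s \<in> {-1..1} \<Longrightarrow> t \<in> {-1..1} \<Longrightarrow> \<bar>V s - V t\<bar> \<le> C * \<bar>s - t\<bar>"
    using V_lipschitz by blast
  \<comment> \<open>At a pole the height differs by half the squared distance, so a Lipschitz profile is
    differentiable with zero derivative.\<close>
  have b: "norm (u y - u x) \<le> C / 2 * norm (y - x) * norm (y - x)" if y: "y \<in> usphere" for y
  proof -
    have n: "x \<bullet> x = 1" "y \<bullet> y = 1" using x y by (simp_all add: norm_eq_1)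
    have "y \<bullet> e = (x \<bullet> e) * (y \<bullet> x)" by (subst ex) simp
    then have "\<bar>y \<bullet> e - x \<bullet> e\<bar> = \<bar>(x \<bullet> e) * (y \<bullet> x - 1)\<bar>" by (simp add: algebra_simps)
    also have "\<dots> = \<bar>y \<bullet> x - 1\<bar>" using pole by (auto simp: abs_mult)
    also have "y \<bullet> x - 1 = - ((y - x) \<bullet> (y - x)) / 2"
      using n by (simp add: inner_diff_left inner_diff_right inner_commute[of x y])
    finally have q: "\<bar>y \<bullet> e - x \<bullet> e\<bar> = (norm (y - x) * norm (y - x)) / 2"
      by (simp add: dot_square_norm power2_eq_square)
    show ?thesis
      using C[OF axis_grad(4)[OF y e] axis_grad(4)[OF x e]] unfolding q by (simp add: u_def mult.assoc)
  qed
  have "(u has_derivative (\<lambda>v. 0)) (at x within usphere)"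
    unfolding has_derivative_within
  proof (rule conjI[OF bounded_linear_zero], rule Lim_null_comparison)
    have "((\<lambda>y. C / 2 * norm (y - x)) \<longlongrightarrow> C / 2 * norm (x - x)) (at x within usphere)"
      by (intro tendsto_intros)
    then show "((\<lambda>y. C / 2 * norm (y - x)) \<longlongrightarrow> 0) (at x within usphere)" by simp
    show "\<forall>\<^sub>F y in at x within usphere. norm ((1 / norm (y - x)) *\<^sub>R (u y - (u x + 0))) \<le> C / 2 * norm (y - x)"
      unfolding eventually_at_filter
    proof (rule always_eventually, intro allI impI)
      fix y assume y: "y \<noteq> x" "y \<in> usphere"
      then show "norm ((1 / norm (y - x)) *\<^sub>R (u y - (u x + 0))) \<le> C / 2 * norm (y - x)"
        using b[OF y(2)] by (simp add: divide_simps)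
    qed
  qed
  then show ?thesis by (simp add: w0)
qed

lemma grad_u:
  assumes x: "x \<in> usphere"
  shows "grad u x = V1 (x \<bullet> e) *\<^sub>R axis_grad e x"
proof -
  have "tderiv u x = (\<lambda>v. V1 (x \<bullet> e) * (axis_grad e x \<bullet> v))"
    by (rule tderiv_unique[OF x u_has_derivative[OF x]]) (simp add: axis_grad(5)[OF x e])
  then have "grad u x = (\<Sum>b\<in>Basis. V1 (x \<bullet> e) *\<^sub>R ((axis_grad e x \<bullet> b) *\<^sub>R b))"
    by (simp add: grad_def)
  also have "\<dots> = V1 (x \<bullet> e) *\<^sub>R axis_grad e x"
    unfolding scaleR_sum_right[symmetric] by (simp add: euclidean_representation)
  finally show ?thesis .
qed

text \<open>
  The ambient derivative of the gradient at \<open>x\<close> on tangent vectors, extended by zero to the normal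
  line. At the poles the first term is zero, both by division by zero and because \<open>axis_grad\<close>
  vanishes.
\<close>

definition hess :: "'a \<Rightarrow> 'a \<Rightarrow> 'a" where
  "hess x v = (M (x \<bullet> e) / (1 - (x \<bullet> e)\<^sup>2) * (axis_grad e x \<bullet> v)) *\<^sub>R axis_grad e x
     - (V1 (x \<bullet> e) * (axis_grad e x \<bullet> v)) *\<^sub>R x - (V1 (x \<bullet> e) * (x \<bullet> e)) *\<^sub>R tangent_proj x v"

lemma axis_grad_has_derivative:
  "((\<lambda>y. axis_grad e y) has_derivative (\<lambda>v. - ((v \<bullet> e) *\<^sub>R x) - (x \<bullet> e) *\<^sub>R v)) (at x within S)"
  unfolding axis_grad_def by (auto intro!: derivative_eq_intros simp: algebra_simps)

lemma grad_has_derivative: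
  assumes x: "x \<in> usphere"
  shows "((\<lambda>y. V1 (y \<bullet> e) *\<^sub>R axis_grad e y) has_derivative hess x) (at x within usphere)"
proof (cases "- 1 < x \<bullet> e \<and> x \<bullet> e < 1")
  case True
  define D where "D v = (M (x \<bullet> e) / (1 - (x \<bullet> e)\<^sup>2) * (v \<bullet> e)) *\<^sub>R axis_grad e x
      + V1 (x \<bullet> e) *\<^sub>R (- ((v \<bullet> e) *\<^sub>R x) - (x \<bullet> e) *\<^sub>R v)" for v
  have d: "((\<lambda>y. y \<bullet> e) has_derivative (\<lambda>v. v \<bullet> e)) (at x within usphere)"
    by (auto intro!: derivative_eq_intros)
  have d1: "((\<lambda>y. V1 (y \<bullet> e)) has_derivative (\<lambda>v. M (x \<bullet> e) / (1 - (x \<bullet> e)\<^sup>2) * (v \<bullet> e))) (at x within usphere)"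
    by (rule has_derivative_compose[OF d V1(2)[unfolded has_field_derivative_def]]) (use True in auto)
  have dD: "((\<lambda>y. V1 (y \<bullet> e) *\<^sub>R axis_grad e y) has_derivative D) (at x within usphere)"
    by (rule has_derivative_eq_rhs[OF has_derivative_scaleR[OF d1 axis_grad_has_derivative]])
       (simp add: D_def fun_eq_iff add.commute)
  have "D (tangent_proj x v) = hess x v" for v
    by (simp add: D_def hess_def axis_grad(3)[OF x e] inner_commute[of _ e] algebra_simps)
  then show ?thesis using tderiv_eq[OF x dD] by simp
next
  case False
  note w0 = axis_grad(6)[OF x e False]
  have c: "((\<lambda>y. V1 (y \<bullet> e)) \<longlongrightarrow> V1 (x \<bullet> e)) (at x within usphere)"
  proof -
    have "continuous_on usphere (\<lambda>y. V1 (y \<bullet> e))"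
      by (intro continuous_on_compose2[OF V1(1)] continuous_intros image_subsetI axis_grad(4) e)
    then show ?thesis using x by (simp add: continuous_on_def)
  qed
  note dD = has_derivative_scaleR_vanishing[where f = "\<lambda>y. V1 (y \<bullet> e)", OF c axis_grad_has_derivative w0]
  have px: "x \<bullet> tangent_proj x v = 0" for v
    using x by (simp add: tangent_proj_def inner_diff_right norm_eq_1)
  have ex: "e = (x \<bullet> e) *\<^sub>R x" using w0 by (simp add: axis_grad_def)
  have "tangent_proj x v \<bullet> e = 0" for v
    by (subst ex) (simp add: px inner_commute)
  then show ?thesis using tderiv_eq[OF x dD] by (simp add: hess_def[abs_def] w0)
qed

lemma bounded_linear_hess: "x \<in> usphere \<Longrightarrow> bounded_linear (hess x)"
  using grad_has_derivative has_derivative_bounded_linear by blast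

lemma continuous_on_axis: "continuous_on usphere (\<lambda>x. x \<bullet> e)" "(\<lambda>x. x \<bullet> e) ` usphere \<subseteq> {-1..1}"
  using axis_grad(4)[OF _ e] by (auto intro!: continuous_intros)

text \<open>
  The squared length of \<open>axis_grad\<close> is \<open>1 - (x \<bullet> e)\<^sup>2\<close>, which cancels the singular denominator.
  Together with \<open>M (-1) = M 1 = 0\<close> this makes the Hessian continuous at the poles.
\<close>

lemma radial_part_bound:
  assumes x: "x \<in> usphere"
  shows "norm ((M (x \<bullet> e) / (1 - (x \<bullet> e)\<^sup>2) * (axis_grad e x \<bullet> v)) *\<^sub>R axis_grad e x) \<le> \<bar>M (x \<bullet> e)\<bar> * norm v"
proof (cases "1 - (x \<bullet> e)\<^sup>2 = 0")
  case False
  have n: "norm (axis_grad e x) * norm (axis_grad e x) = 1 - (x \<bullet> e)\<^sup>2"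
    using axis_grad(1)[OF x e] by (simp add: dot_square_norm power2_eq_square)
  then have p: "1 - (x \<bullet> e)\<^sup>2 > 0" using False by (metis less_eq_real_def zero_le_square)
  have "\<bar>axis_grad e x \<bullet> v\<bar> * norm (axis_grad e x) \<le> (norm (axis_grad e x) * norm v) * norm (axis_grad e x)"
    by (intro mult_right_mono Cauchy_Schwarz_ineq2) auto
  also have "\<dots> = (1 - (x \<bullet> e)\<^sup>2) * norm v" using n by (metis mult.assoc mult.commute)
  finally have "\<bar>M (x \<bullet> e)\<bar> / (1 - (x \<bullet> e)\<^sup>2) * (\<bar>axis_grad e x \<bullet> v\<bar> * norm (axis_grad e x))
      \<le> \<bar>M (x \<bullet> e)\<bar> / (1 - (x \<bullet> e)\<^sup>2) * ((1 - (x \<bullet> e)\<^sup>2) * norm v)"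
    using p by (intro mult_left_mono) auto
  also have "\<dots> = \<bar>M (x \<bullet> e)\<bar> * norm v" using p by simp
  finally show ?thesis using p by (simp add: abs_mult mult.assoc)
qed simp

lemma continuous_hess: "continuous_on usphere (\<lambda>x. hess x v)"
proof -
  have cM: "continuous_on usphere (\<lambda>x. M (x \<bullet> e))" and cV: "continuous_on usphere (\<lambda>x. V1 (x \<bullet> e))"
    by (intro continuous_on_compose2[OF M(1)] continuous_on_compose2[OF V1(1)] continuous_on_axis)+
  let ?k = "\<lambda>x. (M (x \<bullet> e) / (1 - (x \<bullet> e)\<^sup>2) * (axis_grad e x \<bullet> v)) *\<^sub>R axis_grad e x"
  have "continuous_on usphere ?k"
    unfolding continuous_on_def
  proof
    fix x :: 'a assume x: "x \<in> usphere"
    have cw: "((\<lambda>x. axis_grad e x) \<longlongrightarrow> axis_grad e x) (at x within usphere)"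
      unfolding axis_grad_def by (intro tendsto_intros)
    have cMx: "((\<lambda>x. M (x \<bullet> e)) \<longlongrightarrow> M (x \<bullet> e)) (at x within usphere)"
      using cM x by (simp add: continuous_on_def)
    show "(?k \<longlongrightarrow> ?k x) (at x within usphere)"
    proof (cases "- 1 < x \<bullet> e \<and> x \<bullet> e < 1")
      case True
      then have "(x \<bullet> e)\<^sup>2 < 1" by (simp add: abs_square_less_1 abs_less_iff)
      then show ?thesis by (intro tendsto_intros cw cMx) auto
    next
      case False
      note w0 = axis_grad(6)[OF x e False]
      have "x \<bullet> e = 1 \<or> x \<bullet> e = -1" using axis_grad(4)[OF x e] False by auto
      then have "M (x \<bullet> e) = 0" using M by auto
      then have "((\<lambda>x. \<bar>M (x \<bullet> e)\<bar> * norm v) \<longlongrightarrow> 0) (at x within usphere)"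
        using tendsto_mult_right[OF tendsto_rabs[OF cMx], of "norm v"] by simp
      then have "(?k \<longlongrightarrow> 0) (at x within usphere)"
        by (rule Lim_null_comparison[rotated])
           (simp only: eventually_at_filter, rule always_eventually, use radial_part_bound in blast)
      then show ?thesis by (simp add: w0)
    qed
  qed
  moreover have "continuous_on usphere (axis_grad e)" "continuous_on usphere (\<lambda>x. tangent_proj x v)"
    unfolding axis_grad_def tangent_proj_def by (intro continuous_intros)+
  ultimately show ?thesis
    unfolding hess_def
    by (intro continuous_on_diff[OF continuous_on_diff[where f = ?k]]) (assumption, (intro continuous_intros cV; assumption)+)
qed

lemma C2_u: "C2_on_sphere u"
  unfolding C2_on_sphere_def
proof
  show "C1_on usphere u"
    unfolding C1_on_def
  proof (intro exI[of _ "\<lambda>x. blinfun_inner_right (V1 (x \<bullet> e) *\<^sub>R axis_grad e x)"] conjI ballI)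
    show "continuous_on usphere (\<lambda>x. blinfun_inner_right (V1 (x \<bullet> e) *\<^sub>R axis_grad e x))"
      unfolding axis_grad_def
      by (intro bounded_linear.continuous_on[OF bounded_linear_blinfun_inner_right] continuous_intros
          continuous_on_compose2[OF V1(1)] continuous_on_axis)
  qed (rule has_derivative_eq_rhs[OF u_has_derivative], auto simp: fun_eq_iff)
  have "C1_on usphere (\<lambda>y. V1 (y \<bullet> e) *\<^sub>R axis_grad e y)"
    unfolding C1_on_def
  proof (intro exI[of _ "\<lambda>x. Blinfun (hess x)"] conjI ballI)
    show "continuous_on usphere (\<lambda>x. Blinfun (hess x))"
    proof (rule continuous_on_blinfun_componentwise)
      fix i :: 'a
      show "continuous_on usphere (\<lambda>x. blinfun_apply (Blinfun (hess x)) i)"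
        by (rule continuous_on_eq[OF continuous_hess[of i]])
           (simp add: bounded_linear_Blinfun_apply[OF bounded_linear_hess])
    qed
  qed (simp add: bounded_linear_Blinfun_apply[OF bounded_linear_hess] grad_has_derivative)
  then show "C1_on usphere (grad u)"
    by (rule C1_on_cong) (simp add: grad_u)
qed

lemma cov_deriv_u:
  assumes x: "x \<in> usphere"
  shows "cov_deriv (grad u) x v = (M (x \<bullet> e) / (1 - (x \<bullet> e)\<^sup>2) * (axis_grad e x \<bullet> v)) *\<^sub>R axis_grad e x
     - (V1 (x \<bullet> e) * (x \<bullet> e)) *\<^sub>R tangent_proj x v"
proof -
  have "tderiv (grad u) x = tderiv (\<lambda>y. V1 (y \<bullet> e) *\<^sub>R axis_grad e y) x"
    by (rule tderiv_cong[OF x grad_u])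
  also have "\<dots> = hess x"
    by (rule tderiv_unique[OF x grad_has_derivative[OF x]])
       (simp add: hess_def axis_grad(5)[OF x e] tangent_proj_self[OF x])
  finally have "cov_deriv (grad u) x v = tangent_proj x (hess x v)" by (simp add: cov_deriv_def)
  moreover have "x \<bullet> x = 1" using x by (simp add: norm_eq_1)
  ultimately show ?thesis
    by (simp add: hess_def tangent_proj_def inner_diff_right axis_grad(2)[OF x e] algebra_simps)
qed

lemma tangent_proj_trace:
  fixes x :: "'a"
  assumes "x \<in> usphere"
  shows "(\<Sum>b\<in>Basis. tangent_proj x b \<bullet> b) = real DIM('a) - 1"
proof -
  have "(\<Sum>b\<in>Basis. tangent_proj x b \<bullet> b) = (\<Sum>b\<in>Basis. 1 - (x \<bullet> b) * (x \<bullet> b))"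
    by (rule sum.cong) (simp_all add: tangent_proj_def inner_diff_left)
  also have "\<dots> = real DIM('a) - x \<bullet> x"
    by (simp add: sum_subtractf euclidean_inner[of x x])
  finally show ?thesis using assms by (simp add: norm_eq_1)
qed

lemma laplace_u:
  assumes x: "x \<in> usphere"
  shows "laplace_beltrami u x = - M (x \<bullet> e) + (real DIM('a) - 1) * (x \<bullet> e) * V1 (x \<bullet> e)"
proof -
  have "(\<Sum>b\<in>Basis. M (x \<bullet> e) / (1 - (x \<bullet> e)\<^sup>2) * ((axis_grad e x \<bullet> b) * (axis_grad e x \<bullet> b)))
      = M (x \<bullet> e) / (1 - (x \<bullet> e)\<^sup>2) * (1 - (x \<bullet> e)\<^sup>2)"
    unfolding sum_distrib_left[symmetric] euclidean_inner[of "axis_grad e x" "axis_grad e x", symmetric]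
    by (simp add: axis_grad(1)[OF x e])
  also have "\<dots> = M (x \<bullet> e)"
    using M axis_grad(4)[OF x e] by (auto simp: power2_eq_1_iff)
  finally have 1: "(\<Sum>b\<in>Basis. M (x \<bullet> e) / (1 - (x \<bullet> e)\<^sup>2) * ((axis_grad e x \<bullet> b) * (axis_grad e x \<bullet> b))) = M (x \<bullet> e)" .
  have "divergence (grad u) x = (\<Sum>b\<in>Basis. M (x \<bullet> e) / (1 - (x \<bullet> e)\<^sup>2) * ((axis_grad e x \<bullet> b) * (axis_grad e x \<bullet> b))
      - (V1 (x \<bullet> e) * (x \<bullet> e)) * (tangent_proj x b \<bullet> b))"
    unfolding divergence_def by (rule sum.cong) (simp_all add: cov_deriv_u[OF x] inner_diff_left)
  also have "\<dots> = M (x \<bullet> e) - (V1 (x \<bullet> e) * (x \<bullet> e)) * (real DIM('a) - 1)"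
    unfolding sum_subtractf 1 unfolding sum_distrib_left[symmetric] tangent_proj_trace[OF x] ..
  finally show ?thesis by (simp add: laplace_beltrami_def mult.commute mult.left_commute)
qed

lemma norm_tangent_proj: "x \<in> usphere \<Longrightarrow> norm (tangent_proj x v) \<le> norm v"
proof -
  assume x: "x \<in> usphere"
  have "(norm (tangent_proj x v))\<^sup>2 = (norm v)\<^sup>2 - (x \<bullet> v)\<^sup>2"
    using x unfolding power2_norm_eq_inner tangent_proj_def
    by (simp add: inner_diff_left inner_diff_right norm_eq_1 inner_commute[of v x] power2_eq_square)
  then have "(norm (tangent_proj x v))\<^sup>2 \<le> (norm v)\<^sup>2" by simp
  then show ?thesis by (rule power2_le_imp_le) simp
qed

lemma C2_pnorm_u:
  assumes x: "x \<in> usphere"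
  shows "C2_pnorm u x \<le> \<bar>V (x \<bullet> e)\<bar> + \<bar>V1 (x \<bullet> e)\<bar> + real DIM('a) * (\<bar>M (x \<bullet> e)\<bar> + \<bar>V1 (x \<bullet> e)\<bar>)"
proof -
  have t: "\<bar>x \<bullet> e\<bar> \<le> 1" using axis_grad(4)[OF x e] by auto
  have "(norm (axis_grad e x))\<^sup>2 \<le> 1\<^sup>2" using axis_grad(1)[OF x e] by (simp add: power2_norm_eq_inner)
  then have w: "norm (axis_grad e x) \<le> 1" by (rule power2_le_imp_le) simp
  have g: "norm (grad u x) \<le> \<bar>V1 (x \<bullet> e)\<bar>"
    unfolding grad_u[OF x] using mult_left_mono[OF w, of "\<bar>V1 (x \<bullet> e)\<bar>"] by simp
  have "norm (cov_deriv (grad u) x b) \<le> \<bar>M (x \<bullet> e)\<bar> + \<bar>V1 (x \<bullet> e)\<bar>" if b: "b \<in> Basis" for b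
  proof -
    have nb: "norm b = 1" using b by simp
    have "norm ((V1 (x \<bullet> e) * (x \<bullet> e)) *\<^sub>R tangent_proj x b) \<le> (\<bar>V1 (x \<bullet> e)\<bar> * 1) * 1"
      using norm_tangent_proj[OF x, of b] t unfolding norm_scaleR abs_mult nb by (intro mult_mono) auto
    then show ?thesis
      unfolding cov_deriv_u[OF x] using radial_part_bound[OF x, of b] nb
      by (intro order_trans[OF norm_triangle_ineq4] add_mono) auto
  qed
  then have "hess_norm u x \<le> (\<Sum>b\<in>(Basis::'a set). \<bar>M (x \<bullet> e)\<bar> + \<bar>V1 (x \<bullet> e)\<bar>)"
    unfolding hess_norm_def by (intro order_trans[OF L2_set_le_sum] sum_mono) auto
  then show ?thesis using g by (simp add: C2_pnorm_def u_def)
qed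

end

section \<open>Maximum principles on the sphere\<close>

lemma laplace_add:
  assumes "C2_on_sphere f" "C2_on_sphere g" "x \<in> usphere"
  shows "laplace_beltrami (\<lambda>y. f y + g y) x = laplace_beltrami f x + laplace_beltrami g x"
  using assms by (simp add: laplace_beltrami_def divergence_def cov_deriv_grad_add inner_add_left sum.distrib)

lemma laplace_scale:
  assumes "C2_on_sphere f" "x \<in> usphere"
  shows "laplace_beltrami (\<lambda>y. r * f y) x = r * laplace_beltrami f x"
  using assms by (simp add: laplace_beltrami_def divergence_def cov_deriv_grad_scale sum_distrib_left)

lemma laplace_const:
  assumes "x \<in> usphere"
  shows "laplace_beltrami (\<lambda>y. k) x = 0"
proof -
  have "tderiv (grad (\<lambda>y. k)) x = tderiv (\<lambda>y. 0) x"
    by (rule tderiv_cong[OF assms]) (simp add: grad_def tderiv_const)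
  then show ?thesis
    using assms by (simp add: laplace_beltrami_def divergence_def cov_deriv_def tangent_proj_def tderiv_const)
qed

lemma second_derivative_at_min:
  fixes g :: "real \<Rightarrow> real"
  assumes g: "\<And>t. (g has_real_derivative g1 t) (at t)" and H: "(g1 has_real_derivative H) (at 0)"
    and d: "d > 0" and mn: "\<And>t. \<bar>t\<bar> < d \<Longrightarrow> g 0 \<le> g t"
  shows "H \<ge> 0"
proof (rule ccontr)
  assume "\<not> H \<ge> 0"
  then obtain d1 where d1: "d1 > 0" "\<And>h. h > 0 \<Longrightarrow> h < d1 \<Longrightarrow> g1 (0 + h) < g1 0"
    using DERIV_neg_dec_right[OF H] by auto
  have g0: "g1 0 = 0" by (rule DERIV_local_min[OF g d]) (use mn in auto)
  define h where "h = min d d1 / 2"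
  have h: "0 < h" "h < d" "h < d1" using d d1(1) by (auto simp: h_def min_def)
  obtain z where z: "0 < z" "z < h" "g h - g 0 = (h - 0) * g1 z"
    using MVT2[OF h(1), of g g1] g by blast
  have "g1 z < 0" using d1(2)[of z] z h g0 by simp
  then have "g h < g 0" using z(3) mult_pos_neg[OF h(1), of "g1 z"] by simp
  then show False using mn[of h] h by simp
qed

text \<open>
  Restrict to the great circle through \<open>x\<close> with direction \<open>w\<close>. The curvature of the circle
  contributes only a multiple of \<open>grad \<phi> x \<bullet> x = 0\<close>, so the second derivative along it is the
  Hessian.
\<close>

lemma hessian_nonneg_at_min:
  assumes \<phi>: "C2_on_sphere \<phi>" and x: "x \<in> usphere" and U: "open U" "x \<in> U"
    and mn: "\<And>y. y \<in> usphere \<Longrightarrow> y \<in> U \<Longrightarrow> \<phi> x \<le> \<phi> y"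
    and w: "x \<bullet> w = 0" "w \<bullet> w = 1"
  shows "cov_deriv (grad \<phi>) x w \<bullet> w \<ge> 0"
proof -
  define c where "c t = cos t *\<^sub>R x + sin t *\<^sub>R w" for t :: real
  define c1 where "c1 t = - sin t *\<^sub>R x + cos t *\<^sub>R w" for t :: real
  have nx: "x \<bullet> x = 1" using x by (simp add: norm_eq_1)
  have cS: "c t \<in> usphere" for t
  proof -
    have "c t \<bullet> c t = (cos t)\<^sup>2 + (sin t)\<^sup>2"
      using nx w by (simp add: c_def inner_add_left inner_add_right inner_commute power2_eq_square)
    then show ?thesis by (simp add: norm_eq_1)
  qed
  have c0: "c 0 = x" "c1 0 = w" by (simp_all add: c_def c1_def)
  have dc: "(c has_derivative (\<lambda>s. s *\<^sub>R c1 t)) (at t)" for t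
    unfolding c_def c1_def by (auto intro!: derivative_eq_intros simp: algebra_simps)
  have dif: "\<phi> differentiable (at y within usphere)" "grad \<phi> differentiable (at y within usphere)"
    if "y \<in> usphere" for y
    using \<phi> that by (auto simp: C2_on_sphere_def intro: C1_on_differentiable)
  have comp: "((\<lambda>t. G (c t)) has_derivative (\<lambda>s. D (s *\<^sub>R c1 t))) (at t)"
    if "(G has_derivative D) (at (c t) within usphere)" for G :: "'a \<Rightarrow> 'b::real_normed_vector" and D t
  proof -
    have "(G has_derivative D) (at (c t) within c ` UNIV)"
      by (rule has_derivative_subset[OF that]) (use cS in blast)
    from diff_chain_within[OF dc this] show ?thesis by (simp add: o_def)
  qed
  define g1 where "g1 t = grad \<phi> (c t) \<bullet> c1 t" for t
  have d1: "((\<lambda>t. \<phi> (c t)) has_real_derivative g1 t) (at t)" for t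
  proof -
    interpret T: bounded_linear "tderiv \<phi> (c t)" by (rule tderiv_props(3)[OF dif(1)[OF cS] cS])
    show ?thesis
      using comp[OF tderiv_props(1)[OF dif(1)[OF cS] cS], of t]
      by (simp add: has_field_derivative_def g1_def grad_inner(1)[OF dif(1)[OF cS] cS] T.scale mult_commute_abs)
  qed
  interpret T: bounded_linear "tderiv (grad \<phi>) x" by (rule tderiv_props(3)[OF dif(2)[OF x] x])
  have "((\<lambda>t. grad \<phi> (c t)) has_derivative (\<lambda>s. tderiv (grad \<phi>) x (s *\<^sub>R w))) (at 0)"
    using comp[of "grad \<phi>" "tderiv (grad \<phi>) x" 0] tderiv_props(1)[OF dif(2)[OF x] x] by (simp add: c0)
  moreover have "(c1 has_derivative (\<lambda>s. s *\<^sub>R (- x))) (at 0)"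
    unfolding c1_def by (auto intro!: derivative_eq_intros)
  ultimately have "(g1 has_derivative (\<lambda>s. grad \<phi> (c 0) \<bullet> (s *\<^sub>R (- x)) + tderiv (grad \<phi>) x (s *\<^sub>R w) \<bullet> c1 0)) (at 0)"
    unfolding g1_def by (intro has_derivative_inner)
  moreover have "grad \<phi> x \<bullet> x = 0" using grad_inner(2)[OF dif(1)[OF x] x] by (simp add: inner_commute)
  ultimately have d2: "(g1 has_real_derivative tderiv (grad \<phi>) x w \<bullet> w) (at 0)"
    by (simp add: has_field_derivative_def c0 T.scale mult_commute_abs)
  have "isCont c 0" using has_derivative_continuous[OF dc] by simp
  then have "eventually (\<lambda>t. c t \<in> U) (nhds 0)"
    using U c0 by (simp add: isCont_def tendsto_def eventually_at_filter eventually_nhds)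
       (metis UNIV_I c0(1) continuous_on_open_vimage open_UNIV vimage_eq)
  then obtain d where "d > 0" "\<And>t. \<bar>t\<bar> < d \<Longrightarrow> c t \<in> U"
    by (auto simp: eventually_nhds_metric dist_norm)
  then have "tderiv (grad \<phi>) x w \<bullet> w \<ge> 0"
    by (intro second_derivative_at_min[OF d1 d2]) (auto simp: c0 intro: mn cS)
  then show ?thesis using w by (simp add: cov_deriv_def tangent_proj_def inner_diff_left)
qed

lemma laplace_at_min:
  fixes \<phi> :: "'a::euclidean_space \<Rightarrow> real"
  assumes \<phi>: "C2_on_sphere \<phi>" and x: "x \<in> usphere" and U: "open U" "x \<in> U"
    and mn: "\<And>y. y \<in> usphere \<Longrightarrow> y \<in> U \<Longrightarrow> \<phi> x \<le> \<phi> y"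
  shows "laplace_beltrami \<phi> x \<le> 0"
proof -
  have dif: "grad \<phi> differentiable (at x within usphere)"
    using \<phi> x by (auto simp: C2_on_sphere_def intro: C1_on_differentiable)
  note tp = tderiv_props[OF dif x]
  interpret T: bounded_linear "tderiv (grad \<phi>) x" by (rule tp(3))
  have nx: "x \<bullet> x = 1" using x by (simp add: norm_eq_1)
  have "cov_deriv (grad \<phi>) x b \<bullet> b \<ge> 0" for b
  proof -
    define v where "v = tangent_proj x b"
    have xv: "x \<bullet> v = 0" using nx by (simp add: v_def tangent_proj_def inner_diff_right)
    have b: "b = v + (x \<bullet> b) *\<^sub>R x" by (simp add: v_def tangent_proj_def)
    have "tderiv (grad \<phi>) x b = tderiv (grad \<phi>) x v"
      by (subst b) (simp add: T.add T.scale tp(2))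
    then have 1: "cov_deriv (grad \<phi>) x b = cov_deriv (grad \<phi>) x v" by (simp add: cov_deriv_def)
    have "x \<bullet> cov_deriv (grad \<phi>) x v = 0"
      using nx by (simp add: cov_deriv_def tangent_proj_def inner_diff_right)
    then have "cov_deriv (grad \<phi>) x v \<bullet> x = 0" by (simp only: inner_commute)
    then have 2: "cov_deriv (grad \<phi>) x v \<bullet> b = cov_deriv (grad \<phi>) x v \<bullet> v"
      by (subst b) (simp add: inner_add_right)
    have "cov_deriv (grad \<phi>) x v \<bullet> v \<ge> 0"
    proof (cases "v = 0")
      case False
      define w where "w = v /\<^sub>R norm v"
      have w: "x \<bullet> w = 0" "w \<bullet> w = 1" and vw: "v = norm v *\<^sub>R w"
        using xv False by (simp_all add: w_def dot_square_norm power2_eq_square)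
      have "cov_deriv (grad \<phi>) x v = norm v *\<^sub>R cov_deriv (grad \<phi>) x w"
        by (subst vw) (simp add: cov_deriv_def tangent_proj_def T.scale algebra_simps)
      then have "cov_deriv (grad \<phi>) x v \<bullet> v = norm v * norm v * (cov_deriv (grad \<phi>) x w \<bullet> w)"
        by (subst (2) vw) simp
      then show ?thesis using hessian_nonneg_at_min[OF \<phi> x U mn w] by simp
    qed simp
    then show ?thesis using 1 2 by simp
  qed
  then show ?thesis by (simp add: laplace_beltrami_def divergence_def sum_nonneg)
qed

lemma zonal_exp: "e \<in> usphere \<Longrightarrow> zonal_profile e (\<lambda>t. exp (s * t)) (\<lambda>t. s * exp (s * t)) (\<lambda>t. (1 - t\<^sup>2) * (s\<^sup>2 * exp (s * t)))"
proof
  fix t :: real assume t: "-1 < t" "t < 1"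
  then have "t\<^sup>2 < 1" by (simp add: abs_square_less_1 abs_less_iff)
  then show "((\<lambda>t. s * exp (s * t)) has_real_derivative (1 - t\<^sup>2) * (s\<^sup>2 * exp (s * t)) / (1 - t\<^sup>2)) (at t)"
    by (auto intro!: derivative_eq_intros simp: power2_eq_square)
qed (auto intro!: continuous_intros derivative_eq_intros)

text \<open>
  For large \<open>s\<close> and away from the poles the quadratic term dominates; this gives Hopf's barrier.
\<close>

lemma exp_barrier:
  fixes e :: "'a::euclidean_space"
  assumes e: "e \<in> usphere"
  shows "C2_on_sphere (\<lambda>x. exp (s * (x \<bullet> e)))"
    "x \<in> usphere \<Longrightarrow> laplace_beltrami (\<lambda>x. exp (s * (x \<bullet> e))) x
        = - (exp (s * (x \<bullet> e)) * ((1 - (x \<bullet> e)\<^sup>2) * s\<^sup>2 - (real DIM('a) - 1) * (x \<bullet> e) * s))"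
proof -
  interpret zonal_profile e "\<lambda>t. exp (s * t)" "\<lambda>t. s * exp (s * t)" "\<lambda>t. (1 - t\<^sup>2) * (s\<^sup>2 * exp (s * t))"
    by (rule zonal_exp[OF e])
  have u: "u = (\<lambda>x. exp (s * (x \<bullet> e)))" by (simp add: u_def fun_eq_iff)
  show "C2_on_sphere (\<lambda>x. exp (s * (x \<bullet> e)))" using C2_u by (simp add: u)
  assume "x \<in> usphere"
  from laplace_u[OF this, unfolded u] show "laplace_beltrami (\<lambda>x. exp (s * (x \<bullet> e))) x
        = - (exp (s * (x \<bullet> e)) * ((1 - (x \<bullet> e)\<^sup>2) * s\<^sup>2 - (real DIM('a) - 1) * (x \<bullet> e) * s))"
    by (simp add: algebra_simps)
qed

lemma C2_continuous: "C2_on_sphere f \<Longrightarrow> continuous_on usphere f"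
  unfolding C2_on_sphere_def by (blast intro: C1_on_continuous)

text \<open>
  Hopf's argument. Suppose \<open>\<psi> p \<noteq> 0\<close> and let \<open>x2\<close> be a zero of \<open>\<psi>\<close> closest to \<open>p\<close>, at height \<open>t0\<close>.
  Above this height \<open>\<psi>\<close> is positive, so on the parallel at a larger height \<open>t1\<close> it exceeds a small
  multiple of the barrier \<open>exp (s * t) - exp (s * t0)\<close>. Below \<open>t0\<close> the barrier is negative. Hence
  the difference has an interior minimum with nonpositive value in the band between \<open>t0\<close> and \<open>t1\<close>,
  where the differential inequality makes its Laplacian positive.
\<close>

theorem strong_maximum_principle:
  fixes \<psi> :: "'a::euclidean_space \<Rightarrow> real"
  assumes dim: "DIM('a) \<ge> 2" and \<psi>: "C2_on_sphere \<psi>" "\<And>x. x \<in> usphere \<Longrightarrow> \<psi> x \<ge> 0"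
    and L: "\<And>x. x \<in> usphere \<Longrightarrow> laplace_beltrami \<psi> x \<ge> - C * \<psi> x" and C: "C \<ge> 0"
    and z: "x0 \<in> usphere" "\<psi> x0 = 0"
  shows "\<forall>x\<in>usphere. \<psi> x = 0"
proof (rule ccontr)
  assume "\<not> (\<forall>x\<in>usphere. \<psi> x = 0)"
  then obtain p0 where p0: "p0 \<in> usphere" "\<psi> p0 \<noteq> 0" by blast
  \<comment> \<open>The barrier degenerates at the two poles, so the zero must not be antipodal to \<open>p\<close>; if it
    is, an orthogonal point replaces one of the two.\<close>
  have "\<exists>p x1. p \<in> usphere \<and> \<psi> p \<noteq> 0 \<and> x1 \<in> usphere \<and> \<psi> x1 = 0 \<and> x1 \<noteq> - p"
  proof (cases "x0 = - p0")
    case True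
    obtain y where y: "y \<noteq> 0" "orthogonal p0 y" using orthogonal_to_vector_exists[OF dim] by blast
    define p1 where "p1 = y /\<^sub>R norm y"
    have p1: "p1 \<in> usphere" "p0 \<bullet> p1 = 0" using y by (simp_all add: p1_def orthogonal_def)
    have np0: "p0 \<bullet> p0 = 1" using p0 by (simp add: norm_eq_1)
    have ne: "p1 \<noteq> p0" "p1 \<noteq> - p0" "- p1 \<noteq> - p0" using p1(2) np0 by auto
    show ?thesis
    proof (cases "\<psi> p1 = 0")
      case True
      then show ?thesis using p0 p1(1) ne by blast
    next
      case False
      then show ?thesis using p1(1) z \<open>x0 = - p0\<close> ne by metis
    qed
  qed (use p0 z in blast)
  then obtain p x1 where p: "p \<in> usphere" "\<psi> p \<noteq> 0" and x1: "x1 \<in> usphere" "\<psi> x1 = 0" "x1 \<noteq> - p" by blast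
  have np: "p \<bullet> p = 1" using p by (simp add: norm_eq_1)
  have c\<psi>: "continuous_on usphere \<psi>" by (rule C2_continuous[OF \<psi>(1)])
  define K where "K = {x \<in> usphere. \<psi> x = 0}"
  have "closed K"
    unfolding K_def by (rule continuous_closed_preimage_constant[OF c\<psi>]) simp
  then have K: "compact K" unfolding K_def by (metis (no_types, lifting) bounded_sphere bounded_subset compact_eq_bounded_closed mem_Collect_eq subsetI)
  have "K \<noteq> {}" using x1 by (auto simp: K_def)
  moreover have "continuous_on K (\<lambda>x. x \<bullet> p)" by (intro continuous_intros)
  ultimately obtain x2 where x2: "x2 \<in> K" "\<And>x. x \<in> K \<Longrightarrow> x \<bullet> p \<le> x2 \<bullet> p"
    using continuous_attains_sup[OF K, of "\<lambda>x. x \<bullet> p"] by blast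
  define t0 where "t0 = x2 \<bullet> p"
  have eq1: "x = p" if "x \<in> usphere" "x \<bullet> p = 1" for x
  proof -
    have "(x - p) \<bullet> (x - p) = 0"
      using that np by (simp add: inner_diff_left inner_diff_right inner_commute norm_eq_1)
    then show ?thesis by simp
  qed
  have eq2: "x = - p" if "x \<in> usphere" "x \<bullet> p = - 1" for x
  proof -
    have "(x + p) \<bullet> (x + p) = 0"
      using that np by (simp add: inner_add_left inner_add_right inner_commute norm_eq_1)
    then show ?thesis by (simp add: eq_neg_iff_add_eq_0)
  qed
  have t0: "-1 < t0" "t0 < 1"
  proof -
    have "x1 \<bullet> p \<noteq> -1" using eq2 x1 by blast
    then have "-1 < x1 \<bullet> p" using axis_grad(4)[OF x1(1) p(1)] by auto
    also have "\<dots> \<le> t0" unfolding t0_def by (rule x2(2)) (use x1 in \<open>simp add: K_def\<close>)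
    finally show "-1 < t0" .
    have "x2 \<bullet> p \<noteq> 1" using eq1 x2(1) p(2) by (auto simp: K_def)
    then show "t0 < 1" using axis_grad(4)[of x2 p] x2(1) p(1) by (auto simp: K_def t0_def)
  qed
  define t1 where "t1 = (t0 + 1) / 2"
  have t1: "t0 < t1" "t1 < 1" using t0 by (auto simp: t1_def)
  \<comment> \<open>\<open>c0\<close> bounds \<open>1 - t\<^sup>2\<close> from below on the band, and \<open>s\<close> is chosen so that \<open>c0 * s\<close> beats the
    terms of lower order.\<close>
  define c0 where "c0 = (1 + t0) * (1 - t1)"
  have c0: "c0 > 0" using t0 t1 by (simp add: c0_def)
  define N where "N = real DIM('a) - 1"
  have N: "N \<ge> 0" using dim by (simp add: N_def)
  define s where "s = max 1 ((N + C + 1) / c0)"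
  have s: "s \<ge> 1" "c0 * s \<ge> N + C + 1"
    using c0 by (auto simp: s_def max_def field_simps)
  have pos: "(1 - t\<^sup>2) * s\<^sup>2 - N * t * s - C > 0" if "t0 \<le> t" "t \<le> t1" for t
  proof -
    have "c0 \<le> (1 + t) * (1 - t)" unfolding c0_def using that t0 t1 by (intro mult_mono) auto
    then have "c0 * s\<^sup>2 \<le> (1 - t\<^sup>2) * s\<^sup>2" by (intro mult_right_mono) (simp_all add: algebra_simps power2_eq_square)
    moreover have "s * (N + C + 1) \<le> c0 * s\<^sup>2"
      using mult_left_mono[OF s(2), of s] s(1) by (simp add: power2_eq_square mult.left_commute)
    moreover have "N * t * s \<le> N * s" using N that t1 s(1) by (intro mult_right_mono mult_left_le) auto
    moreover have "C \<le> s * C" using C s(1) mult_right_mono[of 1 s C] by simp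
    ultimately show ?thesis using s(1) by (simp add: algebra_simps)
  qed
  define h where "h x = exp (s * (x \<bullet> p)) - exp (s * t0)" for x
  define S1 where "S1 = {x \<in> usphere. x \<bullet> p = t1}"
  obtain m where m: "m > 0" "\<And>x. x \<in> S1 \<Longrightarrow> \<psi> x \<ge> m"
  proof (cases "S1 = {}")
    case False
    have "S1 = usphere \<inter> {x. p \<bullet> x = t1}" by (auto simp: S1_def inner_commute)
    then have "compact S1" by (simp add: compact_Int_closed closed_hyperplane)
    moreover have "continuous_on S1 \<psi>" by (rule continuous_on_subset[OF c\<psi>]) (auto simp: S1_def)
    ultimately obtain x3 where x3: "x3 \<in> S1" "\<And>x. x \<in> S1 \<Longrightarrow> \<psi> x3 \<le> \<psi> x"
      using continuous_attains_inf[OF _ False, of \<psi>] by blast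
    have "x3 \<notin> K" using x2(2)[of x3] x3(1) t1 by (auto simp: S1_def t0_def)
    then have "\<psi> x3 > 0" using x3(1) \<psi>(2)[of x3] by (auto simp: K_def S1_def)
    then show ?thesis using x3(2) that by blast
  qed (use that[of 1] in auto)
  define H1 where "H1 = exp (s * t1) - exp (s * t0)"
  have H1: "H1 > 0" using t1 s(1) by (simp add: H1_def)
  define \<epsilon> where "\<epsilon> = m / (2 * H1)"
  have \<epsilon>: "\<epsilon> > 0" "\<epsilon> * H1 < m" using m H1 by (auto simp: \<epsilon>_def)
  define F where "F x = \<psi> x + (- \<epsilon>) * (exp (s * (x \<bullet> p)) + (- exp (s * t0)))" for x
  have C2e: "C2_on_sphere (\<lambda>x. exp (s * (x \<bullet> p)) + (- exp (s * t0)))"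
    by (intro C2_add exp_barrier(1) p C2_const_fun)
  have C2F: "C2_on_sphere F" unfolding F_def[abs_def] by (intro C2_add \<psi> C2_scale[OF C2e])
  define R where "R = usphere \<inter> {x. p \<bullet> x \<le> t1}"
  have "compact R" unfolding R_def by (intro compact_Int_closed closed_halfspace_le) simp
  moreover have x2R: "x2 \<in> R" using x2(1) t1 by (auto simp: R_def K_def t0_def inner_commute)
  moreover have "continuous_on R F" by (rule continuous_on_subset[OF C2_continuous[OF C2F]]) (simp add: R_def)
  ultimately obtain y where y: "y \<in> R" "\<And>x. x \<in> R \<Longrightarrow> F y \<le> F x"
    using continuous_attains_inf[of R F] by blast
  have yS: "y \<in> usphere" and yt: "y \<bullet> p \<le> t1" using y(1) by (auto simp: R_def inner_commute)
  have "F x2 = 0" using x2(1) by (simp add: F_def K_def t0_def)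
  then have Fy: "F y \<le> 0" using y(2)[OF x2R] by simp
  have ge: "t0 \<le> y \<bullet> p"
  proof (rule ccontr)
    assume "\<not> t0 \<le> y \<bullet> p"
    then have "exp (s * (y \<bullet> p)) < exp (s * t0)" using s(1) by simp
    then have "\<epsilon> * exp (s * (y \<bullet> p)) < \<epsilon> * exp (s * t0)" using \<epsilon>(1) by (rule mult_strict_left_mono)
    then have "F y > 0" using \<psi>(2)[OF yS] unfolding F_def distrib_left by linarith
    then show False using Fy by simp
  qed
  have lt: "y \<bullet> p < t1"
  proof (rule ccontr)
    assume "\<not> y \<bullet> p < t1"
    then have t: "y \<bullet> p = t1" using yt by simp
    then have "\<psi> y \<ge> m" using m(2) yS by (simp add: S1_def)
    then have "F y > 0" using \<epsilon>(2) by (simp add: F_def t H1_def algebra_simps)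
    then show False using Fy by simp
  qed
  have "laplace_beltrami F y \<le> 0"
  proof (rule laplace_at_min[OF C2F yS])
    show "open {x. p \<bullet> x < t1}" by (rule open_halfspace_lt)
    show "y \<in> {x. p \<bullet> x < t1}" using lt by (simp add: inner_commute)
    show "F y \<le> F x" if "x \<in> usphere" "x \<in> {x. p \<bullet> x < t1}" for x
      by (rule y(2)) (use that in \<open>auto simp: R_def\<close>)
  qed
  moreover have "laplace_beltrami F y = laplace_beltrami \<psi> y
      + \<epsilon> * (exp (s * (y \<bullet> p)) * ((1 - (y \<bullet> p)\<^sup>2) * s\<^sup>2 - N * (y \<bullet> p) * s))"
  proof -
    have "laplace_beltrami (\<lambda>x :: 'a. - exp (s * t0)) y = 0" by (rule laplace_const[OF yS])
    then show ?thesis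
      unfolding F_def laplace_add[OF \<psi>(1) C2_scale[OF C2e] yS] laplace_scale[OF C2e yS]
        laplace_add[OF exp_barrier(1)[OF p(1)] C2_const_fun yS] exp_barrier(2)[OF p(1) yS]
      by (simp add: N_def)
  qed
  moreover have "laplace_beltrami \<psi> y \<ge> - (C * (\<epsilon> * exp (s * (y \<bullet> p))))"
  proof -
    have "\<psi> y \<le> \<epsilon> * (exp (s * (y \<bullet> p)) - exp (s * t0))" using Fy by (simp add: F_def algebra_simps)
    also have "\<dots> \<le> \<epsilon> * exp (s * (y \<bullet> p))" using \<epsilon>(1) by (simp add: mult_left_mono)
    finally have "C * \<psi> y \<le> C * (\<epsilon> * exp (s * (y \<bullet> p)))" using C by (rule mult_left_mono)
    then show ?thesis using L[OF yS] by simp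
  qed
  moreover have "\<epsilon> * exp (s * (y \<bullet> p)) * ((1 - (y \<bullet> p)\<^sup>2) * s\<^sup>2 - N * (y \<bullet> p) * s - C) > 0"
    using pos[OF ge yt] \<epsilon>(1) by simp
  ultimately show False by (simp add: algebra_simps)
qed

section \<open>Nonexistence and synchronization\<close>

lemma solves_S_swap: "solves_S q lam a b c u1 u2 \<Longrightarrow> solves_S q lam c b a u2 u1"
  unfolding solves_S_def by (auto simp: algebra_simps)

lemma solves_S_laplace:
  assumes "solves_S q lam a b c u1 u2" "x \<in> usphere"
  shows "laplace_beltrami (C2_fun u1) x
      = C2_fun u1 x * (a * C2_fun u1 x powr (q - 2) + b * C2_fun u2 x powr (q - 2) - lam)"
    and "laplace_beltrami (C2_fun u2) x
      = C2_fun u2 x * (b * C2_fun u1 x powr (q - 2) + c * C2_fun u2 x powr (q - 2) - lam)"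
    and "C2_fun u1 x > 0" "C2_fun u2 x > 0"
proof -
  have p: "y powr (q - 1) = y * y powr (q - 2)" if "y > 0" for y :: real
    using that powr_add[of y 1 "q - 2"] by simp
  show pos: "C2_fun u1 x > 0" "C2_fun u2 x > 0" using assms unfolding solves_S_def by auto
  have "laplace_beltrami (C2_fun u1) x + lam * C2_fun u1 x
          = a * C2_fun u1 x powr (q - 1) + b * C2_fun u2 x powr (q - 2) * C2_fun u1 x"
    "laplace_beltrami (C2_fun u2) x + lam * C2_fun u2 x
          = b * C2_fun u1 x powr (q - 2) * C2_fun u2 x + c * C2_fun u2 x powr (q - 1)"
    using assms unfolding solves_S_def by auto
  then show "laplace_beltrami (C2_fun u1) x
      = C2_fun u1 x * (a * C2_fun u1 x powr (q - 2) + b * C2_fun u2 x powr (q - 2) - lam)"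
    "laplace_beltrami (C2_fun u2) x
      = C2_fun u2 x * (b * C2_fun u1 x powr (q - 2) + c * C2_fun u2 x powr (q - 2) - lam)"
    unfolding p[OF pos(1)] p[OF pos(2)] by (simp_all add: algebra_simps)
qed

text \<open>
  The function \<open>M * u2 - u1\<close> attains its minimum \<open>0\<close> at \<open>x0\<close>; its Laplacian there is \<open>\<le> 0\<close>. The
  terms with \<open>lam\<close> cancel because \<open>u1 = M * u2\<close> at \<open>x0\<close>.
\<close>

lemma quotient_maximum:
  fixes u1 u2 :: "'a::euclidean_space C2_sphere"
  assumes S: "solves_S q lam a b c u1 u2"
  obtains x0 M where "x0 \<in> usphere" "M > 0" "C2_fun u1 x0 = M * C2_fun u2 x0"
    "\<And>x. x \<in> usphere \<Longrightarrow> C2_fun u1 x \<le> M * C2_fun u2 x"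
    "(b - a) * C2_fun u1 x0 powr (q - 2) + (c - b) * C2_fun u2 x0 powr (q - 2) \<le> 0"
proof -
  let ?f = "C2_fun u1" and ?g = "C2_fun u2"
  note pos = solves_S_laplace(3,4)[OF S]
  have "continuous_on usphere (\<lambda>x. ?f x / ?g x)"
    using pos(2) by (intro continuous_on_divide C2_continuous C2_fun_C2) (metis less_irrefl)
  then obtain x0 where x0: "x0 \<in> usphere" "\<And>x. x \<in> usphere \<Longrightarrow> ?f x / ?g x \<le> ?f x0 / ?g x0"
    using continuous_attains_sup[OF compact_sphere usphere_nonempty] by blast
  define M where "M = ?f x0 / ?g x0"
  have M: "M > 0" "?f x0 = M * ?g x0" using pos[OF x0(1)] by (simp_all add: M_def)
  have le: "?f x \<le> M * ?g x" if "x \<in> usphere" for x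
    using x0(2)[OF that] pos(2)[OF that] by (simp add: M_def[symmetric] pos_divide_le_eq)
  have "laplace_beltrami (\<lambda>x. M * ?g x + (-1) * ?f x) x0 \<le> 0"
    by (rule laplace_at_min[OF C2_add[OF C2_scale C2_scale] x0(1) open_UNIV])
       (use le M(2) in \<open>auto intro: C2_fun_C2\<close>)
  then have "M * laplace_beltrami ?g x0 - laplace_beltrami ?f x0 \<le> 0"
    unfolding laplace_add[OF C2_scale[OF C2_fun_C2] C2_scale[OF C2_fun_C2] x0(1)]
      laplace_scale[OF C2_fun_C2 x0(1)] by simp
  moreover have "M * laplace_beltrami ?g x0 - laplace_beltrami ?f x0
      = ?f x0 * ((b - a) * ?f x0 powr (q - 2) + (c - b) * ?g x0 powr (q - 2))"
    unfolding solves_S_laplace(1,2)[OF S x0(1)]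
    by (simp only: mult.assoc[symmetric] M(2)[symmetric]) (simp add: algebra_simps)
  ultimately have "(b - a) * ?f x0 powr (q - 2) + (c - b) * ?g x0 powr (q - 2) \<le> 0"
    using pos(1)[OF x0(1)] by (simp add: mult_le_0_iff)
  then show ?thesis using that x0(1) M le by blast
qed

theorem no_solution:
  fixes u1 u2 :: "'a::euclidean_space C2_sphere"
  assumes "(c \<le> b \<and> b \<le> a \<and> (c < b \<or> b < a)) \<or> (a \<le> b \<and> b \<le> c \<and> (a < b \<or> b < c))"
  shows "\<not> solves_S q lam a b c u1 u2"
proof -
  have no: False if S: "solves_S q lam a b c v1 v2" and o: "a \<le> b" "b \<le> c" "a < b \<or> b < c"
    for a b c and v1 v2 :: "'a C2_sphere"
  proof -
    obtain x0 where x0: "x0 \<in> usphere"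
      "(b - a) * C2_fun v1 x0 powr (q - 2) + (c - b) * C2_fun v2 x0 powr (q - 2) \<le> 0"
      using quotient_maximum[OF S] by metis
    have p: "C2_fun v1 x0 powr (q - 2) > 0" "C2_fun v2 x0 powr (q - 2) > 0"
      using solves_S_laplace(3,4)[OF S x0(1)] by simp_all
    have "(b - a) * C2_fun v1 x0 powr (q - 2) \<ge> 0" "(c - b) * C2_fun v2 x0 powr (q - 2) \<ge> 0"
      using o p by simp_all
    moreover have "(b - a) * C2_fun v1 x0 powr (q - 2) > 0 \<or> (c - b) * C2_fun v2 x0 powr (q - 2) > 0"
      using o(3) p by auto
    ultimately show False using x0(2) by linarith
  qed
  show ?thesis using assms no[of a b c] no[of c b a] solves_S_swap by blast
qed

text \<open>
  For \<open>a, c < b\<close> the inequality at the maximum \<open>M\<close> of \<open>u1 / u2\<close> reads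
  \<open>M powr (q - 2) \<le> (b - c) / (b - a)\<close>, and at the maximum \<open>L\<close> of \<open>u2 / u1\<close> it gives the
  reciprocal bound; hence \<open>M * L \<le> 1\<close>, which pins the quotient. For \<open>a = b = c\<close> both components
  solve the same linear equation, hence so does \<open>M * u2 - u1\<close>, and the strong maximum principle
  applies to it.
\<close>

theorem solutions_synchronized:
  fixes u1 u2 :: "'a::euclidean_space C2_sphere"
  assumes dim: "DIM('a) \<ge> 2" and q: "q > 2" and S: "solves_S q lam a b c u1 u2"
    and abc: "(a < b \<and> c < b) \<or> (a = b \<and> b = c)"
  shows "synchronized u1 u2"
proof -
  let ?f = "C2_fun u1" and ?g = "C2_fun u2"
  note pos = solves_S_laplace(3,4)[OF S]
  obtain x0 M where x0: "x0 \<in> usphere" "M > 0" "?f x0 = M * ?g x0"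
    "\<And>x. x \<in> usphere \<Longrightarrow> ?f x \<le> M * ?g x"
    "(b - a) * ?f x0 powr (q - 2) + (c - b) * ?g x0 powr (q - 2) \<le> 0"
    using quotient_maximum[OF S] by metis
  have all: "\<forall>x\<in>usphere. ?f x = M * ?g x"
    using abc
  proof
    assume ab: "a < b \<and> c < b"
    obtain x1 L where x1: "x1 \<in> usphere" "L > 0" "?g x1 = L * ?f x1"
      "\<And>x. x \<in> usphere \<Longrightarrow> ?g x \<le> L * ?f x"
      "(b - c) * ?g x1 powr (q - 2) + (a - b) * ?f x1 powr (q - 2) \<le> 0"
      using quotient_maximum[OF solves_S_swap[OF S]] by metis
    have "(b - a) * M powr (q - 2) * ?g x0 powr (q - 2) \<le> (b - c) * ?g x0 powr (q - 2)"
      using x0(5) pos(2)[OF x0(1)] x0(2) unfolding x0(3) by (simp add: powr_mult algebra_simps)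
    then have 1: "(b - a) * M powr (q - 2) \<le> b - c" using pos(2)[OF x0(1)] by simp
    have "(b - c) * L powr (q - 2) * ?f x1 powr (q - 2) \<le> (b - a) * ?f x1 powr (q - 2)"
      using x1(5) pos(1)[OF x1(1)] x1(2) unfolding x1(3) by (simp add: powr_mult algebra_simps)
    then have 2: "(b - c) * L powr (q - 2) \<le> b - a" using pos(1)[OF x1(1)] by simp
    have "(b - a) * (M powr (q - 2) * L powr (q - 2)) \<le> (b - c) * L powr (q - 2)"
      using mult_right_mono[OF 1, of "L powr (q - 2)"] by (simp add: mult.assoc)
    also have "\<dots> \<le> b - a" by (rule 2)
    finally have "(M * L) powr (q - 2) \<le> 1" using ab x0(2) x1(2) by (simp add: powr_mult mult_le_cancel_left1)
    then have "(M * L) powr (q - 2) \<le> 1 powr (q - 2)" by simp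
    then have prod_le: "M * L \<le> 1"
      using powr_less_mono2[of "q - 2" 1 "M * L"] q by (metis diff_gt_0_iff_gt linorder_not_less zero_le_one)
    show ?thesis
    proof
      fix x :: 'a assume x: "x \<in> usphere"
      have "M * ?g x \<le> M * (L * ?f x)" using x1(4)[OF x] x0(2) by simp
      also have "\<dots> \<le> ?f x" using mult_right_mono[OF prod_le, of "?f x"] pos(1)[OF x] by (simp add: mult.assoc)
      finally show "?f x = M * ?g x" using x0(4)[OF x] by simp
    qed
  next
    assume ab: "a = b \<and> b = c"
    define \<psi> where "\<psi> x = M * ?g x + (-1) * ?f x" for x
    define W where "W x = a * ?f x powr (q - 2) + a * ?g x powr (q - 2) - lam" for x
    have C2: "C2_on_sphere \<psi>" unfolding \<psi>_def[abs_def] by (intro C2_add C2_scale C2_fun_C2)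
    have L: "laplace_beltrami \<psi> x = W x * \<psi> x" if x: "x \<in> usphere" for x
      unfolding \<psi>_def laplace_add[OF C2_scale[OF C2_fun_C2] C2_scale[OF C2_fun_C2] x]
        laplace_scale[OF C2_fun_C2 x] solves_S_laplace(1,2)[OF S x]
      using ab by (simp add: W_def algebra_simps)
    have "continuous_on usphere W"
      unfolding W_def by (intro continuous_intros C2_continuous C2_fun_C2 ballI disjI1) (use pos in force)+
    then have "bounded (W ` usphere)" by (intro compact_imp_bounded compact_continuous_image) auto
    then obtain C where C: "C > 0" "\<And>x. x \<in> usphere \<Longrightarrow> \<bar>W x\<bar> \<le> C"
      unfolding bounded_pos real_norm_def by blast
    have nn: "\<psi> x \<ge> 0" if "x \<in> usphere" for x using x0(4)[OF that] by (simp add: \<psi>_def)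
    have "\<forall>x\<in>usphere. \<psi> x = 0"
    proof (rule strong_maximum_principle[OF dim C2 nn _ _ x0(1)])
      show "laplace_beltrami \<psi> x \<ge> - C * \<psi> x" if "x \<in> usphere" for x
        unfolding L[OF that] using C(2)[OF that] nn[OF that] by (intro mult_right_mono) auto
    qed (use C x0(3) in \<open>auto simp: \<psi>_def\<close>)
    then show ?thesis by (auto simp: \<psi>_def)
  qed
  show ?thesis unfolding synchronized_def
  proof (intro exI[of _ "1 / M"] conjI ballI)
    fix x :: 'a assume "x \<in> usphere"
    then have "?f x = M * ?g x" using all by blast
    then show "?g x = 1 / M * ?f x" using x0(2) by simp
  qed (use x0(2) in simp)
qed

section \<open>The Poisson equation for zonal sources\<close>

lemma DERIV_flux:
  fixes h :: "real \<Rightarrow> real"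
  assumes "continuous_on {0..b} h" "0 < \<theta>" "\<theta> < b"
  shows "(flux m h has_real_derivative sin \<theta> ^ m * h \<theta>) (at \<theta>)"
  using flux_has_derivative[OF assms(1), of \<theta> m] assms(2,3)
  by (simp add: has_real_derivative_iff_has_vector_derivative at_within_Icc_at)

text \<open>
  By the rule of l'Hospital; the limit is the value at the pole of \<open>v' / sin \<theta>\<close>.
\<close>

lemma flux_ratio_limit:
  fixes h :: "real \<Rightarrow> real"
  assumes h: "continuous_on {0..pi} h"
  shows "((\<lambda>\<theta>. flux m h \<theta> / sin \<theta> ^ Suc m) \<longlongrightarrow> h 0 / real (Suc m)) (at_right 0)"
proof -
  have ev: "eventually (\<lambda>\<theta>. 0 < \<theta> \<and> \<theta> < pi/2) (at_right (0::real))"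
    using pi_gt_zero by (auto simp: eventually_at_right[of 0 1] intro: exI[of _ "pi/2"])
  have r0: "at 0 within {0..pi} = at_right (0::real)" by (rule at_within_Icc_at_right) simp
  show ?thesis
  proof (rule lhopital_right_0[where f' = "\<lambda>\<theta>. sin \<theta> ^ m * h \<theta>" and g' = "\<lambda>\<theta>. real (Suc m) * (cos \<theta> * sin \<theta> ^ m)"])
    show "(flux m h \<longlongrightarrow> 0) (at_right 0)"
      using continuous_on_flux[OF h, of m] unfolding continuous_on_def r0[symmetric] by (metis atLeastAtMost_iff flux_0 order_refl pi_ge_zero)
    have "((\<lambda>\<theta>::real. sin \<theta> ^ Suc m) \<longlongrightarrow> sin 0 ^ Suc m) (at_right 0)" by (intro tendsto_intros)
    then show "((\<lambda>\<theta>::real. sin \<theta> ^ Suc m) \<longlongrightarrow> 0) (at_right 0)" by simp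
    show "\<forall>\<^sub>F \<theta> in at_right 0. sin \<theta> ^ Suc m \<noteq> (0::real)"
      using ev by eventually_elim (use sin_gt_zero pi_half_less in fastforce)
    show "\<forall>\<^sub>F \<theta> in at_right 0. real (Suc m) * (cos \<theta> * sin \<theta> ^ m) \<noteq> 0"
    proof (use ev in eventually_elim)
      fix \<theta> :: real assume t: "0 < \<theta> \<and> \<theta> < pi/2"
      then have "cos \<theta> > 0" "sin \<theta> > 0" using pi_half_less by (auto intro: cos_gt_zero sin_gt_zero)
      then show "real (Suc m) * (cos \<theta> * sin \<theta> ^ m) \<noteq> 0" by simp
    qed
    show "\<forall>\<^sub>F \<theta> in at_right 0. (flux m h has_real_derivative sin \<theta> ^ m * h \<theta>) (at \<theta>)"
      using ev by eventually_elim (rule DERIV_flux[OF h], use pi_half_less in auto)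
    have "((\<lambda>\<theta>. sin \<theta> ^ Suc m) has_real_derivative (1 + real m) * (cos \<theta> * sin \<theta> ^ m)) (at \<theta>)" for \<theta> :: real
      by (intro DERIV_power_Suc DERIV_sin)
    then show "\<forall>\<^sub>F \<theta> in at_right 0. ((\<lambda>\<theta>. sin \<theta> ^ Suc m) has_real_derivative real (Suc m) * (cos \<theta> * sin \<theta> ^ m)) (at \<theta>)"
      by (intro always_eventually) simp
    have "((\<lambda>\<theta>. h \<theta> / (real (Suc m) * cos \<theta>)) \<longlongrightarrow> h 0 / (real (Suc m) * cos 0)) (at_right 0)"
    proof (intro tendsto_intros)
      show "(h \<longlongrightarrow> h 0) (at_right 0)" using h unfolding continuous_on_def r0[symmetric] by simp
    qed simp
    moreover have "\<forall>\<^sub>F \<theta> in at_right 0. h \<theta> / (real (Suc m) * cos \<theta>) = sin \<theta> ^ m * h \<theta> / (real (Suc m) * (cos \<theta> * sin \<theta> ^ m))"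
    proof (use ev in eventually_elim)
      fix \<theta> :: real assume t: "0 < \<theta> \<and> \<theta> < pi/2"
      then have "sin \<theta> > 0" using pi_half_less by (auto intro: sin_gt_zero)
      then show "h \<theta> / (real (Suc m) * cos \<theta>) = sin \<theta> ^ m * h \<theta> / (real (Suc m) * (cos \<theta> * sin \<theta> ^ m))" by simp
    qed
    ultimately show "((\<lambda>\<theta>. sin \<theta> ^ m * h \<theta> / (real (Suc m) * (cos \<theta> * sin \<theta> ^ m))) \<longlongrightarrow> h 0 / real (Suc m)) (at_right 0)"
      by (simp add: Lim_transform_eventually)
  qed
qed

text \<open>
  In the height variable \<open>t = cos \<theta>\<close> the derivative of the solution is \<open>- v' / sin \<theta>\<close>, which is
  minus this ratio. At \<open>0\<close> and \<open>pi\<close> it is given its limits; the second one is the limit provided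
  \<open>flux m h pi = 0\<close>, the solvability condition of the Poisson equation on the closed sphere.
\<close>

definition ratio :: "nat \<Rightarrow> (real \<Rightarrow> real) \<Rightarrow> real \<Rightarrow> real" where
  "ratio m h \<theta> = (if \<theta> = 0 then h 0 / real (Suc m) else if \<theta> = pi then - h pi / real (Suc m)
     else flux m h \<theta> / sin \<theta> ^ Suc m)"

lemma continuous_ratio_left:
  assumes h: "continuous_on {0..pi} h"
  shows "continuous_on {0..pi/2} (ratio m h)"
  unfolding continuous_on_def
proof
  fix \<theta> assume t: "\<theta> \<in> {0..pi/2}"
  show "(ratio m h \<longlongrightarrow> ratio m h \<theta>) (at \<theta> within {0..pi/2})"
  proof (cases "\<theta> = 0")
    case True
    have r0: "at 0 within {0..pi/2} = at_right (0::real)" by (rule at_within_Icc_at_right) (use pi_gt_zero in simp)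
    have "eventually (\<lambda>\<theta>. flux m h \<theta> / sin \<theta> ^ Suc m = ratio m h \<theta>) (at_right (0::real))"
      using pi_gt_zero unfolding eventually_at_right[OF zero_less_one] by (intro exI[of _ pi]) (auto simp: ratio_def)
    moreover have "ratio m h 0 = h 0 / real (Suc m)" by (simp add: ratio_def)
    ultimately show ?thesis
      unfolding True r0 by (metis Lim_transform_eventually[OF flux_ratio_limit[OF h]])
  next
    case False
    then have t0: "0 < \<theta>" "\<theta> < pi" using t pi_half_less by (auto intro: le_less_trans)
    have "isCont (\<lambda>\<theta>. flux m h \<theta> / sin \<theta> ^ Suc m) \<theta>"
      using DERIV_isCont[OF DERIV_flux[OF h t0, of m]] sin_gt_zero[OF t0] by (intro continuous_intros) auto
    then have "((\<lambda>\<theta>. flux m h \<theta> / sin \<theta> ^ Suc m) \<longlongrightarrow> ratio m h \<theta>) (at \<theta> within {0..pi/2})"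
      using t0 unfolding isCont_def ratio_def by (auto intro: tendsto_within_subset)
    moreover have "eventually (\<lambda>\<theta>. flux m h \<theta> / sin \<theta> ^ Suc m = ratio m h \<theta>) (at \<theta> within {0..pi/2})"
      unfolding eventually_at
      by (intro exI[of _ \<theta>]) (use t0 pi_half_less in \<open>auto simp: ratio_def dist_norm\<close>)
    ultimately show ?thesis by (rule Lim_transform_eventually)
  qed
qed

lemma flux_reflect:
  fixes h :: "real \<Rightarrow> real"
  assumes h: "continuous_on {0..pi} h" and t: "\<theta> \<in> {0..pi}"
  shows "flux m h (pi - \<theta>) + flux m (\<lambda>\<sigma>. h (pi - \<sigma>)) \<theta> = flux m h pi"
proof -
  have h': "continuous_on {0..pi} (\<lambda>\<sigma>. h (pi - \<sigma>))"
    by (intro continuous_on_compose2[OF h] continuous_intros) auto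
  let ?W = "\<lambda>\<theta>. flux m h (pi - \<theta>) + flux m (\<lambda>\<sigma>. h (pi - \<sigma>)) \<theta>"
  have dW: "(?W has_vector_derivative 0) (at x within {0..pi})" if x: "x \<in> {0..pi}" for x
  proof -
    have "((\<lambda>\<theta>. pi - \<theta>) has_vector_derivative -1) (at x within {0..pi})"
      by (auto intro!: derivative_eq_intros)
    moreover have "(flux m h has_vector_derivative sin (pi - x) ^ m *\<^sub>R h (pi - x)) (at (pi - x) within (\<lambda>\<theta>. pi - \<theta>) ` {0..pi})"
      by (rule has_vector_derivative_within_subset[OF flux_has_derivative[OF h]]) (use x in auto)
    ultimately have "((flux m h \<circ> (\<lambda>\<theta>. pi - \<theta>)) has_vector_derivative (-1) *\<^sub>R (sin (pi - x) ^ m *\<^sub>R h (pi - x))) (at x within {0..pi})"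
      by (rule vector_diff_chain_within)
    from has_vector_derivative_add[OF this flux_has_derivative[OF h' x, of m]]
    show ?thesis by (simp add: o_def)
  qed
  have "\<exists>c. \<forall>x\<in>{0..pi}. ?W x = c"
    by (rule has_vector_derivative_zero_constant[OF convex_real_interval(5) dW]) blast+
  then obtain c where "\<forall>x\<in>{0..pi}. ?W x = c" by blast
  note c = this[rule_format]
  show ?thesis using c[OF t] c[of 0] by simp
qed

text \<open>
  A source of mean zero may equally be integrated from the other pole, so everything about the
  second pole follows from the first.
\<close>

lemma ratio_reflect:
  assumes h: "continuous_on {0..pi} h" "flux m h pi = 0" and t: "\<theta> \<in> {0..pi}"
  shows "ratio m h \<theta> = - ratio m (\<lambda>\<sigma>. h (pi - \<sigma>)) (pi - \<theta>)"
proof -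
  have "flux m h (pi - (pi - \<theta>)) + flux m (\<lambda>\<sigma>. h (pi - \<sigma>)) (pi - \<theta>) = 0"
    using flux_reflect[OF h(1), of "pi - \<theta>" m] t h(2) by simp
  then have "flux m h \<theta> = - flux m (\<lambda>\<sigma>. h (pi - \<sigma>)) (pi - \<theta>)" by simp
  then show ?thesis by (auto simp: ratio_def)
qed

lemma continuous_ratio:
  assumes h: "continuous_on {0..pi} h" "flux m h pi = 0"
  shows "continuous_on {0..pi} (ratio m h)"
proof -
  have h': "continuous_on {0..pi} (\<lambda>\<sigma>. h (pi - \<sigma>))"
    by (intro continuous_on_compose2[OF h(1)] continuous_intros) auto
  have "continuous_on {pi/2..pi} (\<lambda>\<theta>. - ratio m (\<lambda>\<sigma>. h (pi - \<sigma>)) (pi - \<theta>))"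
    by (intro continuous_intros continuous_on_compose2[OF continuous_ratio_left[OF h']]) auto
  then have "continuous_on {pi/2..pi} (ratio m h)"
    by (rule continuous_on_eq) (use pi_half_less in \<open>auto intro!: ratio_reflect[OF h, symmetric]\<close>)
  then have "continuous_on ({0..pi/2} \<union> {pi/2..pi}) (ratio m h)"
    by (intro continuous_on_closed_Un continuous_ratio_left[OF h(1)]) auto
  moreover have "{0..pi/2} \<union> {pi/2..pi} = {0..pi}" using pi_half_less by auto
  ultimately show ?thesis by simp
qed

text \<open>
  The constant is independent of the source: on the half interval the ratio of \<open>h\<close> is dominated by
  that of the constant \<open>1\<close>.
\<close>

lemma ratio_bound:
  obtains C where "C \<ge> 0" "\<And>(h :: real \<Rightarrow> real) B \<theta>. continuous_on {0..pi} h \<Longrightarrow> flux m h pi = 0 \<Longrightarrow>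
      (\<And>\<sigma>. \<sigma> \<in> {0..pi} \<Longrightarrow> \<bar>h \<sigma>\<bar> \<le> B) \<Longrightarrow> \<theta> \<in> {0..pi} \<Longrightarrow> \<bar>ratio m h \<theta>\<bar> \<le> C * B"
proof -
  have "continuous_on {0..pi/2} (ratio m (\<lambda>_. 1))" by (rule continuous_ratio_left) simp
  then have "bounded (ratio m (\<lambda>_. 1) ` {0..pi/2})" by (intro compact_imp_bounded compact_continuous_image) auto
  then obtain C where C: "C > 0" "\<And>\<theta>. \<theta> \<in> {0..pi/2} \<Longrightarrow> \<bar>ratio m (\<lambda>_. 1) \<theta>\<bar> \<le> C"
    unfolding bounded_pos real_norm_def by blast
  have half: "\<bar>ratio m h \<theta>\<bar> \<le> C * B"
    if h: "continuous_on {0..pi} h" and B: "\<And>\<sigma>. \<sigma> \<in> {0..pi} \<Longrightarrow> \<bar>h \<sigma>\<bar> \<le> B" and t: "\<theta> \<in> {0..pi/2}" for h :: "real \<Rightarrow> real" and B \<theta>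
  proof -
    have B0: "0 \<le> B" using B[of 0] by simp
    have "\<bar>ratio m h \<theta>\<bar> \<le> ratio m (\<lambda>_. 1) \<theta> * B"
    proof (cases "\<theta> = 0")
      case True
      then show ?thesis using B[of 0] by (simp add: ratio_def divide_right_mono)
    next
      case False
      then have t0: "0 < \<theta>" "\<theta> < pi" using t pi_half_less by (auto intro: le_less_trans)
      have i: "(\<lambda>\<sigma>. sin \<sigma> ^ m *\<^sub>R h \<sigma>) integrable_on {0..\<theta>}" "(\<lambda>\<sigma>. sin \<sigma> ^ m * B) integrable_on {0..\<theta>}"
        using t0 by (intro integrable_continuous_interval continuous_intros continuous_on_subset[OF h]; auto)+
      have "norm (flux m h \<theta>) \<le> integral {0..\<theta>} (\<lambda>\<sigma>. sin \<sigma> ^ m * B)"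
        unfolding flux_def
      proof (rule integral_norm_bound_integral[OF i])
        fix \<sigma> assume s: "\<sigma> \<in> {0..\<theta>}"
        then have "sin \<sigma> \<ge> 0" "\<bar>h \<sigma>\<bar> \<le> B" using t0 by (auto intro!: sin_ge_zero B)
        then show "norm (sin \<sigma> ^ m *\<^sub>R h \<sigma>) \<le> sin \<sigma> ^ m * B" by (simp add: abs_mult mult_left_mono)
      qed
      also have "\<dots> = flux m (\<lambda>_. 1) \<theta> * B" by (simp add: flux_def)
      finally have "\<bar>flux m h \<theta>\<bar> / sin \<theta> ^ Suc m \<le> flux m (\<lambda>_. 1) \<theta> * B / sin \<theta> ^ Suc m"
        using sin_gt_zero[OF t0] by (intro divide_right_mono) auto
      then show ?thesis using t0 sin_gt_zero[OF t0] by (simp add: ratio_def abs_mult power_abs)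
    qed
    also have "\<dots> \<le> C * B" using C(2)[OF t] B0 by (intro mult_right_mono) auto
    finally show ?thesis .
  qed
  show ?thesis
  proof (rule that[of C])
    fix h :: "real \<Rightarrow> real" and B \<theta> assume h: "continuous_on {0..pi} h" "flux m h pi = 0"
      and B: "\<And>\<sigma>. \<sigma> \<in> {0..pi} \<Longrightarrow> \<bar>h \<sigma>\<bar> \<le> B" and t: "\<theta> \<in> {0..pi}"
    show "\<bar>ratio m h \<theta>\<bar> \<le> C * B"
    proof (cases "\<theta> \<le> pi/2")
      case True
      then show ?thesis using half[OF h(1) B] t by auto
    next
      case False
      have "continuous_on {0..pi} (\<lambda>\<sigma>. h (pi - \<sigma>))"
        by (intro continuous_on_compose2[OF h(1)] continuous_intros) auto
      then have "\<bar>ratio m (\<lambda>\<sigma>. h (pi - \<sigma>)) (pi - \<theta>)\<bar> \<le> C * B"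
        by (rule half) (use B False t in auto)
      then show ?thesis using ratio_reflect[OF h t] by simp
    qed
  qed (use C in simp)
qed

lemma slope_ratio:
  fixes h :: "real \<Rightarrow> real"
  assumes "flux m h pi = 0" "\<theta> \<in> {0..pi}"
  shows "slope m h \<theta> = sin \<theta> * ratio m h \<theta>"
proof -
  consider "\<theta> = 0" | "\<theta> = pi" | "0 < \<theta>" "\<theta> < pi" using assms(2) by fastforce
  then show ?thesis
  proof cases
    case 3
    then show ?thesis using sin_gt_zero[of \<theta>] by (simp add: slope_def ratio_def divide_inverse)
  qed (use assms(1) in \<open>simp_all add: slope_def\<close>)
qed

lemma continuous_slope_pi:
  fixes h :: "real \<Rightarrow> real"
  assumes h: "continuous_on {0..pi} h" "flux m h pi = 0"
  shows "continuous_on {0..pi} (slope m h)"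
proof -
  have "continuous_on {0..pi} (\<lambda>\<theta>. sin \<theta> * ratio m h \<theta>)" by (intro continuous_intros continuous_ratio h)
  then show ?thesis by (rule continuous_on_eq) (simp add: slope_ratio[OF h(2)])
qed

lemma potential_deriv_pi:
  fixes h :: "real \<Rightarrow> real"
  assumes h: "continuous_on {0..pi} h" "flux m h pi = 0" and t: "\<theta> \<in> {0..pi}"
  shows "(potential m h has_vector_derivative slope m h \<theta>) (at \<theta> within {0..pi})"
  unfolding potential_def by (rule integral_has_vector_derivative[OF continuous_slope_pi[OF h] t])

locale zonal_source =
  fixes e :: "'a::euclidean_space" and m :: nat and c :: real and h :: "real \<Rightarrow> real"
  assumes e: "e \<in> usphere" and dim: "DIM('a) = m + 2"
    and h: "continuous_on {0..pi} h" "flux m h pi = 0"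
begin

definition V where "V t = c + potential m h (arccos t)"
definition V1 where "V1 t = - ratio m h (arccos t)"
definition M where "M t = h (arccos t) + real (Suc m) * t * V1 t"

lemma arccos_cont: "continuous_on {-1..1} arccos" "arccos ` {-1..1} \<subseteq> {0..pi}"
  by (rule continuous_on_arccos') (auto intro: arccos_lbound arccos_ubound)

lemma profile: "zonal_profile e V V1 M"
proof
  show "e \<in> usphere" by (rule e)
  have cp: "continuous_on {0..pi} (potential m h)"
    by (rule continuous_on_vector_derivative) (rule potential_deriv_pi[OF h])
  show cV: "continuous_on {-1..1} V" unfolding V_def
    by (intro continuous_intros continuous_on_compose2[OF cp arccos_cont])
  show cV1: "continuous_on {-1..1} V1" unfolding V1_def
    by (intro continuous_intros continuous_on_compose2[OF continuous_ratio[OF h] arccos_cont])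
  show "continuous_on {-1..1} M" unfolding M_def
    by (intro continuous_intros continuous_on_compose2[OF h(1) arccos_cont] cV1)
  show "M 1 = 0" by (simp add: M_def V1_def ratio_def)
  show "M (-1) = 0" by (simp add: M_def V1_def ratio_def del: of_nat_Suc)
  fix t :: real assume t: "-1 < t" "t < 1"
  define \<theta> where "\<theta> = arccos t"
  have \<theta>: "0 < \<theta>" "\<theta> < pi" using arccos_lt_bounded[OF t] by (auto simp: \<theta>_def)
  have ct: "cos \<theta> = t" using t by (simp add: \<theta>_def)
  have s: "sin \<theta> > 0" by (rule sin_gt_zero[OF \<theta>])
  have s2: "1 - t\<^sup>2 = (sin \<theta>)\<^sup>2" by (simp add: sin_squared_eq ct[symmetric])
  have da: "(arccos has_real_derivative - (1 / sin \<theta>)) (at t)"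
  proof -
    have "sqrt (1 - t\<^sup>2) = sin \<theta>" using s by (simp add: s2)
    then show ?thesis using DERIV_arccos[OF t] by (simp add: inverse_eq_divide)
  qed
  have rat: "ratio m h \<theta> = flux m h \<theta> / sin \<theta> ^ Suc m" using \<theta> by (simp add: ratio_def)
  have dp: "(potential m h has_real_derivative slope m h \<theta>) (at \<theta>)"
    using potential_deriv_pi[OF h, of \<theta>] \<theta>
    by (simp add: has_real_derivative_iff_has_vector_derivative at_within_Icc_at)
  have "((\<lambda>t. c + potential m h (arccos t)) has_real_derivative slope m h \<theta> * (- (1 / sin \<theta>))) (at t)"
    using DERIV_chain2[OF dp[unfolded \<theta>_def] da] DERIV_add[OF DERIV_const, of _ _ t UNIV c] by (fastforce simp: \<theta>_def)
  moreover have "slope m h \<theta> * (- (1 / sin \<theta>)) = V1 t"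
    using slope_ratio[OF h(2), of \<theta>] \<theta> s by (simp add: V1_def \<theta>_def[symmetric])
  ultimately show "(V has_real_derivative V1 t) (at t)" by (simp add: V_def[abs_def])
  have dS: "((\<lambda>\<theta>. sin \<theta> ^ Suc m) has_real_derivative (1 + real m) * (cos \<theta> * sin \<theta> ^ m)) (at \<theta>)"
    by (intro DERIV_power_Suc DERIV_sin)
  have "((\<lambda>\<theta>. flux m h \<theta> / sin \<theta> ^ Suc m) has_real_derivative
      ((sin \<theta> ^ m * h \<theta>) * sin \<theta> ^ Suc m - flux m h \<theta> * ((1 + real m) * (cos \<theta> * sin \<theta> ^ m))) / (sin \<theta> ^ Suc m * sin \<theta> ^ Suc m)) (at \<theta>)"
    by (rule DERIV_divide[OF DERIV_flux[OF h(1) \<theta>] dS]) (use s in simp)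
  also have "((sin \<theta> ^ m * h \<theta>) * sin \<theta> ^ Suc m - flux m h \<theta> * ((1 + real m) * (cos \<theta> * sin \<theta> ^ m))) / (sin \<theta> ^ Suc m * sin \<theta> ^ Suc m)
      = (h \<theta> - real (Suc m) * t * ratio m h \<theta>) / sin \<theta>"
    using s unfolding rat ct by (simp add: field_simps)
  finally have "((\<lambda>\<theta>. flux m h \<theta> / sin \<theta> ^ Suc m) has_real_derivative (h \<theta> - real (Suc m) * t * ratio m h \<theta>) / sin \<theta>) (at \<theta>)" .
  then have "(ratio m h has_real_derivative (h \<theta> - real (Suc m) * t * ratio m h \<theta>) / sin \<theta>) (at \<theta>)"
    by (rule has_field_derivative_transform_within_open[where S = "{0<..<pi}"]) (use \<theta> in \<open>auto simp: ratio_def\<close>)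
  from DERIV_minus[OF DERIV_chain2[OF this[unfolded \<theta>_def] da]]
  have "(V1 has_real_derivative - ((h \<theta> - real (Suc m) * t * ratio m h \<theta>) / sin \<theta> * (- (1 / sin \<theta>)))) (at t)"
    by (simp add: V1_def[abs_def] \<theta>_def)
  also have "- ((h \<theta> - real (Suc m) * t * ratio m h \<theta>) / sin \<theta> * (- (1 / sin \<theta>))) = M t / (1 - t\<^sup>2)"
    unfolding s2 by (simp add: M_def V1_def \<theta>_def[symmetric] power2_eq_square)
  finally show "(V1 has_real_derivative M t / (1 - t\<^sup>2)) (at t)" .
qed

sublocale zonal_profile e V V1 M by (rule profile)

lemma u_eq: "u = (\<lambda>x. c + potential m h (arccos (x \<bullet> e)))"
  by (simp add: u_def V_def fun_eq_iff)

lemma laplace_source: "x \<in> usphere \<Longrightarrow> laplace_beltrami u x = - h (arccos (x \<bullet> e))"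
  using laplace_u[of x] dim by (simp add: M_def)

end

lemma zonal_source_bound:
  obtains K where "K \<ge> 0" "\<And>(e::'a::euclidean_space) c h B (x::'a). zonal_source e m h \<Longrightarrow> (\<And>\<sigma>. \<sigma> \<in> {0..pi} \<Longrightarrow> \<bar>h \<sigma>\<bar> \<le> B) \<Longrightarrow>
     x \<in> usphere \<Longrightarrow> C2_pnorm (\<lambda>x. c + potential m h (arccos (x \<bullet> e))) x \<le> \<bar>c\<bar> + K * B"
proof -
  obtain C where C: "C \<ge> 0" "\<And>(h :: real \<Rightarrow> real) B \<theta>. continuous_on {0..pi} h \<Longrightarrow> flux m h pi = 0 \<Longrightarrow>
      (\<And>\<sigma>. \<sigma> \<in> {0..pi} \<Longrightarrow> \<bar>h \<sigma>\<bar> \<le> B) \<Longrightarrow> \<theta> \<in> {0..pi} \<Longrightarrow> \<bar>ratio m h \<theta>\<bar> \<le> C * B"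
    using ratio_bound by blast
  \<comment> \<open>The terms bound the value, the gradient and the Hessian norm, as they appear in
    \<open>C2_pnorm_u\<close>.\<close>
  define K where "K = pi * C + C + real DIM('a) * ((1 + real (Suc m) * C) + C)"
  show ?thesis
  proof (rule that[of K])
    show "K \<ge> 0" using C(1) by (simp add: K_def)
    fix e x :: 'a and c :: real and h :: "real \<Rightarrow> real" and B :: real
    assume src: "zonal_source e m h" and B: "\<And>\<sigma>. \<sigma> \<in> {0..pi} \<Longrightarrow> \<bar>h \<sigma>\<bar> \<le> B" and x: "x \<in> usphere"
    interpret zonal_source e m c h by (rule src)
    note cB = C(2)[OF h B]
    have B0: "0 \<le> B" using B[of 0] by simp
    have t: "x \<bullet> e \<in> {-1..1}" by (rule axis_grad(4)[OF x e])
    then have a: "arccos (x \<bullet> e) \<in> {0..pi}" using arccos_cont(2) by blast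
    have v1: "\<bar>V1 (x \<bullet> e)\<bar> \<le> C * B" using cB[OF _ a] by (simp add: V1_def)
    have "\<bar>real (Suc m) * (x \<bullet> e) * V1 (x \<bullet> e)\<bar> \<le> real (Suc m) * 1 * (C * B)"
      unfolding abs_mult using t v1 by (intro mult_mono) auto
    then have mm: "\<bar>M (x \<bullet> e)\<bar> \<le> B + real (Suc m) * (C * B)"
      unfolding M_def using B[OF a] by (intro order_trans[OF abs_triangle_ineq] add_mono) auto
    have "norm (potential m h (arccos (x \<bullet> e))) \<le> integral {0..arccos (x \<bullet> e)} (\<lambda>_. C * B)"
      unfolding potential_def
    proof (rule integral_norm_bound_integral)
      show "slope m h integrable_on {0..arccos (x \<bullet> e)}"
        by (intro integrable_continuous_interval continuous_on_subset[OF continuous_slope_pi[OF h]]) (use a in auto)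
      fix \<sigma> assume s: "\<sigma> \<in> {0..arccos (x \<bullet> e)}"
      then have s': "\<sigma> \<in> {0..pi}" using a by auto
      have "\<bar>sin \<sigma>\<bar> * \<bar>ratio m h \<sigma>\<bar> \<le> 1 * (C * B)" using cB[OF _ s'] by (intro mult_mono) auto
      then show "norm (slope m h \<sigma>) \<le> C * B" by (simp add: slope_ratio[OF h(2) s'] abs_mult)
    qed (intro integrable_continuous_interval continuous_intros)
    also have "\<dots> = arccos (x \<bullet> e) * (C * B)" using a by simp
    also have "\<dots> \<le> pi * (C * B)" using a C(1) B0 by (intro mult_right_mono) auto
    finally have v: "\<bar>V (x \<bullet> e)\<bar> \<le> \<bar>c\<bar> + pi * (C * B)"
      unfolding V_def by (intro order_trans[OF abs_triangle_ineq]) auto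
    have "C2_pnorm u x \<le> (\<bar>c\<bar> + pi * (C * B)) + C * B + real DIM('a) * ((B + real (Suc m) * (C * B)) + C * B)"
      by (rule order_trans[OF C2_pnorm_u[OF x]]) (intro add_mono mult_left_mono v v1 mm; simp)
    also have "\<dots> = \<bar>c\<bar> + K * B" by (simp add: K_def algebra_simps)
    finally show "C2_pnorm (\<lambda>x. c + potential m h (arccos (x \<bullet> e))) x \<le> \<bar>c\<bar> + K * B" by (simp add: u_eq)
  qed
qed

lemma flux_one_pos: "flux m (\<lambda>_. 1 :: real) pi > 0"
proof -
  have c: "continuous_on {0..pi} (\<lambda>\<sigma>::real. sin \<sigma> ^ m)" by (intro continuous_intros)
  have nn: "sin \<sigma> ^ m \<ge> 0" if "\<sigma> \<in> {0..pi}" for \<sigma> :: real using that by (simp add: sin_ge_zero)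
  have "integral {0..pi} (\<lambda>\<sigma>. sin \<sigma> ^ m) \<noteq> 0"
  proof
    assume "integral {0..pi} (\<lambda>\<sigma>. sin \<sigma> ^ m) = 0"
    then have "\<forall>\<sigma>\<in>{0..pi}. sin \<sigma> ^ m = 0" using integral_eq_0_iff[OF c pi_gt_zero nn] by simp
    then have "sin (pi/2) ^ m = 0" using pi_half_less by (metis atLeastAtMost_iff less_imp_le)
    then show False by simp
  qed
  moreover have "integral {0..pi} (\<lambda>\<sigma>. sin \<sigma> ^ m) \<ge> 0"
    by (rule integral_nonneg[OF integrable_continuous_interval[OF c] nn])
  ultimately show ?thesis by (simp add: flux_def)
qed

text \<open>
  Subtracting the weighted mean makes every source solvable. The solution operator is thereby a
  bounded linear operator on a whole Banach space, so that \<open>C\<^sup>1\<close> dependence carries over, and on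
  sources of mean zero nothing is changed.
\<close>

definition centered :: "nat \<Rightarrow> (real \<Rightarrow>\<^sub>C real) \<Rightarrow> real \<Rightarrow> real" where
  "centered m h t = apply_bcontfun h t - flux m (apply_bcontfun h) pi / flux m (\<lambda>_. 1) pi"

lemma flux_add:
  fixes h k :: "real \<Rightarrow> real"
  assumes "continuous_on {0..x} h" "continuous_on {0..x} k"
  shows "flux m (\<lambda>\<sigma>. h \<sigma> + k \<sigma>) x = flux m h x + flux m k x"
proof -
  have "integral {0..x} (\<lambda>\<sigma>. sin \<sigma> ^ m *\<^sub>R h \<sigma> + sin \<sigma> ^ m *\<^sub>R k \<sigma>) = flux m h x + flux m k x"
    unfolding flux_def
    by (rule integral_add) (intro integrable_continuous_interval continuous_intros assms)+
  then show ?thesis by (simp add: flux_def distrib_left)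
qed

lemma flux_cmult: "flux m (\<lambda>\<sigma>. r * h \<sigma> :: real) x = r * flux m h x"
  unfolding flux_def using integral_cmul[of "{0..x}" r "\<lambda>\<sigma>. sin \<sigma> ^ m * h \<sigma>"] by (simp add: mult.left_commute)

lemma centered_props:
  shows "continuous_on A (centered m h)" "flux m (centered m h) pi = 0"
    "flux m (apply_bcontfun h) pi = 0 \<Longrightarrow> centered m h = apply_bcontfun h"
    "centered m (h + k) t = centered m h t + centered m k t"
    "centered m (r *\<^sub>R h) t = r * centered m h t"
    "t \<in> {0..pi} \<Longrightarrow> \<bar>centered m h t\<bar> \<le> 2 * norm h"
proof -
  note p = flux_one_pos[of m]
  have hc: "continuous_on B (apply_bcontfun h)" for B and h :: "real \<Rightarrow>\<^sub>C real" by simp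
  show "continuous_on A (centered m h)" unfolding centered_def[abs_def] by (intro continuous_intros hc)
  define r0 where "r0 = - flux m (apply_bcontfun h) pi / flux m (\<lambda>_. 1) pi"
  have "flux m (\<lambda>t. apply_bcontfun h t + r0 * 1) pi = flux m (apply_bcontfun h) pi + r0 * flux m (\<lambda>_. 1) pi"
    unfolding flux_cmult[symmetric] by (rule flux_add[OF hc]) (intro continuous_intros)
  also have "\<dots> = 0" using p by (simp add: r0_def)
  finally show "flux m (centered m h) pi = 0" by (simp add: centered_def[abs_def] r0_def)
  show "flux m (apply_bcontfun h) pi = 0 \<Longrightarrow> centered m h = apply_bcontfun h" by (simp add: centered_def fun_eq_iff)
  show "centered m (h + k) t = centered m h t + centered m k t"
    using flux_add[of pi "apply_bcontfun h" "apply_bcontfun k" m, OF hc hc] by (simp add: centered_def add_divide_distrib)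
  show "centered m (r *\<^sub>R h) t = r * centered m h t"
    using flux_cmult[of m r "apply_bcontfun h" pi] by (simp add: centered_def algebra_simps)
  assume "t \<in> {0..pi}"
  have "norm (flux m (apply_bcontfun h) pi) \<le> integral {0..pi} (\<lambda>\<sigma>. norm h * (sin \<sigma> ^ m * 1))"
    unfolding flux_def
  proof (rule integral_norm_bound_integral)
    fix \<sigma> :: real assume "\<sigma> \<in> {0..pi}"
    then have "sin \<sigma> ^ m \<ge> 0" by (simp add: sin_ge_zero)
    then show "norm (sin \<sigma> ^ m *\<^sub>R apply_bcontfun h \<sigma>) \<le> norm h * (sin \<sigma> ^ m * 1)"
      using norm_bounded[of h \<sigma>] by (simp add: abs_mult mult_right_mono mult.commute[of "sin \<sigma> ^ m"])
  qed (intro integrable_continuous_interval continuous_intros hc)+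
  also have "\<dots> = norm h * flux m (\<lambda>_. 1) pi" by (simp add: flux_def)
  finally have "\<bar>flux m (apply_bcontfun h) pi / flux m (\<lambda>_. 1) pi\<bar> \<le> norm h"
    using p by (simp add: pos_divide_le_eq)
  moreover have "\<bar>apply_bcontfun h t\<bar> \<le> norm h" using norm_bounded[of h t] by simp
  ultimately show "\<bar>centered m h t\<bar> \<le> 2 * norm h" unfolding centered_def by linarith
qed

lemma zonal_source_centered:
  "e \<in> usphere \<Longrightarrow> DIM('a) = m + 2 \<Longrightarrow> zonal_source (e :: 'a::euclidean_space) m (centered m h)"
  by unfold_locales (auto intro: centered_props)

lemma potential_add_pi:
  fixes h k :: "real \<Rightarrow> real"
  assumes "continuous_on {0..pi} h" "flux m h pi = 0" "continuous_on {0..pi} k" "flux m k pi = 0" "\<theta> \<in> {0..pi}"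
  shows "potential m (\<lambda>\<sigma>. h \<sigma> + k \<sigma>) \<theta> = potential m h \<theta> + potential m k \<theta>"
proof -
  have "potential m (\<lambda>\<sigma>. h \<sigma> + k \<sigma>) \<theta> = integral {0..\<theta>} (\<lambda>x. slope m h x + slope m k x)"
    unfolding potential_def
    by (intro integral_cong slope_add) (use assms(5) in \<open>auto intro: continuous_on_subset[OF assms(1)] continuous_on_subset[OF assms(3)]\<close>)
  also have "\<dots> = potential m h \<theta> + potential m k \<theta>"
    unfolding potential_def
    by (rule integral_add; intro integrable_continuous_interval continuous_on_subset[OF continuous_slope_pi[OF assms(1,2)]]
        continuous_on_subset[OF continuous_slope_pi[OF assms(3,4)]]) (use assms(5) in auto)
  finally show ?thesis .
qed

text \<open>
  The zonal solution with value \<open>fst w\<close> at the pole \<open>e\<close> of the Poisson equation whose right-hand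
  side is minus the centered \<open>snd w\<close>.
\<close>

definition zonal_op :: "'a::euclidean_space \<Rightarrow> nat \<Rightarrow> real \<times> (real \<Rightarrow>\<^sub>C real) \<Rightarrow> 'a C2_sphere" where
  "zonal_op e m w = Abs_C2 (\<lambda>x. if x \<in> usphere then fst w + potential m (centered m (snd w)) (arccos (x \<bullet> e)) else 0)"

lemma C2_fun_zonal_op:
  fixes e :: "'a::euclidean_space"
  assumes e: "e \<in> usphere" and dim: "DIM('a) = m + 2"
  shows "C2_fun (zonal_op e m w) x = (if x \<in> usphere then fst w + potential m (centered m (snd w)) (arccos (x \<bullet> e)) else 0)"
proof -
  interpret zonal_source e m "fst w" "centered m (snd w)" by (rule zonal_source_centered[OF e dim])
  have "C2_on_sphere (\<lambda>x. if x \<in> usphere then fst w + potential m (centered m (snd w)) (arccos (x \<bullet> e)) else 0)"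
    by (rule C2_cong[OF C2_u]) (simp add: u_eq)
  then show ?thesis unfolding zonal_op_def by (subst Abs_C2_inverse) auto
qed

lemma laplace_cong:
  assumes "x \<in> usphere" "\<And>y. y \<in> usphere \<Longrightarrow> f y = g y"
  shows "laplace_beltrami f x = laplace_beltrami g x"
proof -
  have "tderiv (grad f) x = tderiv (grad g) x"
    by (rule tderiv_cong[OF assms(1)]) (rule grad_cong, use assms(2) in auto)
  then show ?thesis by (simp add: laplace_beltrami_def divergence_def cov_deriv_def)
qed

lemma laplace_zonal_op:
  fixes e :: "'a::euclidean_space"
  assumes e: "e \<in> usphere" and dim: "DIM('a) = m + 2" and x: "x \<in> usphere"
  shows "laplace_beltrami (C2_fun (zonal_op e m w)) x = - centered m (snd w) (arccos (x \<bullet> e))"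
proof -
  interpret zonal_source e m "fst w" "centered m (snd w)" by (rule zonal_source_centered[OF e dim])
  have "laplace_beltrami (C2_fun (zonal_op e m w)) x = laplace_beltrami u x"
    by (rule laplace_cong[OF x]) (simp add: C2_fun_zonal_op[OF e dim] u_eq)
  then show ?thesis using laplace_source[OF x] by simp
qed

lemma bounded_linear_zonal_op:
  fixes e :: "'a::euclidean_space"
  assumes e: "e \<in> usphere" and dim: "DIM('a) = m + 2"
  shows "bounded_linear (zonal_op e m)"
proof -
  obtain K where K: "K \<ge> 0" "\<And>(e::'a) c h B (x::'a). zonal_source e m h \<Longrightarrow> (\<And>\<sigma>. \<sigma> \<in> {0..pi} \<Longrightarrow> \<bar>h \<sigma>\<bar> \<le> B) \<Longrightarrow>
     x \<in> usphere \<Longrightarrow> C2_pnorm (\<lambda>x. c + potential m h (arccos (x \<bullet> e))) x \<le> \<bar>c\<bar> + K * B"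
    using zonal_source_bound[of m, where 'a = 'a] by blast
  note Z = C2_fun_zonal_op[OF e dim]
  have eqI: "u = v" if "\<And>x. C2_fun u x = C2_fun v x" for u v :: "'a C2_sphere"
    using that by (metis C2_fun_inject ext)
  have arc: "arccos (x \<bullet> e) \<in> {0..pi}" if "x \<in> usphere" for x
    using axis_grad(4)[OF that e] by (auto intro: arccos_lbound arccos_ubound)
  show ?thesis
  proof (rule bounded_linear_intro)
    show "zonal_op e m (w + w') = zonal_op e m w + zonal_op e m w'" for w w'
      by (rule eqI) (auto simp: Z plus_C2_sphere.rep_eq centered_props(4)[abs_def]
          potential_add_pi[OF centered_props(1,2) centered_props(1,2) arc])
    show "zonal_op e m (r *\<^sub>R w) = r *\<^sub>R zonal_op e m w" for r w
      using potential_scaleR[of m r "centered m (snd w)"]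
      by (intro eqI) (auto simp: Z scaleR_C2_sphere.rep_eq centered_props(5)[abs_def] algebra_simps)
    show "norm (zonal_op e m w) \<le> norm w * (1 + 2 * K)" for w
      unfolding norm_C2_sphere_def
    proof (rule cSUP_least[OF usphere_nonempty])
      fix x :: 'a assume x: "x \<in> usphere"
      have "C2_pnorm (C2_fun (zonal_op e m w)) x = C2_pnorm (\<lambda>x. fst w + potential m (centered m (snd w)) (arccos (x \<bullet> e))) x"
        by (rule C2_pnorm_cong[OF x]) (simp add: Z)
      also have "\<dots> \<le> \<bar>fst w\<bar> + K * (2 * norm (snd w))"
        by (rule K(2)[OF zonal_source_centered[OF e dim] centered_props(6) x])
      also have "\<dots> \<le> norm w + K * (2 * norm w)"
        using norm_fst_le[of "fst w" "snd w"] norm_snd_le[of "snd w" "fst w"] K(1)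
        by (intro add_mono mult_left_mono) auto
      finally show "C2_pnorm (C2_fun (zonal_op e m w)) x \<le> norm w * (1 + 2 * K)" by (simp add: algebra_simps)
    qed
  qed
qed

text \<open>
  The extension from the hemisphere with parity \<open>\<sigma>\<close> (\<open>1\<close> or \<open>-1\<close>) about the equator. On either
  side of the equator one of the clamped terms is stuck at \<open>h (pi/2)\<close>; the last term removes it
  for \<open>\<sigma> = 1\<close>. For \<open>\<sigma> = - 1\<close> the value \<open>h (pi/2)\<close> has to vanish by itself. The formula is linear
  in \<open>h\<close>, so no condition at the equator is needed for boundedness.
\<close>

definition extend :: "real \<Rightarrow> (real \<Rightarrow>\<^sub>C real) \<Rightarrow> (real \<Rightarrow>\<^sub>C real)" where
  "extend \<sigma> h = Bcontfun (\<lambda>t. apply_bcontfun h (qclamp t) + \<sigma> * apply_bcontfun h (qclamp (pi - t)) - (1 + \<sigma>) / 2 * apply_bcontfun h (pi/2))"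

lemma extend_apply:
  "apply_bcontfun (extend \<sigma> h) t = apply_bcontfun h (qclamp t) + \<sigma> * apply_bcontfun h (qclamp (pi - t)) - (1 + \<sigma>) / 2 * apply_bcontfun h (pi/2)"
proof -
  have hc: "continuous_on B (apply_bcontfun h)" for B by simp
  have "(\<lambda>t. apply_bcontfun h (qclamp t) + \<sigma> * apply_bcontfun h (qclamp (pi - t)) - (1 + \<sigma>) / 2 * apply_bcontfun h (pi/2)) \<in> bcontfun"
  proof (rule bcontfun_normI)
    show "continuous_on UNIV (\<lambda>t. apply_bcontfun h (qclamp t) + \<sigma> * apply_bcontfun h (qclamp (pi - t)) - (1 + \<sigma>) / 2 * apply_bcontfun h (pi/2))"
      by (intro continuous_intros continuous_on_compose2[OF hc[of UNIV]] continuous_on_compose2[OF qclamp(3)[of UNIV]]) auto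
    show "norm (apply_bcontfun h (qclamp t) + \<sigma> * apply_bcontfun h (qclamp (pi - t)) - (1 + \<sigma>) / 2 * apply_bcontfun h (pi/2))
        \<le> norm h + \<bar>\<sigma>\<bar> * norm h + \<bar>(1 + \<sigma>) / 2\<bar> * norm h" for t
      using norm_bounded[of h] unfolding real_norm_def
      by (intro order_trans[OF abs_triangle_ineq4] order_trans[OF abs_triangle_ineq] add_mono) (auto simp: abs_mult intro!: mult_left_mono mult_mono)
  qed
  then show ?thesis by (simp add: extend_def Bcontfun_inverse)
qed

lemma bounded_linear_extend: "bounded_linear (extend \<sigma>)"
proof (rule bounded_linear_intro)
  show "norm (extend \<sigma> h) \<le> norm h * (1 + \<bar>\<sigma>\<bar> + \<bar>(1 + \<sigma>) / 2\<bar>)" for h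
  proof (rule norm_bound)
    fix t
    have "\<bar>apply_bcontfun h (qclamp t) + \<sigma> * apply_bcontfun h (qclamp (pi - t)) - (1 + \<sigma>) / 2 * apply_bcontfun h (pi/2)\<bar>
        \<le> norm h + \<bar>\<sigma>\<bar> * norm h + \<bar>(1 + \<sigma>) / 2\<bar> * norm h"
      using norm_bounded[of h] unfolding real_norm_def
      by (intro order_trans[OF abs_triangle_ineq4] order_trans[OF abs_triangle_ineq] add_mono) (auto simp: abs_mult intro!: mult_left_mono mult_mono)
    then show "norm (apply_bcontfun (extend \<sigma> h) t) \<le> norm h * (1 + \<bar>\<sigma>\<bar> + \<bar>(1 + \<sigma>) / 2\<bar>)"
      by (simp add: extend_apply algebra_simps)
  qed
qed (auto intro!: bcontfun_eqI simp: extend_apply algebra_simps)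

text \<open>
  The equator conditions are exactly what makes the reflected source continuous and of mean zero,
  and the reflected solution solve the equation across the equator.
\<close>

lemma parity_extension:
  assumes \<sigma>: "\<sigma> = 1 \<or> \<sigma> = - 1"
    and even: "\<sigma> = 1 \<longrightarrow> flux m (apply_bcontfun h) (pi/2) = 0"
    and odd: "\<sigma> = - 1 \<longrightarrow> apply_bcontfun h (pi/2) = 0 \<and> c + potential m (apply_bcontfun h) (pi/2) = 0"
  shows "centered m (extend \<sigma> h) = apply_bcontfun (extend \<sigma> h)"
    and "\<theta> \<in> {0..pi/2} \<Longrightarrow> apply_bcontfun (extend \<sigma> h) \<theta> = apply_bcontfun h \<theta>"
    and "\<theta> \<in> {0..pi} \<Longrightarrow> apply_bcontfun (extend \<sigma> h) (pi - \<theta>) = \<sigma> * apply_bcontfun (extend \<sigma> h) \<theta>"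
    and "\<theta> \<in> {0..pi/2} \<Longrightarrow> potential m (apply_bcontfun (extend \<sigma> h)) \<theta> = potential m (apply_bcontfun h) \<theta>"
    and "\<theta> \<in> {0..pi} \<Longrightarrow> c + potential m (apply_bcontfun (extend \<sigma> h)) (pi - \<theta>) = \<sigma> * (c + potential m (apply_bcontfun (extend \<sigma> h)) \<theta>)"
proof -
  let ?k = "apply_bcontfun (extend \<sigma> h)"
  have kc: "continuous_on B ?k" for B by simp
  show 2: "?k \<theta> = apply_bcontfun h \<theta>" if t: "\<theta> \<in> {0..pi/2}" for \<theta>
  proof -
    have r: "qclamp (pi - \<theta>) = pi/2" using t by (auto simp: qclamp_def min_def max_def)
    show ?thesis using \<sigma> odd unfolding extend_apply qclamp(2)[OF t] r by auto
  qed
  have s2: "\<sigma> * \<sigma> = 1" using \<sigma> by auto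
  show 3: "?k (pi - \<theta>) = \<sigma> * ?k \<theta>" for \<theta>
    using \<sigma> by (auto simp: extend_apply)
  have fh: "flux m ?k x = flux m (apply_bcontfun h) x" if "x \<in> {0..pi/2}" for x
    unfolding flux_def by (intro integral_cong) (use that 2 in auto)
  have refl: "flux m ?k (pi - x) + \<sigma> * flux m ?k x = flux m ?k pi" if "x \<in> {0..pi}" for x
    using flux_reflect[OF kc that, of m] by (simp add: 3[abs_def] flux_cmult)
  have f0: "flux m ?k pi = 0"
    using \<sigma>
  proof
    assume s: "\<sigma> = 1"
    have "flux m ?k (pi/2) = 0" using fh[of "pi/2"] even s pi_half_less by simp
    then show ?thesis using refl[of "pi/2"] s pi_half_less by simp
  next
    assume s: "\<sigma> = - 1"
    show ?thesis using refl[of "pi/2"] s pi_half_less by simp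
  qed
  show 1: "centered m (extend \<sigma> h) = ?k" by (rule centered_props(3)[OF f0])
  show 4: "potential m ?k \<theta> = potential m (apply_bcontfun h) \<theta>" if t: "\<theta> \<in> {0..pi/2}" for \<theta>
    unfolding potential_def
  proof (intro integral_cong)
    fix x assume "x \<in> {0..\<theta>}"
    then have "x \<in> {0..pi/2}" using t by auto
    then show "slope m ?k x = slope m (apply_bcontfun h) x" by (simp add: slope_def fh)
  qed
  have sl: "slope m ?k (pi - x) = - \<sigma> * slope m ?k x" if x: "x \<in> {0..pi}" for x
  proof -
    have "flux m ?k (pi - x) = - \<sigma> * flux m ?k x" using refl[OF x] f0 by simp
    then show ?thesis using f0 by (auto simp: slope_def)
  qed
  let ?W = "\<lambda>x. (c + potential m ?k (pi - x)) - \<sigma> * (c + potential m ?k x)"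
  have dW: "(?W has_vector_derivative 0) (at x within {0..pi})" if x: "x \<in> {0..pi}" for x
  proof -
    have "((\<lambda>x. pi - x) has_vector_derivative -1) (at x within {0..pi})"
      by (auto intro!: derivative_eq_intros)
    moreover have "(potential m ?k has_vector_derivative slope m ?k (pi - x)) (at (pi - x) within (\<lambda>x. pi - x) ` {0..pi})"
      by (rule has_vector_derivative_within_subset[OF potential_deriv_pi[OF kc f0]]) (use x in auto)
    ultimately have "((potential m ?k \<circ> (\<lambda>x. pi - x)) has_vector_derivative (-1) *\<^sub>R slope m ?k (pi - x)) (at x within {0..pi})"
      by (rule vector_diff_chain_within)
    from has_vector_derivative_diff[OF has_vector_derivative_add[OF has_vector_derivative_const this, of c]
        has_vector_derivative_mult_right[OF has_vector_derivative_add[OF has_vector_derivative_const potential_deriv_pi[OF kc f0 x]], of \<sigma> c]]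
    show ?thesis using sl[OF x] by (simp add: o_def)
  qed
  have "\<exists>d. \<forall>x\<in>{0..pi}. ?W x = d"
    by (rule has_vector_derivative_zero_constant[OF convex_real_interval(5) dW]) blast+
  then obtain d where "\<forall>x\<in>{0..pi}. ?W x = d" by blast
  note d = this[rule_format]
  have h2: "pi/2 \<in> {0..pi}" "pi/2 \<in> {0..pi/2}" "pi - pi/2 = pi/2" using pi_half_less by auto
  have w0: "?W (pi/2) = 0"
    using \<sigma> odd 4[OF h2(2)] unfolding h2(3) by auto
  have "d = 0" using w0 unfolding d[OF h2(1)] .
  then show "c + potential m ?k (pi - \<theta>) = \<sigma> * (c + potential m ?k \<theta>)" if "\<theta> \<in> {0..pi}" for \<theta>
    using d[OF that] by simp
qed

section \<open>The branch of non-synchronized solutions\<close>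

lemma bounded_linear_postcompose:
  fixes L :: "'e::real_normed_vector \<Rightarrow> 'f::real_normed_vector"
  assumes L: "bounded_linear L"
  obtains P :: "(real \<Rightarrow>\<^sub>C 'e) \<Rightarrow> (real \<Rightarrow>\<^sub>C 'f)" where "bounded_linear P"
    "\<And>h t. apply_bcontfun (P h) t = L (apply_bcontfun h t)"
proof -
  interpret bounded_linear L by fact
  obtain K where K: "\<And>x. norm (L x) \<le> norm x * K" "K \<ge> 0" using nonneg_bounded by blast
  have b: "norm (L (apply_bcontfun h t)) \<le> norm h * K" for h t
    by (rule order_trans[OF K(1)]) (intro mult_right_mono norm_bounded K)
  define P where "P h = Bcontfun (\<lambda>t. L (apply_bcontfun h t))" for h :: "real \<Rightarrow>\<^sub>C 'e"
  have hc: "continuous_on UNIV (apply_bcontfun h)" for h :: "real \<Rightarrow>\<^sub>C 'e" by simp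
  have P: "apply_bcontfun (P h) t = L (apply_bcontfun h t)" for h t
    unfolding P_def by (subst Bcontfun_inverse) (auto intro!: bcontfun_normI[where b = "norm h * K"] b continuous_on hc)
  have "bounded_linear P"
  proof (rule bounded_linear_intro)
    show "norm (P h) \<le> norm h * K" for h by (rule norm_bound) (simp add: P b)
  qed (auto intro!: bcontfun_eqI simp: P add scale)
  then show ?thesis using that P by blast
qed

context symmetric_system
begin

text \<open>
  The functions \<open>p\<close> and \<open>r\<close> are obtained from the sources of the hemisphere problem by bounded
  linear operators, so they are \<open>C\<^sup>1\<close> in \<open>s\<close> with values in \<open>C\<^sup>2\<close> functions. On the reflected
  hemisphere \<open>p\<close> takes the same values and \<open>r\<close> is multiplied by the parity; since the even part of
  the nonlinearity is even and the odd part is odd in \<open>r\<close>, the equations hold there as well.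
\<close>

theorem zonal_branch:
  fixes e :: "'a::euclidean_space"
  assumes e: "e \<in> usphere" and dim: "DIM('a) = m + 2"
    and j: "j \<ge> 1" and res: "(q - 2) * beta 0 = real j * (real j + real m)"
    and nonres: "\<And>i. i \<ge> 1 \<Longrightarrow> (q - 2) * lam 0 \<noteq> 2 * real i * (2 * real i + real m)"
    and lam0: "lam 0 \<noteq> 0"
    and \<beta>: "(beta has_real_derivative \<beta>') (at 0)" "\<beta>' \<noteq> 0"
  obtains \<eta> \<alpha> and u1 u2 :: "real \<Rightarrow> 'a C2_sphere" where "\<eta> > 0" "\<alpha> 0 = 0" "u1 0 = C2_const (pbar 0)" "u2 0 = C2_const (pbar 0)"
    "C1_on (ball 0 \<eta>) \<alpha>" "C1_on (ball 0 \<eta>) u1" "C1_on (ball 0 \<eta>) u2"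
    "\<And>s. s \<in> ball 0 \<eta> \<Longrightarrow> is_solution ({0<..} \<times> {0<..}) (S_rhs1 q lam a b) (S_rhs2 q lam b a) (\<alpha> s) (u1 s) (u2 s)"
    "\<And>s. s \<in> ball 0 \<eta> \<Longrightarrow> C2_fun (u1 s) e - C2_fun (u2 s) e = 2 * s"
proof (rule profile_branch[OF j res nonres lam0 \<beta>])
  fix \<eta> \<alpha> \<zeta> y h
  assume \<eta>: "\<eta> > 0" and at0: "\<alpha> 0 = 0" "\<zeta> 0 = 0" "\<And>t. fst (apply_bcontfun (y 0) t) = 0"
    and C: "C1_on (ball 0 \<eta>) \<alpha>" "C1_on (ball 0 \<eta>) \<zeta>" "C1_on (ball 0 \<eta>) y" "C1_on (ball 0 \<eta>) h"
    and tub: "\<And>s. s \<in> ball 0 \<eta> \<Longrightarrow> ((s, \<alpha> s, \<zeta> s), y s) \<in> tube fdom"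
    and hs: "\<And>s. s \<in> ball 0 \<eta> \<Longrightarrow> h s = superpose field ((s, \<alpha> s, \<zeta> s), y s)"
    and ys: "\<And>s. s \<in> ball 0 \<eta> \<Longrightarrow> y s = const_bcontfun (\<zeta> s, 1) + solve_op m (h s)"
    and bc1: "\<And>s. s \<in> ball 0 \<eta> \<Longrightarrow> fst (flux m (apply_bcontfun (h s)) (pi/2)) = 0"
    and bc2: "\<And>s. s \<in> ball 0 \<eta> \<Longrightarrow> if even j then snd (flux m (apply_bcontfun (h s)) (pi/2)) = 0
        else snd (apply_bcontfun (y s) (pi/2)) = 0"
  obtain Pf :: "(real \<Rightarrow>\<^sub>C (real \<times> real)) \<Rightarrow> (real \<Rightarrow>\<^sub>C real)" where Pf: "bounded_linear Pf"
    "\<And>h t. apply_bcontfun (Pf h) t = fst (apply_bcontfun h t)"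
    using bounded_linear_postcompose[OF bounded_linear_fst] by blast
  obtain Ps :: "(real \<Rightarrow>\<^sub>C (real \<times> real)) \<Rightarrow> (real \<Rightarrow>\<^sub>C real)" where Ps: "bounded_linear Ps"
    "\<And>h t. apply_bcontfun (Ps h) t = snd (apply_bcontfun h t)"
    using bounded_linear_postcompose[OF bounded_linear_snd] by blast
  define \<sigma> :: real where "\<sigma> = (if even j then 1 else - 1)"
  have \<sigma>: "\<sigma> = 1 \<or> \<sigma> = - 1" by (simp add: \<sigma>_def)
  define p where "p s = zonal_op e m (pbar (\<alpha> s) + \<zeta> s, extend 1 (Pf (h s)))" for s
  define r where "r s = zonal_op e m (1, extend \<sigma> (Ps (h s)))" for s
  define u1 where "u1 s = p s + s *\<^sub>R r s" for s
  define u2 where "u2 s = p s - s *\<^sub>R r s" for s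
  have hp: "pi/2 \<in> {0..pi/2}" using pi_half_less(2) by simp
  have hc: "continuous_on A (apply_bcontfun k)" for A and k :: "real \<Rightarrow>\<^sub>C (real \<times> real)" by simp
  have cf: "continuous_on fdom field" by (rule C1_on_continuous[OF C1_field])
  have \<alpha>I: "\<alpha> s \<in> {-\<epsilon><..<\<epsilon>}" if "s \<in> ball 0 \<eta>" for s
    using tub[OF that] by (simp add: tube_def fdom_def)
  have ht: "apply_bcontfun (h s) t = field ((s, \<alpha> s, \<zeta> s), apply_bcontfun (y s) t)"
    and wt: "(pbar (\<alpha> s) + fst (apply_bcontfun (y s) t), s * snd (apply_bcontfun (y s) t)) \<in> wedge"
    if s: "s \<in> ball 0 \<eta>" and t: "t \<in> {0..pi/2}" for s t
  proof -
    show "apply_bcontfun (h s) t = field ((s, \<alpha> s, \<zeta> s), apply_bcontfun (y s) t)"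
      unfolding hs[OF s] superpose_apply[OF cf tub[OF s]] qclamp(2)[OF t] by simp
    have "((s, \<alpha> s, \<zeta> s), apply_bcontfun (y s) (qclamp t)) \<in> fdom" using tub[OF s] by (simp add: tube_def)
    then show "(pbar (\<alpha> s) + fst (apply_bcontfun (y s) t), s * snd (apply_bcontfun (y s) t)) \<in> wedge"
      unfolding qclamp(2)[OF t] by (simp add: fdom_def coords_def dom3_def case_prod_unfold)
  qed
  have yt: "fst (apply_bcontfun (y s) t) = \<zeta> s + potential m (apply_bcontfun (Pf (h s))) t"
    "snd (apply_bcontfun (y s) t) = 1 + potential m (apply_bcontfun (Ps (h s))) t"
    if s: "s \<in> ball 0 \<eta>" and t: "t \<in> {0..pi/2}" for s t
  proof -
    have t': "t < pi" using t pi_half_less(1) by (meson atLeastAtMost_iff le_less_trans)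
    have e1: "apply_bcontfun (y s) t = (\<zeta> s, 1) + potential m (apply_bcontfun (h s)) t"
      by (subst ys[OF s]) (simp add: solve_op_apply qclamp(2)[OF t])
    show "fst (apply_bcontfun (y s) t) = \<zeta> s + potential m (apply_bcontfun (Pf (h s))) t"
      unfolding e1 Pf(2)[abs_def] using potential_linear[OF bounded_linear_fst hc t', of m "h s"] by simp
    show "snd (apply_bcontfun (y s) t) = 1 + potential m (apply_bcontfun (Ps (h s))) t"
      unfolding e1 Ps(2)[abs_def] using potential_linear[OF bounded_linear_snd hc t', of m "h s"] by simp
  qed
  have evP: "flux m (apply_bcontfun (Pf (h s))) (pi/2) = 0" if "s \<in> ball 0 \<eta>" for s
    unfolding Pf(2)[abs_def] flux_linear[OF bounded_linear_fst hc] by (rule bc1[OF that])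
  have evR: "flux m (apply_bcontfun (Ps (h s))) (pi/2) = 0" if "s \<in> ball 0 \<eta>" "\<sigma> = 1" for s
    unfolding Ps(2)[abs_def] flux_linear[OF bounded_linear_snd hc] using bc2[OF that(1)] that(2)
    by (simp add: \<sigma>_def split: if_splits)
  have odR: "apply_bcontfun (Ps (h s)) (pi/2) = 0 \<and> 1 + potential m (apply_bcontfun (Ps (h s))) (pi/2) = 0"
    if "s \<in> ball 0 \<eta>" "\<sigma> = - 1" for s
  proof -
    have "snd (apply_bcontfun (y s) (pi/2)) = 0" using bc2[OF that(1)] that(2) by (simp add: \<sigma>_def split: if_splits)
    then show ?thesis using yt(2)[OF that(1) hp] ht[OF that(1) hp] by (simp add: Ps(2) field_def)
  qed
  \<comment> \<open>Every point of the sphere is compared with a point of the hemisphere, up to a sign \<open>\<kappa>\<close> of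
    \<open>r\<close>.\<close>
  have main: "\<exists>t \<kappa>. t \<in> {0..pi/2} \<and> (\<kappa> = 1 \<or> \<kappa> = - 1) \<and>
      C2_fun (p s) x = pbar (\<alpha> s) + fst (apply_bcontfun (y s) t) \<and> C2_fun (r s) x = \<kappa> * snd (apply_bcontfun (y s) t) \<and>
      laplace_beltrami (C2_fun (p s)) x = - fst (apply_bcontfun (h s) t) \<and>
      laplace_beltrami (C2_fun (r s)) x = - (\<kappa> * snd (apply_bcontfun (h s) t))"
    if s: "s \<in> ball 0 \<eta>" and x: "x \<in> usphere" for s x
  proof -
    define \<theta> where "\<theta> = arccos (x \<bullet> e)"
    have \<theta>: "\<theta> \<in> {0..pi}"
      using axis_grad(4)[OF x e] by (auto simp: \<theta>_def intro: arccos_lbound arccos_ubound)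
    have c1: "(1::real) = 1 \<longrightarrow> flux m (apply_bcontfun (Pf (h s))) (pi/2) = 0"
      "(1::real) = - 1 \<longrightarrow> apply_bcontfun (Pf (h s)) (pi/2) = 0 \<and> pbar (\<alpha> s) + \<zeta> s + potential m (apply_bcontfun (Pf (h s))) (pi/2) = 0"
      using evP[OF s] by simp_all
    have c2: "\<sigma> = 1 \<longrightarrow> flux m (apply_bcontfun (Ps (h s))) (pi/2) = 0"
      "\<sigma> = - 1 \<longrightarrow> apply_bcontfun (Ps (h s)) (pi/2) = 0 \<and> 1 + potential m (apply_bcontfun (Ps (h s))) (pi/2) = 0"
      using evR[OF s] odR[OF s] by blast+
    note P = parity_extension[OF disjI1[OF refl] c1]
    note R = parity_extension[OF \<sigma> c2]
    have vals: "C2_fun (p s) x = pbar (\<alpha> s) + \<zeta> s + potential m (apply_bcontfun (extend 1 (Pf (h s)))) \<theta>"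
      "C2_fun (r s) x = 1 + potential m (apply_bcontfun (extend \<sigma> (Ps (h s)))) \<theta>"
      "laplace_beltrami (C2_fun (p s)) x = - apply_bcontfun (extend 1 (Pf (h s))) \<theta>"
      "laplace_beltrami (C2_fun (r s)) x = - apply_bcontfun (extend \<sigma> (Ps (h s))) \<theta>"
      using x P(1) R(1) by (simp_all add: p_def r_def C2_fun_zonal_op[OF e dim] laplace_zonal_op[OF e dim x] \<theta>_def)
    show ?thesis
    proof (cases "\<theta> \<le> pi/2")
      case True
      then have t: "\<theta> \<in> {0..pi/2}" using \<theta> by simp
      show ?thesis
        by (rule exI[of _ \<theta>], rule exI[of _ 1], intro conjI t) (simp_all add: vals P(2)[OF t] P(4)[OF t] R(2)[OF t] R(4)[OF t] yt[OF s t] Pf(2) Ps(2))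
    next
      case False
      then have t: "pi - \<theta> \<in> {0..pi/2}" using \<theta> by auto
      then have t2: "pi - \<theta> \<in> {0..pi}" using pi_half_less by auto
      have f: "pi - (pi - \<theta>) = \<theta>" by simp
      have "\<sigma> * (1 + potential m (apply_bcontfun (extend \<sigma> (Ps (h s)))) (pi - \<theta>)) = 1 + potential m (apply_bcontfun (extend \<sigma> (Ps (h s)))) \<theta>"
        using R(5)[OF t2] unfolding f by simp
      moreover have "pbar (\<alpha> s) + \<zeta> s + potential m (apply_bcontfun (extend 1 (Pf (h s)))) (pi - \<theta>) = pbar (\<alpha> s) + \<zeta> s + potential m (apply_bcontfun (extend 1 (Pf (h s)))) \<theta>"
        using P(5)[OF t2] unfolding f by simp
      moreover have "apply_bcontfun (extend \<sigma> (Ps (h s))) \<theta> = \<sigma> * apply_bcontfun (extend \<sigma> (Ps (h s))) (pi - \<theta>)"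
        using R(3)[OF t2] unfolding f by simp
      moreover have "apply_bcontfun (extend 1 (Pf (h s))) \<theta> = apply_bcontfun (extend 1 (Pf (h s))) (pi - \<theta>)"
        using P(3)[OF t2] unfolding f by simp
      ultimately show ?thesis
        using t \<sigma> by (rule_tac exI[of _ "pi - \<theta>"], rule_tac exI[of _ \<sigma>], intro conjI) (simp_all add: vals P(2)[OF t] P(4)[OF t] R(2)[OF t] R(4)[OF t] yt[OF s t] Pf(2) Ps(2))
    qed
  qed
  have sol: "is_solution ({0<..} \<times> {0<..}) (S_rhs1 q lam a b) (S_rhs2 q lam b a) (\<alpha> s) (u1 s) (u2 s)"
    if s: "s \<in> ball 0 \<eta>" for s
    unfolding is_solution_def
  proof
    fix x :: 'a assume x: "x \<in> usphere"
    obtain t \<kappa> where t: "t \<in> {0..pi/2}" and \<kappa>: "\<kappa> = 1 \<or> \<kappa> = - 1"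
      and v: "C2_fun (p s) x = pbar (\<alpha> s) + fst (apply_bcontfun (y s) t)" "C2_fun (r s) x = \<kappa> * snd (apply_bcontfun (y s) t)"
      "laplace_beltrami (C2_fun (p s)) x = - fst (apply_bcontfun (h s) t)"
      "laplace_beltrami (C2_fun (r s)) x = - (\<kappa> * snd (apply_bcontfun (h s) t))"
      using main[OF s x] by blast
    define P where "P = pbar (\<alpha> s) + fst (apply_bcontfun (y s) t)"
    define R where "R = s * snd (apply_bcontfun (y s) t)"
    have w: "(P, R) \<in> wedge" unfolding P_def R_def by (rule wt[OF s t])
    then have w': "(P, \<kappa> * R) \<in> wedge" using \<kappa> by (auto simp: wedge_def)
    have par: "even_part (\<alpha> s, P, \<kappa> * R) = even_part (\<alpha> s, P, R)" "odd_part (\<alpha> s, P, \<kappa> * R) = odd_part (\<alpha> s, P, R)"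
      using \<kappa> parts_reflect w by auto
    have hh: "fst (apply_bcontfun (h s) t) = - even_part (\<alpha> s, P, R)" "s * snd (apply_bcontfun (h s) t) = - (R * odd_part (\<alpha> s, P, R))"
      by (simp_all add: ht[OF s t] field_def coords_def P_def R_def case_prod_unfold)
    have f1: "C2_fun (u1 s) = (\<lambda>x. C2_fun (p s) x + s * C2_fun (r s) x)"
      by (simp add: u1_def plus_C2_sphere.rep_eq scaleR_C2_sphere.rep_eq fun_eq_iff)
    have u2': "u2 s = p s + (- s) *\<^sub>R r s" by (simp add: u2_def)
    have f2: "C2_fun (u2 s) = (\<lambda>x. C2_fun (p s) x + (- s) * C2_fun (r s) x)"
      unfolding u2' by (simp only: plus_C2_sphere.rep_eq scaleR_C2_sphere.rep_eq)
    have l1: "laplace_beltrami (C2_fun (u1 s)) x = even_part (\<alpha> s, P, R) + \<kappa> * (R * odd_part (\<alpha> s, P, R))"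
      unfolding f1 laplace_add[OF C2_fun_C2 C2_scale[OF C2_fun_C2] x] laplace_scale[OF C2_fun_C2 x] v(3,4)
      using hh by (simp add: algebra_simps)
    have l2: "laplace_beltrami (C2_fun (u2 s)) x = even_part (\<alpha> s, P, R) - \<kappa> * (R * odd_part (\<alpha> s, P, R))"
      unfolding f2 laplace_add[OF C2_fun_C2 C2_scale[OF C2_fun_C2] x] laplace_scale[OF C2_fun_C2 x] v(3,4)
      using hh by (simp add: algebra_simps)
    have e1: "C2_fun (u1 s) x = P + \<kappa> * R" "C2_fun (u2 s) x = P - \<kappa> * R"
      by (simp_all add: f1 f2 v P_def R_def)
    show "(C2_fun (u1 s) x, C2_fun (u2 s) x) \<in> {0<..} \<times> {0<..} \<and>
        laplace_beltrami (C2_fun (u1 s)) x = S_rhs1 q lam a b (\<alpha> s, C2_fun (u1 s) x, C2_fun (u2 s) x) \<and>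
        laplace_beltrami (C2_fun (u2 s)) x = S_rhs2 q lam b a (\<alpha> s, C2_fun (u1 s) x, C2_fun (u2 s) x)"
      unfolding l1 l2 e1 rhs_decomposition[OF w'] par using w' by (auto simp: wedge_def)
  qed
  have C1p: "C1_on (ball 0 \<eta>) p"
    unfolding p_def[abs_def]
    by (intro C1_on_linear_image[OF bounded_linear_zonal_op[OF e dim]] C1_on_Pair C1_on_add C(2)
        C1_on_compose[OF C(1) C1_pbar] C1_on_linear_image[OF bounded_linear_extend] C1_on_linear_image[OF Pf(1)] C(4))
       (use \<alpha>I in blast)
  have C1r: "C1_on (ball 0 \<eta>) (\<lambda>s. s *\<^sub>R r s)"
    unfolding r_def[abs_def]
    by (intro C1_on_bilinear[OF bounded_bilinear_scaleR] C1_on_bounded_linear bounded_linear_ident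
        C1_on_linear_image[OF bounded_linear_zonal_op[OF e dim]] C1_on_Pair C1_on_const
        C1_on_linear_image[OF bounded_linear_extend] C1_on_linear_image[OF Ps(1)] C(4))
  have z0: "0 \<in> ball (0::real) \<eta>" using \<eta> by simp
  have eqI: "u = v" if "\<And>x. C2_fun u x = C2_fun v x" for u v :: "'a C2_sphere"
    using that by (metis C2_fun_inject ext)
  have p0: "p 0 = C2_const (pbar 0)"
  proof (rule eqI)
    fix x :: 'a
    show "C2_fun (p 0) x = C2_fun (C2_const (pbar 0)) x"
    proof (cases "x \<in> usphere")
      case True
      then show ?thesis using main[OF z0 True] at0 by (auto simp: C2_const.rep_eq)
    next
      case False
      then show ?thesis by (simp add: C2_const.rep_eq p_def C2_fun_zonal_op[OF e dim])
    qed
  qed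
  have ee: "e \<bullet> e = 1" using e by (simp add: norm_eq_1)
  have re: "C2_fun (r s) e = 1" for s
    using e by (simp add: r_def C2_fun_zonal_op[OF e dim] ee)
  have u2': "u2 s = p s + (- s) *\<^sub>R r s" for s by (simp add: u2_def)
  have diffe: "C2_fun (u1 s) e - C2_fun (u2 s) e = 2 * s" for s
    unfolding u1_def u2' plus_C2_sphere.rep_eq scaleR_C2_sphere.rep_eq re by simp
  show thesis
  proof (rule that[of \<eta> \<alpha> u1 u2])
    show "C1_on (ball 0 \<eta>) u1" "C1_on (ball 0 \<eta>) u2"
      unfolding u1_def[abs_def] u2_def[abs_def] by (intro C1_on_add C1_on_diff C1p C1r)+
    show "u1 0 = C2_const (pbar 0)" "u2 0 = C2_const (pbar 0)" by (simp_all add: u1_def u2_def p0)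
  qed (use \<eta> at0 C sol diffe in auto)
qed

end

text \<open>
  If \<open>u2 = \<Lambda> * u1\<close>, linearity of the Laplacian forces the coefficients of \<open>u1\<close> and \<open>u2\<close> in the two
  equations to coincide, and their difference is \<open>(a - b) * (u1 powr (q - 2) - u2 powr (q - 2))\<close>.
\<close>

lemma synchronized_imp_equal:
  assumes S: "solves_S q lam a b a u1 u2" and q: "q > 2" and ab: "a \<noteq> b"
    and sy: "synchronized u1 u2" and x: "x \<in> usphere"
  shows "C2_fun u1 x = C2_fun u2 x"
proof -
  obtain \<Lambda> where L: "\<And>y. y \<in> usphere \<Longrightarrow> C2_fun u2 y = \<Lambda> * C2_fun u1 y"
    using sy unfolding synchronized_def by blast
  note pos = solves_S_laplace(3,4)[OF S x]
  have "laplace_beltrami (C2_fun u2) x = laplace_beltrami (\<lambda>y. \<Lambda> * C2_fun u1 y) x"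
    by (rule laplace_cong[OF x L])
  also have "\<dots> = \<Lambda> * laplace_beltrami (C2_fun u1) x" by (rule laplace_scale[OF C2_fun_C2 x])
  finally have "C2_fun u2 x * (b * C2_fun u1 x powr (q - 2) + a * C2_fun u2 x powr (q - 2) - lam)
      = C2_fun u2 x * (a * C2_fun u1 x powr (q - 2) + b * C2_fun u2 x powr (q - 2) - lam)"
    unfolding solves_S_laplace(1,2)[OF S x] by (simp add: L[OF x] mult.assoc)
  then have "b * C2_fun u1 x powr (q - 2) + a * C2_fun u2 x powr (q - 2) - lam
      = a * C2_fun u1 x powr (q - 2) + b * C2_fun u2 x powr (q - 2) - lam"
    using pos(2) by (metis mult_left_cancel less_irrefl)
  then have "(a - b) * (C2_fun u1 x powr (q - 2) - C2_fun u2 x powr (q - 2)) = 0"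
    by (simp add: algebra_simps)
  then have "C2_fun u1 x powr (q - 2) = C2_fun u2 x powr (q - 2)" using ab by simp
  then show ?thesis
    using powr_less_mono2[of "q - 2" "C2_fun u1 x" "C2_fun u2 x"] powr_less_mono2[of "q - 2" "C2_fun u2 x" "C2_fun u1 x"] pos q
    by (cases "C2_fun u1 x" "C2_fun u2 x" rule: linorder_cases) auto
qed

lemma bounded_linear_C2_eval:
  fixes e :: "'a::euclidean_space"
  assumes e: "e \<in> usphere"
  shows "bounded_linear (\<lambda>u. C2_fun u e)"
proof (rule bounded_linear_intro)
  show "norm (C2_fun u e) \<le> norm u * 1" for u :: "'a C2_sphere"
  proof -
    have "\<bar>C2_fun u e\<bar> \<le> C2_pnorm (C2_fun u) e" by (simp add: C2_pnorm_def hess_norm_def)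
    also have "\<dots> \<le> norm u" unfolding norm_C2_sphere_def by (intro cSUP_upper e C2_pnorm_bdd C2_fun_C2)
    finally show ?thesis by simp
  qed
qed (simp_all add: plus_C2_sphere.rep_eq scaleR_C2_sphere.rep_eq)

lemma C1_on_S_rhs:
  assumes C: "C1_on I lam" "C1_on I a" "C1_on I b"
  shows "C1_on (I \<times> {0<..} \<times> {0<..}) (S_rhs1 q lam a b)" "C1_on (I \<times> {0<..} \<times> {0<..}) (S_rhs2 q lam b a)"
proof -
  let ?D = "I \<times> {0::real<..} \<times> {0::real<..}"
  have f: "fst ` ?D \<subseteq> I" by auto
  note cs = C1_on_compose[OF C1_on_fst C(1) f] C1_on_compose[OF C1_on_fst C(2) f] C1_on_compose[OF C1_on_fst C(3) f]
  have c: "C1_on ?D (\<lambda>x. fst (snd x))" "C1_on ?D (\<lambda>x. snd (snd x))"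
    by (intro C1_on_bounded_linear bounded_linear_compose[OF bounded_linear_fst bounded_linear_snd]
        bounded_linear_compose[OF bounded_linear_snd bounded_linear_snd])+
  have p: "fst (snd x) > 0" "snd (snd x) > 0" if "x \<in> ?D" for x using that by auto
  show "C1_on ?D (S_rhs1 q lam a b)" unfolding S_rhs1_def case_prod_unfold
    by (intro C1_on_diff C1_on_add C1_on_mult C1_on_powr cs c p)
  show "C1_on ?D (S_rhs2 q lam b a)" unfolding S_rhs2_def case_prod_unfold
    by (intro C1_on_diff C1_on_add C1_on_mult C1_on_powr cs c p)
qed

lemma C2_const_scale: "C2_const k = k *\<^sub>R C2_const 1"
  by (rule C2_fun_inject[THEN iffD1]) (simp add: C2_const.rep_eq scaleR_C2_sphere.rep_eq fun_eq_iff)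

context symmetric_system
begin

lemma const_ref_pbar: "const_ref q lam a b \<alpha> = C2_const (pbar \<alpha>)"
  by (simp add: const_ref_def pbar_def)

lemma constant_solution:
  assumes \<alpha>: "\<alpha> \<in> {-\<epsilon><..<\<epsilon>}"
  shows "is_solution ({0<..} \<times> {0<..}) (S_rhs1 q lam a b) (S_rhs2 q lam b a) \<alpha> (C2_const (pbar \<alpha>)) (C2_const (pbar \<alpha>))"
  unfolding is_solution_def
proof
  fix x :: 'a assume x: "x \<in> usphere"
  note p = pbar_pos[OF \<alpha>]
  have v: "C2_fun (C2_const (pbar \<alpha>)) x = pbar \<alpha>" using x by (simp add: C2_const.rep_eq)
  have "laplace_beltrami (C2_fun (C2_const (pbar \<alpha>))) x = laplace_beltrami (\<lambda>y. pbar \<alpha>) x"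
    by (rule laplace_cong[OF x]) (simp add: C2_const.rep_eq)
  then have l: "laplace_beltrami (C2_fun (C2_const (pbar \<alpha>))) x = 0" by (simp add: laplace_const[OF x])
  have "(pbar \<alpha>, 0) \<in> wedge" using p by (simp add: wedge_def)
  from rhs_decomposition[OF this, of \<alpha>] show "(C2_fun (C2_const (pbar \<alpha>)) x, C2_fun (C2_const (pbar \<alpha>)) x) \<in> {0<..} \<times> {0<..} \<and>
      laplace_beltrami (C2_fun (C2_const (pbar \<alpha>))) x = S_rhs1 q lam a b (\<alpha>, C2_fun (C2_const (pbar \<alpha>)) x, C2_fun (C2_const (pbar \<alpha>)) x) \<and>
      laplace_beltrami (C2_fun (C2_const (pbar \<alpha>))) x = S_rhs2 q lam b a (\<alpha>, C2_fun (C2_const (pbar \<alpha>)) x, C2_fun (C2_const (pbar \<alpha>)) x)"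
    unfolding l v using p even_part_pbar[OF \<alpha>] by simp
qed

lemma branch_setting_constant:
  assumes d: "0 < d" "d < \<epsilon>"
  shows "branch_setting d ({0<..} \<times> {0<..}) (S_rhs1 q lam a b) (S_rhs2 q lam b a)
    (const_ref q lam a b :: real \<Rightarrow> 'a::euclidean_space C2_sphere) (const_ref q lam a b)"
proof -
  have sub: "{-d..d} \<subseteq> {-\<epsilon><..<\<epsilon>}" using d by auto
  have "continuous_on {-\<epsilon><..<\<epsilon>} pbar" by (rule C1_on_continuous[OF C1_pbar])
  then have "continuous_on {-d..d} pbar" by (rule continuous_on_subset[OF _ sub])
  then have "(pbar \<longlongrightarrow> pbar 0) (at 0 within {-d..d})" using d by (simp add: continuous_on_def)
  then have "((\<lambda>\<alpha>. (pbar \<alpha> *\<^sub>R C2_const 1, pbar \<alpha> *\<^sub>R C2_const 1)) \<longlongrightarrow>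
      (pbar 0 *\<^sub>R C2_const 1, pbar 0 *\<^sub>R C2_const 1 :: 'a C2_sphere)) (at 0 within {-d..d})"
    by (intro tendsto_intros)
  then have lim: "((\<lambda>\<alpha>. (C2_const (pbar \<alpha>), C2_const (pbar \<alpha>))) \<longlongrightarrow>
      (C2_const (pbar 0), C2_const (pbar 0) :: 'a C2_sphere)) (at 0 within {-d..d})"
    by (subst (1 2 3 4) C2_const_scale)
  have cs: "is_solution ({0<..} \<times> {0<..}) (S_rhs1 q lam a b) (S_rhs2 q lam b a) \<alpha>
      (C2_const (pbar \<alpha>) :: 'a C2_sphere) (C2_const (pbar \<alpha>))" if "\<alpha> \<in> {-d..d}" for \<alpha>
    by (rule constant_solution) (use that sub in blast)
  show ?thesis
    unfolding branch_setting_def const_ref_pbar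
    using d lim cs C1_on_S_rhs[OF C1_on_subset[OF C1(1) sub] C1_on_subset[OF C1(2) sub] C1_on_subset[OF C1(3) sub]]
    by (auto intro!: open_Times)
qed

text \<open>
  The linear functional \<open>u1 - u2\<close> at the pole equals \<open>2 * s\<close> along the family. This single
  identity shows that the parametrization is injective, that its derivative does not vanish, and
  that \<open>s \<noteq> 0\<close> gives distinct components.
\<close>

theorem branch_exists:
  fixes d :: real and m j :: nat
  assumes dim: "DIM('a::euclidean_space) = m + 2" and d: "0 < d" "d < \<epsilon>"
    and ne: "\<And>\<alpha>. \<alpha> \<in> {-\<epsilon><..<\<epsilon>} \<Longrightarrow> a \<alpha> \<noteq> b \<alpha>"
    and j: "j \<ge> 1" and res: "(q - 2) * beta 0 = real j * (real j + real m)"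
    and nonres: "\<And>i. i \<ge> 1 \<Longrightarrow> (q - 2) * lam 0 \<noteq> 2 * real i * (2 * real i + real m)"
    and lam0: "lam 0 \<noteq> 0"
    and \<beta>: "(beta has_real_derivative \<beta>') (at 0)" "\<beta>' \<noteq> 0"
  shows "\<exists>B :: (real \<times> 'a C2_sphere \<times> 'a C2_sphere) set.
    C1_branch d ({0<..} \<times> {0<..}) (S_rhs1 q lam a b) (S_rhs2 q lam b a) (const_ref q lam a b) (const_ref q lam a b) B
    \<and> nonsynchronized_branch B"
proof -
  obtain e :: 'a where e: "e \<in> usphere" using usphere_nonempty by blast
  show ?thesis
  proof (rule zonal_branch[OF e dim j res nonres lam0 \<beta>])
    fix \<eta> \<alpha> and u1 u2 :: "real \<Rightarrow> 'a C2_sphere"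
    assume \<eta>: "\<eta> > 0" and at0: "\<alpha> 0 = 0" "u1 0 = C2_const (pbar 0)" "u2 0 = C2_const (pbar 0)"
      and C: "C1_on (ball 0 \<eta>) \<alpha>" "C1_on (ball 0 \<eta>) u1" "C1_on (ball 0 \<eta>) u2"
      and sol: "\<And>s. s \<in> ball 0 \<eta> \<Longrightarrow> is_solution ({0<..} \<times> {0<..}) (S_rhs1 q lam a b) (S_rhs2 q lam b a) (\<alpha> s) (u1 s) (u2 s)"
      and gap: "\<And>s. s \<in> ball 0 \<eta> \<Longrightarrow> C2_fun (u1 s) e - C2_fun (u2 s) e = 2 * s"
    have "isCont \<alpha> 0"
      using C1_on_continuous[OF C(1)] \<eta> by (simp add: continuous_on_eq_continuous_at)
    then obtain \<eta>' where \<eta>': "\<eta>' > 0" "\<And>s. \<bar>s\<bar> < \<eta>' \<Longrightarrow> \<bar>\<alpha> s\<bar> < d"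
      using d(1) at0(1) unfolding continuous_at_eps_delta dist_real_def by (metis diff_zero)
    define J where "J = ball (0::real) (min \<eta> \<eta>')"
    have J: "open J" "0 \<in> J" "J \<subseteq> ball 0 \<eta>" using \<eta> \<eta>' by (auto simp: J_def)
    have \<alpha>J: "\<alpha> s \<in> {-d..d}" if "s \<in> J" for s
      using \<eta>'(2)[of s] that by (auto simp: J_def abs_less_iff)
    define \<gamma> where "\<gamma> s = (\<alpha> s, u1 s, u2 s)" for s
    define L where "L w = C2_fun (fst (snd w)) e - C2_fun (snd (snd w)) e" for w :: "real \<times> 'a C2_sphere \<times> 'a C2_sphere"
    have L: "bounded_linear L" unfolding L_def
      by (intro bounded_linear_sub bounded_linear_compose[OF bounded_linear_C2_eval[OF e]]
          bounded_linear_compose[OF bounded_linear_fst bounded_linear_snd]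
          bounded_linear_compose[OF bounded_linear_snd bounded_linear_snd])
    have L\<gamma>: "L (\<gamma> s) = 2 * s" if "s \<in> J" for s
      using gap[of s] that J(3) by (auto simp: L_def \<gamma>_def)
    have C1\<gamma>: "C1_on J \<gamma>" unfolding \<gamma>_def[abs_def]
      by (intro C1_on_Pair C1_on_subset[OF C(1) J(3)] C1_on_subset[OF C(2) J(3)] C1_on_subset[OF C(3) J(3)])
    have inj: "inj_on \<gamma> J"
    proof (rule inj_onI)
      fix s t assume st: "s \<in> J" "t \<in> J" "\<gamma> s = \<gamma> t"
      have "2 * s = 2 * t" unfolding L\<gamma>[OF st(1), symmetric] L\<gamma>[OF st(2), symmetric] st(3) ..
      then show "s = t" by simp
    qed
    have vd: "vector_derivative \<gamma> (at t within J) \<noteq> 0" if t: "t \<in> J" for t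
    proof
      assume z: "vector_derivative \<gamma> (at t within J) = 0"
      have "\<gamma> differentiable (at t)"
        using C1_on_differentiable[OF C1\<gamma> t] by (simp add: at_within_open[OF t J(1)])
      then have "(\<gamma> has_vector_derivative 0) (at t)"
        using z by (simp add: vector_derivative_works at_within_open[OF t J(1)])
      then have "((\<lambda>s. L (\<gamma> s)) has_vector_derivative L 0) (at t)"
        by (rule bounded_linear.has_vector_derivative[OF L])
      then have "((\<lambda>s. 2 * s) has_vector_derivative L 0) (at t)"
        by (rule has_vector_derivative_transform_within_open[OF _ J(1) t]) (simp add: L\<gamma>)
      moreover have "((\<lambda>s. 2 * s) has_vector_derivative (2::real)) (at t)"
        by (auto intro!: derivative_eq_intros)
      ultimately have "L 0 = 2" by (rule vector_derivative_unique_at)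
      then show False using linear_0[OF bounded_linear.linear[OF L]] by simp
    qed
    define B where "B = \<gamma> ` (J - {0})"
    have ref0: "\<gamma> 0 = (0, const_ref q lam a b 0, const_ref q lam a b 0)"
      by (simp add: \<gamma>_def at0 const_ref_pbar)
    have ins: "insert (0, const_ref q lam a b 0, const_ref q lam a b 0) B = \<gamma> ` J"
      using J(2) by (auto simp: B_def ref0[symmetric])
    have "C1_curve (\<gamma> ` J)"
      unfolding C1_curve_def
    proof (intro exI[of _ J] exI[of _ \<gamma>] conjI C1\<gamma> inj ballI refl)
      show "is_interval J" unfolding J_def by (simp add: is_interval_ball_real)
      show "interior J \<noteq> {}" using J by (auto simp: interior_open)
    qed (rule vd)
    moreover have "B \<noteq> {}"
    proof -
      have "min \<eta> \<eta>' / 2 \<in> J - {0}" using \<eta> \<eta>'(1) by (auto simp: J_def dist_norm)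
      then show ?thesis by (auto simp: B_def)
    qed
    moreover have distinct: "u1 s \<noteq> u2 s" if "s \<in> J - {0}" for s
      using gap[of s] that J(3) by auto
    moreover have "B \<subseteq> nonref_solutions d ({0<..} \<times> {0<..}) (S_rhs1 q lam a b) (S_rhs2 q lam b a) (const_ref q lam a b) (const_ref q lam a b)"
    proof
      fix w assume "w \<in> B"
      then obtain s where s: "s \<in> J - {0}" "w = \<gamma> s" by (auto simp: B_def)
      then show "w \<in> nonref_solutions d ({0<..} \<times> {0<..}) (S_rhs1 q lam a b) (S_rhs2 q lam b a) (const_ref q lam a b) (const_ref q lam a b)"
        using \<alpha>J[of s] sol[of s] J(3) distinct[OF s(1)] by (auto simp: nonref_solutions_def \<gamma>_def)
    qed
    moreover have "nonsynchronized_branch B"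
      unfolding nonsynchronized_branch_def
    proof
      fix w assume "w \<in> B"
      then obtain s where s: "s \<in> J - {0}" "w = \<gamma> s" by (auto simp: B_def)
      have "\<not> synchronized (u1 s) (u2 s)"
      proof
        assume sy: "synchronized (u1 s) (u2 s)"
        have \<alpha>s: "\<alpha> s \<in> {-\<epsilon><..<\<epsilon>}" using \<alpha>J[of s] s d by auto
        have "solves_S q (lam (\<alpha> s)) (a (\<alpha> s)) (b (\<alpha> s)) (a (\<alpha> s)) (u1 s) (u2 s)"
          using sol[of s] s J(3) unfolding is_solution_S by blast
        from synchronized_imp_equal[OF this q ne[OF \<alpha>s] sy e] show False
          using gap[of s] s J(3) by auto
      qed
      then show "case w of (\<alpha>, u1, u2) \<Rightarrow> \<not> synchronized u1 u2" by (simp add: s(2) \<gamma>_def)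
    qed
    ultimately show ?thesis unfolding C1_branch_def ins[symmetric] by blast
  qed
qed

end

text \<open>
  The conditions at \<open>0\<close> are open, so they hold on a smaller interval; there \<open>m = n - 1\<close> matches
  the eigenvalues \<open>j * (j + n - 1)\<close> with those of the radial operator.
\<close>

lemma bifurcation:
  fixes n :: nat and q \<delta> :: real and lam a b :: "real \<Rightarrow> real"
  assumes n: "n \<ge> 1" and dim: "DIM('a::euclidean_space) = n + 1" and q: "q > 2" and \<delta>: "\<delta> > 0"
    and C: "C1_on {-\<delta>..\<delta>} lam" "C1_on {-\<delta>..\<delta>} a" "C1_on {-\<delta>..\<delta>} b"
    and A1: "lam 0 * (a 0 + b 0) > 0"
    and A2: "lam 0 \<notin> {2 * real j * (2 * real j + real n - 1) / (q - 2) | j :: nat. j \<ge> 1}"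
    and A3: "lam 0 * (a 0 - b 0) / (a 0 + b 0) \<in> {real j * (real j + real n - 1) / (q - 2) | j :: nat. j \<ge> 1}"
      "deriv (\<lambda>\<alpha>. lam \<alpha> * (a \<alpha> - b \<alpha>) / (a \<alpha> + b \<alpha>)) 0 \<noteq> 0"
  shows "\<exists>\<epsilon>. 0 < \<epsilon> \<and> \<epsilon> \<le> \<delta> \<and>
     branch_setting \<epsilon> ({0<..} \<times> {0<..}) (S_rhs1 q lam a b) (S_rhs2 q lam b a)
       (const_ref q lam a b :: real \<Rightarrow> 'a C2_sphere) (const_ref q lam a b) \<and>
     (\<exists>B. C1_branch \<epsilon> ({0<..} \<times> {0<..}) (S_rhs1 q lam a b) (S_rhs2 q lam b a)
       (const_ref q lam a b :: real \<Rightarrow> 'a C2_sphere) (const_ref q lam a b) B \<and> nonsynchronized_branch B)"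
proof -
  define m where "m = n - 1"
  have rm: "real m = real n - 1" and dm: "DIM('a) = m + 2" using n dim by (auto simp: m_def)
  obtain j :: nat where j: "j \<ge> 1" "lam 0 * (a 0 - b 0) / (a 0 + b 0) = real j * (real j + real m) / (q - 2)"
    using A3(1) by (auto simp: rm algebra_simps)
  have jp: "real j * (real j + real m) / (q - 2) > 0" using j(1) q by (intro divide_pos_pos mult_pos_pos) auto
  have ab0: "a 0 - b 0 \<noteq> 0" using j(2) jp by auto
  have cont: "isCont f 0" if "C1_on {-\<delta>..\<delta>} f" for f :: "real \<Rightarrow> real"
    using C1_on_continuous[OF that] \<delta> by (intro continuous_on_interior[of "{-\<delta>..\<delta>}"]) (auto simp: interior_atLeastAtMost_real)
  have "isCont (\<lambda>x. lam x * (a x + b x)) 0" "isCont (\<lambda>x. \<bar>a x - b x\<bar>) 0"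
    using cont[OF C(1)] cont[OF C(2)] cont[OF C(3)] by (auto intro!: continuous_intros)
  then have tend: "((\<lambda>x. lam x * (a x + b x)) \<longlongrightarrow> lam 0 * (a 0 + b 0)) (nhds 0)"
    "((\<lambda>x. \<bar>a x - b x\<bar>) \<longlongrightarrow> \<bar>a 0 - b 0\<bar>) (nhds 0)"
    unfolding isCont_def
    using tendsto_at_iff_tendsto_nhds[of "\<lambda>x. lam x * (a x + b x)" 0]
      tendsto_at_iff_tendsto_nhds[of "\<lambda>x. \<bar>a x - b x\<bar>" 0] by blast+
  have "\<bar>a 0 - b 0\<bar> > 0" using ab0 by simp
  from order_tendstoD(1)[OF tend(1) A1] order_tendstoD(1)[OF tend(2) this]
  have "eventually (\<lambda>x. lam x * (a x + b x) > 0 \<and> a x \<noteq> b x) (nhds 0)"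
    by eventually_elim auto
  then obtain r where r: "r > 0" "\<And>x. \<bar>x\<bar> < r \<Longrightarrow> lam x * (a x + b x) > 0 \<and> a x \<noteq> b x"
    unfolding eventually_nhds_metric dist_real_def by auto
  define \<epsilon> where "\<epsilon> = min r \<delta>"
  have eps: "\<epsilon> > 0" "\<epsilon> \<le> \<delta>" "\<And>x. x \<in> {-\<epsilon><..<\<epsilon>} \<Longrightarrow> \<bar>x\<bar> < r" using r(1) \<delta> by (auto simp: \<epsilon>_def)
  have sub: "{-\<epsilon><..<\<epsilon>} \<subseteq> {-\<delta>..\<delta>}" using eps by auto
  interpret symmetric_system q \<epsilon> lam a b
  proof
    fix \<alpha> assume "\<alpha> \<in> {-\<epsilon><..<\<epsilon>}"
    then have "lam \<alpha> * (a \<alpha> + b \<alpha>) > 0" using r(2) eps(3) by blast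
    then show "lam \<alpha> / (a \<alpha> + b \<alpha>) > 0" by (simp add: zero_less_mult_iff zero_less_divide_iff)
  qed (use q eps C1_on_subset[OF C(1) sub] C1_on_subset[OF C(2) sub] C1_on_subset[OF C(3) sub] in auto)
  have I0: "0 \<in> {-\<epsilon><..<\<epsilon>}" using eps(1) by simp
  have beta: "beta = (\<lambda>\<alpha>. lam \<alpha> * (a \<alpha> - b \<alpha>) / (a \<alpha> + b \<alpha>))" by (simp add: beta_def fun_eq_iff)
  have "beta differentiable (at 0)"
    using C1_on_differentiable[OF C1_beta I0] I0 by (simp add: at_within_open[OF I0])
  then have db: "(beta has_real_derivative deriv beta 0) (at 0)" by (simp add: DERIV_deriv_iff_real_differentiable)
  have db0: "deriv beta 0 \<noteq> 0" using A3(2) by (simp add: beta)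
  have res: "(q - 2) * beta 0 = real j * (real j + real m)" using j(2) q by (simp add: beta_def)
  have nonres: "(q - 2) * lam 0 \<noteq> 2 * real i * (2 * real i + real m)" if i: "i \<ge> 1" for i :: nat
  proof
    assume "(q - 2) * lam 0 = 2 * real i * (2 * real i + real m)"
    then have "lam 0 = 2 * real i * (2 * real i + real n - 1) / (q - 2)" using q by (simp add: rm field_simps)
    then show False using A2 i by blast
  qed
  have lam0: "lam 0 \<noteq> 0" using A1 by auto
  define d where "d = \<epsilon> / 2"
  have d: "0 < d" "d < \<epsilon>" "d \<le> \<delta>" using eps(1,2) by (auto simp: d_def)
  have ne: "a \<alpha> \<noteq> b \<alpha>" if "\<alpha> \<in> {-\<epsilon><..<\<epsilon>}" for \<alpha> using r(2) eps(3) that by blast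
  show ?thesis
    using branch_setting_constant[OF d(1,2), where 'a = 'a]
      branch_exists[where 'a = 'a, OF dm d(1,2) ne j(1) res nonres lam0 db db0] d by blast
qed

text \<open>
  With \<open>a + b = 2\<close> and \<open>lam\<close> constant, \<open>\<beta>\<close> can be prescribed freely: it is taken as the resonant
  value for \<open>j = 1\<close>, which is \<open>n / (q - 2)\<close>, plus \<open>\<alpha>\<close>. Since \<open>(q - 2) * l = n + 1/2\<close> is not an
  integer, \<open>lam\<close> is not resonant, and \<open>l\<close> exceeds \<open>\<beta>\<close> for small \<open>\<alpha>\<close>, which gives \<open>b > 0\<close>.
\<close>

lemma nonsynchronized_example:
  fixes n :: nat and q :: real
  assumes n: "n \<ge> 1" and dim: "DIM('a::euclidean_space) = n + 1" and q: "q > 2"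
  shows "\<exists>lam a b c :: real. lam > 0 \<and> a = c \<and> c > b \<and> b > 0 \<and>
        (\<exists>u1 u2 :: 'a C2_sphere. solves_S q lam a b c u1 u2 \<and> \<not> synchronized u1 u2)"
proof -
  define l where "l = (real n + 1/2) / (q - 2)"
  define be where "be \<alpha> = real n / (q - 2) + \<alpha>" for \<alpha> :: real
  \<comment> \<open>Small enough for \<open>0 < be \<alpha> < l\<close> on the parameter interval.\<close>
  define \<delta> where "\<delta> = 1 / (4 * (q - 2))"
  define lam where "lam = (\<lambda>\<alpha>::real. l)"
  define a where "a \<alpha> = 1 + be \<alpha> / l" for \<alpha>
  define b where "b \<alpha> = 1 - be \<alpha> / l" for \<alpha>
  have l: "l > 0" using q by (simp add: l_def add_nonneg_pos)
  have \<delta>: "\<delta> > 0" using q by (simp add: \<delta>_def)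
  have bl: "lam \<alpha> * (a \<alpha> - b \<alpha>) / (a \<alpha> + b \<alpha>) = be \<alpha>" for \<alpha> using l by (simp add: lam_def a_def b_def)
  have C: "C1_on {-\<delta>..\<delta>} lam" "C1_on {-\<delta>..\<delta>} a" "C1_on {-\<delta>..\<delta>} b"
    unfolding lam_def a_def[abs_def] b_def[abs_def] be_def divide_inverse
    by (intro C1_on_add C1_on_diff C1_on_const C1_on_mult C1_on_bounded_linear bounded_linear_ident)+
  have "\<exists>\<epsilon>. 0 < \<epsilon> \<and> \<epsilon> \<le> \<delta> \<and>
     branch_setting \<epsilon> ({0<..} \<times> {0<..}) (S_rhs1 q lam a b) (S_rhs2 q lam b a)
       (const_ref q lam a b :: real \<Rightarrow> 'a C2_sphere) (const_ref q lam a b) \<and>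
     (\<exists>B. C1_branch \<epsilon> ({0<..} \<times> {0<..}) (S_rhs1 q lam a b) (S_rhs2 q lam b a)
       (const_ref q lam a b :: real \<Rightarrow> 'a C2_sphere) (const_ref q lam a b) B \<and> nonsynchronized_branch B)"
  proof (rule bifurcation[OF n dim q \<delta> C])
    show "lam 0 * (a 0 + b 0) > 0" using l by (simp add: lam_def a_def b_def)
    show "lam 0 \<notin> {2 * real j * (2 * real j + real n - 1) / (q - 2) | j :: nat. j \<ge> 1}"
    proof
      assume "lam 0 \<in> {2 * real j * (2 * real j + real n - 1) / (q - 2) | j :: nat. j \<ge> 1}"
      then obtain j :: nat where j: "(real n + 1/2) / (q - 2) = 2 * real j * (2 * real j + real n - 1) / (q - 2)"
        by (auto simp: lam_def l_def)
      then have "real n + 1/2 = 2 * real j * (2 * real j + real n - 1)" using q by simp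
      then have "2 * real n + 1 = 2 * (2 * real j * (2 * real j + real n - 1))" by argo
      then have "of_int (2 * int n + 1) = (of_int (2 * (2 * int j * (2 * int j + int n - 1))) :: real)" by simp
      then have "2 * int n + 1 = 2 * (2 * int j * (2 * int j + int n - 1))" by (simp only: of_int_eq_iff)
      then show False by presburger
    qed
    show "lam 0 * (a 0 - b 0) / (a 0 + b 0) \<in> {real j * (real j + real n - 1) / (q - 2) | j :: nat. j \<ge> 1}"
      unfolding bl by (intro CollectI exI[of _ 1]) (simp add: be_def)
    have "deriv be 0 = 1" unfolding be_def[abs_def] by (rule DERIV_imp_deriv) (auto intro!: derivative_eq_intros)
    then show "deriv (\<lambda>\<alpha>. lam \<alpha> * (a \<alpha> - b \<alpha>) / (a \<alpha> + b \<alpha>)) 0 \<noteq> 0" unfolding bl by simp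
  qed
  then obtain \<epsilon> and B :: "(real \<times> 'a C2_sphere \<times> 'a C2_sphere) set" where \<epsilon>: "0 < \<epsilon>" "\<epsilon> \<le> \<delta>"
    and B: "C1_branch \<epsilon> ({0<..} \<times> {0<..}) (S_rhs1 q lam a b) (S_rhs2 q lam b a) (const_ref q lam a b) (const_ref q lam a b) B"
      "nonsynchronized_branch B" by blast
  then obtain \<alpha> u1 u2 where w: "(\<alpha>, u1, u2) \<in> B"
    "(\<alpha>, u1, u2) \<in> nonref_solutions \<epsilon> ({0<..} \<times> {0<..}) (S_rhs1 q lam a b) (S_rhs2 q lam b a) (const_ref q lam a b) (const_ref q lam a b)"
    unfolding C1_branch_def by (metis equals0I prod_cases3 subsetD)
  have \<alpha>: "\<alpha> \<in> {-\<delta>..\<delta>}" and S: "solves_S q (lam \<alpha>) (a \<alpha>) (b \<alpha>) (a \<alpha>) u1 u2"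
    using w(2) \<epsilon> unfolding nonref_solutions_def is_solution_S by auto
  have ns: "\<not> synchronized u1 u2" using B(2) w(1) unfolding nonsynchronized_branch_def by blast
  have d1: "\<delta> * (q - 2) = 1/4" using q by (simp add: \<delta>_def)
  have "be \<alpha> > 0" "be \<alpha> < l"
  proof -
    have "\<bar>\<alpha> * (q - 2)\<bar> \<le> \<delta> * (q - 2)" using \<alpha> q by (auto simp: abs_mult intro!: mult_right_mono)
    then have a4: "\<bar>\<alpha> * (q - 2)\<bar> \<le> 1/4" using d1 by simp
    have bq: "be \<alpha> * (q - 2) = real n + \<alpha> * (q - 2)" "l * (q - 2) = real n + 1/2"
      using q by (simp_all add: be_def l_def field_simps)
    have "0 * (q - 2) < be \<alpha> * (q - 2)" "be \<alpha> * (q - 2) < l * (q - 2)"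
      unfolding bq using a4 n by (auto simp: abs_le_iff)
    then show "be \<alpha> > 0" "be \<alpha> < l" using q by (simp_all only: mult_less_cancel_right)
  qed
  then have "a \<alpha> > b \<alpha>" "b \<alpha> > 0" using l by (simp_all add: a_def b_def)
  then show ?thesis using S ns l by (intro exI[of _ "lam \<alpha>"] exI[of _ "a \<alpha>"] exI[of _ "b \<alpha>"]) (auto simp: lam_def)
qed

theorem theorem1p1:
  fixes n :: nat and q :: real
  assumes "n \<ge> 1" and "DIM('a::euclidean_space) = n + 1" and "q > 2"
  shows
    "(\<forall>lam a b c :: real.
        (c \<le> b \<and> b \<le> a \<and> (c < b \<or> b < a)) \<or> (a \<le> b \<and> b \<le> c \<and> (a < b \<or> b < c)) \<longrightarrow>
        \<not> (\<exists>u1 u2 :: 'a C2_sphere. solves_S q lam a b c u1 u2))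
   \<and> (\<forall>lam a b c :: real.
        (a < b \<and> c < b) \<or> (a = b \<and> b = c) \<longrightarrow>
        (\<forall>u1 u2 :: 'a C2_sphere. solves_S q lam a b c u1 u2 \<longrightarrow> synchronized u1 u2))
   \<and> (\<exists>lam a b c :: real. lam > 0 \<and> a = c \<and> c > b \<and> b > 0 \<and>
        (\<exists>u1 u2 :: 'a C2_sphere. solves_S q lam a b c u1 u2 \<and> \<not> synchronized u1 u2))
   \<and> (\<forall>\<delta>>0. \<forall>lam a b :: real \<Rightarrow> real.
        C1_on {-\<delta>..\<delta>} lam \<and> C1_on {-\<delta>..\<delta>} a \<and> C1_on {-\<delta>..\<delta>} b \<longrightarrow>
        lam 0 * (a 0 + b 0) > 0 \<longrightarrow>
        lam 0 \<notin> {2 * real j * (2 * real j + real n - 1) / (q - 2) | j :: nat. j \<ge> 1} \<longrightarrow>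
        (let \<beta> = (\<lambda>\<alpha>. lam \<alpha> * (a \<alpha> - b \<alpha>) / (a \<alpha> + b \<alpha>)) in
           \<beta> 0 \<in> {real j * (real j + real n - 1) / (q - 2) | j :: nat. j \<ge> 1} \<and> deriv \<beta> 0 \<noteq> 0) \<longrightarrow>
        (\<exists>\<epsilon>. 0 < \<epsilon> \<and> \<epsilon> \<le> \<delta> \<and>
           (let \<Omega> = {0<..} \<times> {0<..}; F1 = S_rhs1 q lam a b; F2 = S_rhs2 q lam b a;
                U = const_ref q lam a b :: real \<Rightarrow> 'a C2_sphere
            in branch_setting \<epsilon> \<Omega> F1 F2 U U \<and>
               (\<exists>B. C1_branch \<epsilon> \<Omega> F1 F2 U U B \<and> nonsynchronized_branch B))))"
  unfolding Let_def
proof (intro conjI allI impI notI)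
  have dim2: "DIM('a) \<ge> 2" using assms(1,2) by simp
  show False if "(c \<le> b \<and> b \<le> a \<and> (c < b \<or> b < a)) \<or> (a \<le> b \<and> b \<le> c \<and> (a < b \<or> b < c))"
    "\<exists>u1 u2 :: 'a C2_sphere. solves_S q lam a b c u1 u2" for lam a b c
    using no_solution[OF that(1)] that(2) by blast
  show "synchronized u1 u2" if "(a < b \<and> c < b) \<or> (a = b \<and> b = c)" "solves_S q lam a b c u1 u2"
    for lam a b c and u1 u2 :: "'a C2_sphere"
    by (rule solutions_synchronized[OF dim2 assms(3) that(2,1)])
  show "\<exists>lam a b c :: real. lam > 0 \<and> a = c \<and> c > b \<and> b > 0 \<and>
        (\<exists>u1 u2 :: 'a C2_sphere. solves_S q lam a b c u1 u2 \<and> \<not> synchronized u1 u2)"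
    by (rule nonsynchronized_example[OF assms])
qed (rule bifurcation[OF assms], auto)

end
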